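(* Let $\mathfrak{g}$ be a (possibly infinite-dimensional) Lie algebra over $\mathbb{C}$ equipped with a non-degenerate symmetric invariant bilinear form $\langle\cdot,\cdot\rangle$, let $p(x)\in\mathbb{C}[x]$, and let $\ell\in\mathbb{C}$. Let $\hat{\mathfrak{g}}_p$ be the Lie algebra over $\mathbb{C}$, and $V_{\check{\mathfrak{g}}_p}(\ell,0)$ the vertex $\mathbb{C}((z))$-algebra, described in the context. (1) For any restricted $\hat{\mathfrak{g}}_p$-module $W$ of level $\ell$, there exists a unique structure $Y_W$ of a type zero $V_{\check{\mathfrak{g}}_p}(\ell,0)$-module on $W$ such that $$Y_W(a,x)=a(x),\qquad Y_W(a^1,x)=a^1(x)\qquad\text{for } a\in\mathfrak{g}.$$ (2) Conversely, let $(W,Y_W)$ be a type zero $V_{\check{\mathfrak{g}}_p}(\ell,0)$-module. Then $W$ is a restricted $\hat{\mathfrak{g}}_p$-module of level $\ell$ with $$a(x)=Y_W(a,x),\qquad a^1(x)=Y_W(a^1,x)\qquad\text{for } a\in\mathfrak{g}$$ and with $\mathbf{k}$ acting as the scalar $\ell$.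
   Context: Notation: $x^{-1}\delta(y/x)=\sum_{n\in\mathbb{Z}}y^{n}x^{-n-1}$. $\mathfrak{g}^1$ is a vector space with a fixed linear isomorphism $\mathfrak{g}\to\mathfrak{g}^1$, $a\mapsto a^1$. For $u\in\mathfrak{g}\oplus\mathfrak{g}^1$, $u(n)$ denotes $u\otimes t^n$ (or the corresponding operator on a module), and $u(x)=\sum_{n\in\mathbb{Z}}u(n)x^{-n-1}$. The Lie algebra $\hat{\mathfrak{g}}_p=(\mathfrak{g}\oplus\mathfrak{g}^1)\otimes\mathbb{C}[t,t^{-1}]\oplus\mathbb{C}\mathbf{k}$ over $\mathbb{C}$ has $\mathbf{k}$ central and, for $a,b\in\mathfrak{g}$, $$[a(x_1),b(x_2)]=[a,b](x_2)x_2^{-1}\delta\left(\tfrac{x_1}{x_2}\right)+\langle a,b\rangle\mathbf{k}\tfrac{\partial}{\partial x_2}x_2^{-1}\delta\left(\tfrac{x_1}{x_2}\right),$$ $$[a(x_1),b^1(x_2)]=[a,b]^1(x_2)x_2^{-1}\delta\left(\tfrac{x_1}{x_2}\right)=[a^1(x_1),b(x_2)],$$ $$[a^1(x_1),b^1(x_2)]=p(x_2)[a,b](x_2)x_2^{-1}\delta\left(\tfrac{x_1}{x_2}\right)+\tfrac12\langle a,b\rangle p'(x_2)\mathbf{k}x_2^{-1}\delta\left(\tfrac{x_1}{x_2}\right)+\langle a,b\rangle p(x_2)\mathbf{k}\tfrac{\partial}{\partial x_2}x_2^{-1}\delta\left(\tfrac{x_1}{x_2}\right).$$ A $\hat{\mathfrak{g}}_p$-module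 $W$ is of level $\ell$ if $\mathbf{k}$ acts as the scalar $\ell$; it is restricted if $a(x),a^1(x)\in\mathrm{Hom}(W,W((x)))$ for all $a\in\mathfrak{g}$. The Lie algebra $\check{\mathfrak{g}}_p=\mathbb{C}((z))\otimes(\mathfrak{g}\oplus\mathfrak{g}^1)\otimes\mathbb{C}[t,t^{-1}]\oplus\mathbb{C}((z))\mathbf{k}$ over the field $\mathbb{C}((z))$ has $\mathbb{C}((z))$-bilinear bracket with $\mathbf{k}$ central and, for $a,b\in\mathfrak{g}$, $$[a(x_1),b(x_2)]=[a,b](x_2)x_2^{-1}\delta\left(\tfrac{x_1}{x_2}\right)+\langle a,b\rangle\mathbf{k}\tfrac{\partial}{\partial x_2}x_2^{-1}\delta\left(\tfrac{x_1}{x_2}\right),$$ $$[a(x_1),b^1(x_2)]=[a,b]^1(x_2)x_2^{-1}\delta\left(\tfrac{x_1}{x_2}\right)=[a^1(x_1),b(x_2)],$$ $$[a^1(x_1),b^1(x_2)]=p(z+x_2)[a,b](x_2)x_2^{-1}\delta\left(\tfrac{x_1}{x_2}\right)+\tfrac12\langle a,b\rangle p'(z+x_2)\mathbf{k}x_2^{-1}\delta\left(\tfrac{x_1}{x_2}\right)+\langle a,b\rangle p(z+x_2)\mathbf{k}\tfrac{\partial}{\partial x_2}x_2^{-1}\delta\left(\tfrac{x_1}{x_2}\right),$$ where $p(z+x_2),p'(z+x_2)\in\mathbb{C}[z,x_2]$. Let $\check{B}=\mathbb{C}((z))\otimes(\mathfrak{g}\oplus\mathfrak{g}^1)\otimes\mathbb{C}[t]\oplus\mathbb{C}((z))\mathbf{k}$,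 a subalgebra of $\check{\mathfrak{g}}_p$, and let $\mathbb{C}((z))_\ell$ be the $\check{B}$-module $\mathbb{C}((z))$ with $\mathbf{k}$ acting as $\ell$ and $\mathbb{C}((z))\otimes(\mathfrak{g}\oplus\mathfrak{g}^1)\otimes\mathbb{C}[t]$ acting as zero. Put $V_{\check{\mathfrak{g}}_p}(\ell,0)=U(\check{\mathfrak{g}}_p)\otimes_{U(\check{B})}\mathbb{C}((z))_\ell$ (universal enveloping algebras over $\mathbb{C}((z))$), $\mathbf{1}=1\otimes1$, and identify $f(z)u\in\mathbb{C}((z))\otimes(\mathfrak{g}\oplus\mathfrak{g}^1)$ with $f(z)u(-1)\mathbf{1}$. A vertex $\mathbb{C}((z))$-algebra is a vertex algebra $V$ over $\mathbb{C}$ equipped with a $\mathbb{C}((z))$-module structure such that $Y(f(z)u,x)g(z)v=f(z+x)g(z)Y(u,x)v$ for $f,g\in\mathbb{C}((z))$, $u,v\in V$, where $f(z+x)=e^{x\frac{d}{dz}}f(z)\in\mathbb{C}((z))[[x]]$. A type zero $V$-module is a module $(W,Y_W)$ (a $\mathbb{C}$-vector space) for $V$ viewed as a vertex algebra over $\mathbb{C}$ such that $Y_W(f(z)v,x)=f(x)Y_W(v,x)$ for $f(z)\in\mathbb{C}((z))$, $v\in V$. Known fact used to make sense of the claim: $V_{\check{\mathfrak{g}}_p}(\ell,0)$, with its given $\mathbb{C}((z))$-module structure, has a unique structure of vertex $\mathbb{C}((z))$-algebra with vacuum vector $\mathbf{1}$ and $Y(u,x)=u(x)$ for $u\in\mathfrak{g}+\mathfrak{g}^1$;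 this is the structure meant. *)

theory Defs
  imports
    "HOL-Algebra.Algebraic_Closure_Type"
    "HOL-Algebra.Free_Abelian_Groups"
    "HOL-Algebra.QuotRing"
    "HOL-Algebra.Module"
    "HOL-Library.Poly_Mapping"
    "HOL-Library.Product_Plus"
    "HOL-Computational_Algebra.Polynomial"
    "HOL-Computational_Algebra.Formal_Laurent_Series"
begin

unbundle fps_syntax

section \<open>Lie algebras with an invariant form\<close>

locale quadratic_lie_algebra = vector_space sc
  for sc :: "complex \<Rightarrow> 'g::ab_group_add \<Rightarrow> 'g" +
  fixes br :: "'g \<Rightarrow> 'g \<Rightarrow> 'g"
    and form :: "'g \<Rightarrow> 'g \<Rightarrow> complex"
  assumes br_linear_right: "Vector_Spaces.linear sc sc (br a)"
    and br_linear_left: "Vector_Spaces.linear sc sc (\<lambda>a. br a b)"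
    and br_alternating: "br a a = 0"
    and br_jacobi: "br a (br b c) + br b (br c a) + br c (br a b) = 0"
    and form_linear: "Vector_Spaces.linear sc (*) (form a)"
    and form_sym: "form a b = form b a"
    and form_invariant: "form (br a b) c = form a (br b c)"
    and form_nondegenerate: "(\<And>b. form a b = 0) \<Longrightarrow> a = 0"


section \<open>The affine-type Lie algebras\<close>

text \<open>
  The following definitions are made over an arbitrary field, so that they apply both to
  the Lie algebra over the complex numbers (with the polynomial \<open>p(x)\<close>) and to the one over
  complex Laurent series in \<open>z\<close> (with the polynomial \<open>p(z + x)\<close> in \<open>x\<close>).
  A pair \<open>(a, b)\<close> stands for \<open>a + b\<^sup>1\<close>, and \<open>(U, c)\<close> stands for
  the sum over \<open>n\<close> of \<open>U(n) \<otimes> t\<^sup>n\<close>, plus \<open>c\<close> times the central element.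
\<close>

type_synonym ('k, 'a) affine = "(int \<Rightarrow>\<^sub>0 'a \<times> 'a) \<times> 'k"

definition mode :: "'a::ab_group_add \<times> 'a \<Rightarrow> int \<Rightarrow> ('k::field, 'a) affine" where
  "mode u n = (Poly_Mapping.single n u, 0)"

definition central :: "('k::field, 'a::ab_group_add) affine" where
  "central = (0, 1)"

definition affine_scale ::
    "('k::field \<Rightarrow> 'a::ab_group_add \<Rightarrow> 'a) \<Rightarrow> 'k \<Rightarrow> ('k, 'a) affine \<Rightarrow> ('k, 'a) affine" where
  "affine_scale sc c x =
     (Poly_Mapping.map (\<lambda>(a, b). (sc c a, sc c b)) (fst x), c * snd x)"

definition int_coeff :: "'k::zero poly \<Rightarrow> int \<Rightarrow> 'k" where
  "int_coeff q j = (if j < 0 then 0 else Polynomial.coeff q (nat j))"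

text \<open>
  \<open>mode_bracket sc br form q q' u m v n\<close> is \<open>[u(m), v(n)]\<close>, that is, the coefficient of
  \<open>x\<^sub>1\<^sup>-\<^sup>m\<^sup>-\<^sup>1 x\<^sub>2\<^sup>-\<^sup>n\<^sup>-\<^sup>1\<close> in the generating function \<open>[u(x\<^sub>1), v(x\<^sub>2)]\<close>; here \<open>q'\<close> plays
  the role of the derivative of \<open>q\<close>.  Since
  \<open>x\<^sub>2\<^sup>-\<^sup>1\<delta>(x\<^sub>1/x\<^sub>2)\<close> has coefficient \<open>x\<^sub>2\<^sup>m\<close> at \<open>x\<^sub>1\<^sup>-\<^sup>m\<^sup>-\<^sup>1\<close>, the factor \<open>q'(x\<^sub>2)\<close> contributes its
  coefficient of index \<open>-m-n-1\<close>, and \<open>q(x\<^sub>2)\<close> times the \<open>x\<^sub>2\<close>-derivative of the delta function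
  contributes \<open>m\<close> times the coefficient of \<open>q\<close> of index \<open>-m-n\<close>.
\<close>

definition mode_bracket ::
    "('k::field \<Rightarrow> 'a::ab_group_add \<Rightarrow> 'a) \<Rightarrow> ('a \<Rightarrow> 'a \<Rightarrow> 'a) \<Rightarrow> ('a \<Rightarrow> 'a \<Rightarrow> 'k)
      \<Rightarrow> 'k poly \<Rightarrow> 'k poly \<Rightarrow> 'a \<times> 'a \<Rightarrow> int \<Rightarrow> 'a \<times> 'a \<Rightarrow> int \<Rightarrow> ('k, 'a) affine" where
  "mode_bracket sc br form q q' u m v n =
     (case (u, v) of ((a, a'), (b, b')) \<Rightarrow>
       mode (br a b, br a b' + br a' b) (m + n)
       + (0, if m + n = 0 then of_int m * form a b else 0)
       + (\<Sum>i\<le>Polynomial.degree q. mode (sc (Polynomial.coeff q i) (br a' b'), 0) (m + n + int i))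
       + (0, 1 / 2 * form a' b' * int_coeff q' (- m - n - 1)
             + form a' b' * of_int m * int_coeff q (- m - n)))"

definition affine_bracket ::
    "('k::field \<Rightarrow> 'a::ab_group_add \<Rightarrow> 'a) \<Rightarrow> ('a \<Rightarrow> 'a \<Rightarrow> 'a) \<Rightarrow> ('a \<Rightarrow> 'a \<Rightarrow> 'k)
      \<Rightarrow> 'k poly \<Rightarrow> 'k poly \<Rightarrow> ('k, 'a) affine \<Rightarrow> ('k, 'a) affine \<Rightarrow> ('k, 'a) affine" where
  "affine_bracket sc br form q q' x x' =
     (\<Sum>m\<in>Poly_Mapping.keys (fst x). \<Sum>n\<in>Poly_Mapping.keys (fst x').
        mode_bracket sc br form q q'
          (Poly_Mapping.lookup (fst x) m) m (Poly_Mapping.lookup (fst x') n) n)"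


subsection \<open>Restricted modules over the complex affine-type algebra\<close>

abbreviation ghat_bracket ::
    "(complex \<Rightarrow> 'g::ab_group_add \<Rightarrow> 'g) \<Rightarrow> ('g \<Rightarrow> 'g \<Rightarrow> 'g) \<Rightarrow> ('g \<Rightarrow> 'g \<Rightarrow> complex)
      \<Rightarrow> complex poly \<Rightarrow> (complex, 'g) affine \<Rightarrow> (complex, 'g) affine \<Rightarrow> (complex, 'g) affine" where
  "ghat_bracket sc br form p \<equiv> affine_bracket sc br form p (pderiv p)"

locale ghat_module = vector_space scW
  for sc :: "complex \<Rightarrow> 'g::ab_group_add \<Rightarrow> 'g"
    and br :: "'g \<Rightarrow> 'g \<Rightarrow> 'g"
    and form :: "'g \<Rightarrow> 'g \<Rightarrow> complex"
    and p :: "complex poly"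
    and scW :: "complex \<Rightarrow> 'w::ab_group_add \<Rightarrow> 'w" +
  fixes \<rho> :: "(complex, 'g) affine \<Rightarrow> 'w \<Rightarrow> 'w"
  assumes act_linear: "Vector_Spaces.linear scW scW (\<rho> x)"
    and act_add: "\<rho> (x + x') w = \<rho> x w + \<rho> x' w"
    and act_scale: "\<rho> (affine_scale sc c x) w = scW c (\<rho> x w)"
    and act_bracket: "\<rho> (ghat_bracket sc br form p x x') w = \<rho> x (\<rho> x' w) - \<rho> x' (\<rho> x w)"

locale restricted_ghat_module = ghat_module sc br form p scW \<rho>
  for sc :: "complex \<Rightarrow> 'g::ab_group_add \<Rightarrow> 'g" and br form p
    and l :: complex and scW :: "complex \<Rightarrow> 'w::ab_group_add \<Rightarrow> 'w" and \<rho> +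
  assumes level: "\<rho> central w = scW l w"
    and restricted: "\<exists>N. \<forall>n\<ge>N. \<rho> (mode u n) w = 0"


subsection \<open>Extension of scalars to Laurent series\<close>

text \<open>
  The convolution of Laurent series with coefficients in vector spaces along a bilinear map.
  The sum ranges over all indices that can contribute.
\<close>

definition fls_bilin ::
    "('a::zero \<Rightarrow> 'b::zero \<Rightarrow> 'c::comm_monoid_add) \<Rightarrow> 'a fls \<Rightarrow> 'b fls \<Rightarrow> 'c fls" where
  "fls_bilin B F G =
     Abs_fls (\<lambda>n. \<Sum>i = fls_subdegree F .. n - fls_subdegree G. B (F $$ i) (G $$ (n - i)))"

lemma fls_nth_fls_bilin:
  "fls_bilin B F G $$ n = (\<Sum>i = fls_subdegree F .. n - fls_subdegree G. B (F $$ i) (G $$ (n - i)))"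
  unfolding fls_bilin_def
  by (rule nth_Abs_fls_lower_bound[of "fls_subdegree F + fls_subdegree G"]) simp

text \<open>
  The natural map from the tensor product over the complex numbers of \<open>\<complex>((z))\<close> and \<open>\<gg>\<close>
  to \<open>\<gg>((z))\<close> is injective; the tensor product is taken to be its image, the set
  of finite sums of elements \<open>f(z)a\<close>.  Its scalar multiplication, bracket and form over
  \<open>\<complex>((z))\<close> are \<open>fls_bilin\<close> of the given ones.
\<close>

definition cz_tensor :: "(complex \<Rightarrow> 'g::ab_group_add \<Rightarrow> 'g) \<Rightarrow> 'g fls set" where
  "cz_tensor sc =
     {\<Sum>i<n. fls_bilin sc (f i) (fls_const (a i)) | (n::nat) (f :: nat \<Rightarrow> complex fls) a. True}"

type_synonym 'g gcheck = "(complex fls, 'g fls) affine"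

definition gcheck_carrier :: "(complex \<Rightarrow> 'g::ab_group_add \<Rightarrow> 'g) \<Rightarrow> 'g gcheck set" where
  "gcheck_carrier sc = {x. \<forall>n. Poly_Mapping.lookup (fst x) n \<in> cz_tensor sc \<times> cz_tensor sc}"

text \<open>The polynomial \<open>p(z + x)\<close> in \<open>x\<close>, with coefficients regarded as Laurent series in \<open>z\<close>.\<close>

definition shift_poly :: "complex poly \<Rightarrow> complex fls poly" where
  "shift_poly p = pcompose (map_poly fls_const p) [:fls_X, 1:]"

abbreviation gcheck_scale ::
    "(complex \<Rightarrow> 'g::ab_group_add \<Rightarrow> 'g) \<Rightarrow> complex fls \<Rightarrow> 'g gcheck \<Rightarrow> 'g gcheck" where
  "gcheck_scale sc \<equiv> affine_scale (fls_bilin sc)"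

abbreviation gcheck_bracket ::
    "(complex \<Rightarrow> 'g::ab_group_add \<Rightarrow> 'g) \<Rightarrow> ('g \<Rightarrow> 'g \<Rightarrow> 'g) \<Rightarrow> ('g \<Rightarrow> 'g \<Rightarrow> complex)
      \<Rightarrow> complex poly \<Rightarrow> 'g gcheck \<Rightarrow> 'g gcheck \<Rightarrow> 'g gcheck" where
  "gcheck_bracket sc br form p \<equiv>
     affine_bracket (fls_bilin sc) (fls_bilin br) (fls_bilin form)
       (shift_poly p) (shift_poly (pderiv p))"

definition bcheck_carrier :: "(complex \<Rightarrow> 'g::ab_group_add \<Rightarrow> 'g) \<Rightarrow> 'g gcheck set" where
  "bcheck_carrier sc = {x \<in> gcheck_carrier sc. \<forall>n<0. Poly_Mapping.lookup (fst x) n = 0}"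


section \<open>Universal enveloping algebras\<close>

text \<open>
  The free associative algebra on a set \<open>L\<close>: finitely supported functions on words over \<open>L\<close>,
  multiplied by concatenation of words.
\<close>

definition free_algebra :: "'l set \<Rightarrow> ('l list \<Rightarrow>\<^sub>0 'k::field) ring" where
  "free_algebra L =
     \<lparr>carrier = {f. \<forall>w\<in>Poly_Mapping.keys f. set w \<subseteq> L},
      monoid.mult = (\<lambda>f g. \<Sum>v\<in>Poly_Mapping.keys f. \<Sum>w\<in>Poly_Mapping.keys g.
        Poly_Mapping.single (v @ w) (Poly_Mapping.lookup f v * Poly_Mapping.lookup g w)),
      one = Poly_Mapping.single [] 1,
      ring.zero = 0,
      add = (+)\<rparr>"

definition uea_relations ::
    "'l::ab_group_add set \<Rightarrow> ('k::field \<Rightarrow> 'l \<Rightarrow> 'l) \<Rightarrow> ('l \<Rightarrow> 'l \<Rightarrow> 'l) \<Rightarrow> ('l list \<Rightarrow>\<^sub>0 'k) set" where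
  "uea_relations L scL brL =
     {Poly_Mapping.single [x + y] 1 - Poly_Mapping.single [x] 1 - Poly_Mapping.single [y] 1
        | x y. x \<in> L \<and> y \<in> L}
     \<union> {Poly_Mapping.single [scL c x] 1 - Poly_Mapping.single [x] c | c x. x \<in> L}
     \<union> {Poly_Mapping.single [x, y] 1 - Poly_Mapping.single [y, x] 1
          - Poly_Mapping.single [brL x y] 1 | x y. x \<in> L \<and> y \<in> L}"

definition uea_ideal ::
    "'l::ab_group_add set \<Rightarrow> ('k::field \<Rightarrow> 'l \<Rightarrow> 'l) \<Rightarrow> ('l \<Rightarrow> 'l \<Rightarrow> 'l) \<Rightarrow> ('l list \<Rightarrow>\<^sub>0 'k) set" where
  "uea_ideal L scL brL = Idl\<^bsub>free_algebra L\<^esub> (uea_relations L scL brL)"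

text \<open>
  The universal enveloping algebra of the Lie algebra \<open>L\<close>.  The free algebra is taken on the
  underlying set of \<open>L\<close>, so that the relations include those of the tensor algebra
  (linearity in each letter).
\<close>

definition uea ::
    "'l::ab_group_add set \<Rightarrow> ('k::field \<Rightarrow> 'l \<Rightarrow> 'l) \<Rightarrow> ('l \<Rightarrow> 'l \<Rightarrow> 'l) \<Rightarrow> ('l list \<Rightarrow>\<^sub>0 'k) set ring" where
  "uea L scL brL = free_algebra L Quot uea_ideal L scL brL"

definition uea_class ::
    "'l::ab_group_add set \<Rightarrow> ('k::field \<Rightarrow> 'l \<Rightarrow> 'l) \<Rightarrow> ('l \<Rightarrow> 'l \<Rightarrow> 'l)
      \<Rightarrow> ('l list \<Rightarrow>\<^sub>0 'k) \<Rightarrow> ('l list \<Rightarrow>\<^sub>0 'k) set" where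
  "uea_class L scL brL f = uea_ideal L scL brL +>\<^bsub>free_algebra L\<^esub> f"

text \<open>
  The algebra homomorphism from the enveloping algebra of a subalgebra to that of \<open>L\<close>:
  all representatives \<open>f\<close> of \<open>A\<close> have the same class, so the union is that class.
\<close>

definition uea_inclusion ::
    "'l::ab_group_add set \<Rightarrow> ('k::field \<Rightarrow> 'l \<Rightarrow> 'l) \<Rightarrow> ('l \<Rightarrow> 'l \<Rightarrow> 'l)
      \<Rightarrow> ('l list \<Rightarrow>\<^sub>0 'k) set \<Rightarrow> ('l list \<Rightarrow>\<^sub>0 'k) set" where
  "uea_inclusion L scL brL A = (\<Union>f\<in>A. uea_class L scL brL f)"

text \<open>
  The action of the enveloping algebra on a module with action \<open>\<sigma>\<close> of the Lie algebra; all
  representatives act in the same way.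
\<close>

definition uea_act ::
    "('k::field \<Rightarrow> 'n::ab_group_add \<Rightarrow> 'n) \<Rightarrow> ('l \<Rightarrow> 'n \<Rightarrow> 'n) \<Rightarrow> ('l list \<Rightarrow>\<^sub>0 'k) set \<Rightarrow> 'n \<Rightarrow> 'n" where
  "uea_act scN \<sigma> A x =
     the_elem ((\<lambda>f. \<Sum>w\<in>Poly_Mapping.keys f. scN (Poly_Mapping.lookup f w) (foldr \<sigma> w x)) ` A)"


section \<open>Tensor products over a noncommutative ring\<close>

text \<open>
  The tensor product over \<open>R\<close> of a right module (the additive group of \<open>M\<close>, with right
  action \<open>ra\<close>) and a left module (the type \<open>'n\<close>, with left action \<open>la\<close>): the free
  abelian group on pairs modulo biadditivity and \<open>R\<close>-balancedness.
\<close>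

definition tensor_free :: "('m, 'c) ring_scheme \<Rightarrow> ('m \<times> 'n::ab_group_add \<Rightarrow>\<^sub>0 int) monoid" where
  "tensor_free M = free_Abelian_group (carrier M \<times> UNIV)"

definition tensor_relations ::
    "('r, 'd) ring_scheme \<Rightarrow> ('m, 'c) ring_scheme \<Rightarrow> ('m \<Rightarrow> 'r \<Rightarrow> 'm)
      \<Rightarrow> ('r \<Rightarrow> 'n \<Rightarrow> 'n) \<Rightarrow> ('m \<times> 'n::ab_group_add \<Rightarrow>\<^sub>0 int) set" where
  "tensor_relations R M ra la =
     {frag_of (m \<oplus>\<^bsub>M\<^esub> m', n) - frag_of (m, n) - frag_of (m', n)
        | m m' n. m \<in> carrier M \<and> m' \<in> carrier M}
     \<union> {frag_of (m, n + n') - frag_of (m, n) - frag_of (m, n') | m n n'. m \<in> carrier M}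
     \<union> {frag_of (ra m r, n) - frag_of (m, la r n) | m r n. m \<in> carrier M \<and> r \<in> carrier R}"

definition tensor_subgroup ::
    "('r, 'd) ring_scheme \<Rightarrow> ('m, 'c) ring_scheme \<Rightarrow> ('m \<Rightarrow> 'r \<Rightarrow> 'm)
      \<Rightarrow> ('r \<Rightarrow> 'n \<Rightarrow> 'n) \<Rightarrow> ('m \<times> 'n::ab_group_add \<Rightarrow>\<^sub>0 int) set" where
  "tensor_subgroup R M ra la = generate (tensor_free M) (tensor_relations R M ra la)"

definition tensor_group ::
    "('r, 'd) ring_scheme \<Rightarrow> ('m, 'c) ring_scheme \<Rightarrow> ('m \<Rightarrow> 'r \<Rightarrow> 'm)
      \<Rightarrow> ('r \<Rightarrow> 'n \<Rightarrow> 'n) \<Rightarrow> ('m \<times> 'n::ab_group_add \<Rightarrow>\<^sub>0 int) set monoid" where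
  "tensor_group R M ra la = tensor_free M Mod tensor_subgroup R M ra la"

definition pure_tensor ::
    "('r, 'd) ring_scheme \<Rightarrow> ('m, 'c) ring_scheme \<Rightarrow> ('m \<Rightarrow> 'r \<Rightarrow> 'm)
      \<Rightarrow> ('r \<Rightarrow> 'n \<Rightarrow> 'n) \<Rightarrow> 'm \<Rightarrow> 'n \<Rightarrow> ('m \<times> 'n::ab_group_add \<Rightarrow>\<^sub>0 int) set" where
  "pure_tensor R M ra la m n = tensor_subgroup R M ra la #>\<^bsub>tensor_free M\<^esub> frag_of (m, n)"

text \<open>
  The endomorphism induced by an endomorphism \<open>\<phi>\<close> of the right module \<open>M\<close>, given by
  \<open>m \<otimes> n \<mapsto> \<phi>(m) \<otimes> n\<close>; again the cosets in the union all coincide.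
\<close>

definition tensor_map ::
    "('r, 'd) ring_scheme \<Rightarrow> ('m, 'c) ring_scheme \<Rightarrow> ('m \<Rightarrow> 'r \<Rightarrow> 'm) \<Rightarrow> ('r \<Rightarrow> 'n \<Rightarrow> 'n)
      \<Rightarrow> ('m \<Rightarrow> 'm) \<Rightarrow> ('m \<times> 'n::ab_group_add \<Rightarrow>\<^sub>0 int) set \<Rightarrow> ('m \<times> 'n \<Rightarrow>\<^sub>0 int) set" where
  "tensor_map R M ra la \<phi> A =
     (\<Union>x\<in>A. tensor_subgroup R M ra la #>\<^bsub>tensor_free M\<^esub>
        frag_extend (\<lambda>(m, n). frag_of (\<phi> m, n)) x)"


section \<open>The induced module\<close>

type_synonym 'g gcheck_uea = "('g gcheck list \<Rightarrow>\<^sub>0 complex fls) set"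
type_synonym 'g vacuum_elem = "('g gcheck_uea \<times> complex fls \<Rightarrow>\<^sub>0 int) set"

context
  fixes sc :: "complex \<Rightarrow> 'g::ab_group_add \<Rightarrow> 'g"
    and br :: "'g \<Rightarrow> 'g \<Rightarrow> 'g"
    and form :: "'g \<Rightarrow> 'g \<Rightarrow> complex"
    and p :: "complex poly"
    and l :: complex
begin

definition U_gcheck :: "'g gcheck_uea ring" where
  "U_gcheck = uea (gcheck_carrier sc) (gcheck_scale sc) (gcheck_bracket sc br form p)"

definition U_gcheck_class :: "('g gcheck list \<Rightarrow>\<^sub>0 complex fls) \<Rightarrow> 'g gcheck_uea" where
  "U_gcheck_class =
     uea_class (gcheck_carrier sc) (gcheck_scale sc) (gcheck_bracket sc br form p)"

definition U_bcheck :: "'g gcheck_uea ring" where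
  "U_bcheck = uea (bcheck_carrier sc) (gcheck_scale sc) (gcheck_bracket sc br form p)"

definition U_right_act :: "'g gcheck_uea \<Rightarrow> 'g gcheck_uea \<Rightarrow> 'g gcheck_uea" where
  "U_right_act A C = A \<otimes>\<^bsub>U_gcheck\<^esub>
     uea_inclusion (gcheck_carrier sc) (gcheck_scale sc) (gcheck_bracket sc br form p) C"

text \<open>The one-dimensional module \<open>\<complex>((z))\<^sub>l\<close>, first over the subalgebra, then over its enveloping algebra.\<close>

definition level_act :: "'g gcheck \<Rightarrow> complex fls \<Rightarrow> complex fls" where
  "level_act x f = snd x * fls_const l * f"

definition U_level_act :: "'g gcheck_uea \<Rightarrow> complex fls \<Rightarrow> complex fls" where
  "U_level_act = uea_act (*) level_act"

text \<open>
  The fields \<open>mult\<close> and \<open>one\<close> of the record are not part of the notion of a module and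
  carry no information.
\<close>

definition Vcheck :: "(complex fls, 'g vacuum_elem) module" where
  "Vcheck =
     \<lparr>carrier = carrier (tensor_group U_bcheck U_gcheck U_right_act U_level_act),
      monoid.mult = undefined,
      one = undefined,
      ring.zero = \<one>\<^bsub>tensor_group U_bcheck U_gcheck U_right_act U_level_act\<^esub>,
      add = (\<otimes>\<^bsub>tensor_group U_bcheck U_gcheck U_right_act U_level_act\<^esub>),
      module.smult = (\<lambda>f. tensor_map U_bcheck U_gcheck U_right_act U_level_act
        (\<lambda>A. U_gcheck_class (Poly_Mapping.single [] f) \<otimes>\<^bsub>U_gcheck\<^esub> A))\<rparr>"

definition Vcheck_act :: "'g gcheck \<Rightarrow> 'g vacuum_elem \<Rightarrow> 'g vacuum_elem" where
  "Vcheck_act x = tensor_map U_bcheck U_gcheck U_right_act U_level_act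
     (\<lambda>A. U_gcheck_class (Poly_Mapping.single [x] 1) \<otimes>\<^bsub>U_gcheck\<^esub> A)"

definition Vcheck_vac :: "'g vacuum_elem" where
  "Vcheck_vac = pure_tensor U_bcheck U_gcheck U_right_act U_level_act \<one>\<^bsub>U_gcheck\<^esub> 1"

definition gcheck_mode :: "'g \<times> 'g \<Rightarrow> int \<Rightarrow> 'g gcheck" where
  "gcheck_mode u n = mode (fls_const (fst u), fls_const (snd u)) n"

text \<open>The identification of \<open>u\<close> with \<open>u(-1)\<one>\<close>.\<close>

definition Vcheck_embed :: "'g \<times> 'g \<Rightarrow> 'g vacuum_elem" where
  "Vcheck_embed u = Vcheck_act (gcheck_mode u (- 1)) Vcheck_vac"

end


section \<open>Vertex algebras and their modules\<close>

text \<open>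
  \<open>Y u n v\<close> is the \<open>n\<close>-th mode of \<open>u\<close> applied to \<open>v\<close>: \<open>Y(u,x)v\<close> is the
  sum over \<open>n\<close> of \<open>u\<^sub>n v x\<^sup>-\<^sup>n\<^sup>-\<^sup>1\<close>.  The infinite sums below have only finitely
  many nonzero terms, by truncation.
\<close>

definition fin_sum :: "('k, 'v, 'm) module_scheme \<Rightarrow> ('i \<Rightarrow> 'v) \<Rightarrow> 'v" where
  "fin_sum V f = finsum V f {i. f i \<noteq> \<zero>\<^bsub>V\<^esub>}"

text \<open>
  The axiom \<open>jacobi\<close> is the coefficient of \<open>x\<^sub>0\<^sup>-\<^sup>k\<^sup>-\<^sup>1 x\<^sub>1\<^sup>-\<^sup>m\<^sup>-\<^sup>1 x\<^sub>2\<^sup>-\<^sup>n\<^sup>-\<^sup>1\<close> in the Jacobi identity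
  \<open>x\<^sub>0\<^sup>-\<^sup>1\<delta>((x\<^sub>1-x\<^sub>2)/x\<^sub>0) Y(u,x\<^sub>1)Y(v,x\<^sub>2) - x\<^sub>0\<^sup>-\<^sup>1\<delta>((x\<^sub>2-x\<^sub>1)/-x\<^sub>0) Y(v,x\<^sub>2)Y(u,x\<^sub>1)
    = x\<^sub>2\<^sup>-\<^sup>1\<delta>((x\<^sub>1-x\<^sub>0)/x\<^sub>2) Y(Y(u,x\<^sub>0)v,x\<^sub>2)\<close>.
\<close>

locale vertex_algebra = Module.module "ring_of_type_algebra :: complex ring" V
  for V :: "(complex, 'v) module" (structure) +
  fixes Y :: "'v \<Rightarrow> int \<Rightarrow> 'v \<Rightarrow> 'v" and vac :: 'v
  assumes Y_closed: "u \<in> carrier V \<Longrightarrow> v \<in> carrier V \<Longrightarrow> Y u n v \<in> carrier V"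
    and Y_add_left: "u \<in> carrier V \<Longrightarrow> u' \<in> carrier V \<Longrightarrow> v \<in> carrier V
          \<Longrightarrow> Y (u \<oplus>\<^bsub>V\<^esub> u') n v = Y u n v \<oplus>\<^bsub>V\<^esub> Y u' n v"
    and Y_add_right: "u \<in> carrier V \<Longrightarrow> v \<in> carrier V \<Longrightarrow> v' \<in> carrier V
          \<Longrightarrow> Y u n (v \<oplus>\<^bsub>V\<^esub> v') = Y u n v \<oplus>\<^bsub>V\<^esub> Y u n v'"
    and Y_smult_left: "u \<in> carrier V \<Longrightarrow> v \<in> carrier V
          \<Longrightarrow> Y (c \<odot>\<^bsub>V\<^esub> u) n v = c \<odot>\<^bsub>V\<^esub> Y u n v"
    and Y_smult_right: "u \<in> carrier V \<Longrightarrow> v \<in> carrier V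
          \<Longrightarrow> Y u n (c \<odot>\<^bsub>V\<^esub> v) = c \<odot>\<^bsub>V\<^esub> Y u n v"
    and truncation: "u \<in> carrier V \<Longrightarrow> v \<in> carrier V \<Longrightarrow> \<exists>N. \<forall>n\<ge>N. Y u n v = \<zero>\<^bsub>V\<^esub>"
    and vac_closed: "vac \<in> carrier V"
    and vacuum: "v \<in> carrier V \<Longrightarrow> Y vac n v = (if n = - 1 then v else \<zero>\<^bsub>V\<^esub>)"
    and creation_regular: "v \<in> carrier V \<Longrightarrow> n \<ge> 0 \<Longrightarrow> Y v n vac = \<zero>\<^bsub>V\<^esub>"
    and creation: "v \<in> carrier V \<Longrightarrow> Y v (- 1) vac = v"
    and jacobi: "u \<in> carrier V \<Longrightarrow> v \<in> carrier V \<Longrightarrow> w \<in> carrier V \<Longrightarrow>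
      fin_sum V (\<lambda>i::nat. ((- 1) ^ i * (of_int k gchoose i))
          \<odot>\<^bsub>V\<^esub> Y u (k + m - int i) (Y v (n + int i) w))
      \<ominus>\<^bsub>V\<^esub> fin_sum V (\<lambda>i::nat. ((- 1) powi k * (- 1) ^ i * (of_int k gchoose i))
          \<odot>\<^bsub>V\<^esub> Y v (k + n - int i) (Y u (m + int i) w))
      = fin_sum V (\<lambda>i::nat. (of_int m gchoose i)
          \<odot>\<^bsub>V\<^esub> Y (Y u (k + int i) v) (m + n - int i) w)"

locale vertex_module = vertex_algebra V Y vac + W: vector_space scW
  for V :: "(complex, 'v) module" and Y :: "'v \<Rightarrow> int \<Rightarrow> 'v \<Rightarrow> 'v" and vac :: 'v
    and scW :: "complex \<Rightarrow> 'w::ab_group_add \<Rightarrow> 'w" +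
  fixes YW :: "'v \<Rightarrow> int \<Rightarrow> 'w \<Rightarrow> 'w"
  assumes YW_add: "u \<in> carrier V \<Longrightarrow> u' \<in> carrier V
          \<Longrightarrow> YW (u \<oplus>\<^bsub>V\<^esub> u') n w = YW u n w + YW u' n w"
    and YW_smult: "u \<in> carrier V \<Longrightarrow> YW (c \<odot>\<^bsub>V\<^esub> u) n w = scW c (YW u n w)"
    and YW_linear: "u \<in> carrier V \<Longrightarrow> Vector_Spaces.linear scW scW (YW u n)"
    and YW_truncation: "u \<in> carrier V \<Longrightarrow> \<exists>N. \<forall>n\<ge>N. YW u n w = 0"
    and YW_vacuum: "YW vac n w = (if n = - 1 then w else 0)"
    and YW_jacobi: "u \<in> carrier V \<Longrightarrow> v \<in> carrier V \<Longrightarrow>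
      Sum_any (\<lambda>i::nat. scW ((- 1) ^ i * (of_int k gchoose i))
          (YW u (k + m - int i) (YW v (n + int i) w)))
      - Sum_any (\<lambda>i::nat. scW ((- 1) powi k * (- 1) ^ i * (of_int k gchoose i))
          (YW v (k + n - int i) (YW u (m + int i) w)))
      = Sum_any (\<lambda>i::nat. scW (of_int m gchoose i)
          (YW (Y u (k + int i) v) (m + n - int i) w))"


subsection \<open>Vertex algebras over Laurent series and type zero modules\<close>

definition restrict_scalars :: "(complex fls, 'v) module \<Rightarrow> (complex, 'v) module" where
  "restrict_scalars V =
     \<lparr>carrier = carrier V, monoid.mult = monoid.mult V, one = one V, ring.zero = ring.zero V,
      add = add V, module.smult = (\<lambda>c. module.smult V (fls_const c))\<rparr>"

text \<open>
  The coefficient of \<open>x\<^sup>i\<close> in \<open>f(z + x)\<close> is the \<open>i\<close>-th derivative of \<open>f\<close> divided by \<open>i!\<close>.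
\<close>

locale vertex_cz_algebra =
    Module.module "ring_of_type_algebra :: complex fls ring" V
    + C: vertex_algebra "restrict_scalars V" Y vac
  for V :: "(complex fls, 'v) module" and Y :: "'v \<Rightarrow> int \<Rightarrow> 'v \<Rightarrow> 'v" and vac :: 'v +
  assumes cz_compatible: "u \<in> carrier V \<Longrightarrow> v \<in> carrier V \<Longrightarrow>
      Y (f \<odot>\<^bsub>V\<^esub> u) n (g \<odot>\<^bsub>V\<^esub> v)
      = fin_sum V (\<lambda>i::nat. (fls_const (1 / fact i) * (fls_deriv ^^ i) f * g)
          \<odot>\<^bsub>V\<^esub> Y u (n + int i) v)"

locale type_zero_module = vertex_module "restrict_scalars V" Y vac scW YW
  for V :: "(complex fls, 'v) module" and Y :: "'v \<Rightarrow> int \<Rightarrow> 'v \<Rightarrow> 'v" and vac :: 'v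
    and scW :: "complex \<Rightarrow> 'w::ab_group_add \<Rightarrow> 'w" and YW :: "'v \<Rightarrow> int \<Rightarrow> 'w \<Rightarrow> 'w" +
  assumes type_zero: "v \<in> carrier V \<Longrightarrow>
      YW (f \<odot>\<^bsub>V\<^esub> v) n w = Sum_any (\<lambda>j::int. scW (f $$ j) (YW v (n + j) w))"

text \<open>
  \<open>Y\<close> is the vertex algebra structure on the induced module for which \<open>Y(u,x) = u(x)\<close>.
\<close>

definition is_Vcheck_structure ::
    "(complex \<Rightarrow> 'g::ab_group_add \<Rightarrow> 'g) \<Rightarrow> ('g \<Rightarrow> 'g \<Rightarrow> 'g) \<Rightarrow> ('g \<Rightarrow> 'g \<Rightarrow> complex)
      \<Rightarrow> complex poly \<Rightarrow> complex \<Rightarrow> ('g vacuum_elem \<Rightarrow> int \<Rightarrow> 'g vacuum_elem \<Rightarrow> 'g vacuum_elem)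
      \<Rightarrow> bool" where
  "is_Vcheck_structure sc br form p l Y \<longleftrightarrow>
     vertex_cz_algebra (Vcheck sc br form p l) Y (Vcheck_vac sc br form p l) \<and>
     (\<forall>u n. \<forall>v\<in>carrier (Vcheck sc br form p l).
        Y (Vcheck_embed sc br form p l u) n v
        = Vcheck_act sc br form p l (gcheck_mode u n) v)"

end

theory Submission
  imports Defs "HOL-Library.Function_Algebras"
begin

text \<open>
  For part (1), let \<open>\<rho>\<close> be the action of the affine algebra on \<open>W\<close> and consider the space
  \<open>E = Hom(W, W((x)))\<close> of fields, on which \<open>f(z)\<close> acts as multiplication by \<open>f(x)\<close>. The products
  \<open>u(x)\<^sub>n \<alpha>(x)\<close> make \<open>E\<close> a module of level \<open>l\<close> over the algebra with \<open>p(z + x\<^sub>2)\<close> in its bracket: the shift by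
  \<open>z\<close> is the Taylor expansion of \<open>p(x\<^sub>2)\<close> around the point \<open>x\<close>. The identity field is annihilated by all
  \<open>u(n)\<close> with \<open>n \<ge> 0\<close>, so the universal property of the induced module \<open>V\<close> yields a map \<open>\<Theta> : V \<rightarrow> E\<close> that
  sends the vacuum to it. To see that \<open>\<Theta>\<close> is a vertex module structure, the Jacobi identity for \<open>(v, w)\<close> is proved
  by induction on \<open>w\<close>, which is generated from the vacuum by the operators \<open>u(n)\<close>. The step needs only the
  commutators of \<open>v\<close> with the generators. They are known for generators \<open>v\<close>, hence on the \<open>\<complex>((z))\<close>-span
  of generators and vacuum, which is stable under \<open>u(n)\<close> for \<open>n \<ge> 0\<close>; a first induction gives the Jacobi
  identity for \<open>v\<close> in that span and all \<open>w\<close>, in particular the commutators of generators with all of \<open>V\<close>,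
  and a second induction gives it everywhere.
  Uniqueness holds because \<open>V\<close> is generated by \<open>u(n)\<close> and \<open>\<complex>((z))\<close> from the vacuum. Part (2) compares the
  coefficients of the commutator formula for generators.
\<close>

section \<open>Products of fields\<close>

text \<open>The induction for the Jacobi identity starts at the vacuum, and this start has content
  of its own: it amounts to Y(v,x)1 = e^(xD) v, that is, the modes of v applied to the vacuum must
  become the divided derivatives of the field of v. Here the factor f(z + x) in the definition of a
  vertex algebra over \<complex>((z)) enters, as Taylor's formula for the coefficient f(x) of a
  field. Products of fields carry a free power of x_1 besides the power of x_1 - x_2. A product is
  then literally the left-hand side of the Jacobi identity, and one commutator formula serves both
  the module structure on fields and the inductive step. All calculus is done on coefficients. The
  infinite sums are finite on each single vector, but with a bound that depends on the vector.
  Identities are therefore proved for sums cut off at N and asserted for all large N, which merges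
  the bounds of several nested sums without naming them.\<close>

lemma gbinomial_Vandermonde_atMost:
  "(\<Sum>i\<le>s. (a gchoose i) * (b gchoose (s - i))) = ((a + b) gchoose s)" for a b :: "'a::field_char_0"
  using gbinomial_Vandermonde[of a b s] by (simp add: atLeast0AtMost)

text \<open>Both sides are the trinomial coefficient (a choose i + q) (i + q choose i).\<close>

lemma gbinomial_mult_swap:
  "(a gchoose i) * ((a - of_nat i) gchoose q) = (a gchoose q) * ((a - of_nat q) gchoose i)"
  for a :: "'a::field_char_0"
proof -
  have 1: "(a gchoose (i + q)) * (of_nat (i + q) gchoose i) = (a gchoose i) * ((a - of_nat i) gchoose q)"
    using gbinomial_trinomial_revision[of i "i + q" a] by simp
  have 2: "(a gchoose (i + q)) * (of_nat (i + q) gchoose q) = (a gchoose q) * ((a - of_nat q) gchoose i)"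
    using gbinomial_trinomial_revision[of q "i + q" a] by simp
  have "(of_nat (i + q) gchoose i) = (of_nat (i + q) gchoose q :: 'a)"
    using gbinomial_of_nat_symmetric[of i "i + q"] by simp
  with 1 2 show ?thesis by simp
qed

text \<open>Negating the upper index turns the second binomial into (-1)^(s - i) (s - n - m - 1
  choose s - i). Its upper entry is free of i, the signs cancel, and Vandermonde applies. The result
  becomes the Leibniz rule in \<open>sum_dcf\<close>.\<close>

lemma sum_signed_gbinomial:
  "(\<Sum>i\<le>s. (m gchoose i) * ((- 1) ^ (s - i) * ((n + m - of_nat i) gchoose (s - i)))) = (- 1) ^ s * (n gchoose s)"
  for m n :: "'a::field_char_0"
proof -
  have "(\<Sum>i\<le>s. (m gchoose i) * ((- 1) ^ (s - i) * ((n + m - of_nat i) gchoose (s - i))))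
      = (\<Sum>i\<le>s. (m gchoose i) * ((of_nat s - n - m - 1) gchoose (s - i)))"
  proof (rule sum.cong[OF refl])
    fix i assume "i \<in> {..s}"
    then have i: "i \<le> s" by simp
    have "((n + m - of_nat i) gchoose (s - i)) = (- 1) ^ (s - i) * ((of_nat s - n - m - 1) gchoose (s - i))"
      using gbinomial_negated_upper[of "n + m - of_nat i" "s - i"] i
      by (simp add: of_nat_diff algebra_simps)
    then show "(m gchoose i) * ((- 1) ^ (s - i) * ((n + m - of_nat i) gchoose (s - i)))
        = (m gchoose i) * ((of_nat s - n - m - 1) gchoose (s - i))"
      by (simp add: mult.assoc[symmetric] power_add[symmetric] flip: mult_2)
  qed
  also have "\<dots> = ((of_nat s - n - 1) gchoose s)"
    using gbinomial_Vandermonde_atMost[of m "of_nat s - n - m - 1" s] by (simp add: algebra_simps)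
  also have "\<dots> = (- 1) ^ s * (n gchoose s)"
    using gbinomial_negated_upper[of n s] by (simp add: mult.assoc[symmetric] power_add[symmetric] flip: mult_2)
  finally show ?thesis .
qed

lemma powi_minus_one_mult:
  "(- 1) powi j * (- 1) powi k = ((- 1) powi (j + k) :: 'a::field)"
  by (simp add: power_int_add)

text \<open>The coefficients of \<open>(x\<^sub>1 - x\<^sub>2)\<^sup>k\<close>, expanded in nonnegative powers of \<open>x\<^sub>2\<close> and of \<open>x\<^sub>1\<close> respectively.\<close>

definition lcf :: "int \<Rightarrow> nat \<Rightarrow> complex" where
  "lcf k i = (- 1) ^ i * (of_int k gchoose i)"

definition rcf :: "int \<Rightarrow> nat \<Rightarrow> complex" where
  "rcf k i = (- 1) powi k * (- 1) ^ i * (of_int k gchoose i)"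

lemma rcf_lcf: "rcf k i = (- 1) powi k * lcf k i"
  by (simp add: rcf_def lcf_def)

text \<open>One coefficient of the identity: (x_1 - x_2)^k times \<partial>_1^q (x_1 - x_2)^j / q!
  equals (j choose q) (x_1 - x_2)^(k + j - q), everything expanded in nonnegative powers of
  x_2.\<close>

lemma sum_lcf_left:
  "(\<Sum>i\<le>s. lcf j i * lcf k (s - i) * (of_int (j - int i) gchoose q))
    = (of_int j gchoose q) * lcf (k + j - int q) s"
proof -
  have "(\<Sum>i\<le>s. lcf j i * lcf k (s - i) * (of_int (j - int i) gchoose q))
      = (\<Sum>i\<le>s. (- 1) ^ s * (of_int j gchoose q) *
          (((of_int j - of_nat q) gchoose i) * (of_int k gchoose (s - i))))"
  proof (rule sum.cong[OF refl])
    fix i assume "i \<in> {..s}"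
    then have "(- 1) ^ i * (- 1) ^ (s - i) = ((- 1) ^ s :: complex)"
      by (simp add: power_add[symmetric])
    moreover have "lcf j i * lcf k (s - i) * (of_int (j - int i) gchoose q) =
      ((- 1) ^ i * (- 1) ^ (s - i)) * ((of_int j gchoose i) * ((of_int j - of_nat i) gchoose q)) * (of_int k gchoose (s - i))"
      by (simp add: lcf_def mult_ac)
    ultimately show "lcf j i * lcf k (s - i) * (of_int (j - int i) gchoose q) =
        (- 1) ^ s * (of_int j gchoose q) * (((of_int j - of_nat q) gchoose i) * (of_int k gchoose (s - i)))"
      by (simp only: gbinomial_mult_swap[of "of_int j" i q] mult_ac)
  qed
  also have "\<dots> = (- 1) ^ s * (of_int j gchoose q) * ((of_int j - of_nat q + of_int k) gchoose s)"
    by (simp only: sum_distrib_left[symmetric] gbinomial_Vandermonde_atMost)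
  finally show ?thesis by (simp add: lcf_def algebra_simps)
qed

text \<open>The identity behind \<open>sum_lcf_left\<close>, expanded in nonnegative powers of x_1.
  Differentiating q times lowers the power of x_1 by q, hence the shift s - q and the empty case s <
  q.\<close>

lemma sum_rcf_left:
  "(\<Sum>i\<le>s. rcf j i * rcf k (s - i) * (of_nat i gchoose q))
    = (if s < q then 0 else (of_int j gchoose q) * rcf (k + j - int q) (s - q))"
proof (cases "s < q")
  case True
  have "(of_nat i gchoose q) = (0::complex)" if "i \<le> s" for i
    using that True by (simp add: binomial_gbinomial[symmetric] binomial_eq_0)
  then show ?thesis using True by simp
next
  case False
  have eq: "rcf j i * rcf k (s - i) * (of_nat i gchoose q) =
      (if i < q then 0 else (- 1) powi (j + k) * (- 1) ^ s * (of_int j gchoose q) *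
          (((of_int j - of_nat q) gchoose (i - q)) * (of_int k gchoose (s - i))))" if "i \<le> s" for i
  proof (cases "i < q")
    case True
    then show ?thesis by (simp add: binomial_gbinomial[symmetric] binomial_eq_0)
  next
    case False
    then have "(of_int j gchoose i) * (of_nat i gchoose q) = (of_int j gchoose q) * ((of_int j - of_nat q) gchoose (i - q) :: complex)"
      using gbinomial_trinomial_revision[of q i "of_int j :: complex"] by simp
    moreover have "(- 1) ^ i * (- 1) ^ (s - i) = ((- 1) ^ s :: complex)"
      using that by (simp add: power_add[symmetric])
    moreover have "rcf j i * rcf k (s - i) * (of_nat i gchoose q) = ((- 1) powi j * (- 1) powi k) * ((- 1) ^ i * (- 1) ^ (s - i))
       * ((of_int j gchoose i) * (of_nat i gchoose q)) * (of_int k gchoose (s - i))"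
      by (simp add: rcf_def mult_ac)
    ultimately show ?thesis using False by (simp add: powi_minus_one_mult mult_ac)
  qed
  have "(\<Sum>i\<le>s. rcf j i * rcf k (s - i) * (of_nat i gchoose q))
      = (\<Sum>i\<in>{q..s}. (- 1) powi (j + k) * (- 1) ^ s * (of_int j gchoose q) *
          (((of_int j - of_nat q) gchoose (i - q)) * (of_int k gchoose (s - i))))"
    by (rule sum.mono_neutral_cong_right) (auto simp: eq)
  also have "\<dots> = (\<Sum>i\<le>s - q. (- 1) powi (j + k) * (- 1) ^ s * (of_int j gchoose q) *
          (((of_int j - of_nat q) gchoose i) * (of_int k gchoose (s - q - i))))"
    by (rule sum.reindex_bij_witness[of _ "\<lambda>i. i + q" "\<lambda>i. i - q"]) (use False in auto)
  also have "\<dots> = (- 1) powi (j + k) * (- 1) ^ s * (of_int j gchoose q) * ((of_int j - of_nat q + of_int k) gchoose (s - q))"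
    by (simp only: sum_distrib_left[symmetric] gbinomial_Vandermonde_atMost)
  also have "\<dots> = (of_int j gchoose q) * rcf (k + j - int q) (s - q)"
  proof -
    have "(- 1) powi (k + j - int q) * (- 1) ^ (s - q) = (- 1) powi (j + k) * ((- 1) ^ s :: complex)"
    proof -
      have "(- 1) powi (- int q) = ((- 1) ^ q :: complex)"
        by (simp add: power_int_minus flip: power_inverse)
      then have "(- 1) powi (k + j - int q) = (- 1) powi (j + k) * ((- 1) ^ q :: complex)"
        using power_int_add[of "- 1 :: complex" "j + k" "- int q"] by (simp add: add.commute)
      moreover have "(- 1) ^ q * (- 1) ^ (s - q) = ((- 1) ^ s :: complex)"
        using False by (simp add: power_add[symmetric])
      ultimately show ?thesis by (simp add: mult.assoc)
    qed
    then show ?thesis by (simp add: rcf_def algebra_simps)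
  qed
  finally show ?thesis using False by simp
qed

lemma sum_square_triangle:
  fixes g :: "nat \<Rightarrow> nat \<Rightarrow> 'a::comm_monoid_add"
  assumes "\<And>i r. i + r \<ge> N \<Longrightarrow> g i r = 0"
  shows "(\<Sum>i<N. \<Sum>r<N. g i r) = (\<Sum>s<N. \<Sum>i\<le>s. g i (s - i))"
proof -
  have "(\<Sum>i<N. \<Sum>r<N. g i r) = (\<Sum>(i, r)\<in>{..<N} \<times> {..<N}. g i r)"
    by (simp add: sum.cartesian_product)
  also have "\<dots> = (\<Sum>(i, r)\<in>{(i, r). i + r < N}. g i r)"
  proof (rule sum.mono_neutral_right)
    show "\<forall>p\<in>{..<N} \<times> {..<N} - {(i, r). i + r < N}. (case p of (i, r) \<Rightarrow> g i r) = 0"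
    proof
      fix p assume p: "p \<in> {..<N} \<times> {..<N} - {(i, r). i + r < N}"
      obtain i r where "p = (i, r)" by (cases p)
      then show "(case p of (i, r) \<Rightarrow> g i r) = 0" using p assms[of i r] by auto
    qed
  qed auto
  also have "\<dots> = (\<Sum>s<N. \<Sum>i\<le>s. g i (s - i))"
    by (rule sum.triangle_reindex)
  finally show ?thesis .
qed

section \<open>Fields and their products, cut off at finite bounds\<close>

locale complex_space = vector_space scW
  for scW :: "complex \<Rightarrow> 'w::ab_group_add \<Rightarrow> 'w"
begin

lemma Sum_any_eq_sum:
  assumes "\<And>i. i \<ge> N \<Longrightarrow> f i = 0"
  shows "Sum_any f = (\<Sum>i<(N::nat). f i)"
  by (rule Sum_any.expand_superset) (use assms in \<open>auto simp: not_less[symmetric]\<close>)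

text \<open>\<open>\<alpha> n\<close> is the coefficient of x^(-n-1); vanishing for large n on each
  vector makes this set Hom(W, W((x))).\<close>

definition fields :: "(int \<Rightarrow> 'w \<Rightarrow> 'w) set" where
  "fields = {\<alpha>. (\<forall>n. Vector_Spaces.linear scW scW (\<alpha> n)) \<and> (\<forall>w. \<exists>N. \<forall>n\<ge>N. \<alpha> n w = 0)}"

lemma linearI:
  assumes "\<And>x y. f (x + y) = f x + f y" "\<And>c x. f (scW c x) = scW c (f x)"
  shows "Vector_Spaces.linear scW scW f"
  using assms vector_space_axioms by (simp add: Vector_Spaces.linear_iff)

lemma fieldsI:
  assumes "\<And>n x y. \<alpha> n (x + y) = \<alpha> n x + \<alpha> n y" "\<And>n c x. \<alpha> n (scW c x) = scW c (\<alpha> n x)"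
    and "\<And>w. \<exists>N. \<forall>n\<ge>N. \<alpha> n w = 0"
  shows "\<alpha> \<in> fields"
  using assms by (simp add: fields_def linearI)

lemma fields_add: "\<alpha> \<in> fields \<Longrightarrow> \<alpha> n (x + y) = \<alpha> n x + \<alpha> n y"
  and fields_scale: "\<alpha> \<in> fields \<Longrightarrow> \<alpha> n (scW c x) = scW c (\<alpha> n x)"
  and fields_linear: "\<alpha> \<in> fields \<Longrightarrow> Vector_Spaces.linear scW scW (\<alpha> n)"
  and fields_trunc: "\<alpha> \<in> fields \<Longrightarrow> \<exists>N. \<forall>n\<ge>N. \<alpha> n w = 0"
  by (auto simp: fields_def Vector_Spaces.linear_iff)

lemma fields_zero: "\<alpha> \<in> fields \<Longrightarrow> \<alpha> n 0 = 0"
  using fields_add[of \<alpha> n 0 0] by simp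

lemma fields_sum: "\<alpha> \<in> fields \<Longrightarrow> \<alpha> n (sum f A) = (\<Sum>i\<in>A. \<alpha> n (f i))"
  by (induction A rule: infinite_finite_induct) (simp_all add: fields_zero fields_add)

lemma fields_diff: "\<alpha> \<in> fields \<Longrightarrow> \<alpha> n (x - y) = \<alpha> n x - \<alpha> n y"
  using fields_add[of \<alpha> n "x - y" y] by (simp add: algebra_simps)

text \<open>Truncation phrased with a filter: the bounds needed in one computation are then combined
  by \<open>eventually_conj\<close> instead of explicit maxima.\<close>

lemma fields_eventually:
  assumes "\<alpha> \<in> fields"
  shows "eventually (\<lambda>N::nat. \<forall>n\<ge>m + int N. \<alpha> n w = 0) sequentially"
proof -
  obtain K where K: "\<forall>n\<ge>K. \<alpha> n w = 0" using fields_trunc[OF assms] by blast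
  show ?thesis
    by (rule eventually_sequentiallyI[of "nat (K - m)"]) (use K in auto)
qed

text \<open>One N serves all i at once, because \<open>\<gamma> (m + int i) w\<close> is nonzero for
  only finitely many i and the property is assumed outright at the zero vector.\<close>

lemma eventually_all_shifts:
  assumes \<gamma>: "\<gamma> \<in> fields" and P0: "\<And>i N. P i 0 N"
    and P: "\<And>i w. eventually (P i w) sequentially"
  shows "eventually (\<lambda>N. \<forall>i. P i (\<gamma> (m + int i) w) N) sequentially"
proof -
  obtain K where K: "\<forall>i\<ge>m + int K. \<gamma> i w = 0"
    using eventually_happens'[OF _ fields_eventually[OF \<gamma>, of m w]] by auto
  have "eventually (\<lambda>N. \<forall>i\<in>{..<K}. P i (\<gamma> (m + int i) w) N) sequentially"
    by (intro eventually_ball_finite) (auto intro: P)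
  then show ?thesis
  proof eventually_elim
    case (elim N)
    show ?case
    proof
      fix i show "P i (\<gamma> (m + int i) w) N"
        using elim K P0 by (cases "i < K") auto
    qed
  qed
qed

text \<open>The coefficients of \<open>(x\<^sub>1 - x\<^sub>2)\<^sup>k \<alpha>(x\<^sub>1) \<beta>(x\<^sub>2) - (- x\<^sub>2 + x\<^sub>1)\<^sup>k \<beta>(x\<^sub>2) \<alpha>(x\<^sub>1)\<close>;
  for \<open>m = 0\<close> they form the field \<open>\<alpha>(x)\<^sub>k \<beta>(x)\<close>.\<close>

definition prd :: "int \<Rightarrow> int \<Rightarrow> (int \<Rightarrow> 'w \<Rightarrow> 'w) \<Rightarrow> (int \<Rightarrow> 'w \<Rightarrow> 'w) \<Rightarrow> int \<Rightarrow> 'w \<Rightarrow> 'w" where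
  "prd m k \<alpha> \<beta> n w =
     Sum_any (\<lambda>i::nat. scW ((- 1) ^ i * (of_int k gchoose i)) (\<alpha> (k + m - int i) (\<beta> (n + int i) w)))
   - Sum_any (\<lambda>i::nat. scW ((- 1) powi k * (- 1) ^ i * (of_int k gchoose i))
       (\<beta> (k + n - int i) (\<alpha> (m + int i) w)))"

text \<open>Agrees with \<open>prd\<close> on a given vector once N is large. Linearity and the
  manipulation of double sums are carried out here, where every sum is finite.\<close>

definition prd_upto :: "nat \<Rightarrow> int \<Rightarrow> int \<Rightarrow> (int \<Rightarrow> 'w \<Rightarrow> 'w) \<Rightarrow> (int \<Rightarrow> 'w \<Rightarrow> 'w) \<Rightarrow> int \<Rightarrow> 'w \<Rightarrow> 'w" where
  "prd_upto N m k \<alpha> \<beta> n w =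
     (\<Sum>i<N. scW (lcf k i) (\<alpha> (k + m - int i) (\<beta> (n + int i) w)))
   - (\<Sum>i<N. scW (rcf k i) (\<beta> (k + n - int i) (\<alpha> (m + int i) w)))"

lemma prd_eq_prd_upto:
  assumes "\<alpha> \<in> fields" "\<beta> \<in> fields" "\<forall>i\<ge>n + int N. \<beta> i w = 0" "\<forall>i\<ge>m + int N. \<alpha> i w = 0"
  shows "prd m k \<alpha> \<beta> n w = prd_upto N m k \<alpha> \<beta> n w"
  unfolding prd_def prd_upto_def lcf_def rcf_def
  by (intro arg_cong2[where f = "(-)"] Sum_any_eq_sum) (use assms in \<open>auto simp: fields_zero\<close>)

text \<open>Uniform in n' \<ge> n, since an outer product evaluates the inner one at all the shifts
  n + i.\<close>

lemma eventually_prd: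
  assumes "\<alpha> \<in> fields" "\<beta> \<in> fields"
  shows "eventually (\<lambda>N. \<forall>n'\<ge>n. prd m k \<alpha> \<beta> n' w = prd_upto N m k \<alpha> \<beta> n' w) sequentially"
  using fields_eventually[OF assms(1), of m w] fields_eventually[OF assms(2), of n w]
proof eventually_elim
  case (elim N)
  then show ?case using assms by (auto intro!: prd_eq_prd_upto)
qed

text \<open>Covers the terms of an outer product in which the inner product acts on
  \<open>\<gamma> (t + int i) w\<close>. The index \<open>h i\<close> may decrease without bound, as
  only finitely many of these vectors are nonzero.\<close>

lemma eventually_prd_shifts:
  assumes "\<alpha> \<in> fields" "\<beta> \<in> fields" "\<gamma> \<in> fields"
  shows "eventually (\<lambda>N. \<forall>i::nat. prd m k \<alpha> \<beta> (h i) (\<gamma> (t + int i) w)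
      = prd_upto N m k \<alpha> \<beta> (h i) (\<gamma> (t + int i) w)) sequentially"
proof (rule eventually_all_shifts[OF assms(3)])
  show "prd m k \<alpha> \<beta> (h i) 0 = prd_upto N m k \<alpha> \<beta> (h i) 0" for i N
    using assms by (simp add: prd_def prd_upto_def fields_zero)
  show "\<forall>\<^sub>F N in sequentially. prd m k \<alpha> \<beta> (h i) w = prd_upto N m k \<alpha> \<beta> (h i) w" for i w
    using eventually_prd[OF assms(1,2), of "h i" m k w] by (rule eventually_mono) auto
qed

lemma prd_upto_add: "\<alpha> \<in> fields \<Longrightarrow> \<beta> \<in> fields \<Longrightarrow>
    prd_upto N m k \<alpha> \<beta> n (x + y) = prd_upto N m k \<alpha> \<beta> n x + prd_upto N m k \<alpha> \<beta> n y"
  by (simp add: prd_upto_def fields_add scale_right_distrib sum.distrib)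

lemma prd_upto_scale: "\<alpha> \<in> fields \<Longrightarrow> \<beta> \<in> fields \<Longrightarrow>
    prd_upto N m k \<alpha> \<beta> n (scW c x) = scW c (prd_upto N m k \<alpha> \<beta> n x)"
  by (simp add: prd_upto_def fields_scale scale_sum_right scale_right_diff_distrib mult.commute)

lemma prd_upto_cong_trunc:
  assumes "\<forall>i. \<beta> (n + int i) w = 0" "\<forall>i<N. \<beta> (k + n - int i) (\<alpha> (m + int i) w) = 0" "\<alpha> \<in> fields"
  shows "prd_upto N m k \<alpha> \<beta> n w = 0"
  using assms by (simp add: prd_upto_def fields_zero)

lemma prd_fields:
  assumes \<alpha>: "\<alpha> \<in> fields" and \<beta>: "\<beta> \<in> fields"
  shows "prd m k \<alpha> \<beta> \<in> fields"
proof (rule fieldsI)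
  fix n x y
  have "\<forall>\<^sub>F N in sequentially. prd m k \<alpha> \<beta> n (x + y) = prd m k \<alpha> \<beta> n x + prd m k \<alpha> \<beta> n y"
    using eventually_prd[OF \<alpha> \<beta>, of n m k x] eventually_prd[OF \<alpha> \<beta>, of n m k y] eventually_prd[OF \<alpha> \<beta>, of n m k "x + y"]
    by eventually_elim (simp add: prd_upto_add[OF \<alpha> \<beta>])
  then show "prd m k \<alpha> \<beta> n (x + y) = prd m k \<alpha> \<beta> n x + prd m k \<alpha> \<beta> n y" by simp
next
  fix n c x
  have "\<forall>\<^sub>F N in sequentially. prd m k \<alpha> \<beta> n (scW c x) = scW c (prd m k \<alpha> \<beta> n x)"
    using eventually_prd[OF \<alpha> \<beta>, of n m k x] eventually_prd[OF \<alpha> \<beta>, of n m k "scW c x"]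
    by eventually_elim (simp add: prd_upto_scale[OF \<alpha> \<beta>])
  then show "prd m k \<alpha> \<beta> n (scW c x) = scW c (prd m k \<alpha> \<beta> n x)" by simp
next
  fix w
  obtain N where N: "\<forall>n\<ge>0. prd m k \<alpha> \<beta> n w = prd_upto N m k \<alpha> \<beta> n w"
    using eventually_happens'[OF _ eventually_prd[OF \<alpha> \<beta>, of 0 m k w]] by auto
  have "\<exists>M. \<forall>i<N. \<forall>n\<ge>int M. \<beta> n (\<alpha> (m + int i) w) = 0"
  proof -
    have "eventually (\<lambda>M. \<forall>i\<in>{..<N}. \<forall>n\<ge>0 + int M. \<beta> n (\<alpha> (m + int i) w) = 0) sequentially"
      by (intro eventually_ball_finite) (auto intro: fields_eventually[OF \<beta>, of 0, simplified])
    from eventually_happens'[OF _ this] show ?thesis by auto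
  qed
  then obtain M where M: "\<forall>i<N. \<forall>n\<ge>int M. \<beta> n (\<alpha> (m + int i) w) = 0" by blast
  obtain K where K: "\<forall>n\<ge>K. \<beta> n w = 0" using fields_trunc[OF \<beta>] by blast
  \<comment> \<open>The three lower bounds on n: K kills the first sum, 0 admits the cut-off N, and
    k + n - i \<ge> M for i < N kills the second sum.\<close>
  have "prd m k \<alpha> \<beta> n w = 0" if n: "n \<ge> max (max K 0) (int M + int N - k)" for n
  proof -
    have "prd_upto N m k \<alpha> \<beta> n w = 0"
      by (rule prd_upto_cong_trunc) (use n K M \<alpha> in auto)
    then show ?thesis using N n by simp
  qed
  then show "\<exists>N. \<forall>n\<ge>N. prd m k \<alpha> \<beta> n w = 0" by blast
qed

end

section \<open>The commutator formula for products of fields\<close>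

lemma sum_rotate:
  "(\<Sum>i\<in>A. \<Sum>r\<in>B. \<Sum>q\<in>C. f i r q) = (\<Sum>q\<in>C. \<Sum>i\<in>A. \<Sum>r\<in>B. f i r q)"
proof -
  have "(\<Sum>i\<in>A. \<Sum>r\<in>B. \<Sum>q\<in>C. f i r q) = (\<Sum>i\<in>A. \<Sum>q\<in>C. \<Sum>r\<in>B. f i r q)"
    by (rule sum.cong[OF refl], rule sum.swap)
  also have "\<dots> = (\<Sum>q\<in>C. \<Sum>i\<in>A. \<Sum>r\<in>B. f i r q)"
    by (rule sum.swap)
  finally show ?thesis .
qed

context complex_space
begin

text \<open>The operator \<open>prd 0 j u\<close> is a derivation of products, up to terms from the
  commutator of u with \<open>\<alpha>\<close>. The hypothesis \<open>comm\<close> says that this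
  commutator is a combination of divided derivatives of the delta function. Taking the residue in
  x_0 against (x_0 - x_2)^j differentiates that power at x_0 = x_1, which is where (j choose q) and
  the exponent k + j - q come from.\<close>

lemma prd_commutator:
  assumes u: "u \<in> fields" and \<alpha>: "\<alpha> \<in> fields" and \<beta>: "\<beta> \<in> fields"
    and \<gamma>: "\<And>q. q < Q \<Longrightarrow> \<gamma> q \<in> fields"
    and comm: "\<And>s t w. u s (\<alpha> t w) - \<alpha> t (u s w)
        = (\<Sum>q<Q. scW (of_int s gchoose q) (\<gamma> q (s + t - int q) w))"
  shows "prd 0 j u (prd m k \<alpha> \<beta>) n w - prd m k \<alpha> (prd 0 j u \<beta>) n w
    = (\<Sum>q<Q. scW (of_int j gchoose q) (prd m (k + j - int q) (\<gamma> q) \<beta> n w))"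
proof -
  define ab where "ab = prd m k \<alpha> \<beta>"
  define ub where "ub = prd 0 j u \<beta>"
  have ab: "ab \<in> fields" and ub: "ub \<in> fields"
    using u \<alpha> \<beta> by (simp_all add: ab_def ub_def prd_fields)
  \<comment> \<open>A single N at which every product below is given by its cut-off sum and at which
    \<open>\<beta>\<close> and all \<open>\<gamma> q\<close> already vanish at the end of the
    range.\<close>
  have "eventually (\<lambda>N. (\<forall>n'\<ge>n. prd 0 j u ab n' w = prd_upto N 0 j u ab n' w)
    \<and> (\<forall>n'\<ge>n. ab n' w = prd_upto N m k \<alpha> \<beta> n' w)
    \<and> (\<forall>i. ab (j + n - int i) (u (0 + int i) w) = prd_upto N m k \<alpha> \<beta> (j + n - int i) (u (0 + int i) w))
    \<and> (\<forall>n'\<ge>n. prd m k \<alpha> ub n' w = prd_upto N m k \<alpha> ub n' w)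
    \<and> (\<forall>n'\<ge>n. ub n' w = prd_upto N 0 j u \<beta> n' w)
    \<and> (\<forall>i. ub (k + n - int i) (\<alpha> (m + int i) w) = prd_upto N 0 j u \<beta> (k + n - int i) (\<alpha> (m + int i) w))
    \<and> (\<forall>q\<in>{..<Q}. \<forall>n'\<ge>n. prd m (k + j - int q) (\<gamma> q) \<beta> n' w = prd_upto N m (k + j - int q) (\<gamma> q) \<beta> n' w)
    \<and> (\<forall>i\<ge>n + int N. \<beta> i w = 0)
    \<and> (\<forall>q\<in>{..<Q}. \<forall>i\<ge>m - int q + int N. \<gamma> q i w = 0)) sequentially"
    unfolding ab_def ub_def
    by (intro eventually_conj eventually_ball_finite ballI eventually_prd eventually_prd_shifts fields_eventually)
      (use u \<alpha> \<beta> \<gamma> ab ub in \<open>auto simp: ab_def ub_def\<close>)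
  then obtain N where
    e1: "\<forall>n'\<ge>n. prd 0 j u ab n' w = prd_upto N 0 j u ab n' w"
    and e2: "\<forall>n'\<ge>n. ab n' w = prd_upto N m k \<alpha> \<beta> n' w"
    and e3: "\<forall>i. ab (j + n - int i) (u (0 + int i) w) = prd_upto N m k \<alpha> \<beta> (j + n - int i) (u (0 + int i) w)"
    and e4: "\<forall>n'\<ge>n. prd m k \<alpha> ub n' w = prd_upto N m k \<alpha> ub n' w"
    and e5: "\<forall>n'\<ge>n. ub n' w = prd_upto N 0 j u \<beta> n' w"
    and e6: "\<forall>i. ub (k + n - int i) (\<alpha> (m + int i) w) = prd_upto N 0 j u \<beta> (k + n - int i) (\<alpha> (m + int i) w)"
    and e7: "\<forall>q\<in>{..<Q}. \<forall>n'\<ge>n. prd m (k + j - int q) (\<gamma> q) \<beta> n' w = prd_upto N m (k + j - int q) (\<gamma> q) \<beta> n' w"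
    and e8: "\<forall>i\<ge>n + int N. \<beta> i w = 0"
    and e9: "\<forall>q\<in>{..<Q}. \<forall>i\<ge>m - int q + int N. \<gamma> q i w = 0"
    using eventually_happens'[OF sequentially_bot] by blast
  \<comment> \<open>The six orders of composition: T1 = u \<alpha> \<beta>, T2 = u \<beta> \<alpha>,
    T3 = \<alpha> \<beta> u, T4 = \<beta> \<alpha> u, S1 = \<alpha> u \<beta>, S4 = \<beta> u
    \<alpha>. T2 and T3 occur in both products and cancel; T1 - S1 and S4 - T4 each contain one
    commutator of u and \<alpha>.\<close>
  define T1 where "T1 = (\<Sum>i<N. \<Sum>r<N. scW (lcf j i * lcf k r) (u (j - int i) (\<alpha> (k + m - int r) (\<beta> (n + int (i + r)) w))))"
  define S1 where "S1 = (\<Sum>i<N. \<Sum>r<N. scW (lcf j i * lcf k r) (\<alpha> (k + m - int r) (u (j - int i) (\<beta> (n + int (i + r)) w))))"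
  define T2 where "T2 = (\<Sum>i<N. \<Sum>r<N. scW (lcf j i * rcf k r) (u (j - int i) (\<beta> (k + n + int i - int r) (\<alpha> (m + int r) w))))"
  define T3 where "T3 = (\<Sum>i<N. \<Sum>r<N. scW (rcf j i * lcf k r) (\<alpha> (k + m - int r) (\<beta> (j + n - int i + int r) (u (int i) w))))"
  define T4 where "T4 = (\<Sum>i<N. \<Sum>r<N. scW (rcf j i * rcf k r) (\<beta> (j + k + n - int (i + r)) (\<alpha> (m + int r) (u (int i) w))))"
  define S4 where "S4 = (\<Sum>i<N. \<Sum>r<N. scW (rcf j i * rcf k r) (\<beta> (j + k + n - int (i + r)) (u (int i) (\<alpha> (m + int r) w))))"
  have L: "prd 0 j u ab n w = (T1 - T2) - (T3 - T4)"
  proof -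
    have "prd 0 j u ab n w = prd_upto N 0 j u ab n w" using e1 by simp
    also have "\<dots> = (\<Sum>i<N. scW (lcf j i) (u (j - int i) (prd_upto N m k \<alpha> \<beta> (n + int i) w)))
        - (\<Sum>i<N. scW (rcf j i) (prd_upto N m k \<alpha> \<beta> (j + n - int i) (u (int i) w)))"
      using e2 e3 by (simp add: prd_upto_def[of N 0 j])
    also have "(\<Sum>i<N. scW (lcf j i) (u (j - int i) (prd_upto N m k \<alpha> \<beta> (n + int i) w))) = T1 - T2"
      unfolding T1_def T2_def prd_upto_def sum_subtractf[symmetric]
      by (rule sum.cong[OF refl])
        (simp add: fields_diff[OF u] fields_sum[OF u] fields_scale[OF u] scale_right_diff_distrib scale_sum_right sum_subtractf algebra_simps)
    also have "(\<Sum>i<N. scW (rcf j i) (prd_upto N m k \<alpha> \<beta> (j + n - int i) (u (int i) w))) = T3 - T4"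
      unfolding T3_def T4_def prd_upto_def sum_subtractf[symmetric]
      by (rule sum.cong[OF refl])
        (simp add: scale_right_diff_distrib scale_sum_right sum_subtractf algebra_simps)
    finally show ?thesis .
  qed
  have R: "prd m k \<alpha> ub n w = (S1 - T3) - (T2 - S4)"
  proof -
    have "prd m k \<alpha> ub n w = prd_upto N m k \<alpha> ub n w" using e4 by simp
    also have "\<dots> = (\<Sum>r<N. scW (lcf k r) (\<alpha> (k + m - int r) (prd_upto N 0 j u \<beta> (n + int r) w)))
        - (\<Sum>r<N. scW (rcf k r) (prd_upto N 0 j u \<beta> (k + n - int r) (\<alpha> (m + int r) w)))"
      using e5 e6 by (simp add: prd_upto_def[of N m k])
    also have "(\<Sum>r<N. scW (lcf k r) (\<alpha> (k + m - int r) (prd_upto N 0 j u \<beta> (n + int r) w))) = S1 - T3"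
      unfolding S1_def T3_def prd_upto_def sum_subtractf[symmetric]
      by (subst sum.swap, rule sum.cong[OF refl])
        (simp add: fields_diff[OF \<alpha>] fields_sum[OF \<alpha>] fields_scale[OF \<alpha>] scale_right_diff_distrib scale_sum_right sum_subtractf algebra_simps)
    also have "(\<Sum>r<N. scW (rcf k r) (prd_upto N 0 j u \<beta> (k + n - int r) (\<alpha> (m + int r) w))) = T2 - S4"
      unfolding T2_def S4_def prd_upto_def sum_subtractf[symmetric]
      by (subst sum.swap, rule sum.cong[OF refl])
        (simp add: scale_right_diff_distrib scale_sum_right sum_subtractf algebra_simps)
    finally show ?thesis .
  qed
  \<comment> \<open>After \<open>comm\<close> is inserted, the terms depend on i and r only through
    s = i + r, so the double sums can be collected along diagonals.\<close>
  define G where "G q s = \<gamma> q (k + j - int q + m - int s) (\<beta> (n + int s) w)" for q s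
  define H where "H q s = \<beta> (k + j + n - int s) (\<gamma> q (m + int s - int q) w)" for q s
  have G0: "G q s = 0" if "q < Q" "s \<ge> N" for q s
    using that e8 \<gamma> by (simp add: G_def fields_zero)
  have H0: "H q s = 0" if "q < Q" "s \<ge> N" for q s
    using that e9 \<beta> by (simp add: H_def fields_zero)
  have D1: "T1 - S1 = (\<Sum>q<Q. scW (of_int j gchoose q) (\<Sum>s<N. scW (lcf (k + j - int q) s) (G q s)))"
  proof -
    have "T1 - S1 = (\<Sum>i<N. \<Sum>r<N. \<Sum>q<Q. scW (lcf j i * lcf k r * (of_int (j - int i) gchoose q)) (G q (i + r)))"
      unfolding T1_def S1_def sum_subtractf[symmetric] scale_right_diff_distrib[symmetric] comm
      by (intro sum.cong refl) (simp add: G_def scale_sum_right algebra_simps)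
    also have "\<dots> = (\<Sum>q<Q. \<Sum>i<N. \<Sum>r<N. scW (lcf j i * lcf k r * (of_int (j - int i) gchoose q)) (G q (i + r)))"
      by (rule sum_rotate)
    also have "\<dots> = (\<Sum>q<Q. \<Sum>s<N. scW ((of_int j gchoose q) * lcf (k + j - int q) s) (G q s))"
    proof (rule sum.cong[OF refl])
      fix q assume q: "q \<in> {..<Q}"
      have "(\<Sum>i<N. \<Sum>r<N. scW (lcf j i * lcf k r * (of_int (j - int i) gchoose q)) (G q (i + r)))
        = (\<Sum>s<N. \<Sum>i\<le>s. scW (lcf j i * lcf k (s - i) * (of_int (j - int i) gchoose q)) (G q (i + (s - i))))"
        by (rule sum_square_triangle) (use G0 q in auto)
      also have "\<dots> = (\<Sum>s<N. scW ((of_int j gchoose q) * lcf (k + j - int q) s) (G q s))"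
        by (rule sum.cong[OF refl], subst sum_lcf_left[symmetric]) (simp add: scale_sum_left)
      finally show "(\<Sum>i<N. \<Sum>r<N. scW (lcf j i * lcf k r * (of_int (j - int i) gchoose q)) (G q (i + r))) = \<dots>" .
    qed
    finally show ?thesis by (simp add: scale_sum_right)
  qed
  have D2: "S4 - T4 = (\<Sum>q<Q. scW (of_int j gchoose q) (\<Sum>s<N. scW (rcf (k + j - int q) s) (H q (s + q))))"
  proof -
    have "S4 - T4 = (\<Sum>i<N. \<Sum>r<N. \<Sum>q<Q. scW (rcf j i * rcf k r * (of_nat i gchoose q)) (H q (i + r)))"
      unfolding T4_def S4_def sum_subtractf[symmetric] scale_right_diff_distrib[symmetric] fields_diff[OF \<beta>, symmetric] comm
      by (intro sum.cong refl) (simp add: H_def scale_sum_right fields_sum[OF \<beta>] fields_scale[OF \<beta>] algebra_simps)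
    also have "\<dots> = (\<Sum>q<Q. \<Sum>i<N. \<Sum>r<N. scW (rcf j i * rcf k r * (of_nat i gchoose q)) (H q (i + r)))"
      by (rule sum_rotate)
    also have "\<dots> = (\<Sum>q<Q. \<Sum>s<N. scW ((of_int j gchoose q) * rcf (k + j - int q) s) (H q (s + q)))"
    proof (rule sum.cong[OF refl])
      fix q assume q: "q \<in> {..<Q}"
      have "(\<Sum>i<N. \<Sum>r<N. scW (rcf j i * rcf k r * (of_nat i gchoose q)) (H q (i + r)))
        = (\<Sum>s<N. \<Sum>i\<le>s. scW (rcf j i * rcf k (s - i) * (of_nat i gchoose q)) (H q (i + (s - i))))"
        by (rule sum_square_triangle) (use H0 q in auto)
      also have "\<dots> = (\<Sum>s<N. scW (if s < q then 0 else (of_int j gchoose q) * rcf (k + j - int q) (s - q)) (H q s))"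
        by (rule sum.cong[OF refl], subst sum_rcf_left[symmetric]) (simp add: scale_sum_left)
      also have "\<dots> = (\<Sum>s\<in>{q..<N}. scW ((of_int j gchoose q) * rcf (k + j - int q) (s - q)) (H q s))"
        by (rule sum.mono_neutral_cong_right) auto
      also have "\<dots> = (\<Sum>s\<in>{..<N - q}. scW ((of_int j gchoose q) * rcf (k + j - int q) s) (H q (s + q)))"
        by (rule sum.reindex_bij_witness[of _ "\<lambda>i. i + q" "\<lambda>i. i - q"]) auto
      also have "\<dots> = (\<Sum>s<N. scW ((of_int j gchoose q) * rcf (k + j - int q) s) (H q (s + q)))"
        by (rule sum.mono_neutral_left) (use H0 q in auto)
      finally show "(\<Sum>i<N. \<Sum>r<N. scW (rcf j i * rcf k r * (of_nat i gchoose q)) (H q (i + r))) = \<dots>" .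
    qed
    finally show ?thesis by (simp add: scale_sum_right)
  qed
  have "prd 0 j u ab n w - prd m k \<alpha> ub n w = (T1 - S1) - (S4 - T4)"
    unfolding L R by (simp add: algebra_simps)
  also have "\<dots> = (\<Sum>q<Q. scW (of_int j gchoose q) (prd_upto N m (k + j - int q) (\<gamma> q) \<beta> n w))"
    unfolding D1 D2 sum_subtractf[symmetric, where A = "{..<Q}"] scale_right_diff_distrib[symmetric]
    by (intro sum.cong refl arg_cong[where f = "scW _"]) (simp add: prd_upto_def G_def H_def algebra_simps)
  also have "\<dots> = (\<Sum>q<Q. scW (of_int j gchoose q) (prd m (k + j - int q) (\<gamma> q) \<beta> n w))"
    by (intro sum.cong refl) (use e7 in auto)
  finally show ?thesis by (simp add: ab_def ub_def)
qed

section \<open>Multiplication of fields by Laurent series in x\<close>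

text \<open>\<open>fscale f \<alpha>\<close> is \<open>f(x)\<alpha>(x)\<close>.\<close>

definition fscale :: "complex fls \<Rightarrow> (int \<Rightarrow> 'w \<Rightarrow> 'w) \<Rightarrow> int \<Rightarrow> 'w \<Rightarrow> 'w" where
  "fscale f \<alpha> n w = Sum_any (\<lambda>j::int. scW (f $$ j) (\<alpha> (n + j) w))"

lemma fscale_eq_sum:
  assumes "\<And>i. i < a \<Longrightarrow> f $$ i = 0" "\<And>i. i \<ge> b \<Longrightarrow> \<alpha> (n + i) w = 0"
  shows "fscale f \<alpha> n w = (\<Sum>j\<in>{a..<b}. scW (f $$ j) (\<alpha> (n + j) w))"
  unfolding fscale_def
proof (rule Sum_any.expand_superset)
  show "{j. scW (f $$ j) (\<alpha> (n + j) w) \<noteq> 0} \<subseteq> {a..<b}"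
  proof
    fix j assume "j \<in> {j. scW (f $$ j) (\<alpha> (n + j) w) \<noteq> 0}"
    then have "f $$ j \<noteq> 0" "\<alpha> (n + j) w \<noteq> 0" by auto
    then have "\<not> j < a" "\<not> b \<le> j" using assms(1)[of j] assms(2)[of j] by blast+
    then show "j \<in> {a..<b}" by simp
  qed
qed simp

lemma fields_eventually_int:
  assumes "\<alpha> \<in> fields"
  shows "eventually (\<lambda>N::nat. \<forall>i\<ge>int N. \<alpha> (n + i) w = 0) sequentially"
  using fields_eventually[OF assms, of n w] by (rule eventually_mono) auto

lemma eventually_fscale:
  assumes "\<alpha> \<in> fields"
  shows "eventually (\<lambda>N. \<forall>n'\<ge>n. fscale f \<alpha> n' w
      = (\<Sum>j\<in>{fls_subdegree f..<int N}. scW (f $$ j) (\<alpha> (n' + j) w))) sequentially"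
  using fields_eventually_int[OF assms, of n w]
proof eventually_elim
  case (elim N)
  show ?case
  proof (intro allI impI fscale_eq_sum)
    fix n' i assume "n \<le> n'" "int N \<le> i"
    then have "\<alpha> (n + (n' - n + i)) w = 0" using elim by (intro elim[rule_format]) simp
    then show "\<alpha> (n' + i) w = 0" by simp
  qed simp
qed

lemma eventually_fscale_shifts:
  assumes "\<alpha> \<in> fields" "\<gamma> \<in> fields"
  shows "eventually (\<lambda>N. \<forall>i::nat. fscale f \<alpha> (h i) (\<gamma> (t + int i) w)
      = (\<Sum>j\<in>{fls_subdegree f..<int N}. scW (f $$ j) (\<alpha> (h i + j) (\<gamma> (t + int i) w)))) sequentially"
proof (rule eventually_all_shifts[OF assms(2)])
  show "fscale f \<alpha> (h i) 0 = (\<Sum>j\<in>{fls_subdegree f..<int N}. scW (f $$ j) (\<alpha> (h i + j) 0))" for i N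
    using assms by (simp add: fscale_def fields_zero)
  show "\<forall>\<^sub>F N in sequentially. fscale f \<alpha> (h i) w
      = (\<Sum>j\<in>{fls_subdegree f..<int N}. scW (f $$ j) (\<alpha> (h i + j) w))" for i w
    using eventually_fscale[OF assms(1), of "h i" f w] by (rule eventually_mono) auto
qed

lemma fscale_fields:
  assumes \<alpha>: "\<alpha> \<in> fields"
  shows "fscale f \<alpha> \<in> fields"
proof (rule fieldsI)
  fix n x y
  have "\<forall>\<^sub>F N in sequentially. fscale f \<alpha> n (x + y) = fscale f \<alpha> n x + fscale f \<alpha> n y"
    using eventually_fscale[OF \<alpha>, of n f x] eventually_fscale[OF \<alpha>, of n f y] eventually_fscale[OF \<alpha>, of n f "x + y"]
    by eventually_elim (simp add: fields_add[OF \<alpha>] scale_right_distrib sum.distrib)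
  then show "fscale f \<alpha> n (x + y) = fscale f \<alpha> n x + fscale f \<alpha> n y" by simp
next
  fix n c x
  have "\<forall>\<^sub>F N in sequentially. fscale f \<alpha> n (scW c x) = scW c (fscale f \<alpha> n x)"
    using eventually_fscale[OF \<alpha>, of n f x] eventually_fscale[OF \<alpha>, of n f "scW c x"]
    by eventually_elim (simp add: fields_scale[OF \<alpha>] scale_sum_right mult.commute)
  then show "fscale f \<alpha> n (scW c x) = scW c (fscale f \<alpha> n x)" by simp
next
  fix w
  obtain K where K: "\<forall>n\<ge>K. \<alpha> n w = 0" using fields_trunc[OF \<alpha>] by blast
  have "fscale f \<alpha> n w = 0" if "n \<ge> K - fls_subdegree f" for n
    using fscale_eq_sum[of "fls_subdegree f" f "fls_subdegree f" \<alpha> n w] K that by simp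
  then show "\<exists>N. \<forall>n\<ge>N. fscale f \<alpha> n w = 0" by blast
qed

lemma fscale_add_right:
  assumes "\<alpha> \<in> fields" "\<beta> \<in> fields"
  shows "fscale f (\<alpha> + \<beta>) = fscale f \<alpha> + fscale f \<beta>"
proof (intro ext)
  fix n w
  have "\<forall>\<^sub>F N in sequentially. fscale f (\<alpha> + \<beta>) n w = (fscale f \<alpha> + fscale f \<beta>) n w"
    using eventually_fscale[OF assms(1), of n f w] eventually_fscale[OF assms(2), of n f w]
      fields_eventually_int[OF assms(1), of n w] fields_eventually_int[OF assms(2), of n w]
  proof eventually_elim
    case (elim N)
    have "fscale f (\<alpha> + \<beta>) n w = (\<Sum>j\<in>{fls_subdegree f..<int N}. scW (f $$ j) ((\<alpha> + \<beta>) (n + j) w))"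
      by (rule fscale_eq_sum) (use elim in auto)
    then show ?case using elim by (simp add: scale_right_distrib sum.distrib)
  qed
  then show "fscale f (\<alpha> + \<beta>) n w = (fscale f \<alpha> + fscale f \<beta>) n w" by simp
qed

lemma fscale_add_left:
  assumes "\<alpha> \<in> fields"
  shows "fscale (f + g) \<alpha> = fscale f \<alpha> + fscale g \<alpha>"
proof (intro ext)
  fix n w
  define a where "a = min (fls_subdegree f) (fls_subdegree g)"
  have a: "\<And>i. i < a \<Longrightarrow> f $$ i = 0" "\<And>i. i < a \<Longrightarrow> g $$ i = 0" by (auto simp: a_def)
  obtain b where b: "\<forall>i\<ge>int b. \<alpha> (n + i) w = 0"
    using eventually_happens'[OF sequentially_bot fields_eventually_int[OF assms, of n w]] by blast
  have "fscale h \<alpha> n w = (\<Sum>j\<in>{a..<int b}. scW (h $$ j) (\<alpha> (n + j) w))" if "h \<in> {f, g, f + g}" for h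
    by (rule fscale_eq_sum) (use a b that in auto)
  then show "fscale (f + g) \<alpha> n w = (fscale f \<alpha> + fscale g \<alpha>) n w"
    by (simp add: scale_left_distrib sum.distrib)
qed

lemma fscale_const: "fscale (fls_const c) \<alpha> n w = scW c (\<alpha> n w)"
  using fscale_eq_sum[of 0 "fls_const c" 1 "\<lambda>n w. \<alpha> n w" n w]
  unfolding fscale_def
proof -
  have "Sum_any (\<lambda>j. scW (fls_const c $$ j) (\<alpha> (n + j) w)) = (\<Sum>j\<in>{0}. scW (fls_const c $$ j) (\<alpha> (n + j) w))"
    by (rule Sum_any.expand_superset) auto
  then show "Sum_any (\<lambda>j. scW (fls_const c $$ j) (\<alpha> (n + j) w)) = scW c (\<alpha> n w)" by simp
qed

lemma fscale_one: "fscale 1 \<alpha> = \<alpha>"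
  using fscale_const[of 1 \<alpha>] by (intro ext) simp

lemma fscale_zero_left [simp]: "fscale 0 \<alpha> = 0"
  by (intro ext) (simp add: fscale_def)

lemma fscale_zero_right [simp]: "fscale f 0 = 0"
  by (intro ext) (simp add: fscale_def)

lemma fscale_mult:
  assumes \<alpha>: "\<alpha> \<in> fields"
  shows "fscale (f * g) \<alpha> = fscale f (fscale g \<alpha>)"
proof (intro ext)
  fix n w
  define a where "a = fls_subdegree f"
  define b where "b = fls_subdegree g"
  obtain K where K: "\<forall>i\<ge>K. \<alpha> i w = 0" using fields_trunc[OF \<alpha>] by blast
  \<comment> \<open>Cut-offs valid for the whole rectangle: for i \<ge> a the inner terms have ended
    by B, and for j \<ge> b the outer ones by A.\<close>
  define B where "B = max (K - n - a) b"
  define A where "A = max (K - n - b) a"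
  have inner: "fscale g \<alpha> (n + i) w = (\<Sum>j\<in>{b..<B}. scW (g $$ j) (\<alpha> (n + i + j) w))" if "i \<ge> a" for i
    by (rule fscale_eq_sum) (use that K in \<open>auto simp: b_def B_def\<close>)
  have "fscale f (fscale g \<alpha>) n w = (\<Sum>i\<in>{a..<A}. scW (f $$ i) (fscale g \<alpha> (n + i) w))"
  proof (rule fscale_eq_sum)
    fix i assume "A \<le> i"
    then have "fscale g \<alpha> (n + i) w = (\<Sum>j\<in>{b..<b}. scW (g $$ j) (\<alpha> (n + i + j) w))"
      by (intro fscale_eq_sum) (use K in \<open>auto simp: b_def A_def\<close>)
    then show "fscale g \<alpha> (n + i) w = 0" by simp
  qed (simp add: a_def)
  also have "\<dots> = (\<Sum>i\<in>{a..<A}. \<Sum>j\<in>{b..<B}. scW (f $$ i * g $$ j) (\<alpha> (n + (i + j)) w))"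
    by (rule sum.cong[OF refl]) (simp add: inner scale_sum_right add.assoc)
  also have "\<dots> = (\<Sum>(i, j)\<in>{a..<A} \<times> {b..<B}. scW (f $$ i * g $$ j) (\<alpha> (n + (i + j)) w))"
    by (simp add: sum.cartesian_product)
  \<comment> \<open>Reindexing by s = i + j. Pairs with s \<ge> K - n drop out because
    \<open>\<alpha>\<close> vanishes there, and A and B are large enough that no smaller s loses a
    pair.\<close>
  also have "\<dots> = (\<Sum>(s, i)\<in>(SIGMA s:{a + b..<K - n}. {a..s - b}). scW (f $$ i * g $$ (s - i)) (\<alpha> (n + s) w))"
  proof (rule sum.reindex_bij_witness_not_neutral[of "{(i, j) \<in> {a..<A} \<times> {b..<B}. i + j \<ge> K - n}" "{}"
        _ "\<lambda>(s, i). (i, s - i)" "\<lambda>(i, j). (i + j, i)"])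
    show "finite {(i, j) \<in> {a..<A} \<times> {b..<B}. i + j \<ge> K - n}"
      by (rule finite_subset[of _ "{a..<A} \<times> {b..<B}"]) auto
  qed (use K in \<open>auto simp: A_def B_def\<close>)
  also have "\<dots> = (\<Sum>s\<in>{a + b..<K - n}. \<Sum>i\<in>{a..s - b}. scW (f $$ i * g $$ (s - i)) (\<alpha> (n + s) w))"
    by (subst sum.Sigma) auto
  also have "\<dots> = (\<Sum>s\<in>{a + b..<K - n}. scW ((f * g) $$ s) (\<alpha> (n + s) w))"
    by (simp add: fls_times_nth(2) a_def b_def scale_sum_left)
  also have "\<dots> = fscale (f * g) \<alpha> n w"
  proof (rule fscale_eq_sum[symmetric])
    fix i assume "i < a + b"
    then show "(f * g) $$ i = 0" by (simp add: fls_times_nth(2) a_def b_def)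
  qed (use K in auto)
  finally show "fscale (f * g) \<alpha> n w = fscale f (fscale g \<alpha>) n w" by simp
qed

text \<open>The second factor sits at x_2, the variable of the product, so f(x_2) factors out. A
  factor in front of \<open>\<alpha>\<close> would be f(x_1); for polynomials that case is
  \<open>prd_poly_left\<close>.\<close>

lemma prd_fscale_right:
  assumes \<alpha>: "\<alpha> \<in> fields" and \<beta>: "\<beta> \<in> fields"
  shows "prd m k \<alpha> (fscale f \<beta>) = fscale f (prd m k \<alpha> \<beta>)"
proof (intro ext)
  fix n w
  define a where "a = fls_subdegree f"
  have f\<beta>: "fscale f \<beta> \<in> fields" by (rule fscale_fields[OF \<beta>])
  have "\<forall>\<^sub>F N in sequentially. prd m k \<alpha> (fscale f \<beta>) n w = fscale f (prd m k \<alpha> \<beta>) n w"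
    using eventually_prd[OF \<alpha> f\<beta>, of n m k w] eventually_fscale[OF \<beta>, of n f w]
      eventually_fscale_shifts[OF \<beta> \<alpha>, of f "\<lambda>i. k + n - int i" m w]
      eventually_fscale[OF prd_fields[OF \<alpha> \<beta>], of n f m k w]
      eventually_prd[OF \<alpha> \<beta>, of "n + a" m k w]
  proof eventually_elim
    case (elim N)
    have "prd m k \<alpha> (fscale f \<beta>) n w = prd_upto N m k \<alpha> (fscale f \<beta>) n w" using elim by simp
    also have "\<dots> = (\<Sum>i<N. scW (lcf k i) (\<alpha> (k + m - int i) (\<Sum>j\<in>{a..<int N}. scW (f $$ j) (\<beta> (n + int i + j) w))))
     - (\<Sum>i<N. scW (rcf k i) (\<Sum>j\<in>{a..<int N}. scW (f $$ j) (\<beta> (k + n - int i + j) (\<alpha> (m + int i) w))))"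
      using elim(2,3) by (simp add: prd_upto_def a_def)
    also have "\<dots> = (\<Sum>j\<in>{a..<int N}. scW (f $$ j) (prd_upto N m k \<alpha> \<beta> (n + j) w))"
      unfolding prd_upto_def scale_right_diff_distrib sum_subtractf
      apply (rule arg_cong2[where f = "(-)"])
      subgoal
        unfolding fields_sum[OF \<alpha>] scale_sum_right
        by (subst sum.swap) (simp add: fields_scale[OF \<alpha>] algebra_simps)
      subgoal
        unfolding scale_sum_right
        by (subst sum.swap) (simp add: algebra_simps)
      done
    also have "\<dots> = fscale f (prd m k \<alpha> \<beta>) n w"
      using elim(4,5) by (simp add: a_def)
    finally show ?case .
  qed
  then show "prd m k \<alpha> (fscale f \<beta>) n w = fscale f (prd m k \<alpha> \<beta>) n w" by simp
qed

end

section \<open>Polynomials, the identity field and derivatives\<close>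

lemma minus_one_power_square: "(- 1) ^ i * (- 1) ^ i = (1::'a::ring_1)"
  by (simp add: power_add[symmetric] flip: mult_2)

definition poly_fls :: "complex poly \<Rightarrow> complex fls" where
  "poly_fls p = poly (map_poly fls_const p) fls_X"

lemma poly_fls_0 [simp]: "poly_fls 0 = 0"
  by (simp add: poly_fls_def)

lemma poly_fls_pCons: "poly_fls (pCons a p) = fls_const a + fls_X * poly_fls p"
  by (simp add: poly_fls_def map_poly_pCons)

lemma int_coeff_pCons: "int_coeff (pCons a p) n = (if n = 0 then a else int_coeff p (n - 1))"
proof -
  have "nat n = Suc (nat (n - 1))" if "n > 0" using that by simp
  then show ?thesis by (auto simp: int_coeff_def)
qed

lemma fls_nth_poly_fls: "poly_fls p $$ n = int_coeff p n"
proof (induction p arbitrary: n)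
  case 0
  then show ?case by (simp add: int_coeff_def)
next
  case (pCons a p)
  then show ?case by (simp add: poly_fls_pCons int_coeff_pCons fls_X_times_conv_shift(1) int_coeff_def[of p "- 1"])
qed

lemma shift_poly_0 [simp]: "shift_poly 0 = 0"
  by (simp add: shift_poly_def)

lemma shift_poly_pCons: "shift_poly (pCons a p) = [:fls_const a:] + [:fls_X, 1:] * shift_poly p"
  by (simp add: shift_poly_def map_poly_pCons pcompose_pCons)

text \<open>The constant term in x is the value of p(z + x) at x = 0.\<close>

lemma coeff_shift_poly_0: "Polynomial.coeff (shift_poly p) 0 = poly_fls p"
  by (simp add: poly_0_coeff_0[symmetric] shift_poly_def poly_pcompose poly_fls_def)

text \<open>The coefficient in \<open>(\<partial>\<^sup>s\<alpha>/s!)\<^sub>n = dcf s n \<alpha>\<^sub>n\<^sub>-\<^sub>s\<close>.\<close>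

definition dcf :: "nat \<Rightarrow> int \<Rightarrow> complex" where
  "dcf s n = (- 1) ^ s * (of_int n gchoose s)"

text \<open>The Leibniz rule for the s-th divided derivative of x^m \<alpha>(x), read off at one
  coefficient.\<close>

lemma sum_dcf:
  "(\<Sum>i\<le>s. (of_int m gchoose i) * dcf (s - i) (n + m - int i)) = dcf s n"
  using sum_signed_gbinomial[of "of_int m :: complex" s "of_int n"] by (simp add: dcf_def)

text \<open>Here and in \<open>lcf_mult_rcf\<close> the function \<partial>_2^i (x_1 - x_2)^k / i!,
  which is \<open>lcf k i\<close> times (x_1 - x_2)^(k - i), is expanded: here in powers of x_2,
  there in powers of x_1.\<close>

lemma lcf_mult_lcf:
  "lcf k i * lcf (k - int i) r = lcf k (i + r) * (of_nat (i + r) gchoose i)"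
proof -
  have "(of_int k gchoose (i + r)) * (of_nat (i + r) gchoose i)
      = (of_int k gchoose i) * ((of_int k - of_nat i) gchoose r :: complex)"
    using gbinomial_trinomial_revision[of i "i + r" "of_int k :: complex"] by simp
  then show ?thesis by (simp add: lcf_def power_add mult_ac)
qed

lemma lcf_mult_rcf:
  "lcf k i * rcf (k - int i) r = rcf k r * (of_int (k - int r) gchoose i)"
proof -
  have "(- 1) powi k = (- 1) powi (k - int i) * ((- 1) ^ i :: complex)"
    using power_int_add[of "- 1 :: complex" "k - int i" "int i"] by simp
  moreover have "lcf k i * rcf (k - int i) r
      = ((- 1) powi (k - int i) * (- 1) ^ i) * (- 1) ^ r * ((of_int k gchoose i) * ((of_int k - of_nat i) gchoose r))"
    by (simp add: lcf_def rcf_def mult_ac)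
  moreover have "rcf k r * (of_int (k - int r) gchoose i)
      = (- 1) powi k * (- 1) ^ r * ((of_int k gchoose r) * ((of_int k - of_nat r) gchoose i))"
    by (simp add: rcf_def mult_ac)
  ultimately show ?thesis by (simp only: gbinomial_mult_swap)
qed

lemma lcf_Suc: "lcf (k + 1) (Suc i) = lcf k (Suc i) - lcf k i"
  using gbinomial_Suc_Suc[of "of_int k :: complex" i] by (simp add: lcf_def algebra_simps)

lemma lcf_0 [simp]: "lcf k 0 = 1"
  by (simp add: lcf_def)

lemma rcf_Suc: "rcf (k + 1) (Suc i) = rcf k i - rcf k (Suc i)"
proof -
  have "(- 1) powi (k + 1) = - ((- 1) powi k :: complex)"
    using power_int_add[of "- 1 :: complex" k 1] by simp
  then show ?thesis unfolding rcf_lcf lcf_Suc by (simp add: algebra_simps)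
qed

lemma rcf_0: "rcf (k + 1) 0 = - rcf k 0"
  using power_int_add[of "- 1 :: complex" k 1] by (simp add: rcf_lcf)

text \<open>Translates the Taylor coefficients of f(z + x) in the axiom \<open>cz_compatible\<close>
  into binomials; the induction step is the absorption identity.\<close>

lemma fls_nth_deriv_funpow:
  "(fls_const (1 / fact i) * (fls_deriv ^^ i) f) $$ n = (of_int (n + int i) gchoose i) * (f $$ (n + int i) :: complex)"
proof (induction i arbitrary: n)
  case 0
  then show ?case by simp
next
  case (Suc i)
  have "(fls_const (1 / fact (Suc i)) * (fls_deriv ^^ Suc i) f) $$ n
      = (1 / of_nat (Suc i)) * of_int (n + 1) * ((fls_const (1 / fact i) * (fls_deriv ^^ i) f) $$ (n + 1))"
    by (simp add: fact_Suc mult_ac add_divide_distrib ring_distribs)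
  also have "\<dots> = (1 / of_nat (Suc i)) * (of_int (n + 1) * (of_int (n + 1 + int i) gchoose i)) * f $$ (n + 1 + int i)"
    by (simp only: Suc mult.assoc)
  also have "of_int (n + 1) * (of_int (n + 1 + int i) gchoose i) = of_nat (Suc i) * (of_int (n + 1 + int i) gchoose Suc i :: complex)"
    using gbinomial_absorb_comp[of "of_int (n + 1 + int i) :: complex" i]
      gbinomial_absorption[of i "of_int (n + 1 + int i) :: complex"] by simp
  also have "1 / of_nat (Suc i) * (of_nat (Suc i) * (of_int (n + 1 + int i) gchoose Suc i)) * f $$ (n + 1 + int i)
     = (of_int (n + int (Suc i)) gchoose Suc i) * f $$ (n + int (Suc i))"
  proof -
    have "n + 1 + int i = n + int (Suc i)" by simp
    then show ?thesis by (simp only:) (simp del: of_nat_Suc)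
  qed
  finally show ?case .
qed

context complex_space
begin

lemma zero_fields [simp]: "0 \<in> fields"
  by (rule fieldsI) auto

lemma add_fields [simp]:
  assumes "\<alpha> \<in> fields" "\<beta> \<in> fields"
  shows "\<alpha> + \<beta> \<in> fields"
proof (rule fieldsI)
  fix w
  obtain N M where "\<forall>n\<ge>N. \<alpha> n w = 0" "\<forall>n\<ge>M. \<beta> n w = 0"
    using fields_trunc[OF assms(1)] fields_trunc[OF assms(2)] by metis
  then have "\<forall>n\<ge>max N M. (\<alpha> + \<beta>) n w = 0" by simp
  then show "\<exists>N. \<forall>n\<ge>N. (\<alpha> + \<beta>) n w = 0" by blast
qed (simp_all add: assms fields_add fields_scale scale_right_distrib)

lemma sum_fields: "(\<And>i. i \<in> A \<Longrightarrow> f i \<in> fields) \<Longrightarrow> sum f A \<in> fields"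
  by (induction A rule: infinite_finite_induct) auto

declare fscale_fields [simp] prd_fields [simp]

lemma uminus_fields [simp]: "\<alpha> \<in> fields \<Longrightarrow> - \<alpha> \<in> fields"
proof -
  assume "\<alpha> \<in> fields"
  moreover have "- \<alpha> = fscale (fls_const (- 1)) \<alpha>"
    by (intro ext) (simp only: fscale_const, simp add: fun_Compl_def)
  ultimately show "- \<alpha> \<in> fields" by simp
qed

lemma prd_upto_add_left: "\<alpha> \<in> fields \<Longrightarrow> \<alpha>' \<in> fields \<Longrightarrow> \<beta> \<in> fields \<Longrightarrow>
    prd_upto N m k (\<alpha> + \<alpha>') \<beta> n w = prd_upto N m k \<alpha> \<beta> n w + prd_upto N m k \<alpha>' \<beta> n w"
  by (simp add: prd_upto_def fields_add scale_right_distrib sum.distrib)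

lemma prd_upto_add_right: "\<alpha> \<in> fields \<Longrightarrow> \<beta>' \<in> fields \<Longrightarrow> \<beta> \<in> fields \<Longrightarrow>
    prd_upto N m k \<alpha> (\<beta> + \<beta>') n w = prd_upto N m k \<alpha> \<beta> n w + prd_upto N m k \<alpha> \<beta>' n w"
  by (simp add: prd_upto_def fields_add scale_right_distrib sum.distrib)

lemma prd_add_left:
  assumes "\<alpha> \<in> fields" "\<alpha>' \<in> fields" "\<beta> \<in> fields"
  shows "prd m k (\<alpha> + \<alpha>') \<beta> = prd m k \<alpha> \<beta> + prd m k \<alpha>' \<beta>"
proof (intro ext)
  fix n w
  have "\<forall>\<^sub>F N in sequentially. prd m k (\<alpha> + \<alpha>') \<beta> n w = (prd m k \<alpha> \<beta> + prd m k \<alpha>' \<beta>) n w"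
    using eventually_prd[OF add_fields[OF assms(1,2)] assms(3), of n m k w]
      eventually_prd[OF assms(1,3), of n m k w] eventually_prd[OF assms(2,3), of n m k w]
    by eventually_elim (simp add: prd_upto_add_left[OF assms])
  then show "prd m k (\<alpha> + \<alpha>') \<beta> n w = (prd m k \<alpha> \<beta> + prd m k \<alpha>' \<beta>) n w" by simp
qed

lemma prd_add_right:
  assumes "\<alpha> \<in> fields" "\<beta>' \<in> fields" "\<beta> \<in> fields"
  shows "prd m k \<alpha> (\<beta> + \<beta>') = prd m k \<alpha> \<beta> + prd m k \<alpha> \<beta>'"
proof (intro ext)
  fix n w
  have "\<forall>\<^sub>F N in sequentially. prd m k \<alpha> (\<beta> + \<beta>') n w = (prd m k \<alpha> \<beta> + prd m k \<alpha> \<beta>') n w"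
    using eventually_prd[OF assms(1) add_fields[OF assms(3,2)], of n m k w]
      eventually_prd[OF assms(1,3), of n m k w] eventually_prd[OF assms(1,2), of n m k w]
    by eventually_elim (simp add: prd_upto_add_right[OF assms])
  then show "prd m k \<alpha> (\<beta> + \<beta>') n w = (prd m k \<alpha> \<beta> + prd m k \<alpha> \<beta>') n w" by simp
qed

lemma prd_zero_left [simp]: "\<beta> \<in> fields \<Longrightarrow> prd m k 0 \<beta> = 0"
  by (intro ext) (simp add: prd_def fields_zero)

lemma prd_zero_right [simp]: "\<alpha> \<in> fields \<Longrightarrow> prd m k \<alpha> 0 = 0"
  by (intro ext) (simp add: prd_def fields_zero)

lemma prd_sum_right:
  assumes "\<alpha> \<in> fields" "\<And>i. i \<in> A \<Longrightarrow> f i \<in> fields"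
  shows "prd m k \<alpha> (sum f A) = (\<Sum>i\<in>A. prd m k \<alpha> (f i))"
  using assms(2) by (induction A rule: infinite_finite_induct) (simp_all add: assms(1) prd_add_right sum_fields)

lemma prd_upto_const_left: "\<alpha> \<in> fields \<Longrightarrow> \<beta> \<in> fields \<Longrightarrow>
    prd_upto N m k (fscale (fls_const c) \<alpha>) \<beta> n w = scW c (prd_upto N m k \<alpha> \<beta> n w)"
  by (simp add: prd_upto_def fscale_const fields_scale scale_sum_right scale_right_diff_distrib mult.commute)

lemma prd_const_left:
  assumes "\<alpha> \<in> fields" "\<beta> \<in> fields"
  shows "prd m k (fscale (fls_const c) \<alpha>) \<beta> = fscale (fls_const c) (prd m k \<alpha> \<beta>)"
proof (intro ext)
  fix n w
  have "\<forall>\<^sub>F N in sequentially. prd m k (fscale (fls_const c) \<alpha>) \<beta> n w = fscale (fls_const c) (prd m k \<alpha> \<beta>) n w"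
    using eventually_prd[OF fscale_fields[OF assms(1)] assms(2), of n m k "fls_const c" w]
      eventually_prd[OF assms, of n m k w]
    by eventually_elim (simp add: prd_upto_const_left[OF assms] fscale_const)
  then show "prd m k (fscale (fls_const c) \<alpha>) \<beta> n w = fscale (fls_const c) (prd m k \<alpha> \<beta>) n w" by simp
qed

lemma fscale_sum_right:
  assumes "\<And>i. i \<in> A \<Longrightarrow> g i \<in> fields"
  shows "fscale f (sum g A) = (\<Sum>i\<in>A. fscale f (g i))"
  using assms by (induction A rule: infinite_finite_induct) (simp_all add: fscale_add_right sum_fields)

section \<open>Polynomials multiplying the first factor of a product\<close>

lemma fscale_fls_X: "fscale fls_X \<alpha> n w = \<alpha> (n + 1) w"
proof -
  have "Sum_any (\<lambda>j. scW (fls_X $$ j) (\<alpha> (n + j) w)) = (\<Sum>j\<in>{1}. scW (fls_X $$ j) (\<alpha> (n + j) w))"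
    by (rule Sum_any.expand_superset) auto
  then show ?thesis by (simp add: fscale_def)
qed

lemma prd_fls_X_left: "prd m k (fscale fls_X \<alpha>) \<beta> = prd (m + 1) k \<alpha> \<beta>"
  by (intro ext) (simp add: prd_def fscale_fls_X algebra_simps)

text \<open>Multiplication by x_1 = (x_1 - x_2) + x_2: the first summand raises k by one, the second
  is the variable of the resulting field.\<close>

lemma prd_m_Suc:
  assumes \<alpha>: "\<alpha> \<in> fields" and \<beta>: "\<beta> \<in> fields"
  shows "prd (m + 1) k \<alpha> \<beta> = prd m (k + 1) \<alpha> \<beta> + fscale fls_X (prd m k \<alpha> \<beta>)"
proof (intro ext)
  fix n w
  have "\<forall>\<^sub>F N in sequentially. prd (m + 1) k \<alpha> \<beta> n w = (prd m (k + 1) \<alpha> \<beta> + fscale fls_X (prd m k \<alpha> \<beta>)) n w"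
    using fields_eventually[OF \<alpha>, of m w] fields_eventually[OF \<beta>, of n w]
  proof eventually_elim
    case (elim N)
    have 1: "prd (m + 1) k \<alpha> \<beta> n w = prd_upto (Suc N) (m + 1) k \<alpha> \<beta> n w"
      by (rule prd_eq_prd_upto[OF \<alpha> \<beta>]) (use elim in auto)
    have 2: "prd m (k + 1) \<alpha> \<beta> n w = prd_upto (Suc N) m (k + 1) \<alpha> \<beta> n w"
      by (rule prd_eq_prd_upto[OF \<alpha> \<beta>]) (use elim in auto)
    have 3: "prd m k \<alpha> \<beta> (n + 1) w = prd_upto (Suc N) m k \<alpha> \<beta> (n + 1) w"
      by (rule prd_eq_prd_upto[OF \<alpha> \<beta>]) (use elim in auto)
    define f where "f i = \<alpha> (k + 1 + m - int i) (\<beta> (n + int i) w)" for i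
    define g where "g i = \<beta> (k + 1 + n - int i) (\<alpha> (m + int i) w)" for i
    \<comment> \<open>The cut-off lies one beyond the last nonzero term: the shifted sums run over
      \<open>f (Suc i)\<close> and \<open>g (Suc i)\<close>, and their boundary terms must
      vanish.\<close>
    have f0: "f (Suc N) = 0" and g0: "g (Suc N) = 0"
      using elim by (simp_all add: f_def g_def fields_zero[OF \<alpha>] fields_zero[OF \<beta>])
    have p1: "prd_upto (Suc N) (m + 1) k \<alpha> \<beta> n w = (\<Sum>i<Suc N. scW (lcf k i) (f i)) - (\<Sum>i<Suc N. scW (rcf k i) (g (Suc i)))"
      by (simp only: prd_upto_def f_def g_def) (simp add: algebra_simps)
    have p3: "prd_upto (Suc N) m k \<alpha> \<beta> (n + 1) w = (\<Sum>i<Suc N. scW (lcf k i) (f (Suc i))) - (\<Sum>i<Suc N. scW (rcf k i) (g i))"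
      by (simp only: prd_upto_def f_def g_def) (simp add: algebra_simps)
    have p2: "prd_upto (Suc N) m (k + 1) \<alpha> \<beta> n w = (\<Sum>i<Suc N. scW (lcf (k + 1) i) (f i)) - (\<Sum>i<Suc N. scW (rcf (k + 1) i) (g i))"
      by (simp only: prd_upto_def f_def g_def)
    have F: "(\<Sum>i<Suc N. scW (lcf (k + 1) i) (f i)) = (\<Sum>i<Suc N. scW (lcf k i) (f i)) - (\<Sum>i<Suc N. scW (lcf k i) (f (Suc i)))"
    proof -
      have "(\<Sum>i<Suc N. scW (lcf k i) (f (Suc i))) = (\<Sum>i<N. scW (lcf k i) (f (Suc i)))"
        using f0 by simp
      then show ?thesis
        by (simp only: sum.lessThan_Suc_shift lcf_Suc scale_left_diff_distrib sum_subtractf lcf_0) simp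
    qed
    have G: "(\<Sum>i<Suc N. scW (rcf (k + 1) i) (g i)) = (\<Sum>i<Suc N. scW (rcf k i) (g (Suc i))) - (\<Sum>i<Suc N. scW (rcf k i) (g i))"
    proof -
      have "(\<Sum>i<Suc N. scW (rcf k i) (g (Suc i))) = (\<Sum>i<N. scW (rcf k i) (g (Suc i)))"
        using g0 by simp
      then show ?thesis
        by (simp only: sum.lessThan_Suc_shift rcf_Suc scale_left_diff_distrib sum_subtractf rcf_0) simp
    qed
    show ?case
      by (simp only: plus_fun_apply fscale_fls_X 1 2 3 p1 p2 p3 F G) (simp add: algebra_simps)
  qed
  then show "prd (m + 1) k \<alpha> \<beta> n w = (prd m (k + 1) \<alpha> \<beta> + fscale fls_X (prd m k \<alpha> \<beta>)) n w" by simp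
qed

text \<open>In the applications \<open>f i\<close> is a product formed with (x_1 - x_2)^(K + i).
  Powers of x_1 - x_2 thus stand for powers of the polynomial variable, while the coefficients in z
  act as series in x_2.\<close>

definition qact :: "complex fls poly \<Rightarrow> (nat \<Rightarrow> int \<Rightarrow> 'w \<Rightarrow> 'w) \<Rightarrow> int \<Rightarrow> 'w \<Rightarrow> 'w" where
  "qact q f = (\<Sum>i\<le>Polynomial.degree q. fscale (Polynomial.coeff q i) (f i))"

lemma qact_eq_sum: "Polynomial.degree q < N \<Longrightarrow> qact q f = (\<Sum>i<N. fscale (Polynomial.coeff q i) (f i))"
  unfolding qact_def by (rule sum.mono_neutral_left) (auto simp: coeff_eq_0)

lemma qact_add:
  assumes "\<And>i. f i \<in> fields"
  shows "qact (q + r) f = qact q f + qact r f"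
proof -
  define N where "N = Suc (max (max (Polynomial.degree q) (Polynomial.degree r)) (Polynomial.degree (q + r)))"
  have "qact h f = (\<Sum>i<N. fscale (Polynomial.coeff h i) (f i))" if "h \<in> {q, r, q + r}" for h
    by (rule qact_eq_sum) (use that in \<open>auto simp: N_def\<close>)
  then show ?thesis by (simp add: fscale_add_left assms sum.distrib)
qed

lemma qact_const: "qact [:c:] f = fscale c (f 0)"
  using qact_eq_sum[of "[:c:]" 1 f] by simp

lemma qact_linear_factor:
  assumes f: "\<And>i. f i \<in> fields"
  shows "qact ([:fls_X, 1:] * q) f = fscale fls_X (qact q f) + qact q (\<lambda>i. f (Suc i))"
proof -
  define N where "N = Suc (max (Polynomial.degree q) (Polynomial.degree ([:fls_X, 1:] * q)))"
  have N: "Polynomial.coeff q N = 0" by (rule coeff_eq_0) (simp add: N_def)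
  have "qact ([:fls_X, 1:] * q) f = (\<Sum>i<Suc N. fscale (Polynomial.coeff ([:fls_X, 1:] * q) i) (f i))"
    by (rule qact_eq_sum) (simp add: N_def)
  also have "\<dots> = (\<Sum>i<Suc N. fscale (fls_X * Polynomial.coeff q i) (f i)) + (\<Sum>i<N. fscale (Polynomial.coeff q i) (f (Suc i)))"
  proof -
    have "Polynomial.coeff ([:fls_X, 1:] * q) i
        = fls_X * Polynomial.coeff q i + (case i of 0 \<Rightarrow> 0 | Suc i' \<Rightarrow> Polynomial.coeff q i')" for i
      by (auto split: nat.split simp: coeff_pCons)
    then show ?thesis
      by (simp only: fscale_add_left[OF f] sum.distrib)
        (simp only: sum.lessThan_Suc_shift[of "\<lambda>i. fscale (case i of 0 \<Rightarrow> 0 | Suc i' \<Rightarrow> Polynomial.coeff q i') (f i)"] nat.case fscale_zero_left add_0)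
  qed
  also have "(\<Sum>i<Suc N. fscale (fls_X * Polynomial.coeff q i) (f i)) = fscale fls_X (\<Sum>i<Suc N. fscale (Polynomial.coeff q i) (f i))"
    by (simp only: fscale_mult[OF f] fscale_sum_right[OF fscale_fields[OF f]])
  also have "(\<Sum>i<Suc N. fscale (Polynomial.coeff q i) (f i)) = qact q f"
    by (rule qact_eq_sum[symmetric]) (simp add: N_def)
  also have "(\<Sum>i<N. fscale (Polynomial.coeff q i) (f (Suc i))) = qact q (\<lambda>i. f (Suc i))"
    by (rule qact_eq_sum[symmetric]) (simp add: N_def)
  finally show ?thesis .
qed

text \<open>This is p(x_1) = p(x_2 + (x_1 - x_2)), proved by Horner's scheme:
  \<open>prd_m_Suc\<close> on fields matches the factor z + x in \<open>shift_poly_pCons\<close>. It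
  is the source of the shift by z in the algebra that acts on fields.\<close>

lemma prd_poly_left:
  assumes \<alpha>: "\<alpha> \<in> fields" and \<beta>: "\<beta> \<in> fields"
  shows "prd 0 K (fscale (poly_fls p) \<alpha>) \<beta> = qact (shift_poly p) (\<lambda>i. prd 0 (K + int i) \<alpha> \<beta>)"
proof (induction p arbitrary: K)
  case 0
  show ?case
    by (simp only: poly_fls_0 fscale_zero_left prd_zero_left[OF \<beta>] shift_poly_0 qact_def) simp
next
  case (pCons a p)
  define \<eta> where "\<eta> = fscale (poly_fls p) \<alpha>"
  have \<eta>: "\<eta> \<in> fields" using \<alpha> by (simp add: \<eta>_def)
  have "fscale (poly_fls (pCons a p)) \<alpha> = fscale (fls_const a) \<alpha> + fscale fls_X \<eta>"
    by (simp add: poly_fls_pCons fscale_add_left \<alpha> fscale_mult \<eta>_def)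
  then have "prd 0 K (fscale (poly_fls (pCons a p)) \<alpha>) \<beta>
      = fscale (fls_const a) (prd 0 K \<alpha> \<beta>) + prd 1 K \<eta> \<beta>"
    using \<alpha> \<beta> \<eta> by (simp add: prd_add_left prd_const_left prd_fls_X_left)
  also have "prd 1 K \<eta> \<beta> = prd 0 (K + 1) \<eta> \<beta> + fscale fls_X (prd 0 K \<eta> \<beta>)"
    using prd_m_Suc[OF \<eta> \<beta>, of 0 K] by simp
  also have "fscale (fls_const a) (prd 0 K \<alpha> \<beta>) + (prd 0 (K + 1) \<eta> \<beta> + fscale fls_X (prd 0 K \<eta> \<beta>))
      = qact (shift_poly (pCons a p)) (\<lambda>i. prd 0 (K + int i) \<alpha> \<beta>)"
    using \<alpha> \<beta>
    by (simp only: shift_poly_pCons qact_add[OF prd_fields] qact_const qact_linear_factor[OF prd_fields] \<eta>_def pCons(2))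
      (simp add: algebra_simps)
  finally show ?case .
qed

lemma fscale_poly_fls:
  assumes "\<alpha> \<in> fields"
  shows "fscale (poly_fls p) \<alpha> n w = (\<Sum>i\<le>Polynomial.degree p. scW (Polynomial.coeff p i) (\<alpha> (n + int i) w))"
proof -
  have "fscale (poly_fls p) \<alpha> n w = (\<Sum>j\<in>int ` {..Polynomial.degree p}. scW (poly_fls p $$ j) (\<alpha> (n + j) w))"
    unfolding fscale_def
  proof (rule Sum_any.expand_superset)
    show "{j. scW (poly_fls p $$ j) (\<alpha> (n + j) w) \<noteq> 0} \<subseteq> int ` {..Polynomial.degree p}"
    proof
      fix j assume "j \<in> {j. scW (poly_fls p $$ j) (\<alpha> (n + j) w) \<noteq> 0}"
      then have "int_coeff p j \<noteq> 0" by (auto simp: fls_nth_poly_fls)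
      then have "j \<ge> 0" "nat j \<le> Polynomial.degree p"
        by (auto simp: int_coeff_def le_degree split: if_splits)
      then show "j \<in> int ` {..Polynomial.degree p}"
        by (metis atMost_iff image_eqI int_nat_eq)
    qed
  qed simp
  then show ?thesis by (simp add: sum.reindex fls_nth_poly_fls int_coeff_def)
qed

section \<open>The identity field and divided derivatives\<close>

definition idf :: "int \<Rightarrow> 'w \<Rightarrow> 'w" where
  "idf n w = (if n = - 1 then w else 0)"

lemma idf_fields [simp]: "idf \<in> fields"
proof (rule fieldsI)
  show "\<exists>N. \<forall>n\<ge>N. idf n w = 0" for w by (intro exI[of _ 0]) (auto simp: idf_def)
qed (auto simp: idf_def)

lemma fscale_idf: "fscale f idf n w = scW (f $$ (- 1 - n)) w"
proof -
  have "Sum_any (\<lambda>j. scW (f $$ j) (idf (n + j) w)) = (\<Sum>j\<in>{- 1 - n}. scW (f $$ j) (idf (n + j) w))"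
    by (rule Sum_any.expand_superset) (auto simp: idf_def)
  then show ?thesis by (simp add: fscale_def idf_def)
qed

text \<open>In the first sum only i = K + 1 can contribute, with coefficient (K choose K + 1), which
  is 0 for K \<ge> 0 and 1 for K = -1. The second sum sees only nonnegative modes of the identity
  field, all zero.\<close>

lemma prd_idf_left:
  assumes \<beta>: "\<beta> \<in> fields"
  shows "prd 0 K idf \<beta> = (if K = - 1 then \<beta> else 0)"
proof (intro ext)
  fix n w
  have r: "Sum_any (\<lambda>i::nat. scW ((- 1) powi K * (- 1) ^ i * (of_int K gchoose i)) (\<beta> (K + n - int i) (idf (0 + int i) w))) = 0"
    by (simp add: idf_def fields_zero[OF \<beta>])
  have l: "Sum_any (\<lambda>i::nat. scW ((- 1) ^ i * (of_int K gchoose i)) (idf (K + 0 - int i) (\<beta> (n + int i) w)))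
     = (if K = - 1 then \<beta> n w else 0)"
  proof (cases "K \<ge> - 1")
    case True
    have "Sum_any (\<lambda>i::nat. scW ((- 1) ^ i * (of_int K gchoose i)) (idf (K + 0 - int i) (\<beta> (n + int i) w)))
      = (\<Sum>i\<in>{nat (K + 1)}. scW ((- 1) ^ i * (of_int K gchoose i)) (idf (K + 0 - int i) (\<beta> (n + int i) w)))"
      by (rule Sum_any.expand_superset) (auto simp: idf_def)
    moreover have "(of_int K gchoose (nat (K + 1))) = (0::complex)" if "K \<noteq> - 1"
    proof -
      from True that have "K \<ge> 0" by simp
      then obtain k where "K = int k" by (rule nonneg_int_cases)
      then show ?thesis by (simp add: binomial_gbinomial[symmetric] nat_add_distrib)
    qed
    ultimately show ?thesis using True by (cases "K = - 1") (simp_all add: idf_def)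
  next
    case False
    then have "idf (K + 0 - int i) (\<beta> (n + int i) w) = 0" for i by (simp add: idf_def)
    then show ?thesis using False by simp
  qed
  show "prd 0 K idf \<beta> n w = (if K = - 1 then \<beta> else 0) n w"
    unfolding prd_def l r by simp
qed

text \<open>For k \<ge> 0 both expansions of (x_1 - x_2)^k are the same polynomial, and the identity
  commutes with \<open>\<alpha>\<close>. Replacing i by j - i matches the terms.\<close>

lemma prd_idf_right_nonneg:
  assumes \<alpha>: "\<alpha> \<in> fields" and k: "k \<ge> 0"
  shows "prd m k \<alpha> idf = 0"
proof (intro ext)
  fix n w
  define j where "j = nat k"
  have kj: "k = int j" using k by (simp add: j_def)
  have z: "(of_int k gchoose i) = (0::complex)" if "i \<ge> Suc j" for i
    using that by (simp add: kj binomial_gbinomial[symmetric] binomial_eq_0)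
  have l: "Sum_any (\<lambda>i::nat. scW ((- 1) ^ i * (of_int k gchoose i)) (\<alpha> (k + m - int i) (idf (n + int i) w)))
     = (\<Sum>i\<le>j. scW (lcf k i) (\<alpha> (k + m - int i) (idf (n + int i) w)))"
    unfolding lcf_def
    by (subst Sum_any_eq_sum[of "Suc j"]) (simp_all add: z lessThan_Suc_atMost)
  have r: "Sum_any (\<lambda>i::nat. scW ((- 1) powi k * (- 1) ^ i * (of_int k gchoose i)) (idf (k + n - int i) (\<alpha> (m + int i) w)))
     = (\<Sum>i\<le>j. scW (rcf k i) (idf (k + n - int i) (\<alpha> (m + int i) w)))"
    unfolding rcf_def
    by (subst Sum_any_eq_sum[of "Suc j"]) (simp_all add: z lessThan_Suc_atMost)
  have "(\<Sum>i\<le>j. scW (rcf k i) (idf (k + n - int i) (\<alpha> (m + int i) w)))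
      = (\<Sum>i\<le>j. scW (lcf k i) (\<alpha> (k + m - int i) (idf (n + int i) w)))"
  proof (rule sum.reindex_bij_witness[of _ "\<lambda>i. j - i" "\<lambda>i. j - i"])
    fix i assume "i \<in> {..j}"
    then have i: "i \<le> j" by simp
    have "(of_int k gchoose (j - i)) = (of_int k gchoose i :: complex)"
      using gbinomial_of_nat_symmetric[of i j, where ?'a = complex] i by (simp add: kj)
    moreover have "(- 1) ^ j * (- 1) ^ i = ((- 1) ^ (j - i) :: complex)"
    proof -
      have "(- 1) ^ j = ((- 1) ^ (j - i) * (- 1) ^ i :: complex)"
        using i by (simp add: power_add[symmetric])
      then show ?thesis by (simp only: mult.assoc minus_one_power_square mult_1_right)
    qed
    ultimately have "rcf k i = lcf k (j - i)"
      by (simp add: rcf_def lcf_def kj)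
    then show "scW (lcf k (j - i)) (\<alpha> (k + m - int (j - i)) (idf (n + int (j - i)) w))
        = scW (rcf k i) (idf (k + n - int i) (\<alpha> (m + int i) w))"
      using i by (auto simp: idf_def kj of_nat_diff fields_zero[OF \<alpha>] algebra_simps)
  qed auto
  then show "prd m k \<alpha> idf n w = 0 n w"
    unfolding prd_def l r by simp
qed

text \<open>The two expansions of (x_1 - x_2)^(-s-1) differ by a divided derivative of the delta
  function. Modes n < 0 see only the expansion in x_2, modes n \<ge> s only the one in x_1; for 0
  \<le> n < s neither contributes, and \<open>dcf s n\<close> is zero.\<close>

lemma prd_idf_right_neg:
  assumes \<alpha>: "\<alpha> \<in> fields"
  shows "prd m (- int s - 1) \<alpha> idf n w = scW (dcf s n) (\<alpha> (n + m - int s) w)"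
proof -
  define k where "k = - int s - 1"
  have cs: "(of_int k gchoose i) = (- 1) ^ i * (of_nat ((s + i) choose s) :: complex)" for i
  proof -
    have "(of_int k gchoose i) = (- 1) ^ i * ((of_nat (s + i)) gchoose i :: complex)"
      using gbinomial_negated_upper[of "of_int k :: complex" i] by (simp add: k_def add.commute)
    also have "((of_nat (s + i)) gchoose i :: complex) = of_nat ((s + i) choose i)"
      by (simp only: binomial_gbinomial)
    also have "(s + i) choose i = (s + i) choose s"
      using binomial_symmetric[of i "s + i"] by simp
    finally show ?thesis .
  qed
  have "(- 1) powi k * (- 1) powi int (s + 1) = (1::complex)"
    by (simp add: powi_minus_one_mult k_def)
  then have "(- 1) powi k * (- 1) ^ (s + 1) = (1::complex)"
    by (simp only: power_int_of_nat)
  then have "(- 1) powi k * (- 1) ^ s = (- 1 :: complex)"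
    by (simp add: minus_equation_iff)
  then have "(- 1) powi k * ((- 1) ^ s * (- 1) ^ s) = - ((- 1) ^ s :: complex)"
    by (simp only: mult.assoc[symmetric]) simp
  then have sgn: "(- 1) powi k = - ((- 1) ^ s :: complex)"
    by (simp only: minus_one_power_square mult_1_right)
  have l: "Sum_any (\<lambda>i::nat. scW ((- 1) ^ i * (of_int k gchoose i)) (\<alpha> (k + m - int i) (idf (n + int i) w)))
     = (if n \<le> - 1 then scW (dcf s n) (\<alpha> (n + m - int s) w) else 0)"
  proof (cases "n \<le> - 1")
    case True
    define i where "i = nat (- 1 - n)"
    have ni: "n = - 1 - int i" using True by (simp add: i_def)
    have "Sum_any (\<lambda>i::nat. scW ((- 1) ^ i * (of_int k gchoose i)) (\<alpha> (k + m - int i) (idf (n + int i) w)))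
      = (\<Sum>i\<in>{i}. scW ((- 1) ^ i * (of_int k gchoose i)) (\<alpha> (k + m - int i) (idf (n + int i) w)))"
      by (rule Sum_any.expand_superset) (auto simp: idf_def fields_zero[OF \<alpha>] ni)
    moreover have "(- 1) ^ i * (of_int k gchoose i) = dcf s n"
    proof -
      have "(of_int n gchoose s) = (- 1) ^ s * (of_nat (s + i) gchoose s :: complex)"
        using gbinomial_negated_upper[of "of_int n :: complex" s] by (simp add: ni add.commute)
      then have "dcf s n = ((- 1) ^ s * (- 1) ^ s) * (of_nat ((s + i) choose s))"
        by (simp add: dcf_def binomial_gbinomial mult.assoc)
      moreover have "(- 1) ^ i * (of_int k gchoose i) = ((- 1) ^ i * (- 1) ^ i) * (of_nat ((s + i) choose s) :: complex)"
        by (simp only: cs mult.assoc)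
      ultimately show ?thesis by (simp add: power_add[symmetric] flip: mult_2)
    qed
    ultimately show ?thesis using True by (simp add: idf_def ni k_def algebra_simps)
  next
    case False
    then have "idf (n + int i) w = 0" for i by (simp add: idf_def)
    then show ?thesis using False by (simp add: fields_zero[OF \<alpha>])
  qed
  have r: "Sum_any (\<lambda>i::nat. scW ((- 1) powi k * (- 1) ^ i * (of_int k gchoose i)) (idf (k + n - int i) (\<alpha> (m + int i) w)))
     = (if n \<le> - 1 then 0 else - scW (dcf s n) (\<alpha> (n + m - int s) w))"
  proof (cases "n \<ge> int s")
    case True
    define i where "i = nat (n - int s)"
    have ni: "n = int s + int i" using True by (simp add: i_def)
    have "Sum_any (\<lambda>i::nat. scW ((- 1) powi k * (- 1) ^ i * (of_int k gchoose i)) (idf (k + n - int i) (\<alpha> (m + int i) w)))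
      = (\<Sum>i\<in>{i}. scW ((- 1) powi k * (- 1) ^ i * (of_int k gchoose i)) (idf (k + n - int i) (\<alpha> (m + int i) w)))"
      by (rule Sum_any.expand_superset) (auto simp: idf_def k_def ni)
    moreover have "(- 1) powi k * (- 1) ^ i * (of_int k gchoose i) = - dcf s n"
    proof -
      have "(of_int n gchoose s) = (of_nat ((s + i) choose s) :: complex)"
        by (simp add: ni binomial_gbinomial)
      then have "dcf s n = (- 1) ^ s * (of_nat ((s + i) choose s))"
        by (simp add: dcf_def)
      moreover have "(- 1) powi k * (- 1) ^ i * (of_int k gchoose i) = - ((- 1) ^ s) * ((- 1) ^ i * (- 1) ^ i) * (of_nat ((s + i) choose s) :: complex)"
        by (simp only: cs sgn mult.assoc)
      ultimately show ?thesis by (simp add: power_add[symmetric] flip: mult_2)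
    qed
    ultimately show ?thesis using True by (simp add: idf_def ni k_def algebra_simps)
  next
    case False
    then have "idf (k + n - int i) (\<alpha> (m + int i) w) = 0" for i by (simp add: idf_def k_def)
    moreover have "dcf s n = 0" if "n \<ge> 0"
    proof -
      obtain t where "n = int t" using \<open>n \<ge> 0\<close> nonneg_int_cases by blast
      then show ?thesis using False by (simp add: dcf_def binomial_gbinomial[symmetric] binomial_eq_0)
    qed
    ultimately show ?thesis using False by auto
  qed
  show ?thesis
    unfolding prd_def k_def[symmetric] l r by simp
qed

text \<open>The divided derivative \<open>\<partial>\<^sup>s\<alpha>/s!\<close>.\<close>

definition dfield :: "nat \<Rightarrow> (int \<Rightarrow> 'w \<Rightarrow> 'w) \<Rightarrow> int \<Rightarrow> 'w \<Rightarrow> 'w" where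
  "dfield s \<alpha> n w = scW (dcf s n) (\<alpha> (n - int s) w)"

lemma dfield_fields [simp]:
  assumes "\<alpha> \<in> fields"
  shows "dfield s \<alpha> \<in> fields"
proof (rule fieldsI)
  fix w
  obtain N where "\<forall>n\<ge>N. \<alpha> n w = 0" using fields_trunc[OF assms] by blast
  then have "\<forall>n\<ge>N + int s. dfield s \<alpha> n w = 0" by (simp add: dfield_def)
  then show "\<exists>N. \<forall>n\<ge>N. dfield s \<alpha> n w = 0" by blast
qed (simp_all add: dfield_def assms fields_add fields_scale scale_right_distrib mult.commute)

text \<open>The Leibniz rule for x^m \<alpha>(x). It brings the product with the identity into the
  shape of the right-hand side of the Jacobi identity with the vacuum as second argument.\<close>

lemma prd_idf_right_expansion:
  assumes "\<alpha> \<in> fields"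
  shows "prd m (- int s - 1) \<alpha> idf n w = (\<Sum>i\<le>s. scW (of_int m gchoose i) (dfield (s - i) \<alpha> (m + n - int i) w))"
proof -
  have "(\<Sum>i\<le>s. scW (of_int m gchoose i) (dfield (s - i) \<alpha> (m + n - int i) w))
      = (\<Sum>i\<le>s. scW ((of_int m gchoose i) * dcf (s - i) (n + m - int i)) (\<alpha> (n + m - int s) w))"
    by (rule sum.cong[OF refl]) (simp add: dfield_def of_nat_diff algebra_simps)
  also have "\<dots> = scW (dcf s n) (\<alpha> (n + m - int s) w)"
    by (simp only: scale_sum_left[symmetric] sum_dcf)
  finally show ?thesis by (simp add: prd_idf_right_neg[OF assms])
qed

text \<open>The Leibniz rule; coefficient by coefficient of f it is the case of a monomial x^j,
  which is \<open>sum_dcf\<close>.\<close>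

lemma dfield_fscale:
  assumes \<alpha>: "\<alpha> \<in> fields"
  shows "dfield s (fscale f \<alpha>) = (\<Sum>i\<le>s. fscale (fls_const (1 / fact i) * (fls_deriv ^^ i) f) (dfield (s - i) \<alpha>))"
proof (intro ext)
  fix n w
  define F where "F i = fls_const (1 / fact i) * (fls_deriv ^^ i) f" for i :: nat
  define a where "a = fls_subdegree f"
  obtain K where K: "\<forall>i\<ge>K. \<alpha> i w = 0" using fields_trunc[OF \<alpha>] by blast
  define b where "b = K - n + int s"
  have F: "F i $$ j = (of_int (j + int i) gchoose i) * f $$ (j + int i)" for i j
    unfolding F_def by (rule fls_nth_deriv_funpow)
  have "(\<Sum>i\<le>s. fscale (F i) (dfield (s - i) \<alpha>) n w)
      = (\<Sum>i\<le>s. \<Sum>j\<in>{a..<b}. scW (f $$ j) (scW ((of_int j gchoose i) * dcf (s - i) (n + j - int i)) (\<alpha> (n + j - int s) w)))"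
  proof (rule sum.cong[OF refl])
    fix i assume "i \<in> {..s}"
    then have i: "i \<le> s" by simp
    have "fscale (F i) (dfield (s - i) \<alpha>) n w
        = (\<Sum>j\<in>{a - int i..<b - int i}. scW (F i $$ j) (dfield (s - i) \<alpha> (n + j) w))"
    proof (rule fscale_eq_sum)
      fix j assume "b - int i \<le> j"
      then show "dfield (s - i) \<alpha> (n + j) w = 0" using K i by (simp add: dfield_def b_def of_nat_diff)
    qed (simp add: F a_def)
    \<comment> \<open>The shift by i makes j index the coefficients of f itself rather than those of
      its i-th derivative.\<close>
    also have "\<dots> = (\<Sum>j\<in>{a..<b}. scW (f $$ j) (scW ((of_int j gchoose i) * dcf (s - i) (n + j - int i)) (\<alpha> (n + j - int s) w)))"
      by (rule sum.reindex_bij_witness[of _ "\<lambda>j. j - int i" "\<lambda>j. j + int i"])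
        (use i in \<open>auto simp: F dfield_def of_nat_diff algebra_simps\<close>)
    finally show "fscale (F i) (dfield (s - i) \<alpha>) n w = \<dots>" .
  qed
  also have "\<dots> = (\<Sum>j\<in>{a..<b}. scW (f $$ j) (scW (dcf s n) (\<alpha> (n + j - int s) w)))"
    by (subst sum.swap) (simp only: scale_sum_right[symmetric] scale_sum_left[symmetric] sum_dcf)
  also have "\<dots> = scW (dcf s n) (\<Sum>j\<in>{a..<b}. scW (f $$ j) (\<alpha> (n - int s + j) w))"
    by (simp add: scale_sum_right algebra_simps)
  also have "(\<Sum>j\<in>{a..<b}. scW (f $$ j) (\<alpha> (n - int s + j) w)) = fscale f \<alpha> (n - int s) w"
    by (rule fscale_eq_sum[symmetric]) (use K in \<open>auto simp: a_def b_def\<close>)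
  finally have "(\<Sum>i\<le>s. fscale (F i) (dfield (s - i) \<alpha>) n w) = dfield s (fscale f \<alpha>) n w"
    by (simp add: dfield_def[of s])
  moreover have "(\<Sum>i\<le>s. g i) n w = (\<Sum>i\<le>s. g i n w)" for g :: "nat \<Rightarrow> int \<Rightarrow> 'w \<Rightarrow> 'w"
    by (induction s) simp_all
  ultimately show "dfield s (fscale f \<alpha>) n w = (\<Sum>i\<le>s. fscale (fls_const (1 / fact i) * (fls_deriv ^^ i) f) (dfield (s - i) \<alpha>)) n w"
    by (simp add: F_def)
qed

text \<open>The Leibniz rule for \<partial>_2 on (x_1 - x_2)^k u(x_1) \<alpha>(x_2), in both
  expansions: the power is differentiated i times and \<open>\<alpha>\<close> the other s - i
  times.\<close>

lemma dfield_prd: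
  assumes u: "u \<in> fields" and \<alpha>: "\<alpha> \<in> fields"
  shows "dfield s (prd 0 k u \<alpha>) n w = (\<Sum>i\<le>s. scW (lcf k i) (prd 0 (k - int i) u (dfield (s - i) \<alpha>) n w))"
proof -
  have "eventually (\<lambda>N. (\<forall>n'\<ge>n - int s. prd 0 k u \<alpha> n' w = prd_upto N 0 k u \<alpha> n' w)
    \<and> (\<forall>i\<in>{..s}. \<forall>n'\<ge>n. prd 0 (k - int i) u (dfield (s - i) \<alpha>) n' w = prd_upto N 0 (k - int i) u (dfield (s - i) \<alpha>) n' w)
    \<and> (\<forall>i\<ge>n - int s + int N. \<alpha> i w = 0)) sequentially"
    by (intro eventually_conj eventually_ball_finite ballI eventually_prd fields_eventually) (use u \<alpha> in auto)
  then obtain N where e1: "\<forall>n'\<ge>n - int s. prd 0 k u \<alpha> n' w = prd_upto N 0 k u \<alpha> n' w"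
    and e2: "\<forall>i\<in>{..s}. \<forall>n'\<ge>n. prd 0 (k - int i) u (dfield (s - i) \<alpha>) n' w = prd_upto N 0 (k - int i) u (dfield (s - i) \<alpha>) n' w"
    and e3: "\<forall>i\<ge>n - int s + int N. \<alpha> i w = 0"
    using eventually_happens'[OF sequentially_bot] by blast
  define G where "G q = u (k - int q) (\<alpha> (n - int s + int q) w)" for q
  define H where "H r = \<alpha> (k + n - int s - int r) (u (int r) w)" for r
  have G0: "G q = 0" if "q \<ge> N" for q using that e3 by (simp add: G_def fields_zero[OF u])
  have P: "prd_upto N 0 (k - int i) u (dfield (s - i) \<alpha>) n w
     = (\<Sum>r<N. scW (lcf (k - int i) r * dcf (s - i) (n + int r)) (G (i + r)))
     - (\<Sum>r<N. scW (rcf (k - int i) r * dcf (s - i) (n + (k - int r) - int i)) (H r))" if i: "i \<le> s" for i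
    unfolding prd_upto_def dfield_def G_def H_def
    by (intro arg_cong2[where f = "(-)"] sum.cong refl)
      (use i in \<open>simp_all add: fields_scale[OF u] of_nat_diff algebra_simps\<close>)
  have "(\<Sum>i\<le>s. scW (lcf k i) (prd 0 (k - int i) u (dfield (s - i) \<alpha>) n w))
      = (\<Sum>i\<le>s. scW (lcf k i) (\<Sum>r<N. scW (lcf (k - int i) r * dcf (s - i) (n + int r)) (G (i + r))))
       - (\<Sum>i\<le>s. scW (lcf k i) (\<Sum>r<N. scW (rcf (k - int i) r * dcf (s - i) (n + (k - int r) - int i)) (H r)))"
    using e2 by (simp add: P scale_right_diff_distrib sum_subtractf)
  also have "(\<Sum>i\<le>s. scW (lcf k i) (\<Sum>r<N. scW (lcf (k - int i) r * dcf (s - i) (n + int r)) (G (i + r))))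
      = (\<Sum>q<N. scW (lcf k q * dcf s n) (G q))"
  proof -
    have "scW (lcf k i) (\<Sum>r<N. scW (lcf (k - int i) r * dcf (s - i) (n + int r)) (G (i + r)))
        = (\<Sum>q<N. scW (lcf k q * ((of_int (int q) gchoose i) * dcf (s - i) (n + int q - int i))) (G q))" if "i \<le> s" for i
    proof -
      have "scW (lcf k i) (\<Sum>r<N. scW (lcf (k - int i) r * dcf (s - i) (n + int r)) (G (i + r)))
          = (\<Sum>r<N. scW (lcf k (i + r) * ((of_nat (i + r) gchoose i) * dcf (s - i) (n + int r))) (G (i + r)))"
        unfolding scale_sum_right
        by (rule sum.cong[OF refl]) (simp only: scale_scale mult.assoc[symmetric] lcf_mult_lcf)
      also have "\<dots> = (\<Sum>r<N - i. scW (lcf k (i + r) * ((of_nat (i + r) gchoose i) * dcf (s - i) (n + int r))) (G (i + r)))"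
        by (rule sum.mono_neutral_right) (use G0 in auto)
      also have "\<dots> = (\<Sum>q\<in>{i..<N}. scW (lcf k q * ((of_int (int q) gchoose i) * dcf (s - i) (n + int q - int i))) (G q))"
        by (rule sum.reindex_bij_witness[of _ "\<lambda>q. q - i" "\<lambda>r. i + r"]) (auto simp: of_nat_diff)
      also have "\<dots> = (\<Sum>q<N. scW (lcf k q * ((of_int (int q) gchoose i) * dcf (s - i) (n + int q - int i))) (G q))"
        by (rule sum.mono_neutral_left) (auto simp: binomial_gbinomial[symmetric] binomial_eq_0)
      finally show ?thesis .
    qed
    then have "(\<Sum>i\<le>s. scW (lcf k i) (\<Sum>r<N. scW (lcf (k - int i) r * dcf (s - i) (n + int r)) (G (i + r))))
      = (\<Sum>q<N. \<Sum>i\<le>s. scW (lcf k q * ((of_int (int q) gchoose i) * dcf (s - i) (n + int q - int i))) (G q))"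
      by (subst sum.swap) simp
    also have "\<dots> = (\<Sum>q<N. scW (lcf k q * dcf s n) (G q))"
      by (simp only: scale_sum_left[symmetric] sum_distrib_left[symmetric] sum_dcf)
    finally show ?thesis .
  qed
  also have "(\<Sum>i\<le>s. scW (lcf k i) (\<Sum>r<N. scW (rcf (k - int i) r * dcf (s - i) (n + (k - int r) - int i)) (H r)))
      = (\<Sum>r<N. scW (rcf k r * dcf s n) (H r))"
  proof -
    have "(\<Sum>i\<le>s. scW (lcf k i) (\<Sum>r<N. scW (rcf (k - int i) r * dcf (s - i) (n + (k - int r) - int i)) (H r)))
      = (\<Sum>r<N. \<Sum>i\<le>s. scW (rcf k r * ((of_int (k - int r) gchoose i) * dcf (s - i) (n + (k - int r) - int i))) (H r))"
      unfolding scale_sum_right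
      by (subst sum.swap, intro sum.cong refl) (simp only: scale_scale mult.assoc[symmetric] lcf_mult_rcf)
    also have "\<dots> = (\<Sum>r<N. scW (rcf k r * dcf s n) (H r))"
      by (simp only: scale_sum_left[symmetric] sum_distrib_left[symmetric] sum_dcf)
    finally show ?thesis .
  qed
  finally have "(\<Sum>i\<le>s. scW (lcf k i) (prd 0 (k - int i) u (dfield (s - i) \<alpha>) n w))
     = scW (dcf s n) (prd_upto N 0 k u \<alpha> (n - int s) w)"
    by (simp add: prd_upto_def G_def H_def scale_right_diff_distrib scale_sum_right algebra_simps)
  then show ?thesis using e1 by (simp add: dfield_def)
qed

end

section \<open>Universal enveloping algebras\<close>

text \<open>With concatenation as addition of words, the free algebra is a monoid algebra, and the
  convolution product of finitely supported functions provides associativity and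
  distributivity.\<close>

instantiation list :: (type) monoid_add
begin
definition zero_list_def: "0 = []"
definition plus_list_def: "xs + ys = xs @ ys"
instance by standard (simp_all add: zero_list_def plus_list_def)
end

lemma poly_mapping_expand:
  "f = (\<Sum>w\<in>Poly_Mapping.keys f. Poly_Mapping.single w (Poly_Mapping.lookup f w))"
proof (rule poly_mapping_eqI)
  fix k
  have "(\<Sum>w\<in>Poly_Mapping.keys f. Poly_Mapping.lookup (Poly_Mapping.single w (Poly_Mapping.lookup f w)) k)
      = (\<Sum>w\<in>Poly_Mapping.keys f. if w = k then Poly_Mapping.lookup f k else 0)"
    by (rule sum.cong[OF refl]) (auto simp: lookup_single when_def)
  also have "\<dots> = Poly_Mapping.lookup f k"
    by (simp add: in_keys_iff)
  finally show "Poly_Mapping.lookup f k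
      = Poly_Mapping.lookup (\<Sum>w\<in>Poly_Mapping.keys f. Poly_Mapping.single w (Poly_Mapping.lookup f w)) k"
    by (simp add: lookup_sum)
qed

lemma poly_mapping_list_times:
  "f * g = (\<Sum>v\<in>Poly_Mapping.keys f. \<Sum>w\<in>Poly_Mapping.keys g.
      Poly_Mapping.single (v @ w) (Poly_Mapping.lookup f v * Poly_Mapping.lookup g w))"
  for f g :: "'l list \<Rightarrow>\<^sub>0 'k::semiring_0"
proof -
  have "f * g = (\<Sum>v\<in>Poly_Mapping.keys f. Poly_Mapping.single v (Poly_Mapping.lookup f v))
      * (\<Sum>w\<in>Poly_Mapping.keys g. Poly_Mapping.single w (Poly_Mapping.lookup g w))"
    by (rule arg_cong2[where f = "(*)"]) (rule poly_mapping_expand)+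
  then show ?thesis
    by (simp add: sum_product mult_single plus_list_def)
qed

lemma single_Nil: "Poly_Mapping.single [] 1 = (1 :: 'l list \<Rightarrow>\<^sub>0 'k::semiring_1)"
  using single_one[where 'a = "'l list" and 'b = 'k] by (simp add: zero_list_def)

lemma free_algebra_simps [simp]:
  "carrier (free_algebra L) = {f. \<forall>w\<in>Poly_Mapping.keys f. set w \<subseteq> L}"
  "f \<otimes>\<^bsub>free_algebra L\<^esub> g = f * g"
  "\<one>\<^bsub>free_algebra L\<^esub> = 1"
  "\<zero>\<^bsub>free_algebra L\<^esub> = 0"
  "f \<oplus>\<^bsub>free_algebra L\<^esub> g = f + g"
  by (simp_all add: free_algebra_def poly_mapping_list_times single_Nil)

lemma ring_free_algebra: "ring (free_algebra L :: ('l list \<Rightarrow>\<^sub>0 'k::field) ring)"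
proof (rule ringI)
  show "abelian_group (free_algebra L :: ('l list \<Rightarrow>\<^sub>0 'k) ring)"
  proof (rule abelian_groupI)
    fix x :: "'l list \<Rightarrow>\<^sub>0 'k" assume "x \<in> carrier (free_algebra L)"
    then show "\<exists>y\<in>carrier (free_algebra L). y \<oplus>\<^bsub>free_algebra L\<^esub> x = \<zero>\<^bsub>free_algebra L\<^esub>"
      by (intro bexI[of _ "- x"]) (auto simp: in_keys_iff)
  qed (auto simp: add_ac dest!: subsetD[OF keys_add])
  show "Group.monoid (free_algebra L :: ('l list \<Rightarrow>\<^sub>0 'k) ring)"
  proof (rule monoidI)
    fix x y :: "'l list \<Rightarrow>\<^sub>0 'k"
    assume "x \<in> carrier (free_algebra L)" "y \<in> carrier (free_algebra L)"
    then show "x \<otimes>\<^bsub>free_algebra L\<^esub> y \<in> carrier (free_algebra L)"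
      using keys_mult[of x y] by (fastforce simp: plus_list_def)
  qed (auto simp: mult.assoc zero_list_def)
qed (auto simp: algebra_simps)

lemma single_in_free_algebra:
  "set w \<subseteq> L \<Longrightarrow> Poly_Mapping.single w c \<in> carrier (free_algebra L)"
  by (auto split: if_splits)

lemma free_algebra_diff: "f \<in> carrier (free_algebra L) \<Longrightarrow> g \<in> carrier (free_algebra L) \<Longrightarrow>
    f - g \<in> carrier (free_algebra L)"
  using keys_diff[of f g] by fastforce

text \<open>Closure puts the defining relations inside the free algebra on \<open>L\<close>, so that
  they generate an ideal of it.\<close>

locale lie_data =
  fixes L :: "'l::ab_group_add set" and scL :: "'k::field \<Rightarrow> 'l \<Rightarrow> 'l" and brL :: "'l \<Rightarrow> 'l \<Rightarrow> 'l"
  assumes L_add: "x \<in> L \<Longrightarrow> y \<in> L \<Longrightarrow> x + y \<in> L"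
    and L_scale: "x \<in> L \<Longrightarrow> scL c x \<in> L"
    and L_bracket: "x \<in> L \<Longrightarrow> y \<in> L \<Longrightarrow> brL x y \<in> L"
begin

sublocale F: ring "free_algebra L :: ('l list \<Rightarrow>\<^sub>0 'k) ring"
  by (rule ring_free_algebra)

lemma relations_subset: "uea_relations L scL brL \<subseteq> carrier (free_algebra L)"
  unfolding uea_relations_def
  by (auto intro!: free_algebra_diff single_in_free_algebra L_add L_scale L_bracket simp del: free_algebra_simps)

sublocale I: ideal "uea_ideal L scL brL" "free_algebra L"
  unfolding uea_ideal_def by (rule F.genideal_ideal[OF relations_subset])

lemma relation_in_ideal: "r \<in> uea_relations L scL brL \<Longrightarrow> r \<in> uea_ideal L scL brL"
  unfolding uea_ideal_def using F.genideal_self[OF relations_subset] by blast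

sublocale U: ring "uea L scL brL"
  unfolding uea_def by (rule I.quotient_is_ring)

lemma class_hom: "uea_class L scL brL \<in> ring_hom (free_algebra L) (uea L scL brL)"
  unfolding uea_def uea_class_def by (rule I.rcos_ring_hom)

lemma uea_carrierE:
  assumes "A \<in> carrier (uea L scL brL)"
  obtains f where "f \<in> carrier (free_algebra L)" "A = uea_class L scL brL f"
  using assms by (auto simp: uea_def uea_class_def FactRing_def A_RCOSETS_def' simp del: free_algebra_simps)

lemma class_closed: "f \<in> carrier (free_algebra L) \<Longrightarrow> uea_class L scL brL f \<in> carrier (uea L scL brL)"
  using class_hom by (rule ring_hom_closed)

lemma class_mult: "f \<in> carrier (free_algebra L) \<Longrightarrow> g \<in> carrier (free_algebra L) \<Longrightarrow>
    uea_class L scL brL f \<otimes>\<^bsub>uea L scL brL\<^esub> uea_class L scL brL g = uea_class L scL brL (f * g)"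
  using ring_hom_mult[OF class_hom] by (simp del: free_algebra_simps(1))

lemma class_add: "f \<in> carrier (free_algebra L) \<Longrightarrow> g \<in> carrier (free_algebra L) \<Longrightarrow>
    uea_class L scL brL f \<oplus>\<^bsub>uea L scL brL\<^esub> uea_class L scL brL g = uea_class L scL brL (f + g)"
  using ring_hom_add[OF class_hom] by (simp del: free_algebra_simps(1))

lemma class_one: "\<one>\<^bsub>uea L scL brL\<^esub> = uea_class L scL brL 1"
  using ring_hom_one[OF class_hom] by simp

lemma class_eq:
  assumes "f \<in> carrier (free_algebra L)" "g \<in> carrier (free_algebra L)" "f - g \<in> uea_ideal L scL brL"
  shows "uea_class L scL brL f = uea_class L scL brL g"
proof -
  have "f = (f - g) \<oplus>\<^bsub>free_algebra L\<^esub> g" by simp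
  then have "f \<in> uea_ideal L scL brL +>\<^bsub>free_algebra L\<^esub> g"
    using assms(3) unfolding a_r_coset_def' by blast
  then show ?thesis
    unfolding uea_class_def using I.a_repr_independence'[OF _ assms(2)] by simp
qed

lemma mem_class:
  assumes "f \<in> carrier (free_algebra L)"
  shows "g \<in> uea_class L scL brL f \<longleftrightarrow> g - f \<in> uea_ideal L scL brL"
proof
  assume "g \<in> uea_class L scL brL f"
  then obtain h where "h \<in> uea_ideal L scL brL" "g = h + f"
    unfolding uea_class_def a_r_coset_def' by auto
  then show "g - f \<in> uea_ideal L scL brL" by simp
next
  assume "g - f \<in> uea_ideal L scL brL"
  moreover have "g = (g - f) \<oplus>\<^bsub>free_algebra L\<^esub> f" by simp
  ultimately show "g \<in> uea_class L scL brL f"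
    unfolding uea_class_def a_r_coset_def' by blast
qed

lemma class_add_letter:
  assumes "x \<in> L" "y \<in> L"
  shows "uea_class L scL brL (Poly_Mapping.single [x + y] 1)
    = uea_class L scL brL (Poly_Mapping.single [x] 1 + Poly_Mapping.single [y] 1)"
proof (rule class_eq)
  show "Poly_Mapping.single [x + y] 1 - (Poly_Mapping.single [x] 1 + Poly_Mapping.single [y] 1) \<in> uea_ideal L scL brL"
    by (rule relation_in_ideal) (unfold uea_relations_def diff_diff_eq[symmetric], use assms in blast)
  show "Poly_Mapping.single [x] (1::'k) + Poly_Mapping.single [y] 1 \<in> carrier (free_algebra L)"
    using F.a_closed[OF single_in_free_algebra single_in_free_algebra, of "[x]" "[y]"] assms
    by (simp del: free_algebra_simps(1))
qed (use assms L_add in \<open>auto intro!: single_in_free_algebra simp del: free_algebra_simps\<close>)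

lemma class_scale_letter:
  assumes "x \<in> L"
  shows "uea_class L scL brL (Poly_Mapping.single [scL c x] 1) = uea_class L scL brL (Poly_Mapping.single [x] c)"
proof (rule class_eq)
  show "Poly_Mapping.single [scL c x] 1 - Poly_Mapping.single [x] c \<in> uea_ideal L scL brL"
    by (rule relation_in_ideal) (unfold uea_relations_def, use assms in blast)
qed (use assms L_scale in \<open>auto intro!: single_in_free_algebra simp del: free_algebra_simps\<close>)

lemma class_bracket_letter:
  assumes "x \<in> L" "y \<in> L"
  shows "uea_class L scL brL (Poly_Mapping.single [x, y] 1)
    = uea_class L scL brL (Poly_Mapping.single [y, x] 1 + Poly_Mapping.single [brL x y] 1)"
proof (rule class_eq)
  show "Poly_Mapping.single [x, y] 1 - (Poly_Mapping.single [y, x] 1 + Poly_Mapping.single [brL x y] 1) \<in> uea_ideal L scL brL"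
    by (rule relation_in_ideal) (unfold uea_relations_def diff_diff_eq[symmetric], use assms in blast)
  show "Poly_Mapping.single [y, x] (1::'k) + Poly_Mapping.single [brL x y] 1 \<in> carrier (free_algebra L)"
    using F.a_closed[OF single_in_free_algebra single_in_free_algebra, of "[y, x]" "[brL x y]"] assms L_bracket
    by (simp del: free_algebra_simps(1))
qed (use assms L_bracket in \<open>auto intro!: single_in_free_algebra simp del: free_algebra_simps\<close>)

end

text \<open>The module is a subset of a type because the main instance is the set of fields, a part
  of the type of all functions.\<close>

locale lie_rep = lie_data L scL brL
  for L :: "'l::ab_group_add set" and scL :: "'k::field \<Rightarrow> 'l \<Rightarrow> 'l" and brL +
  fixes M :: "'m::ab_group_add set" and sM :: "'k \<Rightarrow> 'm \<Rightarrow> 'm" and \<sigma> :: "'l \<Rightarrow> 'm \<Rightarrow> 'm"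
  assumes M_add: "a \<in> M \<Longrightarrow> b \<in> M \<Longrightarrow> a + b \<in> M"
    and M_zero: "0 \<in> M"
    and M_scale: "a \<in> M \<Longrightarrow> sM c a \<in> M"
    and sM_add_right: "a \<in> M \<Longrightarrow> b \<in> M \<Longrightarrow> sM c (a + b) = sM c a + sM c b"
    and sM_add_left: "a \<in> M \<Longrightarrow> sM (c + d) a = sM c a + sM d a"
    and sM_mult: "a \<in> M \<Longrightarrow> sM (c * d) a = sM c (sM d a)"
    and sM_one: "a \<in> M \<Longrightarrow> sM 1 a = a"
    and \<sigma>_closed: "x \<in> L \<Longrightarrow> a \<in> M \<Longrightarrow> \<sigma> x a \<in> M"
    and \<sigma>_add_right: "x \<in> L \<Longrightarrow> a \<in> M \<Longrightarrow> b \<in> M \<Longrightarrow> \<sigma> x (a + b) = \<sigma> x a + \<sigma> x b"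
    and \<sigma>_scale_right: "x \<in> L \<Longrightarrow> a \<in> M \<Longrightarrow> \<sigma> x (sM c a) = sM c (\<sigma> x a)"
    and \<sigma>_add_left: "x \<in> L \<Longrightarrow> y \<in> L \<Longrightarrow> a \<in> M \<Longrightarrow> \<sigma> (x + y) a = \<sigma> x a + \<sigma> y a"
    and \<sigma>_scale_left: "x \<in> L \<Longrightarrow> a \<in> M \<Longrightarrow> \<sigma> (scL c x) a = sM c (\<sigma> x a)"
    and \<sigma>_bracket: "x \<in> L \<Longrightarrow> y \<in> L \<Longrightarrow> a \<in> M \<Longrightarrow> \<sigma> (brL x y) a = \<sigma> x (\<sigma> y a) - \<sigma> y (\<sigma> x a)"
begin

definition word_act :: "('l list \<Rightarrow>\<^sub>0 'k) \<Rightarrow> 'm \<Rightarrow> 'm" where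
  "word_act f a = (\<Sum>w\<in>Poly_Mapping.keys f. sM (Poly_Mapping.lookup f w) (foldr \<sigma> w a))"

lemma sM_zero_left: "a \<in> M \<Longrightarrow> sM 0 a = 0"
  using sM_add_left[of a 0 0] by simp

lemma sM_zero_right: "sM c 0 = 0"
  using sM_add_right[OF M_zero M_zero, of c] by simp

lemma sM_sum: "(\<And>i. i \<in> A \<Longrightarrow> g i \<in> M) \<Longrightarrow> sM c (sum g A) = (\<Sum>i\<in>A. sM c (g i)) \<and> sum g A \<in> M"
  by (induction A rule: infinite_finite_induct) (simp_all add: M_zero M_add sM_zero_right sM_add_right)

lemma M_sum: "(\<And>i. i \<in> A \<Longrightarrow> g i \<in> M) \<Longrightarrow> sum g A \<in> M"
  using sM_sum by blast

lemma foldr_closed: "set w \<subseteq> L \<Longrightarrow> a \<in> M \<Longrightarrow> foldr \<sigma> w a \<in> M"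
  by (induction w) (auto intro: \<sigma>_closed)

lemma foldr_add: "set w \<subseteq> L \<Longrightarrow> a \<in> M \<Longrightarrow> b \<in> M \<Longrightarrow> foldr \<sigma> w (a + b) = foldr \<sigma> w a + foldr \<sigma> w b"
  by (induction w) (auto simp: \<sigma>_add_right foldr_closed)

lemma foldr_scale: "set w \<subseteq> L \<Longrightarrow> a \<in> M \<Longrightarrow> foldr \<sigma> w (sM c a) = sM c (foldr \<sigma> w a)"
  by (induction w) (auto simp: \<sigma>_scale_right foldr_closed)

lemma word_act_closed: "f \<in> carrier (free_algebra L) \<Longrightarrow> a \<in> M \<Longrightarrow> word_act f a \<in> M"
  unfolding word_act_def by (rule M_sum) (auto intro!: M_scale foldr_closed)

lemma word_act_superset:
  assumes "f \<in> carrier (free_algebra L)" "a \<in> M" "finite S" "Poly_Mapping.keys f \<subseteq> S" "\<And>w. w \<in> S \<Longrightarrow> set w \<subseteq> L"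
  shows "word_act f a = (\<Sum>w\<in>S. sM (Poly_Mapping.lookup f w) (foldr \<sigma> w a))"
  unfolding word_act_def
  by (rule sum.mono_neutral_left) (use assms in \<open>auto simp: in_keys_iff sM_zero_left foldr_closed\<close>)

lemma word_act_add_left:
  assumes "f \<in> carrier (free_algebra L)" "g \<in> carrier (free_algebra L)" "a \<in> M"
  shows "word_act (f + g) a = word_act f a + word_act g a"
proof -
  have fg: "f + g \<in> carrier (free_algebra L)"
    using F.a_closed[OF assms(1,2)] by (simp del: free_algebra_simps(1))
  define S where "S = Poly_Mapping.keys f \<union> Poly_Mapping.keys g \<union> Poly_Mapping.keys (f + g)"
  have S: "\<And>w. w \<in> S \<Longrightarrow> set w \<subseteq> L" "finite S" using assms fg by (auto simp: S_def)
  have "word_act h a = (\<Sum>w\<in>S. sM (Poly_Mapping.lookup h w) (foldr \<sigma> w a))" if "h \<in> {f, g, f + g}" for h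
    by (rule word_act_superset) (use that assms fg S in \<open>auto simp: S_def simp del: free_algebra_simps\<close>)
  then show ?thesis
    by (simp add: lookup_add sM_add_left foldr_closed S assms(3) sum.distrib)
qed

lemma word_act_add_right:
  assumes "f \<in> carrier (free_algebra L)" "a \<in> M" "b \<in> M"
  shows "word_act f (a + b) = word_act f a + word_act f b"
  using assms by (simp add: word_act_def foldr_add foldr_closed sM_add_right sum.distrib)

lemma word_act_zero_left [simp]: "word_act 0 a = 0"
  by (simp add: word_act_def)

lemma word_act_uminus:
  assumes "f \<in> carrier (free_algebra L)" "a \<in> M"
  shows "word_act (- f) a = - word_act f a"
  using word_act_add_left[of f "- f" a] assms by (simp add: eq_neg_iff_add_eq_0 add.commute)

lemma word_act_diff:
  assumes "f \<in> carrier (free_algebra L)" "g \<in> carrier (free_algebra L)" "a \<in> M"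
  shows "word_act (f - g) a = word_act f a - word_act g a"
  using word_act_add_left[of f "- g" a] word_act_uminus[OF assms(2,3)] assms by simp

lemma word_act_single:
  assumes "set w \<subseteq> L" "a \<in> M"
  shows "word_act (Poly_Mapping.single w c) a = sM c (foldr \<sigma> w a)"
  using assms by (simp add: word_act_def sM_zero_left foldr_closed)

lemma word_act_sum:
  assumes "finite A" "\<And>i. i \<in> A \<Longrightarrow> g i \<in> carrier (free_algebra L)" "a \<in> M"
  shows "word_act (sum g A) a = (\<Sum>i\<in>A. word_act (g i) a) \<and> sum g A \<in> carrier (free_algebra L)"
  using assms(1,2)
proof (induction A rule: finite_induct)
  case empty
  then show ?case by simp
next
  case (insert x A)
  then show ?case
    using word_act_add_left[of "g x" "sum g A" a] F.a_closed[of "g x" "sum g A"] assms(3)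
    by (simp del: free_algebra_simps(1))
qed

lemma word_act_mult:
  assumes f: "f \<in> carrier (free_algebra L)" and g: "g \<in> carrier (free_algebra L)" and a: "a \<in> M"
  shows "word_act (f * g) a = word_act f (word_act g a)"
proof -
  have fv: "\<And>v. v \<in> Poly_Mapping.keys f \<Longrightarrow> set v \<subseteq> L" and gv: "\<And>v. v \<in> Poly_Mapping.keys g \<Longrightarrow> set v \<subseteq> L"
    using f g by auto
  note fv' = subsetD[OF fv] and gv' = subsetD[OF gv]
  let ?s = "\<lambda>v w. Poly_Mapping.single (v @ w) (Poly_Mapping.lookup f v * Poly_Mapping.lookup g w)"
  have "f * g = (\<Sum>v\<in>Poly_Mapping.keys f. \<Sum>w\<in>Poly_Mapping.keys g. ?s v w)"
    by (rule poly_mapping_list_times)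
  then have "word_act (f * g) a = (\<Sum>v\<in>Poly_Mapping.keys f. word_act (\<Sum>w\<in>Poly_Mapping.keys g. ?s v w) a)"
    using a by (simp del: free_algebra_simps) (rule word_act_sum[THEN conjunct1];
      auto simp del: free_algebra_simps dest: fv' gv' intro!: word_act_sum[THEN conjunct2] single_in_free_algebra)
  also have "\<dots> = (\<Sum>v\<in>Poly_Mapping.keys f. \<Sum>w\<in>Poly_Mapping.keys g. word_act (?s v w) a)"
    using a by (intro sum.cong refl word_act_sum[THEN conjunct1])
      (auto simp del: free_algebra_simps dest: fv' gv' intro!: single_in_free_algebra)
  also have "\<dots> = (\<Sum>v\<in>Poly_Mapping.keys f. \<Sum>w\<in>Poly_Mapping.keys g.
      sM (Poly_Mapping.lookup f v) (foldr \<sigma> v (sM (Poly_Mapping.lookup g w) (foldr \<sigma> w a))))"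
    using fv gv a
    by (intro sum.cong refl) (simp add: word_act_single foldr_closed foldr_scale sM_mult)
  also have "\<dots> = (\<Sum>w\<in>Poly_Mapping.keys g. word_act f (sM (Poly_Mapping.lookup g w) (foldr \<sigma> w a)))"
    unfolding word_act_def by (rule sum.swap)
  also have "\<dots> = word_act f (word_act g a)"
  proof -
    have "word_act f (sum h A) = (\<Sum>i\<in>A. word_act f (h i))" if "finite A" "\<And>i. i \<in> A \<Longrightarrow> h i \<in> M" for h and A :: "'l list set"
      using that
    proof (induction A rule: finite_induct)
      case empty
      have "word_act f 0 = 0" using word_act_add_right[OF f M_zero M_zero] by simp
      then show ?case by simp
    next
      case (insert x A)
      then show ?case by (simp add: word_act_add_right[OF f] M_sum)
    qed
    then show ?thesis
      unfolding word_act_def[of g] using gv a by (simp add: M_scale foldr_closed)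
  qed
  finally show ?thesis .
qed

text \<open>The elements that annihilate \<open>M\<close> form an ideal containing the relations,
  hence the ideal generated by them.\<close>

lemma word_act_ideal:
  assumes "f \<in> uea_ideal L scL brL" "a \<in> M"
  shows "word_act f a = 0"
proof -
  define K where "K = {f \<in> carrier (free_algebra L). \<forall>a\<in>M. word_act f a = 0}"
  have zero_right: "word_act f 0 = 0" if "f \<in> carrier (free_algebra L)" for f
    using word_act_add_right[OF that M_zero M_zero] by simp
  have "ideal K (free_algebra L)"
  proof (rule idealI[OF ring_free_algebra])
    show "subgroup K (add_monoid (free_algebra L))"
    proof (rule group.subgroupI)
      show "Group.group (add_monoid (free_algebra L))" by (rule abelian_group.a_group[OF ring.is_abelian_group[OF ring_free_algebra]])
      show "K \<noteq> {}" by (auto simp: K_def intro!: exI[of _ 0])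
      fix f assume f: "f \<in> K"
      then have "inv\<^bsub>add_monoid (free_algebra L)\<^esub> f = - f"
        using F.minus_equality[of "- f" f] by (simp add: K_def a_inv_def)
      then show "inv\<^bsub>add_monoid (free_algebra L)\<^esub> f \<in> K"
        using f word_act_uminus by (simp add: K_def)
    next
      fix f g assume "f \<in> K" "g \<in> K"
      then show "f \<otimes>\<^bsub>add_monoid (free_algebra L)\<^esub> g \<in> K"
        using word_act_add_left F.a_closed[of f g] by (simp add: K_def)
    qed (auto simp: K_def)
    show "g \<otimes>\<^bsub>free_algebra L\<^esub> f \<in> K" if "f \<in> K" "g \<in> carrier (free_algebra L)" for f g
      using that F.m_closed[of g f] by (simp add: K_def word_act_mult zero_right del: free_algebra_simps(1))
    show "f \<otimes>\<^bsub>free_algebra L\<^esub> g \<in> K" if "f \<in> K" "g \<in> carrier (free_algebra L)" for f g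
      using that F.m_closed[of f g] by (simp add: K_def word_act_mult word_act_closed del: free_algebra_simps(1))
  qed
  moreover have "uea_relations L scL brL \<subseteq> K"
  proof
    fix r assume r: "r \<in> uea_relations L scL brL"
    then have rc: "r \<in> carrier (free_algebra L)" using relations_subset by blast
    have "word_act r a = 0" if a: "a \<in> M" for a
      using r unfolding uea_relations_def
    proof (elim UnE CollectE exE conjE)
      fix x y assume "r = Poly_Mapping.single [x + y] 1 - Poly_Mapping.single [x] 1 - Poly_Mapping.single [y] 1" "x \<in> L" "y \<in> L"
      then show ?thesis using a
        by (simp add: word_act_diff free_algebra_diff single_in_free_algebra word_act_single L_add sM_one M_add \<sigma>_closed \<sigma>_add_left
          del: free_algebra_simps)
    next
      fix c x assume "r = Poly_Mapping.single [scL c x] 1 - Poly_Mapping.single [x] c" "x \<in> L"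
      then show ?thesis using a
        by (simp add: word_act_diff free_algebra_diff single_in_free_algebra word_act_single L_scale sM_one \<sigma>_closed \<sigma>_scale_left
          M_scale del: free_algebra_simps)
    next
      fix x y assume "r = Poly_Mapping.single [x, y] 1 - Poly_Mapping.single [y, x] 1 - Poly_Mapping.single [brL x y] 1" "x \<in> L" "y \<in> L"
      then show ?thesis using a
        by (simp add: word_act_diff free_algebra_diff single_in_free_algebra word_act_single L_bracket sM_one \<sigma>_closed \<sigma>_bracket[symmetric]
          del: free_algebra_simps)
    qed
    then show "r \<in> K" using rc by (simp add: K_def)
  qed
  ultimately have "uea_ideal L scL brL \<subseteq> K"
    unfolding uea_ideal_def by (rule F.genideal_minimal)
  then show ?thesis using assms by (auto simp: K_def)
qed

text \<open>All representatives act alike by \<open>word_act_ideal\<close>, so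
  \<open>the_elem\<close> is applied to a singleton.\<close>

lemma uea_act_class:
  assumes f: "f \<in> carrier (free_algebra L)" and a: "a \<in> M"
  shows "uea_act sM \<sigma> (uea_class L scL brL f) a = word_act f a"
proof -
  have "word_act g a = word_act f a" if "g \<in> uea_class L scL brL f" for g
  proof -
    have i: "g - f \<in> uea_ideal L scL brL" using that mem_class[OF f] by simp
    then have "g - f \<in> carrier (free_algebra L)" by (rule I.a_Hcarr)
    then have "word_act ((g - f) + f) a = word_act (g - f) a + word_act f a"
      using f a by (rule word_act_add_left)
    then show ?thesis using word_act_ideal[OF i a] by simp
  qed
  moreover have "f \<in> uea_class L scL brL f"
    using mem_class[OF f, of f] I.zero_closed by simp
  ultimately have "(\<lambda>f. word_act f a) ` uea_class L scL brL f = {word_act f a}"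
    by blast
  then show ?thesis
    by (simp add: uea_act_def word_act_def)
qed

lemma uea_act_closed: "A \<in> carrier (uea L scL brL) \<Longrightarrow> a \<in> M \<Longrightarrow> uea_act sM \<sigma> A a \<in> M"
  by (elim uea_carrierE) (simp add: uea_act_class word_act_closed del: free_algebra_simps)

lemma uea_act_add_left:
  assumes "A \<in> carrier (uea L scL brL)" "B \<in> carrier (uea L scL brL)" "a \<in> M"
  shows "uea_act sM \<sigma> (A \<oplus>\<^bsub>uea L scL brL\<^esub> B) a = uea_act sM \<sigma> A a + uea_act sM \<sigma> B a"
proof -
  obtain f where f: "f \<in> carrier (free_algebra L)" "A = uea_class L scL brL f" using uea_carrierE[OF assms(1)] .
  obtain g where g: "g \<in> carrier (free_algebra L)" "B = uea_class L scL brL g" using uea_carrierE[OF assms(2)] .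
  have "f + g \<in> carrier (free_algebra L)" using F.a_closed[OF f(1) g(1)] by (simp del: free_algebra_simps(1))
  then show ?thesis
    using f g assms(3) by (simp add: class_add uea_act_class word_act_add_left del: free_algebra_simps)
qed

lemma uea_act_mult:
  assumes "A \<in> carrier (uea L scL brL)" "B \<in> carrier (uea L scL brL)" "a \<in> M"
  shows "uea_act sM \<sigma> (A \<otimes>\<^bsub>uea L scL brL\<^esub> B) a = uea_act sM \<sigma> A (uea_act sM \<sigma> B a)"
proof -
  obtain f where f: "f \<in> carrier (free_algebra L)" "A = uea_class L scL brL f" using uea_carrierE[OF assms(1)] .
  obtain g where g: "g \<in> carrier (free_algebra L)" "B = uea_class L scL brL g" using uea_carrierE[OF assms(2)] .
  have "f * g \<in> carrier (free_algebra L)" using F.m_closed[OF f(1) g(1)] by (simp del: free_algebra_simps(1))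
  then show ?thesis
    using f g assms(3) by (simp add: class_mult uea_act_class word_act_mult word_act_closed del: free_algebra_simps)
qed

lemma uea_act_add_right:
  assumes "A \<in> carrier (uea L scL brL)" "a \<in> M" "b \<in> M"
  shows "uea_act sM \<sigma> A (a + b) = uea_act sM \<sigma> A a + uea_act sM \<sigma> A b"
proof -
  obtain f where f: "f \<in> carrier (free_algebra L)" "A = uea_class L scL brL f" using uea_carrierE[OF assms(1)] .
  then show ?thesis
    using assms by (simp add: uea_act_class word_act_add_right M_add del: free_algebra_simps)
qed

lemma uea_act_single:
  assumes "set w \<subseteq> L" "a \<in> M"
  shows "uea_act sM \<sigma> (uea_class L scL brL (Poly_Mapping.single w c)) a = sM c (foldr \<sigma> w a)"
  using assms by (simp add: uea_act_class single_in_free_algebra word_act_single del: free_algebra_simps)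

end

text \<open>All representatives of a class have the same image, so the union in the definition is a class.\<close>

lemma uea_inclusion_class:
  assumes K: "lie_data K scL brL" and L: "lie_data L scL brL" and sub: "K \<subseteq> L"
    and f: "f \<in> carrier (free_algebra K)"
  shows "uea_inclusion L scL brL (uea_class K scL brL f) = uea_class L scL brL f"
proof -
  interpret K: lie_data K scL brL by fact
  interpret L: lie_data L scL brL by fact
  have carr: "carrier (free_algebra K) \<subseteq> carrier (free_algebra L)" using sub by auto
  \<comment> \<open>The larger ideal meets the smaller free algebra in an ideal that contains the
    smaller set of relations. Hence the smaller ideal lies in the larger one, and a class over
    \<open>K\<close> lands in a single class over \<open>L\<close>.\<close>
  define J where "J = carrier (free_algebra K) \<inter> uea_ideal L scL brL"
  have "ideal J (free_algebra K)"
  proof (rule idealI[OF ring_free_algebra])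
    show "subgroup J (add_monoid (free_algebra K))"
    proof (rule group.subgroupI)
      show "Group.group (add_monoid (free_algebra K))" by (rule abelian_group.a_group[OF ring.is_abelian_group[OF ring_free_algebra]])
      have "0 \<in> J" using L.I.zero_closed by (simp add: J_def)
      then show "J \<noteq> {}" by blast
      fix g assume g: "g \<in> J"
      then have gc: "g \<in> carrier (free_algebra K)" "g \<in> carrier (free_algebra L)" using carr by (auto simp: J_def)
      have "inv\<^bsub>add_monoid (free_algebra K)\<^esub> g = - g"
        using K.F.minus_equality[of "- g" g] gc(1) by (simp add: a_inv_def)
      moreover have "inv\<^bsub>add_monoid (free_algebra L)\<^esub> g = - g"
        using L.F.minus_equality[of "- g" g] gc(2) by (simp add: a_inv_def)
      moreover have "inv\<^bsub>add_monoid (free_algebra L)\<^esub> g \<in> uea_ideal L scL brL"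
        using g L.I.a_inv_closed[of g] by (simp add: J_def a_inv_def)
      ultimately show "inv\<^bsub>add_monoid (free_algebra K)\<^esub> g \<in> J"
        using gc by (simp add: J_def)
    next
      fix g h assume "g \<in> J" "h \<in> J"
      then show "g \<otimes>\<^bsub>add_monoid (free_algebra K)\<^esub> h \<in> J"
        using L.I.a_closed[of g h] K.F.a_closed[of g h] by (simp add: J_def)
    qed (auto simp: J_def)
    show "h \<otimes>\<^bsub>free_algebra K\<^esub> g \<in> J" if "g \<in> J" "h \<in> carrier (free_algebra K)" for g h
      using that K.F.m_closed[of h g] L.I.I_l_closed[of g h] carr
      by (auto simp: J_def simp del: free_algebra_simps(1))
    show "g \<otimes>\<^bsub>free_algebra K\<^esub> h \<in> J" if "g \<in> J" "h \<in> carrier (free_algebra K)" for g h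
      using that K.F.m_closed[of g h] L.I.I_r_closed[of g h] carr
      by (auto simp: J_def simp del: free_algebra_simps(1))
  qed
  moreover have "uea_relations K scL brL \<subseteq> J"
  proof -
    have "uea_relations K scL brL \<subseteq> uea_relations L scL brL"
      using sub unfolding uea_relations_def by blast
    then show ?thesis
      using K.relations_subset L.relation_in_ideal unfolding J_def by blast
  qed
  ultimately have "uea_ideal K scL brL \<subseteq> J"
    unfolding uea_ideal_def[of K] by (rule K.F.genideal_minimal)
  then have IKL: "uea_ideal K scL brL \<subseteq> uea_ideal L scL brL" by (auto simp: J_def)
  have "uea_class L scL brL g = uea_class L scL brL f" if "g \<in> uea_class K scL brL f" for g
  proof (rule L.class_eq)
    have i: "g - f \<in> uea_ideal K scL brL" using that K.mem_class[OF f] by simp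
    then show "g - f \<in> uea_ideal L scL brL" using IKL by blast
    have "(g - f) + f \<in> carrier (free_algebra K)"
      using K.F.a_closed[OF K.I.a_Hcarr[OF i] f] by (simp del: free_algebra_simps(1))
    then show "g \<in> carrier (free_algebra L)" using subsetD[OF carr] by (simp del: free_algebra_simps)
    show "f \<in> carrier (free_algebra L)" using f carr by blast
  qed
  moreover have "f \<in> uea_class K scL brL f"
    using K.mem_class[OF f, of f] K.I.zero_closed by simp
  ultimately show ?thesis
    unfolding uea_inclusion_def by blast
qed

section \<open>Induced modules\<close>

text \<open>The right action is multiplication by elements of \<open>M\<close> itself, the images
  under \<open>\<iota>\<close>. Left multiplications commute with it by associativity and therefore
  descend to the tensor product.\<close>

locale right_tensor = M: ring M
  for R :: "('r, 'd) ring_scheme" and M :: "('m, 'c) ring_scheme"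
    and ra :: "'m \<Rightarrow> 'r \<Rightarrow> 'm" and la :: "'r \<Rightarrow> 'n::ab_group_add \<Rightarrow> 'n" +
  fixes \<iota> :: "'r \<Rightarrow> 'm"
  assumes ra_eq: "m \<in> carrier M \<Longrightarrow> r \<in> carrier R \<Longrightarrow> ra m r = m \<otimes>\<^bsub>M\<^esub> \<iota> r"
    and \<iota>_closed: "r \<in> carrier R \<Longrightarrow> \<iota> r \<in> carrier M"
begin

abbreviation "S \<equiv> carrier M \<times> (UNIV :: 'n set)"
abbreviation "TN \<equiv> tensor_subgroup R M ra la"

definition tcls :: "('m \<times> 'n \<Rightarrow>\<^sub>0 int) \<Rightarrow> ('m \<times> 'n \<Rightarrow>\<^sub>0 int) set" where
  "tcls x = TN #>\<^bsub>tensor_free M\<^esub> x"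

abbreviation "pt m n \<equiv> tcls (frag_of (m, n))"

lemma tensor_free_simps [simp]:
  "x \<in> carrier (tensor_free M) \<longleftrightarrow> Poly_Mapping.keys x \<subseteq> S"
  "x \<otimes>\<^bsub>tensor_free M\<^esub> y = x + y"
  "\<one>\<^bsub>tensor_free M\<^esub> = (0 :: 'm \<times> 'n \<Rightarrow>\<^sub>0 int)"
  by (simp_all add: tensor_free_def)

lemma comm_group_tensor_free: "comm_group (tensor_free M :: ('m \<times> 'n \<Rightarrow>\<^sub>0 int) monoid)"
  unfolding tensor_free_def by (rule abelian_free_Abelian_group)

sublocale T: comm_group "tensor_free M :: ('m \<times> 'n \<Rightarrow>\<^sub>0 int) monoid"
  by (rule comm_group_tensor_free)

lemma inv_tensor_free: "Poly_Mapping.keys x \<subseteq> S \<Longrightarrow> inv\<^bsub>tensor_free M\<^esub> x = - (x :: 'm \<times> 'n \<Rightarrow>\<^sub>0 int)"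
  by (simp add: tensor_free_def)

lemma keys_diff_subset: "Poly_Mapping.keys x \<subseteq> A \<Longrightarrow> Poly_Mapping.keys y \<subseteq> A \<Longrightarrow> Poly_Mapping.keys (x - y) \<subseteq> A"
  for x y :: "'z \<Rightarrow>\<^sub>0 int"
  using keys_diff[of x y] by blast

lemma keys_add_subset: "Poly_Mapping.keys x \<subseteq> A \<Longrightarrow> Poly_Mapping.keys y \<subseteq> A \<Longrightarrow> Poly_Mapping.keys (x + y) \<subseteq> A"
  for x y :: "'z \<Rightarrow>\<^sub>0 int"
  using Poly_Mapping.keys_add[of x y] by blast

lemma tensor_relations_subset: "tensor_relations R M ra la \<subseteq> carrier (tensor_free M)"
  unfolding tensor_relations_def
  by (auto dest!: subsetD[OF keys_diff] simp: ra_eq \<iota>_closed)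

lemma relation_keys: "x \<in> tensor_relations R M ra la \<Longrightarrow> Poly_Mapping.keys x \<subseteq> S"
  using subsetD[OF tensor_relations_subset] tensor_free_simps(1) by blast

lemma TN_subgroup: "subgroup TN (tensor_free M)"
  unfolding tensor_subgroup_def by (rule T.generate_is_subgroup[OF tensor_relations_subset])

lemma relation_in_TN: "x \<in> tensor_relations R M ra la \<Longrightarrow> x \<in> TN"
  unfolding tensor_subgroup_def by (rule generate.incl)

lemma TN_closed: "x \<in> TN \<Longrightarrow> Poly_Mapping.keys x \<subseteq> S"
  using subsetD[OF subgroup.subset[OF TN_subgroup]] tensor_free_simps(1) by blast

lemma TN_zero: "0 \<in> TN"
  using subgroup.one_closed[OF TN_subgroup] by simp

lemma TN_add: "x \<in> TN \<Longrightarrow> y \<in> TN \<Longrightarrow> x + y \<in> TN"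
  using subgroup.m_closed[OF TN_subgroup] by fastforce

lemma TN_uminus: "x \<in> TN \<Longrightarrow> - x \<in> TN"
  using subgroup.m_inv_closed[OF TN_subgroup, of x] TN_closed[of x] by (simp add: inv_tensor_free)

lemma TN_diff: "x \<in> TN \<Longrightarrow> y \<in> TN \<Longrightarrow> x - y \<in> TN"
  using TN_add[of x "- y"] TN_uminus[of y] by simp

lemma TN_induct [consumes 1, case_names zero rel minus add]:
  assumes "x \<in> TN" "P 0" "\<And>x. x \<in> tensor_relations R M ra la \<Longrightarrow> P x"
    "\<And>x. x \<in> tensor_relations R M ra la \<Longrightarrow> P (- x)"
    "\<And>x y. x \<in> TN \<Longrightarrow> y \<in> TN \<Longrightarrow> P x \<Longrightarrow> P y \<Longrightarrow> P (x + y)"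
  shows "P x"
  using assms(1) unfolding tensor_subgroup_def
proof (induction rule: generate.induct)
  case (inv h)
  then have "Poly_Mapping.keys h \<subseteq> S" by (rule relation_keys)
  then show ?case using assms(4) inv by (simp add: inv_tensor_free)
next
  case (eng h1 h2)
  then show ?case using assms(5)[of h1 h2] by (simp add: tensor_subgroup_def)
qed (use assms in auto)

lemma tcls_mem: "z \<in> tcls x \<longleftrightarrow> z - x \<in> TN"
proof -
  have "z \<in> tcls x \<longleftrightarrow> (\<exists>h\<in>TN. z = h + x)" by (auto simp: tcls_def r_coset_def)
  also have "\<dots> \<longleftrightarrow> z - x \<in> TN" by (metis add_diff_cancel diff_add_cancel)
  finally show ?thesis .
qed

lemma tcls_eq: "tcls x = tcls y \<longleftrightarrow> x - y \<in> TN"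
proof
  assume "tcls x = tcls y"
  then show "x - y \<in> TN" using tcls_mem[of x x] tcls_mem[of x y] TN_zero by simp
next
  assume d: "x - y \<in> TN"
  show "tcls x = tcls y"
  proof (rule Set.set_eqI)
    fix z
    have "z - x = (z - y) - (x - y)" "z - y = (z - x) + (x - y)" by simp_all
    then show "z \<in> tcls x \<longleftrightarrow> z \<in> tcls y"
      unfolding tcls_mem using d by (metis TN_diff TN_add)
  qed
qed

lemma tensor_carrier: "carrier (tensor_group R M ra la) = tcls ` {x. Poly_Mapping.keys x \<subseteq> S}"
  by (auto simp: tensor_group_def FactGroup_def RCOSETS_def tcls_def)

lemma tensor_one: "\<one>\<^bsub>tensor_group R M ra la\<^esub> = tcls 0"
proof -
  have "TN = tcls 0" by (rule Set.set_eqI) (simp add: tcls_mem)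
  then show ?thesis by (simp add: tensor_group_def FactGroup_def)
qed

lemma tensor_mult:
  assumes "Poly_Mapping.keys x \<subseteq> S" "Poly_Mapping.keys y \<subseteq> S"
  shows "tcls x \<otimes>\<^bsub>tensor_group R M ra la\<^esub> tcls y = tcls (x + y)"
proof -
  interpret N: normal TN "tensor_free M :: ('m \<times> 'n \<Rightarrow>\<^sub>0 int) monoid"
    by (rule T.subgroup_imp_normal[OF TN_subgroup])
  show ?thesis
    using N.rcos_sum[of x y] assms by (simp add: tensor_group_def FactGroup_def tcls_def)
qed

lemma tensor_carrierE:
  assumes "v \<in> carrier (tensor_group R M ra la)"
  obtains x where "Poly_Mapping.keys x \<subseteq> S" "v = tcls x"
  using assms by (auto simp: tensor_carrier)

lemma tensor_induct [consumes 1, case_names zero pure diff]: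
  assumes "v \<in> carrier (tensor_group R M ra la)"
    and "P (tcls 0)" "\<And>m n. m \<in> carrier M \<Longrightarrow> P (pt m n)"
    and "\<And>x y. Poly_Mapping.keys x \<subseteq> S \<Longrightarrow> Poly_Mapping.keys y \<subseteq> S \<Longrightarrow> P (tcls x) \<Longrightarrow> P (tcls y) \<Longrightarrow> P (tcls (x - y))"
  shows "P v"
proof -
  obtain x where x: "Poly_Mapping.keys x \<subseteq> S" "v = tcls x" using assms(1) by (rule tensor_carrierE)
  have "P (tcls x)"
    using x(1) by (rule free_Abelian_group_induct) (use assms in auto)
  then show ?thesis using x by simp
qed

section \<open>Left multiplication on the tensor product, and its universal property\<close>

definition ext :: "('m \<Rightarrow> 'm) \<Rightarrow> ('m \<times> 'n \<Rightarrow>\<^sub>0 int) \<Rightarrow> 'm \<times> 'n \<Rightarrow>\<^sub>0 int" where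
  "ext \<phi> = frag_extend (\<lambda>(m, n). frag_of (\<phi> m, n))"

abbreviation lm :: "'m \<Rightarrow> ('m \<times> 'n \<Rightarrow>\<^sub>0 int) set \<Rightarrow> ('m \<times> 'n \<Rightarrow>\<^sub>0 int) set" where
  "lm c \<equiv> tensor_map R M ra la (\<lambda>A. c \<otimes>\<^bsub>M\<^esub> A)"

lemma ext_simps [simp]:
  "ext \<phi> (frag_of (m, n)) = frag_of (\<phi> m, n)" "ext \<phi> (x + y) = ext \<phi> x + ext \<phi> y"
  "ext \<phi> (x - y) = ext \<phi> x - ext \<phi> y" "ext \<phi> 0 = 0" "ext \<phi> (- x) = - ext \<phi> x"
  by (simp_all add: ext_def frag_extend_add frag_extend_diff frag_extend_minus)

lemma keys_ext:
  assumes "Poly_Mapping.keys x \<subseteq> S" "\<And>m. m \<in> carrier M \<Longrightarrow> \<phi> m \<in> carrier M"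
  shows "Poly_Mapping.keys (ext \<phi> x) \<subseteq> S"
proof -
  have "Poly_Mapping.keys (ext \<phi> x) \<subseteq> (\<Union>p\<in>Poly_Mapping.keys x. Poly_Mapping.keys ((\<lambda>(m, n). frag_of (\<phi> m, n)) p))"
    unfolding ext_def by (rule keys_frag_extend)
  also have "\<dots> \<subseteq> S" using assms by (auto simp: subset_iff)
  finally show ?thesis .
qed

text \<open>Left multiplication maps each of the three families of relations into itself: the first
  by distributivity, the balancing one by associativity.\<close>

lemma ext_TN:
  assumes "c \<in> carrier M" "x \<in> TN"
  shows "ext (\<lambda>A. c \<otimes>\<^bsub>M\<^esub> A) x \<in> TN"
proof -
  have rel: "ext (\<lambda>A. c \<otimes>\<^bsub>M\<^esub> A) y \<in> TN" if "y \<in> tensor_relations R M ra la" for y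
  proof (rule relation_in_TN)
    show "ext (\<lambda>A. c \<otimes>\<^bsub>M\<^esub> A) y \<in> tensor_relations R M ra la"
      using that unfolding tensor_relations_def
    proof (elim UnE CollectE exE conjE)
      fix m m' :: 'm and n :: 'n
      assume *: "y = frag_of (m \<oplus>\<^bsub>M\<^esub> m', n) - frag_of (m, n) - frag_of (m', n)" "m \<in> carrier M" "m' \<in> carrier M"
      show "ext (\<lambda>A. c \<otimes>\<^bsub>M\<^esub> A) y
        \<in> {frag_of (m \<oplus>\<^bsub>M\<^esub> m', n) - frag_of (m, n) - frag_of (m', n)
            | m m' n. m \<in> carrier M \<and> m' \<in> carrier M}
         \<union> {frag_of (m, n + n') - frag_of (m, n) - frag_of (m, n') | m n n'. m \<in> carrier M}
         \<union> {frag_of (ra m r, n) - frag_of (m, la r n) | m r n. m \<in> carrier M \<and> r \<in> carrier R}"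
        apply (rule UnI1, rule UnI1, rule CollectI, rule exI[of _ "c \<otimes>\<^bsub>M\<^esub> m"], rule exI[of _ "c \<otimes>\<^bsub>M\<^esub> m'"], rule exI[of _ n])
        using * assms(1) by (simp add: M.r_distr)
    next
      fix m :: 'm and n n' :: 'n
      assume *: "y = frag_of (m, n + n') - frag_of (m, n) - frag_of (m, n')" "m \<in> carrier M"
      show "ext (\<lambda>A. c \<otimes>\<^bsub>M\<^esub> A) y
        \<in> {frag_of (m \<oplus>\<^bsub>M\<^esub> m', n) - frag_of (m, n) - frag_of (m', n)
            | m m' n. m \<in> carrier M \<and> m' \<in> carrier M}
         \<union> {frag_of (m, n + n') - frag_of (m, n) - frag_of (m, n') | m n n'. m \<in> carrier M}
         \<union> {frag_of (ra m r, n) - frag_of (m, la r n) | m r n. m \<in> carrier M \<and> r \<in> carrier R}"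
        apply (rule UnI1, rule UnI2, rule CollectI, rule exI[of _ "c \<otimes>\<^bsub>M\<^esub> m"], rule exI[of _ n], rule exI[of _ n'])
        using * assms(1) by simp
    next
      fix m :: 'm and r :: 'r and n :: 'n
      assume *: "y = frag_of (ra m r, n) - frag_of (m, la r n)" "m \<in> carrier M" "r \<in> carrier R"
      show "ext (\<lambda>A. c \<otimes>\<^bsub>M\<^esub> A) y
        \<in> {frag_of (m \<oplus>\<^bsub>M\<^esub> m', n) - frag_of (m, n) - frag_of (m', n)
            | m m' n. m \<in> carrier M \<and> m' \<in> carrier M}
         \<union> {frag_of (m, n + n') - frag_of (m, n) - frag_of (m, n') | m n n'. m \<in> carrier M}
         \<union> {frag_of (ra m r, n) - frag_of (m, la r n) | m r n. m \<in> carrier M \<and> r \<in> carrier R}"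
        apply (rule UnI2, intro CollectI exI[of _ "c \<otimes>\<^bsub>M\<^esub> m"] exI[of _ r] exI[of _ n])
        using * assms(1) by (simp add: ra_eq \<iota>_closed M.m_assoc)
    qed
  qed
  show ?thesis using assms(2)
    by (induction rule: TN_induct) (auto simp: TN_zero rel TN_uminus TN_add)
qed

lemma lm_tcls:
  assumes "c \<in> carrier M" "Poly_Mapping.keys x \<subseteq> S"
  shows "lm c (tcls x) = tcls (ext (\<lambda>A. c \<otimes>\<^bsub>M\<^esub> A) x)"
proof -
  have "tcls (ext (\<lambda>A. c \<otimes>\<^bsub>M\<^esub> A) z) = tcls (ext (\<lambda>A. c \<otimes>\<^bsub>M\<^esub> A) x)" if "z \<in> tcls x" for z
    using ext_TN[OF assms(1), of "z - x"] that by (simp add: tcls_mem tcls_eq)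
  moreover have "x \<in> tcls x" by (simp add: tcls_mem TN_zero)
  ultimately show ?thesis
    unfolding tensor_map_def tcls_def[symmetric] ext_def[symmetric] by blast
qed

lemma lm_closed:
  assumes "c \<in> carrier M" "v \<in> carrier (tensor_group R M ra la)"
  shows "lm c v \<in> carrier (tensor_group R M ra la)"
proof -
  obtain x where x: "Poly_Mapping.keys x \<subseteq> S" "v = tcls x" using assms(2) by (rule tensor_carrierE)
  have "Poly_Mapping.keys (ext (\<lambda>A. c \<otimes>\<^bsub>M\<^esub> A) x) \<subseteq> S" by (rule keys_ext[OF x(1)]) (use assms(1) in simp)
  then show ?thesis using assms(1) x by (simp add: lm_tcls tensor_carrier)
qed

lemma lm_add_right:
  assumes "c \<in> carrier M" "v \<in> carrier (tensor_group R M ra la)" "w \<in> carrier (tensor_group R M ra la)"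
  shows "lm c (v \<otimes>\<^bsub>tensor_group R M ra la\<^esub> w) = lm c v \<otimes>\<^bsub>tensor_group R M ra la\<^esub> lm c w"
proof -
  obtain x where x: "Poly_Mapping.keys x \<subseteq> S" "v = tcls x" using assms(2) by (rule tensor_carrierE)
  obtain y where y: "Poly_Mapping.keys y \<subseteq> S" "w = tcls y" using assms(3) by (rule tensor_carrierE)
  show ?thesis using assms(1) x y
    by (simp add: tensor_mult lm_tcls keys_ext keys_add_subset)
qed

lemma tensor_ext_eq:
  assumes v: "v \<in> carrier (tensor_group R M ra la)"
    and pure: "\<And>m n. m \<in> carrier M \<Longrightarrow> tcls (f (frag_of (m, n))) = tcls (g (frag_of (m, n)))"
    and f: "f 0 = 0" "\<And>x y. f (x - y) = f x - f y"
    and g: "g 0 = 0" "\<And>x y. g (x - y) = g x - g y"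
    and vx: "v = tcls x" "Poly_Mapping.keys x \<subseteq> S"
  shows "tcls (f x) = tcls (g x)"
  using vx(2)
proof (rule free_Abelian_group_induct)
  fix x y assume "tcls (f x) = tcls (g x)" "tcls (f y) = tcls (g y)"
  then have "(f x - g x) - (f y - g y) \<in> TN" unfolding tcls_eq by (rule TN_diff)
  then show "tcls (f (x - y)) = tcls (g (x - y))"
    unfolding tcls_eq by (simp add: f g algebra_simps)
qed (use pure f g in auto)

lemma pt_add_left:
  assumes "m \<in> carrier M" "m' \<in> carrier M"
  shows "tcls (frag_of (m \<oplus>\<^bsub>M\<^esub> m', n)) = tcls (frag_of (m, n) + frag_of (m', n))"
  unfolding tcls_eq
  by (rule relation_in_TN) (unfold tensor_relations_def diff_diff_eq[symmetric], use assms in blast)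

lemma pt_balanced:
  assumes "m \<in> carrier M" "r \<in> carrier R"
  shows "pt (ra m r) n = pt m (la r n)"
  unfolding tcls_eq
  by (rule relation_in_TN) (unfold tensor_relations_def diff_diff_eq[symmetric], use assms in blast)

lemma lm_add_left:
  assumes "c \<in> carrier M" "d \<in> carrier M" "v \<in> carrier (tensor_group R M ra la)"
  shows "lm (c \<oplus>\<^bsub>M\<^esub> d) v = lm c v \<otimes>\<^bsub>tensor_group R M ra la\<^esub> lm d v"
proof -
  obtain x where x: "Poly_Mapping.keys x \<subseteq> S" "v = tcls x" using assms(3) by (rule tensor_carrierE)
  have "tcls (ext (\<lambda>A. (c \<oplus>\<^bsub>M\<^esub> d) \<otimes>\<^bsub>M\<^esub> A) x) = tcls (ext (\<lambda>A. c \<otimes>\<^bsub>M\<^esub> A) x + ext (\<lambda>A. d \<otimes>\<^bsub>M\<^esub> A) x)"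
    by (rule tensor_ext_eq[OF assms(3) _ _ _ _ _ x(2,1)])
      (use assms in \<open>simp_all add: M.l_distr pt_add_left\<close>)
  then show ?thesis using assms x by (simp add: lm_tcls tensor_mult keys_ext)
qed

lemma lm_mult:
  assumes "c \<in> carrier M" "d \<in> carrier M" "v \<in> carrier (tensor_group R M ra la)"
  shows "lm (c \<otimes>\<^bsub>M\<^esub> d) v = lm c (lm d v)"
proof -
  obtain x where x: "Poly_Mapping.keys x \<subseteq> S" "v = tcls x" using assms(3) by (rule tensor_carrierE)
  have "tcls (ext (\<lambda>A. (c \<otimes>\<^bsub>M\<^esub> d) \<otimes>\<^bsub>M\<^esub> A) x) = tcls (ext (\<lambda>A. c \<otimes>\<^bsub>M\<^esub> A) (ext (\<lambda>A. d \<otimes>\<^bsub>M\<^esub> A) x))"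
    by (rule tensor_ext_eq[OF assms(3) _ _ _ _ _ x(2,1)])
      (use assms in \<open>simp_all add: M.m_assoc\<close>)
  then show ?thesis using assms x by (simp add: lm_tcls keys_ext)
qed

lemma tensor_group_comm_group: "comm_group (tensor_group R M ra la)"
  unfolding tensor_group_def by (rule T.abelian_FactGroup[OF TN_subgroup])

lemma tensor_universal:
  fixes \<beta> :: "'m \<Rightarrow> 'n \<Rightarrow> 'z::ab_group_add"
  assumes \<beta>_add_left: "\<And>m m' n. m \<in> carrier M \<Longrightarrow> m' \<in> carrier M \<Longrightarrow> \<beta> (m \<oplus>\<^bsub>M\<^esub> m') n = \<beta> m n + \<beta> m' n"
    and \<beta>_add_right: "\<And>m n n'. m \<in> carrier M \<Longrightarrow> \<beta> m (n + n') = \<beta> m n + \<beta> m n'"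
    and \<beta>_balanced: "\<And>m r n. m \<in> carrier M \<Longrightarrow> r \<in> carrier R \<Longrightarrow> \<beta> (ra m r) n = \<beta> m (la r n)"
  obtains \<Theta> where
    "\<And>v w. v \<in> carrier (tensor_group R M ra la) \<Longrightarrow> w \<in> carrier (tensor_group R M ra la) \<Longrightarrow>
       \<Theta> (v \<otimes>\<^bsub>tensor_group R M ra la\<^esub> w) = \<Theta> v + \<Theta> w"
    "\<And>m n. m \<in> carrier M \<Longrightarrow> \<Theta> (pt m n) = \<beta> m n"
proof -
  \<comment> \<open>The type \<open>'z\<close> repackaged as a group record, the form in which the
    universal property of free abelian groups is stated.\<close>
  define G where "G = \<lparr>carrier = (UNIV :: 'z set), monoid.mult = (+), one = (0 :: 'z)\<rparr>"
  interpret G: comm_group G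
  proof (rule comm_groupI)
    fix x assume "x \<in> carrier G"
    show "\<exists>y\<in>carrier G. y \<otimes>\<^bsub>G\<^esub> x = \<one>\<^bsub>G\<^esub>"
      by (intro bexI[of _ "- x"]) (simp_all add: G_def)
  qed (simp_all add: G_def add_ac)
  obtain h where h: "h \<in> hom (free_Abelian_group S) G" "\<And>p. p \<in> S \<Longrightarrow> h (frag_of p) = case_prod \<beta> p"
    using G.free_Abelian_group_universal[of "case_prod \<beta>" S] by (auto simp: G_def)
  have add: "h (x + y) = h x + h y" if "Poly_Mapping.keys x \<subseteq> S" "Poly_Mapping.keys y \<subseteq> S" for x y
    using hom_mult[OF h(1), of x y] that by (simp add: G_def)
  have zero: "h 0 = 0" using add[of 0 0] by simp
  have neg: "h (- x) = - h x" if "Poly_Mapping.keys x \<subseteq> S" for x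
    using add[of x "- x"] that zero by (simp add: eq_neg_iff_add_eq_0 add.commute)
  have diff: "h (x - y) = h x - h y" if "Poly_Mapping.keys x \<subseteq> S" "Poly_Mapping.keys y \<subseteq> S" for x y
    using add[of x "- y"] neg[of y] that by simp
  have bal: "\<beta> (m \<otimes>\<^bsub>M\<^esub> \<iota> r) n = \<beta> m (la r n)" if "m \<in> carrier M" "r \<in> carrier R" for m r n
    using \<beta>_balanced[OF that] ra_eq[OF that] by simp
  have rel: "h y = 0" if "y \<in> tensor_relations R M ra la" for y
    using that unfolding tensor_relations_def
    by (elim UnE CollectE exE conjE)
      (simp_all add: diff keys_diff_subset h(2) ra_eq \<iota>_closed \<beta>_add_left \<beta>_add_right bal)
  have TN: "h x = 0" if "x \<in> TN" for x
    using that
  proof (induction rule: TN_induct)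
    case (minus x)
    then have "Poly_Mapping.keys x \<subseteq> S" by (rule relation_keys)
    then show ?case using neg rel[OF minus] by simp
  next
    case (add x y)
    then show ?case using \<open>\<And>x y. Poly_Mapping.keys x \<subseteq> S \<Longrightarrow> Poly_Mapping.keys y \<subseteq> S \<Longrightarrow> h (x + y) = h x + h y\<close>[of x y]
      TN_closed by simp
  qed (simp_all add: zero rel)
  \<comment> \<open>The value at a coset is read off at a chosen representative; the choice is
    immaterial because h vanishes on \<open>TN\<close>.\<close>
  define \<Theta> where "\<Theta> v = h (SOME x. Poly_Mapping.keys x \<subseteq> S \<and> tcls x = v)" for v
  have \<Theta>: "\<Theta> (tcls x) = h x" if "Poly_Mapping.keys x \<subseteq> S" for x
  proof -
    define y where "y = (SOME y. Poly_Mapping.keys y \<subseteq> S \<and> tcls y = tcls x)"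
    have y: "Poly_Mapping.keys y \<subseteq> S \<and> tcls y = tcls x"
      unfolding y_def by (rule someI[of _ x]) (use that in simp)
    then have "h (y - x) = 0" using TN by (simp add: tcls_eq)
    then show ?thesis using diff[of y x] y that by (simp add: \<Theta>_def y_def)
  qed
  show thesis
  proof (rule that[of \<Theta>])
    show "\<Theta> (v \<otimes>\<^bsub>tensor_group R M ra la\<^esub> w) = \<Theta> v + \<Theta> w"
      if "v \<in> carrier (tensor_group R M ra la)" "w \<in> carrier (tensor_group R M ra la)" for v w
      using that by (elim tensor_carrierE) (simp add: tensor_mult \<Theta> keys_add_subset add)
    show "\<Theta> (pt m n) = \<beta> m n" if "m \<in> carrier M" for m n
      using that by (simp add: \<Theta> h(2))
  qed
qed

end

section \<open>Affine Lie algebras\<close>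

text \<open>Any lower bounds for the orders may replace the subdegrees. Sums for F, F' and F + F',
  whose subdegrees can differ, are thus compared over one common range.\<close>

lemma fls_bilin_nth_bounds:
  assumes z: "\<And>y. B 0 y = 0" "\<And>x. B x 0 = 0"
    and F: "\<And>i. i < a \<Longrightarrow> F $$ i = 0" and G: "\<And>i. i < b \<Longrightarrow> G $$ i = 0"
  shows "fls_bilin B F G $$ n = (\<Sum>i = a..n - b. B (F $$ i) (G $$ (n - i)))"
proof -
  have "(\<Sum>i = fls_subdegree F..n - fls_subdegree G. B (F $$ i) (G $$ (n - i)))
      = (\<Sum>i \<in> {fls_subdegree F..n - fls_subdegree G} \<inter> {a..n - b}. B (F $$ i) (G $$ (n - i)))"
  proof (rule sum.mono_neutral_right)
    show "\<forall>i\<in>{fls_subdegree F..n - fls_subdegree G} - {fls_subdegree F..n - fls_subdegree G} \<inter> {a..n - b}.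
        B (F $$ i) (G $$ (n - i)) = 0"
    proof
      fix i assume "i \<in> {fls_subdegree F..n - fls_subdegree G} - {fls_subdegree F..n - fls_subdegree G} \<inter> {a..n - b}"
      then have "i < a \<or> n - i < b" by auto
      then show "B (F $$ i) (G $$ (n - i)) = 0" using F[of i] G[of "n - i"] z by auto
    qed
  qed auto
  also have "\<dots> = (\<Sum>i = a..n - b. B (F $$ i) (G $$ (n - i)))"
  proof (rule sum.mono_neutral_left)
    show "\<forall>i\<in>{a..n - b} - {fls_subdegree F..n - fls_subdegree G} \<inter> {a..n - b}. B (F $$ i) (G $$ (n - i)) = 0"
    proof
      fix i assume "i \<in> {a..n - b} - {fls_subdegree F..n - fls_subdegree G} \<inter> {a..n - b}"
      then have "i < fls_subdegree F \<or> n - i < fls_subdegree G" by auto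
      then show "B (F $$ i) (G $$ (n - i)) = 0" using z by auto
    qed
  qed auto
  finally show ?thesis by (simp add: fls_nth_fls_bilin)
qed

text \<open>One notion for the scalar action, the bracket and the form, whose types differ.\<close>

definition biadditive :: "('a::ab_group_add \<Rightarrow> 'b::ab_group_add \<Rightarrow> 'c::ab_group_add) \<Rightarrow> bool" where
  "biadditive B \<longleftrightarrow> (\<forall>x y z. B (x + y) z = B x z + B y z) \<and> (\<forall>x y z. B x (y + z) = B x y + B x z)"

lemma biadditiveD:
  assumes "biadditive B"
  shows "B (x + x') z = B x z + B x' z" "B x (z + z') = B x z + B x z'" "B 0 z = 0" "B x 0 = 0"
proof -
  have *: "B (x + x') z = B x z + B x' z" "B x (z + z') = B x z + B x z'" for x x' z z'
    using assms by (auto simp: biadditive_def)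
  show "B (x + x') z = B x z + B x' z" "B x (z + z') = B x z + B x z'" by (rule *)+
  show "B 0 z = 0" "B x 0 = 0"
    using *(1)[of 0 0 z] *(2)[of x 0 0] by auto
qed

lemma biadditive_fls_bilin:
  fixes B :: "'a::ab_group_add \<Rightarrow> 'b::ab_group_add \<Rightarrow> 'c::ab_group_add"
  assumes B: "biadditive B"
  shows "biadditive (fls_bilin B)"
  unfolding biadditive_def
proof (intro conjI allI)
  fix F F' :: "'a fls" and G :: "'b fls"
  define a where "a = min (fls_subdegree F) (fls_subdegree F')"
  have a: "\<And>i. i < a \<Longrightarrow> F $$ i = 0" "\<And>i. i < a \<Longrightarrow> F' $$ i = 0" by (auto simp: a_def)
  show "fls_bilin B (F + F') G = fls_bilin B F G + fls_bilin B F' G"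
  proof (rule fls_eqI)
    fix n
    have "fls_bilin B H G $$ n = (\<Sum>i = a..n - fls_subdegree G. B (H $$ i) (G $$ (n - i)))" if "H \<in> {F, F', F + F'}" for H
      by (rule fls_bilin_nth_bounds) (use a that biadditiveD[OF B] in auto)
    then show "fls_bilin B (F + F') G $$ n = (fls_bilin B F G + fls_bilin B F' G) $$ n"
      by (simp add: biadditiveD[OF B] sum.distrib)
  qed
next
  fix F :: "'a fls" and G G' :: "'b fls"
  define b where "b = min (fls_subdegree G) (fls_subdegree G')"
  have b: "\<And>i. i < b \<Longrightarrow> G $$ i = 0" "\<And>i. i < b \<Longrightarrow> G' $$ i = 0" by (auto simp: b_def)
  show "fls_bilin B F (G + G') = fls_bilin B F G + fls_bilin B F G'"
  proof (rule fls_eqI)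
    fix n
    have "fls_bilin B F H $$ n = (\<Sum>i = fls_subdegree F..n - b. B (F $$ i) (H $$ (n - i)))" if "H \<in> {G, G', G + G'}" for H
      by (rule fls_bilin_nth_bounds) (use b that biadditiveD[OF B] in auto)
    then show "fls_bilin B F (G + G') $$ n = (fls_bilin B F G + fls_bilin B F G') $$ n"
      by (simp add: biadditiveD[OF B] sum.distrib)
  qed
qed

section \<open>Modes, and additivity of the bracket in each argument\<close>

lemma mode_simps [simp]:
  "fst (mode u n) = Poly_Mapping.single n u" "snd (mode u n) = 0"
  by (simp_all add: mode_def)

lemma central_simps [simp]: "fst central = 0" "snd central = 1"
  by (simp_all add: central_def)

lemma mode_add: "mode (u + v) n = mode u n + mode v n"
  by (simp add: prod_eq_iff single_add)

lemma mode_zero [simp]: "mode 0 n = 0"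
  by (simp add: prod_eq_iff)

lemma affine_expand: "x = (\<Sum>n\<in>Poly_Mapping.keys (fst x). mode (Poly_Mapping.lookup (fst x) n) n) + (0, snd x)"
  using poly_mapping_expand[of "fst x"]
  by (simp add: prod_eq_iff fst_sum snd_sum)

lemma lookup_affine_scale:
  assumes "\<And>c. sc c 0 = 0"
  shows "Poly_Mapping.lookup (fst (affine_scale sc c x)) n
    = (sc c (fst (Poly_Mapping.lookup (fst x) n)), sc c (snd (Poly_Mapping.lookup (fst x) n)))"
  using assms by (auto simp: affine_scale_def map.rep_eq when_def split_beta zero_prod_def)

lemma snd_affine_scale [simp]: "snd (affine_scale sc c x) = c * snd x"
  by (simp add: affine_scale_def)

lemma affine_eqI:
  assumes "\<And>n. fst (Poly_Mapping.lookup (fst x) n) = fst (Poly_Mapping.lookup (fst y) n)"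
    "\<And>n. snd (Poly_Mapping.lookup (fst x) n) = snd (Poly_Mapping.lookup (fst y) n)" "snd x = snd y"
  shows "x = y"
  using assms by (simp add: prod_eq_iff poly_mapping_eq_iff fun_eq_iff)

lemma affine_scale_mode:
  assumes "\<And>c. sc c 0 = 0"
  shows "affine_scale sc c (mode (a, b) n) = mode (sc c a, sc c b) n"
  by (rule affine_eqI) (auto simp: lookup_affine_scale assms lookup_single when_def)

lemma affine_scale_add:
  assumes "biadditive sc"
  shows "affine_scale sc c (x + y) = affine_scale sc c x + affine_scale sc c y"
  by (rule affine_eqI)
    (auto simp: lookup_affine_scale biadditiveD[OF assms] lookup_add fst_add snd_add algebra_simps)

lemma affine_scale_central:
  assumes "\<And>c. sc c 0 = 0"
  shows "affine_scale sc c central = (0, c)"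
  by (rule affine_eqI) (auto simp: lookup_affine_scale assms)

context
  fixes sc :: "'k::field \<Rightarrow> 'a::ab_group_add \<Rightarrow> 'a" and br :: "'a \<Rightarrow> 'a \<Rightarrow> 'a" and form :: "'a \<Rightarrow> 'a \<Rightarrow> 'k"
    and q q' :: "'k poly"
  assumes sc: "biadditive sc" and br: "biadditive br" and form: "biadditive form"
begin

lemma mode_bracket_pair:
  "mode_bracket sc br form q q' (a, a') m (b, b') n =
    mode (br a b, br a b' + br a' b) (m + n)
    + (0, if m + n = 0 then of_int m * form a b else 0)
    + (\<Sum>i\<le>Polynomial.degree q. mode (sc (Polynomial.coeff q i) (br a' b'), 0) (m + n + int i))
    + (0, 1 / 2 * form a' b' * int_coeff q' (- m - n - 1) + form a' b' * of_int m * int_coeff q (- m - n))"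
  by (simp add: mode_bracket_def)

lemma mode_bracket_add_left:
  "mode_bracket sc br form q q' (u1 + u2) m v n = mode_bracket sc br form q q' u1 m v n + mode_bracket sc br form q q' u2 m v n"
proof -
  obtain a1 a1' a2 a2' b b' where uv: "u1 = (a1, a1')" "u2 = (a2, a2')" "v = (b, b')" by (metis prod.exhaust)
  note bi = biadditiveD[OF sc] biadditiveD[OF br] biadditiveD[OF form]
  have t1: "mode (br (a1 + a2) (b), br (a1 + a2) (b') + br (a1' + a2') (b)) (m + n) =
    mode (br (a1) (b), br (a1) (b') + br (a1') (b)) (m + n) +
    (mode (br (a2) (b), br (a2) (b') + br (a2') (b)) (m + n) :: ('k, 'a) affine)"
    by (simp add: bi mode_add[symmetric] algebra_simps)
  have t2: "(0, if m + n = 0 then of_int m * form (a1 + a2) (b) else 0) =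
    (0, if m + n = 0 then of_int m * form (a1) (b) else 0) +
    ((0, if m + n = 0 then of_int m * form (a2) (b) else 0) :: ('k, 'a) affine)"
    by (simp add: bi algebra_simps)
  have t3: "(\<Sum>i\<le>Polynomial.degree q. mode (sc (Polynomial.coeff q i) (br (a1' + a2') (b')), 0) (m + n + int i)) =
    (\<Sum>i\<le>Polynomial.degree q. mode (sc (Polynomial.coeff q i) (br (a1') (b')), 0) (m + n + int i)) +
    ((\<Sum>i\<le>Polynomial.degree q. mode (sc (Polynomial.coeff q i) (br (a2') (b')), 0) (m + n + int i)) :: ('k, 'a) affine)"
    by (simp add: bi mode_add[symmetric] sum.distrib[symmetric])
  have t4: "(0, 1 / 2 * form (a1' + a2') (b') * int_coeff q' (- m - n - 1) + form (a1' + a2') (b') * of_int m * int_coeff q (- m - n)) =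
    (0, 1 / 2 * form (a1') (b') * int_coeff q' (- m - n - 1) + form (a1') (b') * of_int m * int_coeff q (- m - n)) +
    ((0, 1 / 2 * form (a2') (b') * int_coeff q' (- m - n - 1) + form (a2') (b') * of_int m * int_coeff q (- m - n)) :: ('k, 'a) affine)"
    by (simp add: bi algebra_simps add_divide_distrib)
  have uv12: "u1 + u2 = (a1 + a2, a1' + a2')" by (simp add: uv)
  show ?thesis
    unfolding uv12 unfolding uv mode_bracket_pair t1 t2 t3 t4 by (simp only: add_ac)
qed

lemma mode_bracket_add_right:
  "mode_bracket sc br form q q' u m (v1 + v2) n = mode_bracket sc br form q q' u m v1 n + mode_bracket sc br form q q' u m v2 n"
proof -
  obtain a a' b1 b1' b2 b2' where uv: "u = (a, a')" "v1 = (b1, b1')" "v2 = (b2, b2')" by (metis prod.exhaust)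
  note bi = biadditiveD[OF sc] biadditiveD[OF br] biadditiveD[OF form]
  have t1: "mode (br (a) (b1 + b2), br (a) (b1' + b2') + br (a') (b1 + b2)) (m + n) =
    mode (br (a) (b1), br (a) (b1') + br (a') (b1)) (m + n) +
    (mode (br (a) (b2), br (a) (b2') + br (a') (b2)) (m + n) :: ('k, 'a) affine)"
    by (simp add: bi mode_add[symmetric] algebra_simps)
  have t2: "(0, if m + n = 0 then of_int m * form (a) (b1 + b2) else 0) =
    (0, if m + n = 0 then of_int m * form (a) (b1) else 0) +
    ((0, if m + n = 0 then of_int m * form (a) (b2) else 0) :: ('k, 'a) affine)"
    by (simp add: bi algebra_simps)
  have t3: "(\<Sum>i\<le>Polynomial.degree q. mode (sc (Polynomial.coeff q i) (br (a') (b1' + b2')), 0) (m + n + int i)) =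
    (\<Sum>i\<le>Polynomial.degree q. mode (sc (Polynomial.coeff q i) (br (a') (b1')), 0) (m + n + int i)) +
    ((\<Sum>i\<le>Polynomial.degree q. mode (sc (Polynomial.coeff q i) (br (a') (b2')), 0) (m + n + int i)) :: ('k, 'a) affine)"
    by (simp add: bi mode_add[symmetric] sum.distrib[symmetric])
  have t4: "(0, 1 / 2 * form (a') (b1' + b2') * int_coeff q' (- m - n - 1) + form (a') (b1' + b2') * of_int m * int_coeff q (- m - n)) =
    (0, 1 / 2 * form (a') (b1') * int_coeff q' (- m - n - 1) + form (a') (b1') * of_int m * int_coeff q (- m - n)) +
    ((0, 1 / 2 * form (a') (b2') * int_coeff q' (- m - n - 1) + form (a') (b2') * of_int m * int_coeff q (- m - n)) :: ('k, 'a) affine)"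
    by (simp add: bi algebra_simps add_divide_distrib)
  have uv12: "v1 + v2 = (b1 + b2, b1' + b2')" by (simp add: uv)
  show ?thesis
    unfolding uv12 unfolding uv mode_bracket_pair t1 t2 t3 t4 by (simp only: add_ac)
qed

lemma mode_bracket_zero [simp]:
  "mode_bracket sc br form q q' 0 m v n = 0" "mode_bracket sc br form q q' u m 0 n = 0"
  using mode_bracket_add_left[of 0 0 m v n] mode_bracket_add_right[of u m 0 0 n] by simp_all

lemma affine_bracket_superset:
  assumes "finite A" "Poly_Mapping.keys (fst x) \<subseteq> A" "finite B" "Poly_Mapping.keys (fst y) \<subseteq> B"
  shows "affine_bracket sc br form q q' x y = (\<Sum>m\<in>A. \<Sum>n\<in>B.
    mode_bracket sc br form q q' (Poly_Mapping.lookup (fst x) m) m (Poly_Mapping.lookup (fst y) n) n)"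
proof -
  have "(\<Sum>n\<in>Poly_Mapping.keys (fst y). mode_bracket sc br form q q' u m (Poly_Mapping.lookup (fst y) n) n)
      = (\<Sum>n\<in>B. mode_bracket sc br form q q' u m (Poly_Mapping.lookup (fst y) n) n)" for u m
    by (rule sum.mono_neutral_left) (use assms in \<open>auto simp: in_keys_iff\<close>)
  then have "affine_bracket sc br form q q' x y = (\<Sum>m\<in>Poly_Mapping.keys (fst x). \<Sum>n\<in>B.
    mode_bracket sc br form q q' (Poly_Mapping.lookup (fst x) m) m (Poly_Mapping.lookup (fst y) n) n)"
    by (simp add: affine_bracket_def)
  also have "\<dots> = (\<Sum>m\<in>A. \<Sum>n\<in>B.
    mode_bracket sc br form q q' (Poly_Mapping.lookup (fst x) m) m (Poly_Mapping.lookup (fst y) n) n)"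
    by (rule sum.mono_neutral_left) (use assms in \<open>auto simp: in_keys_iff\<close>)
  finally show ?thesis .
qed

lemma affine_bracket_add_left:
  "affine_bracket sc br form q q' (x + x') y = affine_bracket sc br form q q' x y + affine_bracket sc br form q q' x' y"
proof -
  define A where "A = Poly_Mapping.keys (fst x) \<union> Poly_Mapping.keys (fst x') \<union> Poly_Mapping.keys (fst (x + x'))"
  have "affine_bracket sc br form q q' z y = (\<Sum>m\<in>A. \<Sum>n\<in>Poly_Mapping.keys (fst y).
    mode_bracket sc br form q q' (Poly_Mapping.lookup (fst z) m) m (Poly_Mapping.lookup (fst y) n) n)" if "z \<in> {x, x', x + x'}" for z
    by (rule affine_bracket_superset) (use that in \<open>auto simp: A_def\<close>)
  then show ?thesis
    by (simp add: lookup_add mode_bracket_add_left sum.distrib)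
qed

lemma affine_bracket_add_right:
  "affine_bracket sc br form q q' x (y + y') = affine_bracket sc br form q q' x y + affine_bracket sc br form q q' x y'"
proof -
  define A where "A = Poly_Mapping.keys (fst y) \<union> Poly_Mapping.keys (fst y') \<union> Poly_Mapping.keys (fst (y + y'))"
  have "affine_bracket sc br form q q' x z = (\<Sum>m\<in>Poly_Mapping.keys (fst x). \<Sum>n\<in>A.
    mode_bracket sc br form q q' (Poly_Mapping.lookup (fst x) m) m (Poly_Mapping.lookup (fst z) n) n)" if "z \<in> {y, y', y + y'}" for z
    by (rule affine_bracket_superset) (use that in \<open>auto simp: A_def\<close>)
  then show ?thesis
    by (simp add: lookup_add mode_bracket_add_right sum.distrib)
qed

lemma affine_bracket_mode:
  "affine_bracket sc br form q q' (mode u m) (mode v n) = mode_bracket sc br form q q' u m v n"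
  using affine_bracket_superset[of "{m}" "mode u m" "{n}" "mode v n"] by simp

end

section \<open>Elements f(z) a and the generators of the algebra over \<complex>((z))\<close>

context quadratic_lie_algebra
begin

lemma br_add: "br a (b + c) = br a b + br a c" "br (a + b) c = br a c + br b c"
  using br_linear_right[of a] br_linear_left[of c] by (simp_all add: Vector_Spaces.linear_iff)

lemma br_scale: "br a (sc k b) = sc k (br a b)" "br (sc k a) b = sc k (br a b)"
  using br_linear_right[of a] br_linear_left[of b] by (simp_all add: Vector_Spaces.linear_iff)

lemma form_add: "form a (b + c) = form a b + form a c" "form (a + b) c = form a c + form b c"
  using form_linear[of a] form_linear[of c] by (simp_all add: Vector_Spaces.linear_iff form_sym[of _ c])

lemma form_scale: "form a (sc k b) = k * form a b" "form (sc k a) b = k * form a b"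
  using form_linear[of a] form_linear[of b] by (simp_all add: Vector_Spaces.linear_iff form_sym[of _ b])

lemma biadditive_sc: "biadditive sc" and biadditive_br: "biadditive br" and biadditive_form: "biadditive form"
  by (simp_all add: biadditive_def scale_left_distrib scale_right_distrib br_add form_add)

lemmas biadditive_fls = biadditive_fls_bilin[OF biadditive_sc] biadditive_fls_bilin[OF biadditive_br]
  biadditive_fls_bilin[OF biadditive_form]

abbreviation "fsc \<equiv> fls_bilin sc"

definition stens :: "complex fls \<Rightarrow> 'g \<Rightarrow> 'g fls" where
  "stens f a = fsc f (fls_const a)"

lemma stens_nth: "stens f a $$ n = sc (f $$ n) a"
proof -
  have "stens f a $$ n = (\<Sum>i = fls_subdegree f..n - 0. sc (f $$ i) (fls_const a $$ (n - i)))"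
    unfolding stens_def by (rule fls_bilin_nth_bounds) auto
  also have "\<dots> = (\<Sum>i = fls_subdegree f..n. if i = n then sc (f $$ n) a else 0)"
    by (rule sum.cong) auto
  also have "\<dots> = sc (f $$ n) a"
    by (cases "fls_subdegree f \<le> n") auto
  finally show ?thesis .
qed

lemma stens_below: "i < fls_subdegree f \<Longrightarrow> stens f a $$ i = 0"
  by (simp add: stens_nth)

lemma stens_zero [simp]: "stens f 0 = 0" "stens 0 a = 0"
  by (rule fls_eqI, simp add: stens_nth)+

lemma stens_one: "stens 1 a = fls_const a"
  by (rule fls_eqI) (simp add: stens_nth)

lemma stens_add: "stens f (a + b) = stens f a + stens f b" "stens (f + g) a = stens f a + stens g a"
  by (rule fls_eqI, simp add: stens_nth scale_left_distrib scale_right_distrib)+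

lemma fsc_stens: "fsc g (stens f a) = stens (g * f) a"
proof (rule fls_eqI)
  fix n
  have "fsc g (stens f a) $$ n = (\<Sum>i = fls_subdegree g..n - fls_subdegree f. sc (g $$ i) (stens f a $$ (n - i)))"
    by (rule fls_bilin_nth_bounds) (auto simp: stens_below)
  also have "\<dots> = sc ((g * f) $$ n) a"
    by (simp add: stens_nth fls_times_nth(2) scale_sum_left)
  finally show "fsc g (stens f a) $$ n = stens (g * f) a $$ n" by (simp add: stens_nth)
qed

lemma fbr_stens: "fls_bilin br (stens f a) (stens g b) = stens (f * g) (br a b)"
proof (rule fls_eqI)
  fix n
  have "fls_bilin br (stens f a) (stens g b) $$ n
      = (\<Sum>i = fls_subdegree f..n - fls_subdegree g. br (stens f a $$ i) (stens g b $$ (n - i)))"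
    by (rule fls_bilin_nth_bounds) (auto simp: stens_below biadditiveD[OF biadditive_br])
  also have "\<dots> = sc ((f * g) $$ n) (br a b)"
    by (simp add: stens_nth fls_times_nth(2) scale_sum_left br_scale mult.commute)
  finally show "fls_bilin br (stens f a) (stens g b) $$ n = stens (f * g) (br a b) $$ n" by (simp add: stens_nth)
qed

lemma fform_stens: "fls_bilin form (stens f a) (stens g b) = f * g * fls_const (form a b)"
proof (rule fls_eqI)
  fix n
  have "fls_bilin form (stens f a) (stens g b) $$ n
      = (\<Sum>i = fls_subdegree f..n - fls_subdegree g. form (stens f a $$ i) (stens g b $$ (n - i)))"
    by (rule fls_bilin_nth_bounds) (auto simp: stens_below biadditiveD[OF biadditive_form])
  also have "\<dots> = (f * g) $$ n * form a b"
    by (simp add: stens_nth fls_times_nth(2) sum_distrib_left form_scale mult_ac)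
  finally show "fls_bilin form (stens f a) (stens g b) $$ n = (f * g * fls_const (form a b)) $$ n"
    by simp
qed

abbreviation "czt \<equiv> cz_tensor sc"

lemma stens_in_czt: "stens f a \<in> czt"
proof -
  have "stens f a = (\<Sum>i<1::nat. fls_bilin sc f (fls_const a))" by (simp add: stens_def)
  then show ?thesis
    unfolding cz_tensor_def by (intro CollectI exI[of _ 1] exI[of _ "\<lambda>_. f"] exI[of _ "\<lambda>_. a"]) simp
qed

lemma czt_zero: "0 \<in> czt"
  using stens_in_czt[of 0 0] by simp

lemma czt_add_stens:
  assumes "F \<in> czt" shows "F + stens g b \<in> czt"
proof -
  obtain n :: nat and f a where F: "F = (\<Sum>i<n. fls_bilin sc (f i) (fls_const (a i)))"
    using assms unfolding cz_tensor_def by blast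
  have "F + stens g b = (\<Sum>i<Suc n. fls_bilin sc ((f(n := g)) i) (fls_const ((a(n := b)) i)))"
    by (simp add: F stens_def)
  then show ?thesis unfolding cz_tensor_def by blast
qed

lemma czt_induct [consumes 1, case_names zero add]:
  assumes "F \<in> czt" "P 0" "\<And>F f a. F \<in> czt \<Longrightarrow> P F \<Longrightarrow> P (F + stens f a)"
  shows "P F"
proof -
  obtain n :: nat and f a where F: "F = (\<Sum>i<n. stens (f i) (a i))"
    using assms(1) unfolding cz_tensor_def stens_def by blast
  have "(\<Sum>i<n. stens (f i) (a i)) \<in> czt \<and> P (\<Sum>i<n. stens (f i) (a i))" for n
    by (induction n) (auto simp: czt_zero assms(2,3) intro: czt_add_stens)
  then show ?thesis using F by simp
qed

lemma czt_add: "F \<in> czt \<Longrightarrow> G \<in> czt \<Longrightarrow> F + G \<in> czt"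
  by (rotate_tac 1, induction G rule: czt_induct) (auto simp: add.assoc[symmetric] intro: czt_add_stens)

lemma czt_fsc: "F \<in> czt \<Longrightarrow> fsc g F \<in> czt"
  by (induction F rule: czt_induct)
    (auto simp: czt_zero biadditiveD[OF biadditive_fls(1)] fsc_stens intro: czt_add_stens)

abbreviation "gcar \<equiv> gcheck_carrier sc"
abbreviation "bcar \<equiv> bcheck_carrier sc"
abbreviation "gsc \<equiv> affine_scale fsc"

lemma fsc_zero: "fsc c 0 = 0"
  using biadditiveD(4)[OF biadditive_fls(1)] .

lemma gcar_iff: "x \<in> gcar \<longleftrightarrow> (\<forall>n. fst (Poly_Mapping.lookup (fst x) n) \<in> czt \<and> snd (Poly_Mapping.lookup (fst x) n) \<in> czt)"
  by (auto simp: gcheck_carrier_def mem_Times_iff)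

lemma gcar_add: "x \<in> gcar \<Longrightarrow> y \<in> gcar \<Longrightarrow> x + y \<in> gcar"
  by (auto simp: gcar_iff lookup_add intro: czt_add)

lemma gcar_scale: "x \<in> gcar \<Longrightarrow> gsc c x \<in> gcar"
  by (auto simp: gcar_iff lookup_affine_scale fsc_zero intro: czt_fsc)

lemma gcar_mode: "F \<in> czt \<Longrightarrow> G \<in> czt \<Longrightarrow> mode (F, G) n \<in> gcar"
  by (auto simp: gcar_iff lookup_single when_def czt_zero)

lemma gcar_central: "(0, c) \<in> gcar"
  by (simp add: gcar_iff czt_zero)

lemma gcar_sum: "(\<And>i. i \<in> A \<Longrightarrow> f i \<in> gcar) \<Longrightarrow> sum f A \<in> gcar"
proof (induction A rule: infinite_finite_induct)
  case (insert x A)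
  then show ?case by (simp add: gcar_add)
qed (use gcar_central[of 0] in \<open>auto simp: zero_prod_def\<close>)

lemma gcheck_mode_in: "gcheck_mode u n \<in> gcar"
  unfolding gcheck_mode_def by (intro gcar_mode) (simp_all add: stens_one[symmetric] stens_in_czt)

lemma gsc_gcheck_mode: "gsc f (gcheck_mode (a, b) n) = mode (stens f a, stens f b) n"
  by (simp add: gcheck_mode_def affine_scale_mode fsc_zero stens_def)

lemma gsc_central: "gsc c central = (0, c)"
  by (rule affine_scale_central) (rule fsc_zero)

text \<open>Reduces additive statements about x to modes of elements of \<gg> itself, with all
  dependence on z collected in one scalar.\<close>

lemma gcar_induct [consumes 1, case_names mode central add]:
  assumes "x \<in> gcar"
    and Pmode: "\<And>f u n. P (gsc f (gcheck_mode u n))"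
    and Pcentral: "\<And>c. P (gsc c central)"
    and Padd: "\<And>x y. x \<in> gcar \<Longrightarrow> y \<in> gcar \<Longrightarrow> P x \<Longrightarrow> P y \<Longrightarrow> P (x + y)"
  shows "P x"
proof -
  have "gsc 0 (gcheck_mode (0, 0) 0) = 0"
    by (simp only: gsc_gcheck_mode stens_zero) (simp add: zero_prod_def[symmetric])
  then have zero: "P 0" using Pmode[of 0 "(0, 0)" 0] by (simp only:)
  have 1: "P (mode (F, 0) n)" if "F \<in> czt" for F n
    using that
  proof (induction F rule: czt_induct)
    case zero
    show ?case using \<open>P 0\<close> by (simp add: zero_prod_def[symmetric])
  next
    case (add F f a)
    have "mode (F + stens f a, 0) n = mode (F, 0) n + gsc f (gcheck_mode (a, 0) n)"
      by (simp add: gsc_gcheck_mode mode_add[symmetric])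
    moreover have "P \<dots>"
      by (intro Padd gcar_mode gcar_scale gcheck_mode_in Pmode czt_zero add)
    ultimately show ?case by simp
  qed
  have 2: "P (mode (0, F) n)" if "F \<in> czt" for F n
    using that
  proof (induction F rule: czt_induct)
    case zero
    show ?case using \<open>P 0\<close> by (simp add: zero_prod_def[symmetric])
  next
    case (add F f a)
    have "mode (0, F + stens f a) n = mode (0, F) n + gsc f (gcheck_mode (0, a) n)"
      by (simp add: gsc_gcheck_mode mode_add[symmetric])
    moreover have "P \<dots>"
      by (intro Padd gcar_mode gcar_scale gcheck_mode_in Pmode czt_zero add)
    ultimately show ?case by simp
  qed
  have 3: "P (mode u n)" if "fst u \<in> czt" "snd u \<in> czt" for u n
  proof -
    have "mode u n = mode (fst u, 0) n + mode (0, snd u) n" by (simp add: mode_add[symmetric])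
    then show ?thesis by (rule ssubst) (intro Padd gcar_mode 1 2 that czt_zero)
  qed
  have "P (\<Sum>n\<in>A. mode (Poly_Mapping.lookup (fst x) n) n) \<and> (\<Sum>n\<in>A. mode (Poly_Mapping.lookup (fst x) n) n) \<in> gcar" for A
  proof (induction A rule: infinite_finite_induct)
    case (insert n A)
    have n: "fst (Poly_Mapping.lookup (fst x) n) \<in> czt" "snd (Poly_Mapping.lookup (fst x) n) \<in> czt"
      using assms(1) by (auto simp: gcar_iff)
    then have "mode (Poly_Mapping.lookup (fst x) n) n \<in> gcar"
      using gcar_mode[of "fst (Poly_Mapping.lookup (fst x) n)" "snd (Poly_Mapping.lookup (fst x) n)" n] by simp
    then show ?case using insert Padd 3[OF n] gcar_add by simp
  qed (use zero gcar_central[of 0] in \<open>auto simp: zero_prod_def\<close>)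
  moreover have "P (0, snd x)" using Pcentral[of "snd x"] by (simp add: gsc_central)
  ultimately have "P ((\<Sum>n\<in>Poly_Mapping.keys (fst x). mode (Poly_Mapping.lookup (fst x) n) n) + (0, snd x))"
    using Padd gcar_central by blast
  then show ?thesis using affine_expand[of x] by simp
qed

end

lemma lookup_mode_bracket_neg:
  assumes "m \<ge> 0" "n \<ge> 0" "k < 0"
  shows "Poly_Mapping.lookup (fst (mode_bracket sc br form q q' u m v n)) k = 0"
proof -
  obtain a a' b b' where "u = (a, a')" "v = (b, b')" by (metis prod.exhaust)
  then show ?thesis using assms
    by (simp add: mode_bracket_def fst_sum lookup_add lookup_sum lookup_single when_def)
qed

text \<open>Each central term carries the factor m = 0 or a polynomial coefficient of negative
  index. Since scalars commute, brackets have to act as zero in a representation by scalars; this is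
  what makes \<open>level_act\<close> one.\<close>

lemma snd_mode_bracket_nonneg:
  assumes "m \<ge> 0" "n \<ge> 0"
  shows "snd (mode_bracket sc br form q q' u m v n) = 0"
proof -
  obtain a a' b b' where uv: "u = (a, a')" "v = (b, b')" by (metis prod.exhaust)
  have "m = 0 \<or> - m - n < 0" using assms by auto
  then have "of_int m * int_coeff q (- m - n) = 0" by (auto simp: int_coeff_def)
  moreover have "int_coeff q' (- m - n - 1) = 0" using assms by (simp add: int_coeff_def)
  moreover have "(if m + n = 0 then of_int m * form a b else 0) = 0" using assms by (cases "m = 0") auto
  ultimately show ?thesis
    by (simp add: uv mode_bracket_def snd_sum mult.assoc)
qed

section \<open>The algebra with p(z + x) in its bracket and its subalgebra of nonnegative
  modes\<close>

locale gcheck = quadratic_lie_algebra sc br form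
  for sc :: "complex \<Rightarrow> 'g::ab_group_add \<Rightarrow> 'g" and br form +
  fixes p :: "complex poly" and l :: complex
begin

abbreviation "gbr \<equiv> gcheck_bracket sc br form p"

definition klev :: "'g \<times> 'g \<Rightarrow> int \<Rightarrow> 'g \<times> 'g \<Rightarrow> int \<Rightarrow> complex fls" where
  "klev u m v n = fls_const (if m + n = 0 then of_int m * form (fst u) (fst v) else 0)
    + (fls_const (1 / 2 * form (snd u) (snd v)) * int_coeff (shift_poly (pderiv p)) (- m - n - 1)
      + fls_const (form (snd u) (snd v)) * of_int m * int_coeff (shift_poly p) (- m - n))"

text \<open>Writing b^1 as e b with e^2 = p, \<open>br0\<close> is the part of the bracket free of p
  and \<open>br1\<close> the part multiplied by p.\<close>

abbreviation br0 :: "'g \<times> 'g \<Rightarrow> 'g \<times> 'g \<Rightarrow> 'g \<times> 'g" where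
  "br0 u v \<equiv> (br (fst u) (fst v), br (fst u) (snd v) + br (snd u) (fst v))"

abbreviation br1 :: "'g \<times> 'g \<Rightarrow> 'g \<times> 'g \<Rightarrow> 'g \<times> 'g" where
  "br1 u v \<equiv> (br (snd u) (snd v), 0)"

lemma gbr_add: "gbr (x + y) z = gbr x z + gbr y z" "gbr x (y + z) = gbr x y + gbr x z"
  by (rule affine_bracket_add_left[OF biadditive_fls] affine_bracket_add_right[OF biadditive_fls])+

lemma gbr_central: "gbr (gsc c central) y = 0" "gbr x (gsc c central) = 0"
  by (simp_all add: gsc_central affine_bracket_def)

lemma fls_const_eq_half: "1 / 2 * (fls_const c) = (fls_const (1 / 2 * c) :: complex fls)"
proof -
  have "(1 / 2 :: complex fls) = fls_const (1 / 2)"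
    by (metis (no_types, lifting) fls_const_divide_const fls_const_1 fls_const_numeral)
  then show ?thesis by (simp only: fls_const_mult_const)
qed

lemma gbr_modes:
  "gbr (gsc f (gcheck_mode u m)) (gsc g (gcheck_mode v n)) =
    gsc (f * g) (gcheck_mode (br0 u v) (m + n))
    + (\<Sum>i\<le>Polynomial.degree (shift_poly p).
        gsc (f * g * Polynomial.coeff (shift_poly p) i) (gcheck_mode (br1 u v) (m + n + int i)))
    + gsc (f * g * klev u m v n) central"
proof -
  obtain a a' b b' where uv: "u = (a, a')" "v = (b, b')" by (metis prod.exhaust)
  have "gbr (gsc f (gcheck_mode u m)) (gsc g (gcheck_mode v n)) =
    mode (stens (f * g) (br a b), stens (f * g) (br a b') + stens (f * g) (br a' b)) (m + n)
    + (0, if m + n = 0 then of_int m * (f * g * fls_const (form a b)) else 0)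
    + (\<Sum>i\<le>Polynomial.degree (shift_poly p).
         mode (stens (Polynomial.coeff (shift_poly p) i * (f * g)) (br a' b'), 0) (m + n + int i))
    + (0, 1 / 2 * (f * g * fls_const (form a' b')) * int_coeff (shift_poly (pderiv p)) (- m - n - 1)
        + f * g * fls_const (form a' b') * of_int m * int_coeff (shift_poly p) (- m - n))"
    by (simp only: uv gsc_gcheck_mode affine_bracket_mode[OF biadditive_fls]
        mode_bracket_pair[OF biadditive_fls] fbr_stens fform_stens fsc_stens)
  also have "\<dots> = gsc (f * g) (gcheck_mode (br0 u v) (m + n))
    + (\<Sum>i\<le>Polynomial.degree (shift_poly p).
        gsc (f * g * Polynomial.coeff (shift_poly p) i) (gcheck_mode (br1 u v) (m + n + int i)))
    + ((0, if m + n = 0 then of_int m * (f * g * fls_const (form a b)) else 0)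
      + (0, 1 / 2 * (f * g * fls_const (form a' b')) * int_coeff (shift_poly (pderiv p)) (- m - n - 1)
        + f * g * fls_const (form a' b') * of_int m * int_coeff (shift_poly p) (- m - n)))"
    by (simp only: uv gsc_gcheck_mode stens_add fst_conv snd_conv stens_zero mult.commute[of _ "f * g"] add_ac)
  also have "((0, if m + n = 0 then of_int m * (f * g * fls_const (form a b)) else 0)
      + (0, 1 / 2 * (f * g * fls_const (form a' b')) * int_coeff (shift_poly (pderiv p)) (- m - n - 1)
        + f * g * fls_const (form a' b') * of_int m * int_coeff (shift_poly p) (- m - n)))
      = gsc (f * g * klev u m v n) central"
  proof -
    have e: "1 / 2 * (f * g * fls_const (form a' b')) = f * g * fls_const (1 / 2 * form a' b')"
      unfolding fls_const_eq_half[symmetric] by (simp only: mult_ac)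
    have "(if m + n = 0 then of_int m * (f * g * fls_const (form a b)) else 0)
        = f * g * fls_const (if m + n = 0 then of_int m * form a b else 0)"
      by (simp add: fls_of_int fls_const_mult_const[symmetric] mult_ac del: fls_const_mult_const)
    then show ?thesis
      unfolding e by (simp only: gsc_central klev_def uv fst_conv snd_conv add_Pair add_0 distrib_left mult.assoc)
  qed
  finally show ?thesis .
qed

lemma gsc_one_mode: "gsc 1 (gcheck_mode u n) = gcheck_mode u n"
  by (cases u) (simp only: gsc_gcheck_mode stens_one, simp add: gcheck_mode_def)

lemma gbr_modes':
  "gbr (gcheck_mode u m) (gcheck_mode v n) =
    gcheck_mode (br0 u v) (m + n)
    + (\<Sum>i\<le>Polynomial.degree (shift_poly p).
        gsc (Polynomial.coeff (shift_poly p) i) (gcheck_mode (br1 u v) (m + n + int i)))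
    + gsc (klev u m v n) central"
  using gbr_modes[of 1 u m 1 v n] by (simp add: gsc_one_mode)

lemma gbr_closed:
  assumes "x \<in> gcar" "y \<in> gcar"
  shows "gbr x y \<in> gcar"
  using assms
proof (induction x rule: gcar_induct)
  case (mode f u m)
  show ?case using mode
  proof (induction y rule: gcar_induct)
    case (mode g v n)
    show ?case unfolding gbr_modes
      by (intro gcar_add gcar_sum gcar_scale gcheck_mode_in) (simp add: gcar_central central_def)
  qed (simp_all add: gbr_add gbr_central gcar_add gcar_central[of 0, folded zero_prod_def])
qed (simp_all add: gbr_add gbr_central gcar_add gcar_central[of 0, folded zero_prod_def])

lemma lie_data_gcar: "lie_data gcar gsc gbr"
  by unfold_locales (simp_all add: gcar_add gcar_scale gbr_closed)

lemma bcar_subset: "bcar \<subseteq> gcar"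
  by (auto simp: bcheck_carrier_def)

lemma lookup_sum': "Poly_Mapping.lookup (fst (sum f A)) k = (\<Sum>i\<in>A. Poly_Mapping.lookup (fst (f i)) k)"
  by (simp add: fst_sum lookup_sum)

lemma bcar_keys: "x \<in> bcar \<Longrightarrow> m \<in> Poly_Mapping.keys (fst x) \<Longrightarrow> m \<ge> 0"
  by (force simp: bcheck_carrier_def in_keys_iff not_less[symmetric])

lemma bcar_bracket:
  assumes "x \<in> bcar" "y \<in> bcar"
  shows "gbr x y \<in> bcar" "snd (gbr x y) = 0"
proof -
  have "Poly_Mapping.lookup (fst (gbr x y)) k = 0" if "k < 0" for k
    unfolding affine_bracket_def lookup_sum'
    by (intro sum.neutral ballI) (simp add: lookup_mode_bracket_neg that bcar_keys[OF assms(1)] bcar_keys[OF assms(2)])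
  then show "gbr x y \<in> bcar"
    using gbr_closed[of x y] assms by (auto simp: bcheck_carrier_def)
  show "snd (gbr x y) = 0"
    unfolding affine_bracket_def snd_sum
    by (intro sum.neutral ballI) (simp add: snd_mode_bracket_nonneg bcar_keys[OF assms(1)] bcar_keys[OF assms(2)])
qed

lemma bcar_add: "x \<in> bcar \<Longrightarrow> y \<in> bcar \<Longrightarrow> x + y \<in> bcar"
  using gcar_add[of x y] by (auto simp: bcheck_carrier_def lookup_add)

lemma bcar_scale: "x \<in> bcar \<Longrightarrow> gsc c x \<in> bcar"
  using gcar_scale[of x c] by (auto simp: bcheck_carrier_def lookup_affine_scale fsc_zero zero_prod_def)

lemma gcheck_mode_in_bcar: "n \<ge> 0 \<Longrightarrow> gcheck_mode u n \<in> bcar"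
  using gcheck_mode_in[of u n] by (auto simp: bcheck_carrier_def gcheck_mode_def lookup_single when_def)

lemma central_in_bcar: "central \<in> bcar"
  using gcar_central[of 1] by (auto simp: bcheck_carrier_def central_def)

lemma lie_rep_bcar: "lie_rep bcar gsc gbr UNIV (*) (level_act l)"
  by unfold_locales (auto simp: bcar_add bcar_scale bcar_bracket level_act_def algebra_simps)

end

section \<open>The vacuum module\<close>

context lie_rep
begin

lemma M_uminus: "a \<in> M \<Longrightarrow> - a \<in> M"
proof -
  assume a: "a \<in> M"
  have "a + sM (- 1) a = 0" using sM_add_left[OF a, of 1 "- 1"] a by (simp add: sM_one sM_zero_left)
  then have "- a = sM (- 1) a" by (rule minus_unique)
  then show ?thesis using M_scale[OF a] by simp
qed

lemma M_diff: "a \<in> M \<Longrightarrow> b \<in> M \<Longrightarrow> a - b \<in> M"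
  using M_add[of a "- b"] M_uminus[of b] by simp

lemma uea_act_diff:
  assumes "A \<in> carrier (uea L scL brL)" "a \<in> M" "b \<in> M"
  shows "uea_act sM \<sigma> A (a - b) = uea_act sM \<sigma> A a - uea_act sM \<sigma> A b"
  using uea_act_add_right[OF assms(1) M_diff[OF assms(2,3)] assms(3)] by (simp add: algebra_simps)

end

section \<open>The induced module as a tensor product, and its universal property\<close>

context gcheck
begin

abbreviation "UG \<equiv> U_gcheck sc br form p"
abbreviation "UB \<equiv> U_bcheck sc br form p"
abbreviation "V \<equiv> Vcheck sc br form p l"
abbreviation "act \<equiv> Vcheck_act sc br form p l"
abbreviation "vac \<equiv> Vcheck_vac sc br form p l"
abbreviation "emb \<equiv> Vcheck_embed sc br form p l"
abbreviation "cls \<equiv> uea_class gcar gsc gbr"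
abbreviation "bcls \<equiv> uea_class bcar gsc gbr"
abbreviation "\<iota> \<equiv> uea_inclusion gcar gsc gbr"

interpretation gL: lie_data gcar gsc gbr
  by (rule lie_data_gcar)

interpretation bR: lie_rep bcar gsc gbr UNIV "(*)" "level_act l"
  by (rule lie_rep_bcar)

lemma UG_eq: "UG = uea gcar gsc gbr" and UB_eq: "UB = uea bcar gsc gbr"
  by (simp_all add: U_gcheck_def U_bcheck_def)

lemma bcar_free: "f \<in> carrier (free_algebra bcar) \<Longrightarrow> f \<in> carrier (free_algebra gcar)"
  using bcar_subset by auto

lemma incl_class: "f \<in> carrier (free_algebra bcar) \<Longrightarrow> \<iota> (bcls f) = cls f"
  by (rule uea_inclusion_class[OF bR.lie_data_axioms gL.lie_data_axioms bcar_subset])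

lemma right_tensor_Vcheck: "right_tensor UB UG (U_right_act sc br form p) \<iota>"
proof (rule right_tensor.intro)
  show "ring UG" unfolding UG_eq by (rule gL.U.ring_axioms)
  show "right_tensor_axioms UB UG (U_right_act sc br form p) \<iota>"
  proof
    fix r assume "r \<in> carrier UB"
    then obtain f where f: "f \<in> carrier (free_algebra bcar)" "r = bcls f"
      unfolding UB_eq by (rule bR.uea_carrierE)
    then show "\<iota> r \<in> carrier UG"
      unfolding UG_eq using gL.class_closed[OF bcar_free] incl_class by simp
  qed (simp add: U_right_act_def)
qed

interpretation tp: right_tensor UB UG "U_right_act sc br form p" "U_level_act l" \<iota>
  by (rule right_tensor_Vcheck)

lemma V_simps [simp]:
  "carrier V = carrier (tensor_group UB UG (U_right_act sc br form p) (U_level_act l))"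
  "v \<oplus>\<^bsub>V\<^esub> w = v \<otimes>\<^bsub>tensor_group UB UG (U_right_act sc br form p) (U_level_act l)\<^esub> w"
  "f \<odot>\<^bsub>V\<^esub> v = tp.lm (cls (Poly_Mapping.single [] f)) v"
  "\<zero>\<^bsub>V\<^esub> = tp.tcls 0"
  by (simp_all add: Vcheck_def U_gcheck_class_def tp.tensor_one)

lemma act_eq: "act x = tp.lm (cls (Poly_Mapping.single [x] 1))"
  by (simp add: Vcheck_act_def U_gcheck_class_def)

lemma vac_eq: "vac = tp.pt \<one>\<^bsub>UG\<^esub> 1"
  by (simp add: Vcheck_vac_def pure_tensor_def tp.tcls_def)

lemma one_UG: "\<one>\<^bsub>UG\<^esub> = cls (Poly_Mapping.single [] 1)"
  unfolding UG_eq single_Nil by (rule gL.class_one)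

lemma cls_single_closed: "set w \<subseteq> gcar \<Longrightarrow> cls (Poly_Mapping.single w c) \<in> carrier UG"
  unfolding UG_eq by (rule gL.class_closed[OF single_in_free_algebra])

lemma cls_single_mult:
  assumes "set v \<subseteq> gcar" "set w \<subseteq> gcar"
  shows "cls (Poly_Mapping.single v c) \<otimes>\<^bsub>UG\<^esub> cls (Poly_Mapping.single w d) = cls (Poly_Mapping.single (v @ w) (c * d))"
  unfolding UG_eq gL.class_mult[OF single_in_free_algebra[OF assms(1)] single_in_free_algebra[OF assms(2)]]
  by (simp add: mult_single plus_list_def)

lemma cls_add:
  assumes "f \<in> carrier (free_algebra gcar)" "g \<in> carrier (free_algebra gcar)"
  shows "cls f \<oplus>\<^bsub>UG\<^esub> cls g = cls (f + g)"
  unfolding UG_eq by (rule gL.class_add[OF assms])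

lemma lm_single_mult:
  assumes "set v \<subseteq> gcar" "set w \<subseteq> gcar" "x \<in> carrier V"
  shows "tp.lm (cls (Poly_Mapping.single v c)) (tp.lm (cls (Poly_Mapping.single w d)) x)
    = tp.lm (cls (Poly_Mapping.single (v @ w) (c * d))) x"
  using tp.lm_mult[OF cls_single_closed[OF assms(1)] cls_single_closed[OF assms(2)]] assms
  by (simp add: cls_single_mult)

lemma V_add_closed: "v \<in> carrier V \<Longrightarrow> w \<in> carrier V \<Longrightarrow> v \<oplus>\<^bsub>V\<^esub> w \<in> carrier V"
  using comm_group.axioms(1)[OF tp.tensor_group_comm_group] monoid.m_closed[OF comm_monoid.axioms(1)] by simp

lemma smult_closed: "v \<in> carrier V \<Longrightarrow> f \<odot>\<^bsub>V\<^esub> v \<in> carrier V"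
  using tp.lm_closed[OF cls_single_closed[of "[]"]] by simp

lemma act_closed: "x \<in> gcar \<Longrightarrow> v \<in> carrier V \<Longrightarrow> act x v \<in> carrier V"
  unfolding act_eq using tp.lm_closed[OF cls_single_closed[of "[x]"]] by simp

lemma act_add_right: "x \<in> gcar \<Longrightarrow> v \<in> carrier V \<Longrightarrow> w \<in> carrier V \<Longrightarrow> act x (v \<oplus>\<^bsub>V\<^esub> w) = act x v \<oplus>\<^bsub>V\<^esub> act x w"
  unfolding act_eq using tp.lm_add_right[OF cls_single_closed[of "[x]"]] by simp

lemma act_smult: "x \<in> gcar \<Longrightarrow> v \<in> carrier V \<Longrightarrow> act x (f \<odot>\<^bsub>V\<^esub> v) = f \<odot>\<^bsub>V\<^esub> act x v"
  unfolding act_eq by (simp add: lm_single_mult[simplified])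

lemma act_add_left:
  assumes "x \<in> gcar" "y \<in> gcar" "v \<in> carrier V"
  shows "act (x + y) v = act x v \<oplus>\<^bsub>V\<^esub> act y v"
proof -
  have "cls (Poly_Mapping.single [x + y] 1) = cls (Poly_Mapping.single [x] 1) \<oplus>\<^bsub>UG\<^esub> cls (Poly_Mapping.single [y] 1)"
    unfolding gL.class_add_letter[OF assms(1,2)] using assms by (intro cls_add[symmetric]) (simp_all add: single_in_free_algebra del: free_algebra_simps)
  then show ?thesis
    unfolding act_eq using tp.lm_add_left[OF cls_single_closed cls_single_closed, of "[x]" "[y]" v] assms by simp
qed

lemma act_scale_left:
  assumes "x \<in> gcar" "v \<in> carrier V"
  shows "act (gsc f x) v = f \<odot>\<^bsub>V\<^esub> act x v"
  unfolding act_eq using assms by (simp add: gL.class_scale_letter lm_single_mult[simplified])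

lemma act_bracket:
  assumes "x \<in> gcar" "y \<in> gcar" "v \<in> carrier V"
  shows "act x (act y v) = act y (act x v) \<oplus>\<^bsub>V\<^esub> act (gbr x y) v"
proof -
  have z: "gbr x y \<in> gcar" using assms by (simp add: gbr_closed)
  have "cls (Poly_Mapping.single [x, y] 1) = cls (Poly_Mapping.single [y, x] 1) \<oplus>\<^bsub>UG\<^esub> cls (Poly_Mapping.single [gbr x y] 1)"
    unfolding gL.class_bracket_letter[OF assms(1,2)] using assms z by (intro cls_add[symmetric]) (simp_all add: single_in_free_algebra del: free_algebra_simps)
  then show ?thesis
    unfolding act_eq using tp.lm_add_left[OF cls_single_closed cls_single_closed, of "[y, x]" "[gbr x y]" v] assms z
    by (simp add: lm_single_mult[simplified])
qed

lemma vac_closed: "vac \<in> carrier V"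
  by (simp add: vac_eq tp.tensor_carrier)

lemma lm_pt: "A \<in> carrier UG \<Longrightarrow> B \<in> carrier UG \<Longrightarrow> tp.lm A (tp.pt B f) = tp.pt (A \<otimes>\<^bsub>UG\<^esub> B) f"
  by (simp add: tp.lm_tcls)

text \<open>Balancedness carries an element of the enveloping algebra of the subalgebra across the
  tensor sign, where it acts on \<complex>((z)) through the level.\<close>

lemma pt_one_class:
  assumes "f \<in> carrier (free_algebra bcar)"
  shows "tp.pt (cls f) g = tp.pt \<one>\<^bsub>UG\<^esub> (bR.word_act f g)"
proof -
  have b: "bcls f \<in> carrier UB" unfolding UB_eq by (rule bR.class_closed[OF assms])
  have c: "cls f \<in> carrier UG" unfolding UG_eq by (rule gL.class_closed[OF bcar_free[OF assms]])
  have "U_right_act sc br form p \<one>\<^bsub>UG\<^esub> (bcls f) = cls f"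
    using tp.ra_eq[OF tp.M.one_closed b] incl_class[OF assms] c by simp
  moreover have "U_level_act l (bcls f) g = bR.word_act f g"
    by (simp add: U_level_act_def bR.uea_act_class[OF assms])
  ultimately show ?thesis
    using tp.pt_balanced[OF tp.M.one_closed b, of g] by simp
qed

lemma pt_one: "tp.pt \<one>\<^bsub>UG\<^esub> f = f \<odot>\<^bsub>V\<^esub> vac"
proof -
  have "f \<odot>\<^bsub>V\<^esub> vac = tp.pt (cls (Poly_Mapping.single [] f)) 1"
    using cls_single_closed[of "[]" f] by (simp add: vac_eq lm_pt)
  also have "\<dots> = tp.pt \<one>\<^bsub>UG\<^esub> f"
    by (subst pt_one_class) (simp_all add: bR.word_act_single[simplified])
  finally show ?thesis by simp
qed

lemma act_vac:
  assumes "x \<in> bcar"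
  shows "act x vac = (snd x * fls_const l) \<odot>\<^bsub>V\<^esub> vac"
proof -
  have x: "x \<in> gcar" using assms bcar_subset by blast
  have "act x vac = tp.pt (cls (Poly_Mapping.single [x] 1)) 1"
    unfolding act_eq using cls_single_closed[of "[x]"] x by (simp add: vac_eq lm_pt)
  also have "\<dots> = tp.pt \<one>\<^bsub>UG\<^esub> (snd x * fls_const l)"
    using assms by (subst pt_one_class) (simp_all add: single_in_free_algebra bR.word_act_single level_act_def del: free_algebra_simps)
  finally show ?thesis by (simp add: pt_one[simplified])
qed

lemma pt_eq: "A \<in> carrier UG \<Longrightarrow> tp.pt A f = tp.lm A (f \<odot>\<^bsub>V\<^esub> vac)"
  by (simp add: pt_one[symmetric, simplified] lm_pt)

text \<open>The map sends A \<otimes> f to A (f m0). It respects balancing because the subalgebra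
  acts on \<open>m0\<close> by the same scalars as on \<complex>((z)).\<close>

lemma V_universal:
  assumes rep: "lie_rep gcar gsc gbr M sM \<sigma>" and m0: "m0 \<in> M"
    and b: "\<And>x. x \<in> bcar \<Longrightarrow> \<sigma> x m0 = sM (snd x * fls_const l) m0"
  obtains \<Theta> where
    "\<And>v. v \<in> carrier V \<Longrightarrow> \<Theta> v \<in> M"
    "\<And>v w. v \<in> carrier V \<Longrightarrow> w \<in> carrier V \<Longrightarrow> \<Theta> (v \<oplus>\<^bsub>V\<^esub> w) = \<Theta> v + \<Theta> w"
    "\<And>f v. v \<in> carrier V \<Longrightarrow> \<Theta> (f \<odot>\<^bsub>V\<^esub> v) = sM f (\<Theta> v)"
    "\<And>x v. x \<in> gcar \<Longrightarrow> v \<in> carrier V \<Longrightarrow> \<Theta> (act x v) = \<sigma> x (\<Theta> v)"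
    "\<Theta> vac = m0"
proof -
  interpret r: lie_rep gcar gsc gbr M sM \<sigma> by fact
  define \<beta> where "\<beta> A f = uea_act sM \<sigma> A (sM f m0)" for A f
  \<comment> \<open>Letters of the subalgebra act on multiples of \<open>m0\<close> as scalars, one
    after another; \<open>bal\<close> extends this from words to all representatives.\<close>
  have foldr_b: "foldr \<sigma> w (sM f m0) = sM (foldr (level_act l) w f) m0" if "set w \<subseteq> bcar" for w f
    using that
  proof (induction w)
    case (Cons x w)
    then have x: "x \<in> gcar" using bcar_subset by auto
    then show ?case using Cons b[of x]
      by (simp add: r.\<sigma>_scale_right m0 r.sM_mult[symmetric] level_act_def mult_ac)
  qed simp
  have bal: "uea_act sM \<sigma> (cls g) (sM f m0) = sM (bR.word_act g f) m0" if g: "g \<in> carrier (free_algebra bcar)" for g f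
  proof -
    have sum: "sM (sum h A) m0 = (\<Sum>i\<in>A. sM (h i) m0)" for h and A :: "'g gcheck list set"
      by (induction A rule: infinite_finite_induct) (simp_all add: r.sM_zero_left r.sM_add_left m0)
    have "uea_act sM \<sigma> (cls g) (sM f m0) = r.word_act g (sM f m0)"
      by (rule r.uea_act_class[OF bcar_free[OF g] r.M_scale[OF m0]])
    also have "\<dots> = (\<Sum>w\<in>Poly_Mapping.keys g. sM (Poly_Mapping.lookup g w) (sM (foldr (level_act l) w f) m0))"
      unfolding r.word_act_def by (rule sum.cong[OF refl]) (use g in \<open>simp add: foldr_b\<close>)
    also have "\<dots> = sM (bR.word_act g f) m0"
      unfolding bR.word_act_def sum by (simp add: r.sM_mult[OF m0])
    finally show ?thesis .
  qed
  have \<beta>1: "\<beta> (A \<oplus>\<^bsub>UG\<^esub> B) f = \<beta> A f + \<beta> B f" if "A \<in> carrier UG" "B \<in> carrier UG" for A B f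
      using that unfolding \<beta>_def UG_eq by (rule r.uea_act_add_left) (rule r.M_scale[OF m0])
  have \<beta>2: "\<beta> A (f + g) = \<beta> A f + \<beta> A g" if "A \<in> carrier UG" for A f g
      using that unfolding \<beta>_def UG_eq by (simp add: r.sM_add_left m0 r.uea_act_add_right r.M_scale)
  have \<beta>3: "\<beta> (U_right_act sc br form p A R) f = \<beta> A (U_level_act l R f)" if A: "A \<in> carrier UG" and R: "R \<in> carrier UB" for A R f
    proof -
      obtain g where g: "g \<in> carrier (free_algebra bcar)" "R = bcls g"
        using R unfolding UB_eq by (rule bR.uea_carrierE)
      have "U_right_act sc br form p A R = A \<otimes>\<^bsub>UG\<^esub> cls g"
        using tp.ra_eq[OF A R] incl_class[OF g(1)] g(2) by simp
      moreover have "cls g \<in> carrier UG"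
        unfolding UG_eq by (rule gL.class_closed[OF bcar_free[OF g(1)]])
      ultimately show ?thesis
        using A bal[OF g(1)] unfolding \<beta>_def UG_eq
        by (simp add: r.uea_act_mult r.M_scale m0 g(2) U_level_act_def bR.uea_act_class[OF g(1)])
    qed
  obtain \<Theta> where add0: "\<And>v w. v \<in> carrier (tensor_group UB UG (U_right_act sc br form p) (U_level_act l)) \<Longrightarrow>
      w \<in> carrier (tensor_group UB UG (U_right_act sc br form p) (U_level_act l)) \<Longrightarrow>
      \<Theta> (v \<otimes>\<^bsub>tensor_group UB UG (U_right_act sc br form p) (U_level_act l)\<^esub> w) = \<Theta> v + \<Theta> w"
    and pt: "\<And>A f. A \<in> carrier UG \<Longrightarrow> \<Theta> (tp.pt A f) = \<beta> A f"
    by (rule tp.tensor_universal[of \<beta>, OF \<beta>1 \<beta>2 \<beta>3]) blast+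
  have add: "\<Theta> (v \<oplus>\<^bsub>V\<^esub> w) = \<Theta> v + \<Theta> w" if "v \<in> carrier V" "w \<in> carrier V" for v w
    using add0 that by simp
  have diff: "\<Theta> (tp.tcls (x - y)) = \<Theta> (tp.tcls x) - \<Theta> (tp.tcls y)"
    if "Poly_Mapping.keys x \<subseteq> tp.S" "Poly_Mapping.keys y \<subseteq> tp.S" for x y
    using add[of "tp.tcls (x - y)" "tp.tcls y"] that tp.keys_diff_subset[OF that]
    by (simp add: tp.tensor_carrier tp.tensor_mult)
  have zero: "\<Theta> (tp.tcls 0) = 0"
    using add[of "tp.tcls 0" "tp.tcls 0"] by (simp add: tp.tensor_carrier tp.tensor_mult)
  \<comment> \<open>Compatibility with all of \<open>UG\<close> in one induction; scalars and
    elements of the Lie algebra are afterwards the words of length zero and one.\<close>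
  have main: "\<Theta> v \<in> M \<and> (\<forall>C\<in>carrier UG. \<Theta> (tp.lm C v) = uea_act sM \<sigma> C (\<Theta> v))" if "v \<in> carrier V" for v
    using that unfolding V_simps
  proof (induction v rule: tp.tensor_induct)
    case zero
    have "uea_act sM \<sigma> C 0 = 0" if "C \<in> carrier UG" for C
      using r.uea_act_add_right[of C 0 0] that r.M_zero by (simp add: UG_eq)
    then show ?case using \<open>\<Theta> (tp.tcls 0) = 0\<close> r.M_zero by (simp add: tp.lm_tcls)
  next
    case (pure A f)
    have "\<beta> A f \<in> M" using pure unfolding \<beta>_def UG_eq by (rule r.uea_act_closed) (rule r.M_scale[OF m0])
    moreover have "\<beta> (C \<otimes>\<^bsub>UG\<^esub> A) f = uea_act sM \<sigma> C (\<beta> A f)" if "C \<in> carrier UG" for C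
      using that pure unfolding \<beta>_def UG_eq by (intro r.uea_act_mult) (simp_all add: r.M_scale m0)
    ultimately show ?case using pure by (simp add: pt lm_pt)
  next
    case (diff x y)
    have "\<Theta> (tp.lm C (tp.tcls (x - y))) = uea_act sM \<sigma> C (\<Theta> (tp.tcls x) - \<Theta> (tp.tcls y))" if C: "C \<in> carrier UG" for C
    proof -
      have k: "Poly_Mapping.keys (tp.ext ((\<otimes>\<^bsub>UG\<^esub>) C) z) \<subseteq> tp.S" if "Poly_Mapping.keys z \<subseteq> tp.S" for z
        using that by (rule tp.keys_ext) (simp add: C)
      have "\<Theta> (tp.lm C (tp.tcls (x - y))) = \<Theta> (tp.lm C (tp.tcls x)) - \<Theta> (tp.lm C (tp.tcls y))"
        using \<open>\<And>x y. Poly_Mapping.keys x \<subseteq> tp.S \<Longrightarrow> Poly_Mapping.keys y \<subseteq> tp.S \<Longrightarrow>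
            \<Theta> (tp.tcls (x - y)) = \<Theta> (tp.tcls x) - \<Theta> (tp.tcls y)\<close>[OF k[OF diff(1)] k[OF diff(2)]]
          diff(1,2) tp.keys_diff_subset[OF diff(1,2)] C by (simp add: tp.lm_tcls)
      then show ?thesis using diff C r.uea_act_diff[of C] by (simp add: UG_eq)
    qed
    then show ?case
      using \<open>\<And>x y. Poly_Mapping.keys x \<subseteq> tp.S \<Longrightarrow> Poly_Mapping.keys y \<subseteq> tp.S \<Longrightarrow>
            \<Theta> (tp.tcls (x - y)) = \<Theta> (tp.tcls x) - \<Theta> (tp.tcls y)\<close>[OF diff(1,2)] diff r.M_diff by simp
  qed
  show thesis
  proof (rule that[of \<Theta>])
    show "\<Theta> v \<in> M" if "v \<in> carrier V" for v using main[OF that] by simp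
    show "\<Theta> (v \<oplus>\<^bsub>V\<^esub> w) = \<Theta> v + \<Theta> w" if "v \<in> carrier V" "w \<in> carrier V" for v w using that by (rule add)
    show "\<Theta> (f \<odot>\<^bsub>V\<^esub> v) = sM f (\<Theta> v)" if "v \<in> carrier V" for f v
      using main[OF that] cls_single_closed[of "[]" f] r.uea_act_single[of "[]" "\<Theta> v" f] by simp
    show "\<Theta> (act x v) = \<sigma> x (\<Theta> v)" if "x \<in> gcar" "v \<in> carrier V" for x v
      using main[OF that(2)] cls_single_closed[of "[x]" 1] r.uea_act_single[of "[x]" "\<Theta> v" 1] that(1)
      by (simp add: act_eq r.\<sigma>_closed r.sM_one)
    have "uea_act sM \<sigma> \<one>\<^bsub>UG\<^esub> (sM 1 m0) = m0"
      using r.uea_act_single[of "[]" m0 1] by (simp add: one_UG r.sM_one m0)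
    then show "\<Theta> vac = m0"
      using pt[OF tp.M.one_closed] by (simp add: vac_eq \<beta>_def)
  qed
qed

text \<open>From here on \<open>V\<close> is used through its module operations; the tensor
  construction is unfolded only where it is named.\<close>

declare V_simps [simp del]

end

lemma restrict_scalars_simps [simp]:
  "carrier (restrict_scalars V) = carrier V"
  "v \<oplus>\<^bsub>restrict_scalars V\<^esub> w = v \<oplus>\<^bsub>V\<^esub> w"
  "\<zero>\<^bsub>restrict_scalars V\<^esub> = \<zero>\<^bsub>V\<^esub>"
  "c \<odot>\<^bsub>restrict_scalars V\<^esub> v = fls_const c \<odot>\<^bsub>V\<^esub> v"
  by (simp_all add: restrict_scalars_def)

lemma fls_const_mult_swap: "fls_const c * f * fls_const d = fls_const (c * d) * f" for c d :: "'k::comm_semiring_1"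
  by (simp only: fls_const_mult_const[symmetric] mult_ac)

section \<open>Induction on \<open>V\<close> and the products of its generators\<close>

locale vcheck = gcheck sc br form p l
  for sc :: "complex \<Rightarrow> 'g::ab_group_add \<Rightarrow> 'g" and br form p l +
  fixes Y :: "'g vacuum_elem \<Rightarrow> int \<Rightarrow> 'g vacuum_elem \<Rightarrow> 'g vacuum_elem"
  assumes V_structure: "is_Vcheck_structure sc br form p l Y"
begin

lemma V_cz_algebra: "vertex_cz_algebra V Y vac"
  using V_structure by (simp add: is_Vcheck_structure_def)

lemma V_module: "Module.module ring_of_type_algebra V"
  by (rule vertex_cz_algebra.axioms(1)[OF V_cz_algebra])

lemma V_vertex_algebra: "vertex_algebra (restrict_scalars V) Y vac"
  by (rule vertex_cz_algebra.axioms(2)[OF V_cz_algebra])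

lemmas V_abelian_group = Module.module.axioms(2)[OF V_module]
lemmas V_abelian_monoid = abelian_group.axioms(1)[OF V_abelian_group]
lemmas V_zero [simp] = abelian_monoid.zero_closed[OF V_abelian_monoid]
  abelian_monoid.l_zero[OF V_abelian_monoid] abelian_monoid.r_zero[OF V_abelian_monoid]

lemma Y_emb: "v \<in> carrier V \<Longrightarrow> Y (emb u) n v = act (gcheck_mode u n) v"
  using V_structure unfolding is_Vcheck_structure_def by blast

lemma smult_add_left: "v \<in> carrier V \<Longrightarrow> (f + g) \<odot>\<^bsub>V\<^esub> v = f \<odot>\<^bsub>V\<^esub> v \<oplus>\<^bsub>V\<^esub> g \<odot>\<^bsub>V\<^esub> v"
  using Module.module.smult_l_distr[OF V_module, of f g v] by (simp add: ring_of_type_algebra_def)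

lemma smult_add_right: "v \<in> carrier V \<Longrightarrow> w \<in> carrier V \<Longrightarrow> f \<odot>\<^bsub>V\<^esub> (v \<oplus>\<^bsub>V\<^esub> w) = f \<odot>\<^bsub>V\<^esub> v \<oplus>\<^bsub>V\<^esub> f \<odot>\<^bsub>V\<^esub> w"
  using Module.module.smult_r_distr[OF V_module, of f v w] by (simp add: ring_of_type_algebra_def)

lemma smult_mult: "v \<in> carrier V \<Longrightarrow> (f * g) \<odot>\<^bsub>V\<^esub> v = f \<odot>\<^bsub>V\<^esub> (g \<odot>\<^bsub>V\<^esub> v)"
  using Module.module.smult_assoc1[OF V_module, of f g v] by (simp add: ring_of_type_algebra_def)

lemma smult_1: "v \<in> carrier V \<Longrightarrow> 1 \<odot>\<^bsub>V\<^esub> v = v"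
  using Module.module.smult_one[OF V_module, of v] by (simp add: ring_of_type_algebra_def)

lemma smult_0: "v \<in> carrier V \<Longrightarrow> 0 \<odot>\<^bsub>V\<^esub> v = \<zero>\<^bsub>V\<^esub>"
  using Module.module.smult_l_null[OF V_module, of v] by (simp add: ring_of_type_algebra_def)

lemma smult_neg: "v \<in> carrier V \<Longrightarrow> v \<oplus>\<^bsub>V\<^esub> (- 1) \<odot>\<^bsub>V\<^esub> v = \<zero>\<^bsub>V\<^esub>"
  using smult_add_left[of v 1 "- 1"] by (simp add: smult_1 smult_0)

lemma act_zero: "x \<in> gcar \<Longrightarrow> act x \<zero>\<^bsub>V\<^esub> = \<zero>\<^bsub>V\<^esub>"
  using act_smult[of x vac 0] vac_closed act_closed by (simp add: smult_0)

interpretation gL: lie_data gcar gsc gbr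
  by (rule lie_data_gcar)

interpretation tp: right_tensor UB UG "U_right_act sc br form p" "U_level_act l" \<iota>
  by (rule right_tensor_Vcheck)

text \<open>\<open>V\<close> is additively generated by elements A \<otimes> f, that is, A applied
  to f times the vacuum. The element A is treated as a word, then as a word with a coefficient, then
  as a sum of these, and finally as a class.\<close>

lemma V_raw_induct [consumes 1, case_names vac add smult act]:
  assumes v: "v \<in> carrier V" and vac: "P vac"
    and add: "\<And>v w. v \<in> carrier V \<Longrightarrow> w \<in> carrier V \<Longrightarrow> P v \<Longrightarrow> P w \<Longrightarrow> P (v \<oplus>\<^bsub>V\<^esub> w)"
    and smult: "\<And>f v. v \<in> carrier V \<Longrightarrow> P v \<Longrightarrow> P (f \<odot>\<^bsub>V\<^esub> v)"
    and act: "\<And>x v. x \<in> gcar \<Longrightarrow> v \<in> carrier V \<Longrightarrow> P v \<Longrightarrow> P (act x v)"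
  shows "P v"
proof -
  have zero: "P \<zero>\<^bsub>V\<^esub>" using smult[OF vac_closed vac, of 0] by (simp add: smult_0 vac_closed)
  have word: "P (tp.lm (cls (Poly_Mapping.single w 1)) v) \<and> tp.lm (cls (Poly_Mapping.single w 1)) v \<in> carrier V"
    if "set w \<subseteq> gcar" "v \<in> carrier V" "P v" for w v
    using that(1)
  proof (induction w)
    case Nil
    have "tp.lm (cls (Poly_Mapping.single [] 1)) v = v" using smult_1[OF that(2)] by (simp add: V_simps)
    then show ?case using that by simp
  next
    case (Cons x w)
    have "tp.lm (cls (Poly_Mapping.single (x # w) 1)) v = act x (tp.lm (cls (Poly_Mapping.single w 1)) v)"
      using Cons.prems that(2) by (simp add: act_eq lm_single_mult)
    then show ?case using Cons act act_closed by simp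
  qed
  have letters: "P (tp.lm (cls (Poly_Mapping.single w c)) v) \<and> tp.lm (cls (Poly_Mapping.single w c)) v \<in> carrier V"
    if "set w \<subseteq> gcar" "v \<in> carrier V" "P v" for w c v
  proof -
    have "tp.lm (cls (Poly_Mapping.single w c)) v = c \<odot>\<^bsub>V\<^esub> tp.lm (cls (Poly_Mapping.single w 1)) v"
      using that by (simp add: V_simps(3) lm_single_mult)
    then show ?thesis using word[OF that] smult smult_closed by simp
  qed
  have full: "P (tp.lm (cls g) v)" if "g \<in> carrier (free_algebra gcar)" "v \<in> carrier V" "P v" for g v
  proof -
    have "(\<Sum>w\<in>A. Poly_Mapping.single w (Poly_Mapping.lookup g w)) \<in> carrier (free_algebra gcar) \<and>
        P (tp.lm (cls (\<Sum>w\<in>A. Poly_Mapping.single w (Poly_Mapping.lookup g w))) v) \<and>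
        tp.lm (cls (\<Sum>w\<in>A. Poly_Mapping.single w (Poly_Mapping.lookup g w))) v \<in> carrier V"
      if "finite A" "A \<subseteq> Poly_Mapping.keys g" for A
      using that
    proof (induction A rule: finite_induct)
      case empty
      have "tp.lm (cls 0) v = \<zero>\<^bsub>V\<^esub>" using smult_0[OF \<open>v \<in> carrier V\<close>] by (simp add: V_simps(3))
      then show ?case using zero by simp
    next
      case (insert w A)
      define s where "s = (\<Sum>w\<in>A. Poly_Mapping.single w (Poly_Mapping.lookup g w))"
      define t where "t = Poly_Mapping.single w (Poly_Mapping.lookup g w)"
      have w: "set w \<subseteq> gcar" using insert.prems \<open>g \<in> carrier (free_algebra gcar)\<close> by auto
      have s: "s \<in> carrier (free_algebra gcar)" "P (tp.lm (cls s) v)" "tp.lm (cls s) v \<in> carrier V"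
        using insert by (simp_all add: s_def del: free_algebra_simps)
      have t: "t \<in> carrier (free_algebra gcar)" unfolding t_def by (rule single_in_free_algebra[OF w])
      have st: "t + s \<in> carrier (free_algebra gcar)"
        using gL.F.a_closed[OF t s(1)] by (simp del: free_algebra_simps(1))
      have "tp.lm (cls (t + s)) v = tp.lm (cls t) v \<oplus>\<^bsub>V\<^esub> tp.lm (cls s) v"
        using tp.lm_add_left[of "cls t" "cls s" v] gL.class_closed[OF t] gL.class_closed[OF s(1)] \<open>v \<in> carrier V\<close>
        by (simp add: V_simps cls_add[OF t s(1)] UG_eq[symmetric])
      moreover have "P (tp.lm (cls t) v)" "tp.lm (cls t) v \<in> carrier V"
        using letters[OF w] \<open>v \<in> carrier V\<close> \<open>P v\<close> by (simp_all add: t_def)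
      ultimately have "P (tp.lm (cls (t + s)) v)" "tp.lm (cls (t + s)) v \<in> carrier V"
        using s add V_add_closed by simp_all
      then show ?case using insert st by (simp add: s_def t_def del: free_algebra_simps)
    qed
    from this[of "Poly_Mapping.keys g"] show ?thesis
      using poly_mapping_expand[of g] by simp
  qed
  show ?thesis using v unfolding V_simps(1)
  proof (induction v rule: tp.tensor_induct)
    case zero
    then show ?case using \<open>P \<zero>\<^bsub>V\<^esub>\<close> by (simp add: V_simps)
  next
    case (pure A f)
    obtain g where g: "g \<in> carrier (free_algebra gcar)" "A = cls g"
      using pure unfolding UG_eq by (rule gL.uea_carrierE)
    then show ?case
      using full[OF g(1) smult_closed[OF vac_closed] smult[OF vac_closed vac]] pt_eq[OF pure] by simp
  next
    case (diff x y)
    have xy: "Poly_Mapping.keys (x - y) \<subseteq> tp.S" by (rule tp.keys_diff_subset[OF diff(1,2)])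
    have c: "tp.tcls z \<in> carrier V" if "Poly_Mapping.keys z \<subseteq> tp.S" for z
      using that by (simp add: V_simps tp.tensor_carrier)
    have n: "(- 1) \<odot>\<^bsub>V\<^esub> tp.tcls y \<in> carrier V" by (rule smult_closed[OF c[OF diff(2)]])
    \<comment> \<open>The induction on the tensor product forms differences; since -y is the scalar
      multiple (-1) y, closure under sums and scalars covers them.\<close>
    have "tp.tcls x = tp.tcls (x - y) \<oplus>\<^bsub>V\<^esub> tp.tcls y"
      using tp.tensor_mult[OF xy diff(2)] by (simp add: V_simps)
    then have "tp.tcls x \<oplus>\<^bsub>V\<^esub> (- 1) \<odot>\<^bsub>V\<^esub> tp.tcls y = tp.tcls (x - y) \<oplus>\<^bsub>V\<^esub> (tp.tcls y \<oplus>\<^bsub>V\<^esub> (- 1) \<odot>\<^bsub>V\<^esub> tp.tcls y)"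
      using abelian_monoid.a_assoc[OF V_abelian_monoid c[OF xy] c[OF diff(2)] n] by simp
    also have "\<dots> = tp.tcls (x - y)"
      using smult_neg[OF c[OF diff(2)]] abelian_monoid.r_zero[OF V_abelian_monoid c[OF xy]] by simp
    finally show ?case
      using add[OF c[OF diff(1)] n diff(3) smult[OF c[OF diff(2)] diff(4)]] by simp
  qed
qed

text \<open>The central element commutes with the whole action, so its value on the vacuum spreads
  through \<open>V\<close>.\<close>

lemma act_central:
  assumes "v \<in> carrier V"
  shows "act (gsc c central) v = (c * fls_const l) \<odot>\<^bsub>V\<^esub> v"
  using assms
proof (induction v rule: V_raw_induct)
  case vac
  have "gsc c central \<in> bcar" by (intro bcar_scale central_in_bcar)
  then show ?case using act_vac[of "gsc c central"] by simp
next
  case (add v w)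
  then show ?case using gcar_central[of c] by (simp add: act_add_right gsc_central smult_add_right)
next
  case (smult f v)
  then show ?case using gcar_central[of c]
    by (simp add: act_smult gsc_central smult_mult[symmetric] mult.commute)
next
  case (act x v)
  have c: "gsc c central \<in> gcar" using gcar_central[of c] by (simp add: gsc_central)
  have "act (gsc c central) (act x v) = act x (act (gsc c central) v) \<oplus>\<^bsub>V\<^esub> act 0 v"
    using act_bracket[OF c act(1,2)] by (simp add: gbr_central)
  also have "act 0 v = \<zero>\<^bsub>V\<^esub>"
  proof -
    have "central \<in> gcar" using gcar_central[of 1] by (simp add: central_def)
    moreover have "(0 :: 'g gcheck) = gsc 0 central" by (simp add: gsc_central zero_prod_def)
    ultimately show ?thesis
      using act_scale_left[of central v 0] act(2) smult_0 act_closed by simp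
  qed
  finally show ?case using act by (simp add: act_smult act_closed smult_closed)
qed

text \<open>The action of any x is a \<complex>((z))-combination of modes of elements of \<gg> and
  \<gg>^1 and, by \<open>act_central\<close>, of scalars.\<close>

lemma V_induct [consumes 1, case_names vac add smult act]:
  assumes v: "v \<in> carrier V" and vac: "P vac"
    and add: "\<And>v w. v \<in> carrier V \<Longrightarrow> w \<in> carrier V \<Longrightarrow> P v \<Longrightarrow> P w \<Longrightarrow> P (v \<oplus>\<^bsub>V\<^esub> w)"
    and smult: "\<And>f v. v \<in> carrier V \<Longrightarrow> P v \<Longrightarrow> P (f \<odot>\<^bsub>V\<^esub> v)"
    and act: "\<And>u n v. v \<in> carrier V \<Longrightarrow> P v \<Longrightarrow> P (act (gcheck_mode u n) v)"
  shows "P v"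
  using v
proof (induction v rule: V_raw_induct)
  case (act x v)
  from act(1) show ?case
  proof (induction x rule: gcar_induct)
    case (mode f u n)
    then show ?case
      using act(2,3) by (simp add: act_scale_left gcheck_mode_in smult assms(5) act_closed)
  next
    case (central c)
    then show ?case using act(2,3) by (simp add: act_central smult)
  next
    case (add x y)
    then show ?case using act(2) by (simp add: act_add_left assms(3) act_closed)
  qed
qed (use assms in auto)

lemma emb_closed: "emb u \<in> carrier V"
  unfolding Vcheck_embed_def by (intro act_closed gcheck_mode_in vac_closed)

lemma gcheck_mode_add: "gcheck_mode (u + v) n = gcheck_mode u n + gcheck_mode v n"
  for u v :: "'g \<times> 'g"
proof -
  have "fls_const (a + b) = fls_const a + (fls_const b :: 'g fls)" for a b
    by (rule fls_eqI) simp
  then show ?thesis by (simp only: gcheck_mode_def mode_add[symmetric] add_Pair fst_add snd_add)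
qed

lemma gcheck_mode_scale: "gcheck_mode (sc c a, sc c b) n = gsc (fls_const c) (gcheck_mode (a, b) n)"
proof -
  have "stens (fls_const c) a = fls_const (sc c a)" for a by (rule fls_eqI) (simp add: stens_nth)
  then show ?thesis by (simp add: gsc_gcheck_mode) (simp add: gcheck_mode_def)
qed

lemma emb_add: "emb (u + v) = emb u \<oplus>\<^bsub>V\<^esub> emb v"
  unfolding Vcheck_embed_def gcheck_mode_add by (intro act_add_left gcheck_mode_in vac_closed)

lemma emb_scale: "emb (sc c a, sc c b) = fls_const c \<odot>\<^bsub>V\<^esub> emb (a, b)"
  unfolding Vcheck_embed_def gcheck_mode_scale by (intro act_scale_left gcheck_mode_in vac_closed)

lemma act_vac_nonneg: "n \<ge> 0 \<Longrightarrow> act (gcheck_mode u n) vac = \<zero>\<^bsub>V\<^esub>"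
  using act_vac[OF gcheck_mode_in_bcar, of n u] by (simp add: gcheck_mode_def smult_0 vac_closed)

text \<open>u(q) annihilates the vacuum, so only its bracket with v(-1) survives.\<close>

lemma act_emb:
  assumes "q \<ge> 0"
  shows "act (gcheck_mode u q) (emb v) = act (gbr (gcheck_mode u q) (gcheck_mode v (- 1))) vac"
proof -
  have "act (gcheck_mode u q) (emb v) = act (gcheck_mode v (- 1)) (act (gcheck_mode u q) vac)
      \<oplus>\<^bsub>V\<^esub> act (gbr (gcheck_mode u q) (gcheck_mode v (- 1))) vac"
    unfolding Vcheck_embed_def by (intro act_bracket gcheck_mode_in vac_closed)
  moreover have "act (gbr (gcheck_mode u q) (gcheck_mode v (- 1))) vac \<in> carrier V"
    by (intro act_closed gbr_closed gcheck_mode_in vac_closed)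
  ultimately show ?thesis using assms by (simp add: act_vac_nonneg act_zero gcheck_mode_in)
qed

lemma bcar_sum: "(\<And>i. i \<in> A \<Longrightarrow> f i \<in> bcar) \<Longrightarrow> sum f A \<in> bcar"
proof (induction A rule: infinite_finite_induct)
  case (insert x A)
  then show ?case by (simp add: bcar_add)
qed (use bcar_scale[OF central_in_bcar, of 0] in \<open>simp_all add: gsc_central zero_prod_def\<close>)

text \<open>Among the modes in the bracket only those of index -1 survive on the vacuum. In the
  terms of index -1 + i coming from p(z + x) this means i = 0, so p(z) is what remains of p(z +
  x).\<close>

lemma act_emb_0:
  "act (gcheck_mode u 0) (emb v) = emb (br0 u v) \<oplus>\<^bsub>V\<^esub> (poly_fls p \<odot>\<^bsub>V\<^esub> emb (br1 u v)
    \<oplus>\<^bsub>V\<^esub> (fls_const (1 / 2 * form (snd u) (snd v) * l) * poly_fls (pderiv p)) \<odot>\<^bsub>V\<^esub> vac)"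
proof -
  define d where "d = Polynomial.degree (shift_poly p)"
  \<comment> \<open>The remaining terms lie in the subalgebra and act on the vacuum through their
    central component alone.\<close>
  define R where "R = (\<Sum>i\<in>{1..d}. gsc (Polynomial.coeff (shift_poly p) i) (gcheck_mode (br1 u v) (- 1 + int i)))
     + gsc (klev u 0 v (- 1)) central"
  have Rb: "R \<in> bcar"
    unfolding R_def by (intro bcar_add bcar_sum bcar_scale gcheck_mode_in_bcar central_in_bcar) auto
  have snd_mode: "snd (gcheck_mode w n) = (0 :: complex fls)" for w :: "'g \<times> 'g" and n by (simp add: gcheck_mode_def)
  have "klev u 0 v (- 1) = fls_const (1 / 2 * form (snd u) (snd v)) * poly_fls (pderiv p)"
    by (simp add: klev_def int_coeff_def coeff_shift_poly_0)
  then have sR: "snd R * fls_const l = fls_const (1 / 2 * form (snd u) (snd v) * l) * poly_fls (pderiv p)"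
    by (simp add: R_def snd_sum snd_mode fls_const_mult_swap)
  have "gbr (gcheck_mode u 0) (gcheck_mode v (- 1)) =
      gcheck_mode (br0 u v) (- 1) + (gsc (poly_fls p) (gcheck_mode (br1 u v) (- 1)) + R)"
  proof -
    have "(\<Sum>i\<le>d. gsc (Polynomial.coeff (shift_poly p) i) (gcheck_mode (br1 u v) (- 1 + int i)))
      = gsc (poly_fls p) (gcheck_mode (br1 u v) (- 1))
        + (\<Sum>i\<in>{1..d}. gsc (Polynomial.coeff (shift_poly p) i) (gcheck_mode (br1 u v) (- 1 + int i)))"
      by (simp add: atMost_atLeast0 sum.atLeast_Suc_atMost coeff_shift_poly_0)
    then show ?thesis
      by (simp add: gbr_modes' R_def d_def add.assoc)
  qed
  then have "act (gcheck_mode u 0) (emb v) = act (gcheck_mode (br0 u v) (- 1)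
      + (gsc (poly_fls p) (gcheck_mode (br1 u v) (- 1)) + R)) vac"
    by (simp add: act_emb)
  also have "\<dots> = act (gcheck_mode (br0 u v) (- 1)) vac \<oplus>\<^bsub>V\<^esub>
      (poly_fls p \<odot>\<^bsub>V\<^esub> act (gcheck_mode (br1 u v) (- 1)) vac \<oplus>\<^bsub>V\<^esub> act R vac)"
    using subsetD[OF bcar_subset Rb]
    by (simp add: act_add_left act_scale_left gcar_add gcar_scale gcheck_mode_in vac_closed)
  also have "act R vac = (fls_const (1 / 2 * form (snd u) (snd v) * l) * poly_fls (pderiv p)) \<odot>\<^bsub>V\<^esub> vac"
    by (simp only: act_vac[OF Rb] sR)
  finally show ?thesis by (simp add: Vcheck_embed_def)
qed

lemma act_emb_pos:
  assumes "q \<ge> 1"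
  shows "act (gcheck_mode u q) (emb v) = (klev u q v (- 1) * fls_const l) \<odot>\<^bsub>V\<^esub> vac"
proof -
  have "gbr (gcheck_mode u q) (gcheck_mode v (- 1)) \<in> bcar"
    unfolding gbr_modes'
    by (intro bcar_add bcar_sum bcar_scale gcheck_mode_in_bcar central_in_bcar) (use assms in auto)
  moreover have "snd (gbr (gcheck_mode u q) (gcheck_mode v (- 1))) = klev u q v (- 1)"
    unfolding gbr_modes' by (simp add: snd_sum gcheck_mode_def)
  ultimately show ?thesis using assms by (simp add: act_emb act_vac)
qed

lemma act_emb_1:
  "act (gcheck_mode u 1) (emb v)
    = (fls_const (form (fst u) (fst v) * l) + fls_const (form (snd u) (snd v) * l) * poly_fls p) \<odot>\<^bsub>V\<^esub> vac"
proof -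
  have "klev u 1 v (- 1) = fls_const (form (fst u) (fst v)) + fls_const (form (snd u) (snd v)) * poly_fls p"
    by (simp add: klev_def int_coeff_def coeff_shift_poly_0)
  then have "klev u 1 v (- 1) * fls_const l
      = fls_const (form (fst u) (fst v) * l) + fls_const (form (snd u) (snd v) * l) * poly_fls p"
    by (simp only: distrib_right fls_const_mult_swap fls_const_mult_const)
  then show ?thesis using act_emb_pos[of 1 u v] by simp
qed

text \<open>The indices -q and 1 - q of the polynomial coefficients are negative. Hence commutators
  of generators involve only the delta function and its first derivative.\<close>

lemma act_emb_ge2:
  assumes "q \<ge> 2"
  shows "act (gcheck_mode u q) (emb v) = \<zero>\<^bsub>V\<^esub>"
proof -
  have "klev u q v (- 1) = 0" using assms by (simp add: klev_def int_coeff_def)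
  then show ?thesis using act_emb_pos[of q u v] assms by (simp add: smult_0 vac_closed)
qed

end

section \<open>From type zero modules to restricted modules\<close>

context complex_space
begin

lemma prd_k0:
  assumes "\<alpha> \<in> fields" "\<beta> \<in> fields"
  shows "prd m 0 \<alpha> \<beta> n w = \<alpha> m (\<beta> n w) - \<beta> n (\<alpha> m w)"
proof -
  have l: "Sum_any (\<lambda>i::nat. scW ((- 1) ^ i * (of_int 0 gchoose i)) (\<alpha> (0 + m - int i) (\<beta> (n + int i) w))) = \<alpha> m (\<beta> n w)"
    by (subst Sum_any_eq_sum[of 1]) (simp_all add: gbinomial_0_left)
  have r: "Sum_any (\<lambda>i::nat. scW ((- 1) powi 0 * (- 1) ^ i * (of_int 0 gchoose i)) (\<beta> (0 + n - int i) (\<alpha> (m + int i) w))) = \<beta> n (\<alpha> m w)"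
    by (subst Sum_any_eq_sum[of 1]) (simp_all add: gbinomial_0_left)
  show ?thesis unfolding prd_def l r ..
qed

end

locale vcheck_space = vcheck sc br form p l Y + W: complex_space scW
  for sc :: "complex \<Rightarrow> 'g::ab_group_add \<Rightarrow> 'g" and br form p l Y
    and scW :: "complex \<Rightarrow> 'w::ab_group_add \<Rightarrow> 'w"
begin

definition level_coeff :: "'g \<times> 'g \<Rightarrow> int \<Rightarrow> 'g \<times> 'g \<Rightarrow> int \<Rightarrow> complex" where
  "level_coeff u m v n = (if m + n = 0 then of_int m * form (fst u) (fst v) else 0)
    + (1 / 2 * form (snd u) (snd v) * int_coeff (pderiv p) (- m - n - 1)
      + form (snd u) (snd v) * of_int m * int_coeff p (- m - n))"

text \<open>The coefficients of \<open>[u(x\<^sub>1), v(x\<^sub>2)]\<close> at the delta function and its derivative, if \<open>\<alpha>\<close> and \<open>\<beta>\<close> are the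
  fields of \<open>br0 u v\<close> and \<open>br1 u v\<close>.\<close>

definition bracket_field :: "(int \<Rightarrow> 'w \<Rightarrow> 'w) \<Rightarrow> (int \<Rightarrow> 'w \<Rightarrow> 'w) \<Rightarrow> 'g \<times> 'g \<Rightarrow> 'g \<times> 'g \<Rightarrow> nat \<Rightarrow> int \<Rightarrow> 'w \<Rightarrow> 'w" where
  "bracket_field \<alpha> \<beta> u v q =
    (if q = 0 then \<alpha> + (W.fscale (poly_fls p) \<beta>
        + W.fscale (fls_const (1 / 2 * form (snd u) (snd v) * l) * poly_fls (pderiv p)) W.idf)
     else W.fscale (fls_const (form (fst u) (fst v) * l) + fls_const (form (snd u) (snd v) * l) * poly_fls p) W.idf)"

text \<open>Multiplication by p(x) shifts the modes of \<open>\<beta>\<close>, while a series times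
  the identity field contributes a scalar in each mode. With (m choose 1) = m this is the mode form
  of the bracket; both directions of the theorem compare commutators through it.\<close>

lemma sum_bracket_field:
  assumes "\<alpha> \<in> W.fields" "\<beta> \<in> W.fields"
  shows "(\<Sum>q<2. scW (of_int m gchoose q) (bracket_field \<alpha> \<beta> u v q (m + n - int q) w))
    = \<alpha> (m + n) w + (\<Sum>i\<le>Polynomial.degree p. scW (Polynomial.coeff p i) (\<beta> (m + n + int i) w))
      + scW (l * level_coeff u m v n) w"
proof -
  have e: "- 1 - (m + n) = - m - n - 1" by simp
  have t0: "bracket_field \<alpha> \<beta> u v 0 (m + n) w = \<alpha> (m + n) w
      + ((\<Sum>i\<le>Polynomial.degree p. scW (Polynomial.coeff p i) (\<beta> (m + n + int i) w))
        + scW (1 / 2 * form (snd u) (snd v) * l * int_coeff (pderiv p) (- m - n - 1)) w)"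
    using assms by (simp add: bracket_field_def W.fscale_poly_fls W.fscale_idf fls_nth_poly_fls e)
  have t1: "bracket_field \<alpha> \<beta> u v (Suc 0) (m + n - 1) w
      = scW ((if m + n = 0 then form (fst u) (fst v) * l else 0) + form (snd u) (snd v) * l * int_coeff p (- m - n)) w"
    by (simp add: bracket_field_def W.fscale_idf fls_nth_poly_fls algebra_simps)
  have "(\<Sum>q<2. scW (of_int m gchoose q) (bracket_field \<alpha> \<beta> u v q (m + n - int q) w))
    = bracket_field \<alpha> \<beta> u v 0 (m + n) w + scW (of_int m) (bracket_field \<alpha> \<beta> u v (Suc 0) (m + n - 1) w)"
    by (simp add: numeral_2_eq_2)
  also have "\<dots> = \<alpha> (m + n) w + (\<Sum>i\<le>Polynomial.degree p. scW (Polynomial.coeff p i) (\<beta> (m + n + int i) w))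
      + (scW (1 / 2 * form (snd u) (snd v) * l * int_coeff (pderiv p) (- m - n - 1)) w
        + scW (of_int m * ((if m + n = 0 then form (fst u) (fst v) * l else 0) + form (snd u) (snd v) * l * int_coeff p (- m - n))) w)"
    unfolding t0 t1 by (simp add: add.assoc)
  also have "scW (1 / 2 * form (snd u) (snd v) * l * int_coeff (pderiv p) (- m - n - 1)) w
        + scW (of_int m * ((if m + n = 0 then form (fst u) (fst v) * l else 0) + form (snd u) (snd v) * l * int_coeff p (- m - n))) w
      = scW (l * level_coeff u m v n) w"
    unfolding W.scale_left_distrib[symmetric] level_coeff_def
    by (rule arg_cong[where f = "\<lambda>c. scW c w"]) (simp add: algebra_simps)
  finally show ?thesis .
qed

end

text \<open>Met by the vertex operators of any type zero module and also by the map constructed from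
  a restricted module, so that brackets of generators are computed once for both directions.\<close>

locale field_map = vcheck_space sc br form p l Y scW
  for sc :: "complex \<Rightarrow> 'g::ab_group_add \<Rightarrow> 'g" and br form p l Y
    and scW :: "complex \<Rightarrow> 'w::ab_group_add \<Rightarrow> 'w" +
  fixes \<Theta> :: "'g vacuum_elem \<Rightarrow> int \<Rightarrow> 'w \<Rightarrow> 'w"
  assumes \<Theta>_fields: "v \<in> carrier V \<Longrightarrow> \<Theta> v \<in> W.fields"
    and \<Theta>_add: "v \<in> carrier V \<Longrightarrow> w \<in> carrier V \<Longrightarrow> \<Theta> (v \<oplus>\<^bsub>V\<^esub> w) = \<Theta> v + \<Theta> w"
    and \<Theta>_smult: "v \<in> carrier V \<Longrightarrow> \<Theta> (f \<odot>\<^bsub>V\<^esub> v) = W.fscale f (\<Theta> v)"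
    and \<Theta>_vac: "\<Theta> vac = W.idf"
begin

lemma \<Theta>_zero: "\<Theta> \<zero>\<^bsub>V\<^esub> = 0"
  using \<Theta>_smult[OF vac_closed, of 0] by (simp add: smult_0 vac_closed)

lemma \<Theta>_emb_zero: "\<Theta> (emb 0) = 0"
  using \<Theta>_add[OF emb_closed[of 0] emb_closed[of 0]] emb_add[of 0 0] by simp

lemma sum_bracket_modes:
  "(\<Sum>q<2. scW (of_int m gchoose q) (\<Theta> (act (gcheck_mode u (int q)) (emb v)) (m + n - int q) w))
    = \<Theta> (emb (br0 u v)) (m + n) w
      + (\<Sum>i\<le>Polynomial.degree p. scW (Polynomial.coeff p i) (\<Theta> (emb (br1 u v)) (m + n + int i) w))
      + scW (l * level_coeff u m v n) w"
proof -
  have "\<Theta> (act (gcheck_mode u (int q)) (emb v)) = bracket_field (\<Theta> (emb (br0 u v))) (\<Theta> (emb (br1 u v))) u v q" if "q < 2" for q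
  proof -
    have "q = 0 \<or> q = 1" using that by auto
    then show ?thesis
    proof
      assume "q = 0"
      then show ?thesis
        by (simp add: bracket_field_def act_emb_0 \<Theta>_add \<Theta>_smult \<Theta>_vac emb_closed smult_closed vac_closed V_add_closed)
    next
      assume "q = 1"
      then show ?thesis using act_emb_1[of u v] by (simp add: bracket_field_def \<Theta>_smult \<Theta>_vac vac_closed)
    qed
  qed
  then show ?thesis
    using sum_bracket_field[OF \<Theta>_fields[OF emb_closed] \<Theta>_fields[OF emb_closed]] by simp
qed

end

context vcheck_space
begin

lemma type_zero_field_map:
  assumes "type_zero_module V Y vac scW YW"
  shows "field_map sc br form p l Y scW YW"
proof -
  interpret T: type_zero_module V Y vac scW YW by fact
  show ?thesis
  proof unfold_locales
    fix v assume v: "v \<in> carrier V"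
    show "YW v \<in> W.fields"
      using T.YW_linear[of v] T.YW_truncation[of v] v by (simp add: W.fields_def)
    show "YW (f \<odot>\<^bsub>V\<^esub> v) = W.fscale f (YW v)" for f
      by (intro ext) (simp add: T.type_zero[OF v] W.fscale_def)
  next
    fix v w assume "v \<in> carrier V" "w \<in> carrier V"
    then show "YW (v \<oplus>\<^bsub>V\<^esub> w) = YW v + YW w"
      by (intro ext) (simp add: T.YW_add[simplified])
  next
    show "YW vac = W.idf" by (intro ext) (simp add: T.YW_vacuum W.idf_def)
  qed
qed

text \<open>\<open>W.prd\<close> has been set up as the left-hand side of the module axiom
  \<open>YW_jacobi\<close>.\<close>

lemma type_zero_prd:
  assumes "type_zero_module V Y vac scW YW" and u: "u \<in> carrier V" and v: "v \<in> carrier V"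
  shows "W.prd m k (YW u) (YW v) n w
    = Sum_any (\<lambda>i::nat. scW (of_int m gchoose i) (YW (Y u (k + int i) v) (m + n - int i) w))"
proof -
  interpret T: type_zero_module V Y vac scW YW by fact
  show ?thesis unfolding W.prd_def by (rule T.YW_jacobi) (simp_all add: u v)
qed

lemma type_zero_commutator:
  assumes T: "type_zero_module V Y vac scW YW"
  shows "YW (emb u) m (YW (emb v) n w) - YW (emb v) n (YW (emb u) m w)
    = YW (emb (br0 u v)) (m + n) w
      + (\<Sum>i\<le>Polynomial.degree p. scW (Polynomial.coeff p i) (YW (emb (br1 u v)) (m + n + int i) w))
      + scW (l * level_coeff u m v n) w"
proof -
  interpret F: field_map sc br form p l Y scW YW by (rule type_zero_field_map[OF T])
  have "YW (emb u) m (YW (emb v) n w) - YW (emb v) n (YW (emb u) m w) = W.prd m 0 (YW (emb u)) (YW (emb v)) n w"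
    by (simp add: W.prd_k0 F.\<Theta>_fields emb_closed)
  also have "\<dots> = Sum_any (\<lambda>i::nat. scW (of_int m gchoose i) (YW (act (gcheck_mode u (int i)) (emb v)) (m + n - int i) w))"
    by (simp add: type_zero_prd[OF T emb_closed emb_closed] Y_emb emb_closed)
  also have "\<dots> = (\<Sum>i<2. scW (of_int m gchoose i) (YW (act (gcheck_mode u (int i)) (emb v)) (m + n - int i) w))"
    by (rule W.Sum_any_eq_sum) (simp add: act_emb_ge2 F.\<Theta>_zero)
  also note F.sum_bracket_modes
  finally show ?thesis .
qed

text \<open>\<open>\<rho>\<close> is forced on modes and on the central element. Bilinearity reduces
  the bracket relation to pairs of modes, where it is \<open>type_zero_commutator\<close>.\<close>

lemma restricted_ghat_module_of_type_zero:
  assumes T: "type_zero_module V Y vac scW YW"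
  obtains \<rho> where "restricted_ghat_module sc br form p l scW \<rho>" "\<And>u n. \<rho> (mode u n) = YW (emb u) n"
proof -
  interpret F: field_map sc br form p l Y scW YW by (rule type_zero_field_map[OF T])
  define \<rho> :: "(complex, 'g) affine \<Rightarrow> 'w \<Rightarrow> 'w" where
    "\<rho> x w = (\<Sum>n\<in>Poly_Mapping.keys (fst x). YW (emb (Poly_Mapping.lookup (fst x) n)) n w) + scW (l * snd x) w" for x w
  have fld: "YW (emb u) \<in> W.fields" for u by (rule F.\<Theta>_fields[OF emb_closed])
  have sup: "\<rho> x w = (\<Sum>n\<in>A. YW (emb (Poly_Mapping.lookup (fst x) n)) n w) + scW (l * snd x) w"
    if "finite A" "Poly_Mapping.keys (fst x) \<subseteq> A" for x w A
    unfolding \<rho>_def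
    by (intro arg_cong2[where f = "(+)"] refl sum.mono_neutral_left) (use that in \<open>auto simp: in_keys_iff F.\<Theta>_emb_zero\<close>)
  have mode: "\<rho> (mode u n) w = YW (emb u) n w" for u n w
    using sup[of "{n}" "mode u n"] by simp
  have \<rho>c: "\<rho> (0, c) w = scW (l * c) w" for c w
    by (simp add: \<rho>_def)
  have emb_add': "YW (emb (u + v)) n w = YW (emb u) n w + YW (emb v) n w" for u v n w
    by (simp add: emb_add F.\<Theta>_add emb_closed)
  have emb_scale': "YW (emb (sc c a, sc c b)) n w = scW c (YW (emb (a, b)) n w)" for c a b n w
    by (simp add: emb_scale F.\<Theta>_smult emb_closed W.fscale_const)
  have add: "\<rho> (x + y) w = \<rho> x w + \<rho> y w" for x y w
  proof -
    define A where "A = Poly_Mapping.keys (fst x) \<union> Poly_Mapping.keys (fst y) \<union> Poly_Mapping.keys (fst (x + y))"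
    have "\<rho> z w = (\<Sum>n\<in>A. YW (emb (Poly_Mapping.lookup (fst z) n)) n w) + scW (l * snd z) w" if "z \<in> {x, y, x + y}" for z
      by (rule sup) (use that in \<open>auto simp: A_def\<close>)
    then show ?thesis
      by (simp add: lookup_add emb_add' sum.distrib distrib_left W.scale_left_distrib)
  qed
  have zero: "\<rho> 0 w = 0" for w by (simp add: \<rho>_def)
  have sum: "\<rho> (sum f A) w = (\<Sum>i\<in>A. \<rho> (f i) w)" for f :: "int \<Rightarrow> (complex, 'g) affine" and A w
    by (induction A rule: infinite_finite_induct) (simp_all add: zero add)
  have sum': "\<rho> (sum f A) w = (\<Sum>i\<in>A. \<rho> (f i) w)" for f :: "nat \<Rightarrow> (complex, 'g) affine" and A w
    by (induction A rule: infinite_finite_induct) (simp_all add: zero add)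
  have lin: "\<rho> x (w + w') = \<rho> x w + \<rho> x w'" "\<rho> x (scW c w) = scW c (\<rho> x w)" for x w w' c
    by (simp_all add: \<rho>_def W.fields_add[OF fld] W.fields_scale[OF fld] sum.distrib W.scale_right_distrib
        W.scale_sum_right mult.commute add_ac)
  have br: "\<rho> (mode_bracket sc br form p (pderiv p) u m v n) w
      = YW (emb u) m (YW (emb v) n w) - YW (emb v) n (YW (emb u) m w)" for u m v n w
  proof -
    obtain a a' b b' where uv: "u = (a, a')" "v = (b, b')" by (metis prod.exhaust)
    have "\<rho> (mode (sc c (br a' b'), 0) k) w = scW c (YW (emb (br a' b', 0)) k w)" for c k
      using emb_scale'[of c "br a' b'" 0 k w] by (simp add: mode scale_zero_right)
    then have "\<rho> (mode_bracket sc br form p (pderiv p) u m v n) w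
        = YW (emb (br0 u v)) (m + n) w + scW (l * (if m + n = 0 then of_int m * form a b else 0)) w
          + (\<Sum>i\<le>Polynomial.degree p. scW (Polynomial.coeff p i) (YW (emb (br1 u v)) (m + n + int i) w))
          + scW (l * (1 / 2 * form a' b' * int_coeff (pderiv p) (- m - n - 1) + form a' b' * of_int m * int_coeff p (- m - n))) w"
      by (simp only: uv mode_bracket_pair[OF biadditive_sc biadditive_br biadditive_form] add mode \<rho>c sum' fst_conv snd_conv)
    also have "\<dots> = YW (emb (br0 u v)) (m + n) w
          + (\<Sum>i\<le>Polynomial.degree p. scW (Polynomial.coeff p i) (YW (emb (br1 u v)) (m + n + int i) w))
          + scW (l * level_coeff u m v n) w"
      unfolding level_coeff_def uv fst_conv snd_conv distrib_left[of l "if m + n = 0 then of_int m * form a b else 0"] W.scale_left_distrib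
      by (simp only: add_ac)
    finally show ?thesis by (simp only: type_zero_commutator[OF T])
  qed
  have "restricted_ghat_module sc br form p l scW \<rho>"
  proof (intro restricted_ghat_module.intro ghat_module.intro ghat_module_axioms.intro restricted_ghat_module_axioms.intro)
    show "vector_space scW" by (rule W.vector_space_axioms)
    show "Vector_Spaces.linear scW scW (\<rho> x)" for x by (rule W.linearI) (simp_all add: lin)
    show "\<rho> (x + x') w = \<rho> x w + \<rho> x' w" for x x' w by (rule add)
    show "\<rho> (affine_scale sc c x) w = scW c (\<rho> x w)" for c x w
    proof -
      have z: "\<And>c. sc c 0 = 0" by simp
      have k: "Poly_Mapping.keys (fst (affine_scale sc c x)) \<subseteq> Poly_Mapping.keys (fst x)"
        by (auto simp: in_keys_iff lookup_affine_scale[of sc, OF z] zero_prod_def)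
      have "\<rho> (affine_scale sc c x) w = (\<Sum>n\<in>Poly_Mapping.keys (fst x).
          scW c (YW (emb (Poly_Mapping.lookup (fst x) n)) n w)) + scW (l * (c * snd x)) w"
        by (subst sup[OF _ k]) (simp_all add: lookup_affine_scale[of sc, OF z] emb_scale')
      then show ?thesis by (simp add: \<rho>_def W.scale_right_distrib W.scale_sum_right mult_ac)
    qed
    show "\<rho> (ghat_bracket sc br form p x x') w = \<rho> x (\<rho> x' w) - \<rho> x' (\<rho> x w)" for x x' w
    proof -
      define a where "a m = YW (emb (Poly_Mapping.lookup (fst x) m)) m" for m
      define b where "b n = YW (emb (Poly_Mapping.lookup (fst x') n)) n" for n
      define A where "A = Poly_Mapping.keys (fst x)"
      define B where "B = Poly_Mapping.keys (fst x')"
      have ab: "a m (sum f C) = (\<Sum>i\<in>C. a m (f i))" "b m (sum f C) = (\<Sum>i\<in>C. b m (f i))"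
        "a m (s + t) = a m s + a m t" "b m (s + t) = b m s + b m t"
        "a m (scW c s) = scW c (a m s)" "b m (scW c s) = scW c (b m s)" for m s t c and f :: "int \<Rightarrow> 'w" and C
        by (simp_all add: a_def b_def W.fields_sum[OF fld] W.fields_add[OF fld] W.fields_scale[OF fld])
      have \<rho>a: "\<rho> x s = (\<Sum>m\<in>A. a m s) + scW (l * snd x) s" and \<rho>b: "\<rho> x' s = (\<Sum>n\<in>B. b n s) + scW (l * snd x') s" for s
        by (simp_all add: \<rho>_def a_def b_def A_def B_def)
      have "\<rho> (ghat_bracket sc br form p x x') w = (\<Sum>m\<in>A. \<Sum>n\<in>B. a m (b n w) - b n (a m w))"
        by (simp add: affine_bracket_def sum br a_def b_def A_def B_def)
      also have "\<dots> = (\<Sum>m\<in>A. \<Sum>n\<in>B. a m (b n w)) - (\<Sum>n\<in>B. \<Sum>m\<in>A. b n (a m w))"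
        by (simp only: sum_subtractf sum.swap[of _ B A])
      \<comment> \<open>The scalar parts of x and x' commute with everything and cancel.\<close>
      also have "\<dots> = \<rho> x (\<rho> x' w) - \<rho> x' (\<rho> x w)"
        unfolding \<rho>a \<rho>b ab sum.distrib W.scale_right_distrib W.scale_sum_right[symmetric]
        by (simp add: W.scale_left_commute mult.commute)
      finally show ?thesis .
    qed
    show "\<rho> central w = scW l w" for w using \<rho>c[of 1 w] by (simp add: central_def)
    show "\<exists>N. \<forall>n\<ge>N. \<rho> (mode u n) w = 0" for u w
      using W.fields_trunc[OF fld[of u], of w] by (simp add: mode)
  qed
  then show thesis using that mode by blast
qed

end

section \<open>The Jacobi identity\<close>

context complex_space
begin

text \<open>The divided derivative \<open>\<partial>\<^sup>i x\<^sup>m/i!\<close>.\<close>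

definition xbin :: "int \<Rightarrow> nat \<Rightarrow> complex fls" where
  "xbin m i = fls_const (of_int m gchoose i) * fls_X_intpow (m - int i)"

lemma fscale_xbin:
  "fscale (xbin m i) \<beta> n w = scW (of_int m gchoose i) (\<beta> (m + n - int i) w)"
proof -
  have c: "xbin m i $$ j = (if j = m - int i then (of_int m gchoose i) else 0)" for j
    by (simp add: xbin_def)
  have "fscale (xbin m i) \<beta> n w = (\<Sum>j\<in>{m - int i}. scW (xbin m i $$ j) (\<beta> (n + j) w))"
    unfolding fscale_def by (rule Sum_any.expand_superset) (auto simp: c)
  then show ?thesis by (simp add: c algebra_simps)
qed

lemma sum_fun_apply: "(\<Sum>i\<in>A. g i) n w = (\<Sum>i\<in>A. g i n w)" for g :: "'i \<Rightarrow> int \<Rightarrow> 'w \<Rightarrow> 'w"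
  by (induction A rule: infinite_finite_induct) simp_all

end

lemma (in abelian_group) minus_add_cancel:
  "x \<in> carrier G \<Longrightarrow> y \<in> carrier G \<Longrightarrow> (x \<ominus> y) \<oplus> y = x"
  by (simp add: a_minus_def a_assoc l_neg)

lemma fin_sum_restrict: "fin_sum (restrict_scalars V) f = fin_sum V f"
proof -
  have "finsum (restrict_scalars V) f A = finsum V f A" for A
    by (simp add: finsum_def finprod_def restrict_scalars_def)
  then show ?thesis by (simp add: fin_sum_def)
qed

section \<open>Rules for \<open>Y\<close> on the induced module and the span of the
  generators\<close>

context vcheck
begin

lemma Y_closed: "u \<in> carrier V \<Longrightarrow> v \<in> carrier V \<Longrightarrow> Y u n v \<in> carrier V"
  using vertex_algebra.Y_closed[OF V_vertex_algebra, of u v n] by simp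

lemma Y_add_left: "u \<in> carrier V \<Longrightarrow> u' \<in> carrier V \<Longrightarrow> v \<in> carrier V
    \<Longrightarrow> Y (u \<oplus>\<^bsub>V\<^esub> u') n v = Y u n v \<oplus>\<^bsub>V\<^esub> Y u' n v"
  using vertex_algebra.Y_add_left[OF V_vertex_algebra, of u u' v n] by simp

lemma Y_add_right: "u \<in> carrier V \<Longrightarrow> v \<in> carrier V \<Longrightarrow> v' \<in> carrier V
    \<Longrightarrow> Y u n (v \<oplus>\<^bsub>V\<^esub> v') = Y u n v \<oplus>\<^bsub>V\<^esub> Y u n v'"
  using vertex_algebra.Y_add_right[OF V_vertex_algebra, of u v v' n] by simp

lemma Y_zero_left: "v \<in> carrier V \<Longrightarrow> Y \<zero>\<^bsub>V\<^esub> n v = \<zero>\<^bsub>V\<^esub>"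
  using vertex_algebra.Y_smult_left[OF V_vertex_algebra, of vac v 0 n] vac_closed Y_closed
  by (simp add: smult_0)

lemma Y_zero_right: "v \<in> carrier V \<Longrightarrow> Y v n \<zero>\<^bsub>V\<^esub> = \<zero>\<^bsub>V\<^esub>"
  using vertex_algebra.Y_smult_right[OF V_vertex_algebra, of v vac n 0] vac_closed Y_closed
  by (simp add: smult_0)

lemma Y_truncation:
  assumes "u \<in> carrier V" "v \<in> carrier V"
  shows "eventually (\<lambda>N::nat. \<forall>i\<ge>N. Y u (k + int i) v = \<zero>\<^bsub>V\<^esub>) sequentially"
proof -
  obtain K where K: "\<forall>n\<ge>K. Y u n v = \<zero>\<^bsub>V\<^esub>"
    using vertex_algebra.truncation[OF V_vertex_algebra, of u v] assms by auto
  show ?thesis by (rule eventually_sequentiallyI[of "nat (K - k)"]) (use K in auto)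
qed

lemma Y_vac_nonneg: "v \<in> carrier V \<Longrightarrow> n \<ge> 0 \<Longrightarrow> Y v n vac = \<zero>\<^bsub>V\<^esub>"
  using vertex_algebra.creation_regular[OF V_vertex_algebra, of v n] by simp

lemma Y_vac: "Y vac n vac = (if n = - 1 then vac else \<zero>\<^bsub>V\<^esub>)"
  using vertex_algebra.vacuum[OF V_vertex_algebra, of vac n] vac_closed by simp

lemma fin_sum_single:
  assumes "\<And>i. i \<noteq> (0::nat) \<Longrightarrow> f i = \<zero>\<^bsub>V\<^esub>" "f 0 \<in> carrier V"
  shows "fin_sum V f = f 0"
proof -
  interpret A: abelian_monoid V by (rule V_abelian_monoid)
  show ?thesis
  proof (cases "f 0 = \<zero>\<^bsub>V\<^esub>")
    case True
    have "f i = \<zero>\<^bsub>V\<^esub>" for i using True assms(1)[of i] by (cases "i = 0") simp_all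
    then have "{i. f i \<noteq> \<zero>\<^bsub>V\<^esub>} = {}" by blast
    then show ?thesis using True by (simp add: fin_sum_def)
  next
    case False
    then have "{i. f i \<noteq> \<zero>\<^bsub>V\<^esub>} = {0}" using assms(1) by blast
    then show ?thesis using assms(2) by (simp add: fin_sum_def)
  qed
qed

text \<open>The compatibility axiom with the series 1 on the left factor: all derivatives of 1
  beyond the zeroth vanish.\<close>

lemma Y_smult_right:
  assumes "u \<in> carrier V" "v \<in> carrier V"
  shows "Y u n (f \<odot>\<^bsub>V\<^esub> v) = f \<odot>\<^bsub>V\<^esub> Y u n v"
proof -
  have z: "(fls_deriv ^^ i) 1 = (0 :: complex fls)" if "i \<noteq> 0" for i
  proof -
    obtain j where j: "i = Suc j" using \<open>i \<noteq> 0\<close> not0_implies_Suc by blast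
    have "(fls_deriv ^^ j) 0 = (0 :: complex fls)" for j by (induction j) simp_all
    then show ?thesis by (simp only: j funpow_Suc_right comp_apply fls_deriv_one)
  qed
  have "Y u n (f \<odot>\<^bsub>V\<^esub> v) = Y (1 \<odot>\<^bsub>V\<^esub> u) n (f \<odot>\<^bsub>V\<^esub> v)" by (simp add: smult_1 assms)
  also have "\<dots> = fin_sum V (\<lambda>i::nat. (fls_const (1 / fact i) * (fls_deriv ^^ i) 1 * f) \<odot>\<^bsub>V\<^esub> Y u (n + int i) v)"
    by (rule vertex_cz_algebra.cz_compatible[OF V_cz_algebra assms])
  also have "\<dots> = (fls_const (1 / fact 0) * (fls_deriv ^^ 0) 1 * f) \<odot>\<^bsub>V\<^esub> Y u (n + int 0) v"
    by (rule fin_sum_single) (simp_all add: z smult_0 Y_closed smult_closed assms)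
  finally show ?thesis by simp
qed

lemma Y_smult_left_vac:
  assumes "v \<in> carrier V"
  shows "Y (f \<odot>\<^bsub>V\<^esub> v) n vac
    = fin_sum V (\<lambda>i::nat. (fls_const (1 / fact i) * (fls_deriv ^^ i) f) \<odot>\<^bsub>V\<^esub> Y v (n + int i) vac)"
  using vertex_cz_algebra.cz_compatible[OF V_cz_algebra assms vac_closed, of f n 1]
  by (simp add: smult_1 vac_closed)

inductive_set gens :: "'g vacuum_elem set" where
  emb: "emb u \<in> gens"
| vac: "vac \<in> gens"
| add: "v \<in> gens \<Longrightarrow> w \<in> gens \<Longrightarrow> v \<oplus>\<^bsub>V\<^esub> w \<in> gens"
| smult: "v \<in> gens \<Longrightarrow> f \<odot>\<^bsub>V\<^esub> v \<in> gens"

lemma gens_closed: "v \<in> gens \<Longrightarrow> v \<in> carrier V"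
  by (induction rule: gens.induct) (auto intro: emb_closed vac_closed V_add_closed smult_closed)

text \<open>Nonnegative modes send a generator to multiples of generators and of the vacuum, kill
  the vacuum, and commute with scalars.\<close>

lemma gens_act: "v \<in> gens \<Longrightarrow> q \<ge> 0 \<Longrightarrow> act (gcheck_mode u q) v \<in> gens"
proof (induction rule: gens.induct)
  case (emb v)
  consider "q = 0" | "q \<ge> 1" using emb by linarith
  then show ?case
  proof cases
    case 1
    then show ?thesis by (auto simp: act_emb_0 intro: gens.intros)
  next
    case 2
    then show ?thesis by (auto simp: act_emb_pos intro: gens.intros)
  qed
next
  case vac
  then show ?case using gens.smult[OF gens.vac, of 0] by (simp add: act_vac_nonneg smult_0 vac_closed)
next
  case (add v w)
  then show ?case by (simp add: act_add_right gcheck_mode_in gens_closed gens.add)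
next
  case (smult v f)
  then show ?case by (simp add: act_smult gcheck_mode_in gens_closed gens.smult)
qed

end

section \<open>The Jacobi identity transported to fields\<close>

context field_map
begin

lemma \<Theta>_minus:
  assumes "v \<in> carrier V" "w \<in> carrier V"
  shows "\<Theta> (v \<ominus>\<^bsub>restrict_scalars V\<^esub> w) = \<Theta> v - \<Theta> w" "v \<ominus>\<^bsub>restrict_scalars V\<^esub> w \<in> carrier V"
proof -
  interpret A: abelian_group "restrict_scalars V"
    using vertex_algebra.axioms(1)[OF V_vertex_algebra] by (rule Module.module.axioms(2))
  show c: "v \<ominus>\<^bsub>restrict_scalars V\<^esub> w \<in> carrier V" using A.minus_closed[of v w] assms by simp
  have "(v \<ominus>\<^bsub>restrict_scalars V\<^esub> w) \<oplus>\<^bsub>V\<^esub> w = v"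
    using A.minus_add_cancel[of v w] assms by simp
  then show "\<Theta> (v \<ominus>\<^bsub>restrict_scalars V\<^esub> w) = \<Theta> v - \<Theta> w"
    using \<Theta>_add[OF c assms(2)] by (simp add: algebra_simps)
qed

lemma \<Theta>_finsum:
  assumes "finite A" "\<And>i. i \<in> A \<Longrightarrow> f i \<in> carrier V"
  shows "\<Theta> (finsum V f A) = (\<Sum>i\<in>A. \<Theta> (f i)) \<and> finsum V f A \<in> carrier V"
  using assms
proof (induction A rule: finite_induct)
  case empty
  show ?case by (simp add: abelian_monoid.finsum_empty[OF V_abelian_monoid] \<Theta>_zero)
next
  case (insert x A)
  then have "finsum V f (insert x A) = f x \<oplus>\<^bsub>V\<^esub> finsum V f A"
    by (intro abelian_monoid.finsum_insert[OF V_abelian_monoid]) auto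
  then show ?case using insert by (simp add: \<Theta>_add V_add_closed)
qed

lemma \<Theta>_fin_sum:
  assumes "\<And>i. f i \<in> carrier V" "\<And>i. i \<ge> N \<Longrightarrow> f i = \<zero>\<^bsub>V\<^esub>"
  shows "\<Theta> (fin_sum V f) = (\<Sum>i<(N::nat). \<Theta> (f i))" "fin_sum V f \<in> carrier V"
proof -
  have sub: "{i. f i \<noteq> \<zero>\<^bsub>V\<^esub>} \<subseteq> {..<N}" using assms(2) by (auto simp: not_le[symmetric])
  then have fin: "finite {i. f i \<noteq> \<zero>\<^bsub>V\<^esub>}" by (rule finite_subset) simp
  show "fin_sum V f \<in> carrier V" unfolding fin_sum_def using \<Theta>_finsum[OF fin] assms(1) by blast
  have "\<Theta> (fin_sum V f) = (\<Sum>i\<in>{i. f i \<noteq> \<zero>\<^bsub>V\<^esub>}. \<Theta> (f i))"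
    unfolding fin_sum_def using \<Theta>_finsum[OF fin] assms(1) by blast
  also have "\<dots> = (\<Sum>i<N. \<Theta> (f i))"
    by (rule sum.mono_neutral_left) (use sub in \<open>auto simp: \<Theta>_zero\<close>)
  finally show "\<Theta> (fin_sum V f) = (\<Sum>i<N. \<Theta> (f i))" .
qed

text \<open>Truncation in \<open>V\<close> gives the three sums of its Jacobi identity a common
  finite range, on which \<open>\<Theta>\<close> can be applied term by term.\<close>

lemma \<Theta>_jacobi:
  assumes u: "u \<in> carrier V" and v: "v \<in> carrier V" and w: "w \<in> carrier V"
  shows "eventually (\<lambda>N.
      (\<Sum>i<N. W.fscale (fls_const (lcf k i)) (\<Theta> (Y u (k + m - int i) (Y v (n + int i) w))))
      - (\<Sum>i<N. W.fscale (fls_const (rcf k i)) (\<Theta> (Y v (k + n - int i) (Y u (m + int i) w))))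
      = (\<Sum>i<N. W.fscale (fls_const (of_int m gchoose i)) (\<Theta> (Y (Y u (k + int i) v) (m + n - int i) w)))) sequentially"
  using Y_truncation[OF v w, of n] Y_truncation[OF u w, of m] Y_truncation[OF u v, of k]
proof eventually_elim
  case (elim N)
  let ?a = "\<lambda>i. fls_const (lcf k i) \<odot>\<^bsub>V\<^esub> Y u (k + m - int i) (Y v (n + int i) w)"
  let ?b = "\<lambda>i. fls_const (rcf k i) \<odot>\<^bsub>V\<^esub> Y v (k + n - int i) (Y u (m + int i) w)"
  let ?c = "\<lambda>i. fls_const (of_int m gchoose i) \<odot>\<^bsub>V\<^esub> Y (Y u (k + int i) v) (m + n - int i) w"
  have z: "f \<odot>\<^bsub>V\<^esub> \<zero>\<^bsub>V\<^esub> = \<zero>\<^bsub>V\<^esub>" for f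
    using smult_mult[OF vac_closed, of f 0] by (simp add: smult_0 vac_closed)
  have J: "fin_sum V ?a \<ominus>\<^bsub>restrict_scalars V\<^esub> fin_sum V ?b = fin_sum V ?c"
    using vertex_algebra.jacobi[OF V_vertex_algebra, of u v w k m n] u v w
    by (simp add: fin_sum_restrict lcf_def rcf_def)
  have a: "\<Theta> (fin_sum V ?a) = (\<Sum>i<N. \<Theta> (?a i))" "fin_sum V ?a \<in> carrier V"
    by (rule \<Theta>_fin_sum[where N = N]; use u v w elim in \<open>simp add: Y_closed smult_closed Y_zero_right z\<close>)+
  have b: "\<Theta> (fin_sum V ?b) = (\<Sum>i<N. \<Theta> (?b i))" "fin_sum V ?b \<in> carrier V"
    by (rule \<Theta>_fin_sum[where N = N]; use u v w elim in \<open>simp add: Y_closed smult_closed Y_zero_right z\<close>)+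
  have c: "\<Theta> (fin_sum V ?c) = (\<Sum>i<N. \<Theta> (?c i))"
    by (rule \<Theta>_fin_sum; use u v w elim in \<open>simp add: Y_closed smult_closed Y_zero_left z\<close>)
  have "\<Theta> (fin_sum V ?a) - \<Theta> (fin_sum V ?b) = \<Theta> (fin_sum V ?c)"
    using \<Theta>_minus(1)[OF a(2) b(2)] J by simp
  then show ?case
    unfolding a(1) b(1) c using u v w by (simp add: \<Theta>_smult Y_closed)
qed

lemma dfield_idf: "W.dfield s W.idf = (if s = 0 then W.idf else 0)"
proof (intro ext)
  fix n w
  have "dcf s n = 0" if "n - int s = - 1" "s \<noteq> 0"
  proof -
    obtain t where t: "s = Suc t" using \<open>s \<noteq> 0\<close> not0_implies_Suc by blast
    have "n = int t" using that t by simp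
    then have "(of_int n gchoose s :: complex) = of_nat (t choose s)"
      by (simp add: binomial_gbinomial)
    then show ?thesis using t by (simp add: dcf_def)
  qed
  then show "W.dfield s W.idf n w = (if s = 0 then W.idf else 0) n w"
    by (cases "s = 0") (auto simp: W.dfield_def W.idf_def dcf_def[of 0])
qed

lemma dfield_add: "W.dfield s (\<alpha> + \<beta>) = W.dfield s \<alpha> + W.dfield s \<beta>"
  by (intro ext) (simp add: W.dfield_def W.scale_right_distrib)

text \<open>The right-hand sum does not depend on N as long as the omitted terms vanish. Quantifying
  over all such N lets \<open>Jac\<close> be used with any bound and, by \<open>JacI\<close>, be
  proved for large ones. The index k is a parameter because the inductive step changes it.\<close>

definition Jac :: "'g vacuum_elem \<Rightarrow> 'g vacuum_elem \<Rightarrow> int \<Rightarrow> bool" where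
  "Jac v v' k \<longleftrightarrow> (\<forall>m N. (\<forall>i\<ge>N. Y v (k + int i) v' = \<zero>\<^bsub>V\<^esub>) \<longrightarrow>
    W.prd m k (\<Theta> v) (\<Theta> v') = (\<Sum>i<N. W.fscale (W.xbin m i) (\<Theta> (Y v (k + int i) v'))))"

lemma Jac_sum_extend:
  assumes "\<forall>i\<ge>N. Y v (k + int i) v' = \<zero>\<^bsub>V\<^esub>" "N \<le> N'"
  shows "(\<Sum>i<N. W.fscale (W.xbin m i) (\<Theta> (Y v (k + int i) v'))) = (\<Sum>i<N'. W.fscale (W.xbin m i) (\<Theta> (Y v (k + int i) v')))"
  by (rule sum.mono_neutral_left) (use assms in \<open>auto simp: \<Theta>_zero\<close>)

lemma JacI:
  assumes "v \<in> carrier V" "v' \<in> carrier V"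
    and "\<And>m. eventually (\<lambda>N. W.prd m k (\<Theta> v) (\<Theta> v') = (\<Sum>i<N. W.fscale (W.xbin m i) (\<Theta> (Y v (k + int i) v')))) sequentially"
  shows "Jac v v' k"
  unfolding Jac_def
proof (intro allI impI)
  fix m N assume N: "\<forall>i\<ge>N. Y v (k + int i) v' = \<zero>\<^bsub>V\<^esub>"
  have "eventually (\<lambda>N'. N \<le> N' \<and> W.prd m k (\<Theta> v) (\<Theta> v') = (\<Sum>i<N'. W.fscale (W.xbin m i) (\<Theta> (Y v (k + int i) v')))) sequentially"
    by (intro eventually_conj assms(3) eventually_ge_at_top)
  then obtain N' where "N \<le> N'" "W.prd m k (\<Theta> v) (\<Theta> v') = (\<Sum>i<N'. W.fscale (W.xbin m i) (\<Theta> (Y v (k + int i) v')))"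
    using eventually_happens'[OF sequentially_bot] by blast
  then show "W.prd m k (\<Theta> v) (\<Theta> v') = (\<Sum>i<N. W.fscale (W.xbin m i) (\<Theta> (Y v (k + int i) v')))"
    using Jac_sum_extend[OF N] by simp
qed

lemma Jac_eventually:
  assumes "v \<in> carrier V" "v' \<in> carrier V" "Jac v v' k"
  shows "eventually (\<lambda>N. W.prd m k (\<Theta> v) (\<Theta> v') = (\<Sum>i<N. W.fscale (W.xbin m i) (\<Theta> (Y v (k + int i) v')))) sequentially"
  using Y_truncation[OF assms(1,2), of k] by (rule eventually_mono) (use assms(3) in \<open>auto simp: Jac_def\<close>)

lemma Jac_add:
  assumes "v \<in> carrier V" "a \<in> carrier V" "b \<in> carrier V" "Jac v a k" "Jac v b k"
  shows "Jac v (a \<oplus>\<^bsub>V\<^esub> b) k"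
proof (rule JacI[OF assms(1) V_add_closed[OF assms(2,3)]])
  fix m
  show "\<forall>\<^sub>F N in sequentially. W.prd m k (\<Theta> v) (\<Theta> (a \<oplus>\<^bsub>V\<^esub> b))
      = (\<Sum>i<N. W.fscale (W.xbin m i) (\<Theta> (Y v (k + int i) (a \<oplus>\<^bsub>V\<^esub> b))))"
    using Jac_eventually[OF assms(1,2,4), of m] Jac_eventually[OF assms(1,3,5), of m]
    by eventually_elim
      (use assms in \<open>simp add: \<Theta>_add \<Theta>_fields Y_add_right Y_closed W.prd_add_right W.fscale_add_right sum.distrib\<close>)
qed

text \<open>f(x_2) factors out of both sides, by \<open>W.prd_fscale_right\<close> on fields and
  \<open>Y_smult_right\<close> in \<open>V\<close>.\<close>

lemma Jac_smult:
  assumes "v \<in> carrier V" "a \<in> carrier V" "Jac v a k"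
  shows "Jac v (f \<odot>\<^bsub>V\<^esub> a) k"
proof (rule JacI[OF assms(1) smult_closed[OF assms(2)]])
  fix m
  show "\<forall>\<^sub>F N in sequentially. W.prd m k (\<Theta> v) (\<Theta> (f \<odot>\<^bsub>V\<^esub> a))
      = (\<Sum>i<N. W.fscale (W.xbin m i) (\<Theta> (Y v (k + int i) (f \<odot>\<^bsub>V\<^esub> a))))"
    using Jac_eventually[OF assms, of m]
  proof eventually_elim
    case (elim N)
    have "W.prd m k (\<Theta> v) (\<Theta> (f \<odot>\<^bsub>V\<^esub> a)) = W.fscale f (\<Sum>i<N. W.fscale (W.xbin m i) (\<Theta> (Y v (k + int i) a)))"
      using assms elim by (simp add: \<Theta>_smult \<Theta>_fields W.prd_fscale_right)
    also have "\<dots> = (\<Sum>i<N. W.fscale (W.xbin m i) (W.fscale f (\<Theta> (Y v (k + int i) a))))"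
      using assms by (simp add: W.fscale_sum_right \<Theta>_fields Y_closed W.fscale_mult[symmetric] mult.commute)
    finally show ?case using assms by (simp add: Y_smult_right \<Theta>_smult Y_closed)
  qed
qed

context
  assumes \<Theta>_act: "\<And>u n v. v \<in> carrier V \<Longrightarrow> \<Theta> (act (gcheck_mode u n) v) = W.prd 0 n (\<Theta> (emb u)) (\<Theta> v)"
begin

text \<open>In a vertex algebra the mode of index -s-1 of v sends the vacuum to D^s v / s!; under
  \<open>\<Theta>\<close> the operator D becomes d/dx. For scalars the factor f(z + x) yields the
  Leibniz rule \<open>W.dfield_fscale\<close>, for u(k) v the Jacobi identity of \<open>V\<close>
  yields \<open>W.dfield_prd\<close>.\<close>

lemma \<Theta>_Y_vac:
  assumes "v \<in> carrier V"
  shows "\<Theta> (Y v (- int s - 1) vac) = W.dfield s (\<Theta> v)"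
  using assms
proof (induction v arbitrary: s rule: V_induct)
  case vac
  then show ?case by (simp add: Y_vac \<Theta>_vac dfield_idf) (simp add: \<Theta>_zero)
next
  case (add v w)
  then show ?case by (simp only: Y_add_left vac_closed \<Theta>_add Y_closed dfield_add)
next
  case (smult f v)
  let ?f = "\<lambda>i::nat. (fls_const (1 / fact i) * (fls_deriv ^^ i) f) \<odot>\<^bsub>V\<^esub> Y v (- int s - 1 + int i) vac"
  have z: "h \<odot>\<^bsub>V\<^esub> \<zero>\<^bsub>V\<^esub> = \<zero>\<^bsub>V\<^esub>" for h
    using smult_mult[OF vac_closed, of h 0] by (simp add: smult_0 vac_closed)
  have "\<Theta> (Y (f \<odot>\<^bsub>V\<^esub> v) (- int s - 1) vac) = (\<Sum>i<Suc s. \<Theta> (?f i))"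
    unfolding Y_smult_left_vac[OF smult(1)]
    by (rule \<Theta>_fin_sum(1)) (use smult(1) in \<open>simp_all add: smult_closed Y_closed vac_closed Y_vac_nonneg z\<close>)
  also have "\<dots> = (\<Sum>i\<le>s. W.fscale (fls_const (1 / fact i) * (fls_deriv ^^ i) f) (W.dfield (s - i) (\<Theta> v)))"
    unfolding lessThan_Suc_atMost
  proof (rule sum.cong[OF refl])
    fix i assume "i \<in> {..s}"
    then have "- int s - 1 + int i = - int (s - i) - 1" by (simp add: of_nat_diff)
    then show "\<Theta> (?f i) = W.fscale (fls_const (1 / fact i) * (fls_deriv ^^ i) f) (W.dfield (s - i) (\<Theta> v))"
      using smult by (simp only: \<Theta>_smult Y_closed vac_closed)
  qed
  also have "\<dots> = W.dfield s (\<Theta> (f \<odot>\<^bsub>V\<^esub> v))"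
    using smult(1) by (simp add: \<Theta>_smult W.dfield_fscale \<Theta>_fields)
  finally show ?case .
next
  case (act u k v)
  have e: "emb u \<in> carrier V" by (rule emb_closed)
  obtain N0 where N0: "\<forall>N\<ge>N0.
      (\<Sum>i<N. W.fscale (fls_const (lcf k i)) (\<Theta> (Y (emb u) (k + 0 - int i) (Y v (- int s - 1 + int i) vac))))
      - (\<Sum>i<N. W.fscale (fls_const (rcf k i)) (\<Theta> (Y v (k + (- int s - 1) - int i) (Y (emb u) (0 + int i) vac))))
      = (\<Sum>i<N. W.fscale (fls_const (of_int 0 gchoose i)) (\<Theta> (Y (Y (emb u) (k + int i) v) (0 + (- int s - 1) - int i) vac)))"
    using \<Theta>_jacobi[OF e act(1) vac_closed, of k 0 "- int s - 1"] unfolding eventually_sequentially by blast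
  \<comment> \<open>Modes of v of index -s-1+i with i > s kill the vacuum, so any N > s captures the
    whole first sum.\<close>
  define N where "N = max N0 (Suc s)"
  have N: "N \<ge> N0" "N \<ge> Suc s" "N > 0" by (auto simp: N_def)
  \<comment> \<open>Nonnegative modes of u kill the vacuum, so the second sum drops out; since m =
    0, the right-hand side is the single term i = 0.\<close>
  have r: "(\<Sum>i<N. W.fscale (fls_const (rcf k i)) (\<Theta> (Y v (k + (- int s - 1) - int i) (Y (emb u) (0 + int i) vac)))) = 0"
    by (rule sum.neutral) (use e act(1) in \<open>simp add: Y_vac_nonneg Y_zero_right \<Theta>_zero\<close>)
  have "(\<Sum>i<N. W.fscale (fls_const (of_int 0 gchoose i)) (\<Theta> (Y (Y (emb u) (k + int i) v) (0 + (- int s - 1) - int i) vac)))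
      = (\<Sum>i\<in>{0}. W.fscale (fls_const (of_int 0 gchoose i)) (\<Theta> (Y (Y (emb u) (k + int i) v) (0 + (- int s - 1) - int i) vac)))"
    by (rule sum.mono_neutral_right) (use N in \<open>auto simp: gbinomial_0_left\<close>)
  also have "\<dots> = \<Theta> (Y (act (gcheck_mode u k) v) (- int s - 1) vac)"
    by (simp add: W.fscale_one Y_emb act(1))
  finally have "\<Theta> (Y (act (gcheck_mode u k) v) (- int s - 1) vac)
      = (\<Sum>i<N. W.fscale (fls_const (lcf k i)) (\<Theta> (Y (emb u) (k + 0 - int i) (Y v (- int s - 1 + int i) vac))))"
    using N0[rule_format, OF N(1)] r by simp
  also have "\<dots> = (\<Sum>i\<le>s. W.fscale (fls_const (lcf k i)) (\<Theta> (Y (emb u) (k + 0 - int i) (Y v (- int s - 1 + int i) vac))))"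
    by (rule sum.mono_neutral_right) (use N e act(1) in \<open>auto simp: Y_vac_nonneg Y_zero_right \<Theta>_zero\<close>)
  also have "\<dots> = (\<Sum>i\<le>s. W.fscale (fls_const (lcf k i)) (W.prd 0 (k - int i) (\<Theta> (emb u)) (W.dfield (s - i) (\<Theta> v))))"
  proof (rule sum.cong[OF refl])
    fix i assume "i \<in> {..s}"
    then have i: "- int s - 1 + int i = - int (s - i) - 1" by (simp add: of_nat_diff)
    have c: "Y v (- int (s - i) - 1) vac \<in> carrier V" using act(1) by (simp add: Y_closed vac_closed)
    show "W.fscale (fls_const (lcf k i)) (\<Theta> (Y (emb u) (k + 0 - int i) (Y v (- int s - 1 + int i) vac)))
      = W.fscale (fls_const (lcf k i)) (W.prd 0 (k - int i) (\<Theta> (emb u)) (W.dfield (s - i) (\<Theta> v)))"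
      unfolding i by (simp only: Y_emb[OF c] \<Theta>_act[OF c] act(2) add_0_right)
  qed
  also have "\<dots> = W.dfield s (\<Theta> (act (gcheck_mode u k) v))"
    using act(1) e
    by (intro ext) (simp add: W.sum_fun_apply W.fscale_const \<Theta>_act W.dfield_prd \<Theta>_fields)
  finally show ?case .
qed

text \<open>For k \<ge> 0 both sides vanish. For k = -s-1, \<open>\<Theta>_Y_vac\<close> turns the
  right-hand side into the expansion of \<open>W.prd_idf_right_expansion\<close>. The bound -k is
  where k + i becomes nonnegative.\<close>

lemma Jac_vac:
  assumes v: "v \<in> carrier V"
  shows "Jac v vac k"
proof (rule JacI[OF v vac_closed])
  fix m
  have "W.prd m k (\<Theta> v) (\<Theta> vac) = (\<Sum>i<N. W.fscale (W.xbin m i) (\<Theta> (Y v (k + int i) vac)))" if N: "N \<ge> nat (- k)" for N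
  proof (cases "k \<ge> 0")
    case True
    then have "(\<Sum>i<N. W.fscale (W.xbin m i) (\<Theta> (Y v (k + int i) vac))) = 0"
      by (intro sum.neutral) (simp add: v Y_vac_nonneg \<Theta>_zero)
    then show ?thesis using True v by (simp add: \<Theta>_vac W.prd_idf_right_nonneg \<Theta>_fields)
  next
    case False
    define s where "s = nat (- k - 1)"
    have k: "k = - int s - 1" using False by (simp add: s_def)
    have "(\<Sum>i<N. W.fscale (W.xbin m i) (\<Theta> (Y v (k + int i) vac))) = (\<Sum>i\<le>s. W.fscale (W.xbin m i) (\<Theta> (Y v (k + int i) vac)))"
      by (rule sum.mono_neutral_right) (use N v in \<open>auto simp: k Y_vac_nonneg \<Theta>_zero\<close>)
    also have "\<dots> = (\<Sum>i\<le>s. W.fscale (W.xbin m i) (W.dfield (s - i) (\<Theta> v)))"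
    proof (rule sum.cong[OF refl])
      fix i assume "i \<in> {..s}"
      then have i: "k + int i = - int (s - i) - 1" by (simp add: k of_nat_diff)
      show "W.fscale (W.xbin m i) (\<Theta> (Y v (k + int i) vac)) = W.fscale (W.xbin m i) (W.dfield (s - i) (\<Theta> v))"
        unfolding i by (simp only: \<Theta>_Y_vac[OF v])
    qed
    also have "\<dots> = W.prd m k (\<Theta> v) (\<Theta> vac)"
      unfolding k \<Theta>_vac
      by (intro ext) (simp only: W.prd_idf_right_expansion[OF \<Theta>_fields[OF v]] W.sum_fun_apply W.fscale_xbin)
    finally show ?thesis by simp
  qed
  then show "\<forall>\<^sub>F N in sequentially. W.prd m k (\<Theta> v) (\<Theta> vac) = (\<Sum>i<N. W.fscale (W.xbin m i) (\<Theta> (Y v (k + int i) vac)))"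
    unfolding eventually_sequentially by blast
qed

text \<open>The Jacobi identity of \<open>V\<close> at exponent 0 of x_1 - x_2, where (0 choose i)
  leaves one term in each sum on the left: the commutator formula inside \<open>V\<close>.\<close>

lemma \<Theta>_act_Y:
  assumes v: "v \<in> carrier V" and w: "w \<in> carrier V" and Q: "\<forall>q\<ge>Q. act (gcheck_mode u (int q)) v = \<zero>\<^bsub>V\<^esub>"
  shows "\<Theta> (act (gcheck_mode u j) (Y v k w)) - \<Theta> (Y v k (act (gcheck_mode u j) w))
    = (\<Sum>q<Q. W.fscale (fls_const (of_int j gchoose q)) (\<Theta> (Y (act (gcheck_mode u (int q)) v) (j + k - int q) w)))"
proof -
  have e: "emb u \<in> carrier V" by (rule emb_closed)
  obtain N0 where N0: "\<forall>N\<ge>N0.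
      (\<Sum>i<N. W.fscale (fls_const (lcf 0 i)) (\<Theta> (Y (emb u) (0 + j - int i) (Y v (k + int i) w))))
      - (\<Sum>i<N. W.fscale (fls_const (rcf 0 i)) (\<Theta> (Y v (0 + k - int i) (Y (emb u) (j + int i) w))))
      = (\<Sum>i<N. W.fscale (fls_const (of_int j gchoose i)) (\<Theta> (Y (Y (emb u) (0 + int i) v) (j + k - int i) w)))"
    using \<Theta>_jacobi[OF e v w, of 0 j k] unfolding eventually_sequentially by blast
  define N where "N = max N0 (Suc Q)"
  have N: "N \<ge> N0" "N \<ge> Q" "N > 0" by (auto simp: N_def)
  have "(\<Sum>i<N. W.fscale (fls_const (lcf 0 i)) (\<Theta> (Y (emb u) (0 + j - int i) (Y v (k + int i) w))))
      = (\<Sum>i\<in>{0}. W.fscale (fls_const (lcf 0 i)) (\<Theta> (Y (emb u) (0 + j - int i) (Y v (k + int i) w))))"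
    by (rule sum.mono_neutral_right) (use N in \<open>auto simp: gbinomial_0_left lcf_def\<close>)
  moreover have "(\<Sum>i<N. W.fscale (fls_const (rcf 0 i)) (\<Theta> (Y v (0 + k - int i) (Y (emb u) (j + int i) w))))
      = (\<Sum>i\<in>{0}. W.fscale (fls_const (rcf 0 i)) (\<Theta> (Y v (0 + k - int i) (Y (emb u) (j + int i) w))))"
    by (rule sum.mono_neutral_right) (use N in \<open>auto simp: gbinomial_0_left rcf_def\<close>)
  moreover have "(\<Sum>i<N. W.fscale (fls_const (of_int j gchoose i)) (\<Theta> (Y (Y (emb u) (0 + int i) v) (j + k - int i) w)))
      = (\<Sum>i<Q. W.fscale (fls_const (of_int j gchoose i)) (\<Theta> (Y (Y (emb u) (0 + int i) v) (j + k - int i) w)))"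
    by (rule sum.mono_neutral_right) (use N Q v w in \<open>auto simp: Y_emb Y_zero_left \<Theta>_zero\<close>)
  ultimately show ?thesis
    using N0[rule_format, OF N(1)] v w by (simp add: W.fscale_one Y_emb Y_closed rcf_def)
qed

text \<open>Commuting \<open>u\<^sub>j\<close> past both sides moves the Jacobi identity from \<open>w\<close> to \<open>u\<^sub>j w\<close>; this needs it for
  \<open>u\<^sub>q v\<close> with \<open>q \<ge> 0\<close> in place of \<open>v\<close>, hence the set \<open>T\<close> closed under these operators.\<close>

lemma Jac_induct:
  assumes T: "T \<subseteq> carrier V" "\<And>v u q. v \<in> T \<Longrightarrow> act (gcheck_mode u (int q)) v \<in> T"
    and comm: "\<And>v u. v \<in> T \<Longrightarrow> Jac (emb u) v 0"
    and v: "v \<in> T" and w: "w \<in> carrier V"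
  shows "Jac v w k"
  using w v
proof (induction w arbitrary: v k rule: V_induct)
  case vac
  then show ?case using T(1) Jac_vac by blast
next
  case (add a b)
  then show ?case using T(1) Jac_add by blast
next
  case (smult f a)
  then show ?case using T(1) Jac_smult by blast
next
  case (act u j w v k)
  have v: "v \<in> carrier V" and e: "emb u \<in> carrier V" using act.prems T(1) emb_closed by auto
  note w = act(1)
  obtain Q where "\<forall>q\<ge>Q. Y (emb u) (0 + int q) v = \<zero>\<^bsub>V\<^esub>"
    using eventually_happens'[OF sequentially_bot Y_truncation[OF e v, of 0]] by blast
  then have Q: "\<forall>q\<ge>Q. act (gcheck_mode u (int q)) v = \<zero>\<^bsub>V\<^esub>" using v by (simp add: Y_emb)
  define uq where "uq q = act (gcheck_mode u (int q)) v" for q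
  have uqT: "uq q \<in> T" for q unfolding uq_def by (rule T(2)[OF act.prems])
  then have uqV: "uq q \<in> carrier V" for q using T(1) by blast
  \<comment> \<open>At exponent 0 a product is a commutator, so \<open>comm\<close> supplies the
    hypothesis of \<open>W.prd_commutator\<close>.\<close>
  have comm': "\<Theta> (emb u) s (\<Theta> v t x) - \<Theta> v t (\<Theta> (emb u) s x)
      = (\<Sum>q<Q. scW (of_int s gchoose q) (\<Theta> (uq q) (s + t - int q) x))" for s t x
  proof -
    have "W.prd s 0 (\<Theta> (emb u)) (\<Theta> v) = (\<Sum>q<Q. W.fscale (W.xbin s q) (\<Theta> (Y (emb u) (0 + int q) v)))"
      using comm[OF act.prems, of u] Q v unfolding Jac_def by (simp add: Y_emb)
    then show ?thesis
      using W.prd_k0[OF \<Theta>_fields[OF e] \<Theta>_fields[OF v], of s t x] v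
      by (simp add: W.sum_fun_apply W.fscale_xbin Y_emb uq_def)
  qed
  show ?case
  proof (rule JacI[OF v act_closed[OF gcheck_mode_in w]])
    fix m
    \<comment> \<open>Only q < Q occur, so one N serves the induction hypotheses for all
      \<open>uq q\<close>.\<close>
    have "eventually (\<lambda>N. \<forall>q\<in>{..<Q}. W.prd m (k + j - int q) (\<Theta> (uq q)) (\<Theta> w)
        = (\<Sum>i<N. W.fscale (W.xbin m i) (\<Theta> (Y (uq q) (k + j - int q + int i) w)))) sequentially"
      by (intro eventually_ball_finite ballI Jac_eventually uqV w act(2) uqT) simp
    with Jac_eventually[OF v w act(2)[OF act.prems], of m k]
    show "\<forall>\<^sub>F N in sequentially. W.prd m k (\<Theta> v) (\<Theta> (act (gcheck_mode u j) w))
      = (\<Sum>i<N. W.fscale (W.xbin m i) (\<Theta> (Y v (k + int i) (act (gcheck_mode u j) w))))"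
    proof eventually_elim
      case (elim N)
      have e1: "W.prd m k (\<Theta> v) (\<Theta> w) = (\<Sum>i<N. W.fscale (W.xbin m i) (\<Theta> (Y v (k + int i) w)))"
        using elim by blast
      have Yc: "Y v (k + int i) w \<in> carrier V" "Y (uq q) t w \<in> carrier V" for i q t
        using v w uqV by (simp_all add: Y_closed)
      have "W.prd m k (\<Theta> v) (\<Theta> (act (gcheck_mode u j) w)) n x
          = (\<Sum>i<N. W.fscale (W.xbin m i) (\<Theta> (Y v (k + int i) (act (gcheck_mode u j) w)))) n x" for n x
      proof -
        have "W.prd m k (\<Theta> v) (\<Theta> (act (gcheck_mode u j) w)) n x
          = W.prd 0 j (\<Theta> (emb u)) (W.prd m k (\<Theta> v) (\<Theta> w)) n x
            - (\<Sum>q<Q. scW (of_int j gchoose q) (W.prd m (k + j - int q) (\<Theta> (uq q)) (\<Theta> w) n x))"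
          using W.prd_commutator[OF \<Theta>_fields[OF e] \<Theta>_fields[OF v] \<Theta>_fields[OF w] \<Theta>_fields[OF uqV] comm', of j m k n x]
          by (simp add: \<Theta>_act[OF w] algebra_simps)
        also have "W.prd 0 j (\<Theta> (emb u)) (W.prd m k (\<Theta> v) (\<Theta> w))
            = (\<Sum>i<N. W.fscale (W.xbin m i) (\<Theta> (act (gcheck_mode u j) (Y v (k + int i) w))))"
          unfolding e1 using e Yc
          by (simp add: W.prd_sum_right W.prd_fscale_right \<Theta>_fields \<Theta>_act)
        \<comment> \<open>The induction hypothesis for \<open>uq q\<close> at the index k + j - q;
          for this both v and k are arbitrary in the induction.\<close>
        also have "(\<Sum>q<Q. scW (of_int j gchoose q) (W.prd m (k + j - int q) (\<Theta> (uq q)) (\<Theta> w) n x))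
            = (\<Sum>i<N. W.fscale (W.xbin m i)
                (\<Sum>q<Q. W.fscale (fls_const (of_int j gchoose q)) (\<Theta> (Y (uq q) (j + (k + int i) - int q) w))) n x)"
        proof -
          have "(\<Sum>q<Q. scW (of_int j gchoose q) (W.prd m (k + j - int q) (\<Theta> (uq q)) (\<Theta> w) n x))
            = (\<Sum>q<Q. \<Sum>i<N. scW (of_int m gchoose i) (scW (of_int j gchoose q) (\<Theta> (Y (uq q) (j + (k + int i) - int q) w) (m + n - int i) x)))"
          proof (rule sum.cong[OF refl])
            fix q assume "q \<in> {..<Q}"
            then have "W.prd m (k + j - int q) (\<Theta> (uq q)) (\<Theta> w)
                = (\<Sum>i<N. W.fscale (W.xbin m i) (\<Theta> (Y (uq q) (k + j - int q + int i) w)))"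
              using elim by blast
            moreover have "k + j - int q + int i = j + (k + int i) - int q" for i by simp
            ultimately show "scW (of_int j gchoose q) (W.prd m (k + j - int q) (\<Theta> (uq q)) (\<Theta> w) n x)
              = (\<Sum>i<N. scW (of_int m gchoose i) (scW (of_int j gchoose q) (\<Theta> (Y (uq q) (j + (k + int i) - int q) w) (m + n - int i) x)))"
              by (simp only: W.sum_fun_apply W.fscale_xbin W.scale_sum_right W.scale_left_commute)
          qed
          then show ?thesis
            by (subst (asm) sum.swap)
              (simp add: W.fscale_xbin W.sum_fun_apply W.fscale_const W.scale_sum_right)
        qed
        also have "(\<Sum>i<N. W.fscale (W.xbin m i) (\<Theta> (act (gcheck_mode u j) (Y v (k + int i) w)))) n x - \<dots>
            = (\<Sum>i<N. scW (of_int m gchoose i)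
                ((\<Theta> (act (gcheck_mode u j) (Y v (k + int i) w)) - (\<Sum>q<Q. W.fscale (fls_const (of_int j gchoose q)) (\<Theta> (Y (uq q) (j + (k + int i) - int q) w)))) (m + n - int i) x))"
          by (simp add: W.sum_fun_apply W.fscale_xbin sum_subtractf[symmetric] W.scale_right_diff_distrib[symmetric])
        \<comment> \<open>The commutator formula inside \<open>V\<close> has the same correction
          terms as the one for fields, so their difference leaves u(j) w in the second slot.\<close>
        also have "\<dots> = (\<Sum>i<N. W.fscale (W.xbin m i) (\<Theta> (Y v (k + int i) (act (gcheck_mode u j) w)))) n x"
          unfolding uq_def \<Theta>_act_Y[OF v w Q, symmetric]
          by (simp add: W.sum_fun_apply W.fscale_xbin)
        finally show ?thesis .
      qed
      then show ?case by (intro ext)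
    qed
  qed
qed

lemma Jac_all:
  assumes comm: "\<And>u v. Jac (emb u) (emb v) 0"
    and v: "v \<in> carrier V" and w: "w \<in> carrier V"
  shows "Jac v w k"
proof -
  have g: "Jac (emb u) v 0" if "v \<in> gens" for u v
    using that
  proof (induction rule: gens.induct)
    case (emb v)
    then show ?case by (rule comm)
  next
    case vac
    then show ?case using Jac_vac emb_closed by blast
  next
    case (add v w)
    then show ?case using Jac_add emb_closed gens_closed by blast
  next
    case (smult v f)
    then show ?case using Jac_smult emb_closed gens_closed by blast
  qed
  have all: "Jac (emb u) v 0" if "v \<in> carrier V" for u v
  proof (rule Jac_induct)
    show "gens \<subseteq> carrier V" using gens_closed by blast
    show "act (gcheck_mode u (int q)) v \<in> gens" if "v \<in> gens" for v u q
      using that by (rule gens_act) simp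
    show "Jac (emb u) v 0" if "v \<in> gens" for v u using that by (rule g)
    show "emb u \<in> gens" by (rule gens.emb)
  qed (rule that)
  show ?thesis
  \<comment> \<open>Commutators of generators with every element are now available, so all of
    \<open>V\<close> can serve as \<open>T\<close>.\<close>
  proof (rule Jac_induct)
    show "carrier V \<subseteq> carrier V" ..
    show "act (gcheck_mode u (int q)) v \<in> carrier V" if "v \<in> carrier V" for v u q
      by (rule act_closed[OF gcheck_mode_in that])
  qed (fact all v w)+
qed

end

end

section \<open>From restricted modules to type zero modules\<close>

context quadratic_lie_algebra
begin

lemma czt_pair_induct [consumes 2, case_names stens add]:
  assumes u: "fst u \<in> czt" "snd u \<in> czt"
    and stens: "\<And>f a b. P (stens f a, stens f b)"
    and add: "\<And>u v. fst u \<in> czt \<Longrightarrow> snd u \<in> czt \<Longrightarrow> fst v \<in> czt \<Longrightarrow> snd v \<in> czt \<Longrightarrow> P u \<Longrightarrow> P v \<Longrightarrow> P (u + v)"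
  shows "P u"
proof -
  have zero: "P 0" using stens[of 0 0 0] by (simp add: zero_prod_def)
  have 1: "P (F, 0)" if "F \<in> czt" for F
    using that
  proof (induction F rule: czt_induct)
    case zero
    show ?case using \<open>P 0\<close> by (simp add: zero_prod_def)
  next
    case (add F f a)
    then show ?case using assms(4)[of "(F, 0)" "(stens f a, 0)"] stens[of f a 0]
      by (simp add: czt_zero stens_in_czt)
  qed
  have 2: "P (0, F)" if "F \<in> czt" for F
    using that
  proof (induction F rule: czt_induct)
    case zero
    show ?case using \<open>P 0\<close> by (simp add: zero_prod_def)
  next
    case (add F f a)
    then show ?case using assms(4)[of "(0, F)" "(0, stens f a)"] stens[of f 0 a]
      by (simp add: czt_zero stens_in_czt)
  qed
  have "P ((fst u, 0) + (0, snd u))"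
    by (rule add) (simp_all add: u czt_zero 1 2)
  then show ?thesis by simp
qed

lemma gsc_gsc_mode: "gsc c (gsc f (gcheck_mode u n)) = gsc (c * f) (gcheck_mode u n)"
proof -
  obtain a b where u: "u = (a, b)" by (cases u)
  show ?thesis
    unfolding u by (simp only: gsc_gcheck_mode affine_scale_mode[of fsc, OF fsc_zero] fsc_stens)
qed

lemma gsc_gsc_central: "gsc c (gsc d central) = gsc (c * d) central"
  unfolding gsc_central
  by (rule affine_eqI) (simp_all add: lookup_affine_scale[of fsc, OF fsc_zero] fsc_zero)

end

section \<open>The action on fields defined by a restricted module\<close>

context vcheck_space
begin

context
  fixes \<rho> :: "(complex, 'g) affine \<Rightarrow> 'w \<Rightarrow> 'w"
  assumes \<rho>: "restricted_ghat_module sc br form p l scW \<rho>"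
begin

text \<open>These rules also apply to eta-expanded sums, and replace a sum of fields by an abstraction.\<close>

declare plus_fun_apply [simp del] and minus_apply [simp del]

definition rf :: "'g \<times> 'g \<Rightarrow> int \<Rightarrow> 'w \<Rightarrow> 'w" where
  "rf u n = \<rho> (mode u n)"

lemmas \<rho>_module = restricted_ghat_module.axioms(1)[OF \<rho>]

lemma rf_fields: "rf u \<in> W.fields"
  using ghat_module.act_linear[OF \<rho>_module] restricted_ghat_module.restricted[OF \<rho>]
  by (simp add: W.fields_def rf_def)

lemma rf_add: "rf (u + v) = rf u + rf v"
  by (intro ext) (simp add: rf_def mode_add ghat_module.act_add[OF \<rho>_module] plus_fun_apply)

lemma rf_scale: "rf (sc c a, sc c b) = W.fscale (fls_const c) (rf (a, b))"
proof (intro ext)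
  fix n w
  have "mode (sc c a, sc c b) n = affine_scale sc c (mode (a, b) n)"
    by (rule affine_scale_mode[symmetric]) simp
  then show "rf (sc c a, sc c b) n w = W.fscale (fls_const c) (rf (a, b)) n w"
    by (simp add: rf_def W.fscale_const ghat_module.act_scale[OF \<rho>_module])
qed

lemma rf_commutator:
  "rf u m (rf v n w) - rf v n (rf u m w)
    = (\<Sum>q<2. scW (of_int m gchoose q) (bracket_field (rf (br0 u v)) (rf (br1 u v)) u v q (m + n - int q) w))"
proof -
  obtain a a' b b' where uv: "u = (a, a')" "v = (b, b')" by (metis prod.exhaust)
  have \<rho>c: "\<rho> (0, c) w = scW (l * c) w" for c
  proof -
    have "(0, c) = affine_scale sc c central" by (rule affine_scale_central[symmetric]) simp
    then show ?thesis
      using ghat_module.act_scale[OF \<rho>_module, of c central w] restricted_ghat_module.level[OF \<rho>, of w]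
      by (simp add: mult.commute)
  qed
  have \<rho>0: "\<rho> 0 w = 0" using \<rho>c[of 0] by (simp add: zero_prod_def)
  have \<rho>add: "\<rho> (x + y) w = \<rho> x w + \<rho> y w" for x y by (rule ghat_module.act_add[OF \<rho>_module])
  have \<rho>sum: "\<rho> (sum f A) w = (\<Sum>i\<in>A. \<rho> (f i) w)" for f :: "nat \<Rightarrow> (complex, 'g) affine" and A
    by (induction A rule: infinite_finite_induct) (simp_all add: \<rho>0 \<rho>add)
  have s: "\<rho> (mode (sc c (br a' b'), 0) k) w = scW c (rf (br a' b', 0) k w)" for c k
    using rf_scale[of c "br a' b'" 0] by (simp add: W.fscale_const flip: rf_def)
  have "rf u m (rf v n w) - rf v n (rf u m w) = \<rho> (mode_bracket sc br form p (pderiv p) u m v n) w"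
    using ghat_module.act_bracket[OF \<rho>_module, of "mode u m" "mode v n" w]
    by (simp add: affine_bracket_mode[OF biadditive_sc biadditive_br biadditive_form] rf_def)
  also have "\<dots> = rf (br0 u v) (m + n) w + scW (l * (if m + n = 0 then of_int m * form a b else 0)) w
        + (\<Sum>i\<le>Polynomial.degree p. scW (Polynomial.coeff p i) (rf (br1 u v) (m + n + int i) w))
        + scW (l * (1 / 2 * form a' b' * int_coeff (pderiv p) (- m - n - 1) + form a' b' * of_int m * int_coeff p (- m - n))) w"
    by (simp only: uv mode_bracket_pair[OF biadditive_sc biadditive_br biadditive_form] \<rho>add \<rho>c \<rho>sum s fst_conv snd_conv)
      (simp only: rf_def)
  also have "\<dots> = rf (br0 u v) (m + n) w
        + (\<Sum>i\<le>Polynomial.degree p. scW (Polynomial.coeff p i) (rf (br1 u v) (m + n + int i) w))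
        + scW (l * level_coeff u m v n) w"
    unfolding level_coeff_def uv fst_conv snd_conv distrib_left[of l "if m + n = 0 then of_int m * form a b else 0"] W.scale_left_distrib
    by (simp only: add_ac)
  finally show ?thesis by (simp only: sum_bracket_field[OF rf_fields rf_fields])
qed

text \<open>The action of \<open>F(z) \<otimes> t\<^sup>k\<close>, for \<open>F\<close> a pair of series with coefficients in \<open>\<gg>\<close>.\<close>

definition smear :: "int \<Rightarrow> 'g fls \<times> 'g fls \<Rightarrow> (int \<Rightarrow> 'w \<Rightarrow> 'w) \<Rightarrow> int \<Rightarrow> 'w \<Rightarrow> 'w" where
  "smear k F \<alpha> n w = Sum_any (\<lambda>j::int. W.prd 0 k (rf (fst F $$ j, snd F $$ j)) \<alpha> (n + j) w)"

definition \<sigma> :: "'g gcheck \<Rightarrow> (int \<Rightarrow> 'w \<Rightarrow> 'w) \<Rightarrow> int \<Rightarrow> 'w \<Rightarrow> 'w" where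
  "\<sigma> x \<alpha> = (\<Sum>k\<in>Poly_Mapping.keys (fst x). smear k (Poly_Mapping.lookup (fst x) k) \<alpha>)
    + W.fscale (snd x * fls_const l) \<alpha>"

lemma smear_stens:
  assumes "\<alpha> \<in> W.fields"
  shows "smear k (stens f a, stens f b) \<alpha> = W.fscale f (W.prd 0 k (rf (a, b)) \<alpha>)"
proof (intro ext)
  fix n w
  have "W.prd 0 k (rf (stens f a $$ j, stens f b $$ j)) \<alpha> (n + j) w = scW (f $$ j) (W.prd 0 k (rf (a, b)) \<alpha> (n + j) w)" for j
    unfolding stens_nth rf_scale W.prd_const_left[OF rf_fields assms] by (rule W.fscale_const)
  then show "smear k (stens f a, stens f b) \<alpha> n w = W.fscale f (W.prd 0 k (rf (a, b)) \<alpha>) n w"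
    unfolding smear_def W.fscale_def by simp
qed

text \<open>\<open>smear\<close> is defined by coefficients of F, so no decomposition of F into
  elements f(z) a has to be chosen. The sum is finite because such an F involves finitely many
  elements of \<gg>, whose fields share a truncation bound on w.\<close>

lemma smear_finite:
  assumes "fst F \<in> czt" "snd F \<in> czt" "\<alpha> \<in> W.fields"
  shows "finite {j. W.prd 0 k (rf (fst F $$ j, snd F $$ j)) \<alpha> (n + j) w \<noteq> 0}"
  using assms(1,2)
proof (induction rule: czt_pair_induct)
  case (stens f a b)
  obtain K :: int where K: "\<forall>i\<ge>K. W.prd 0 k (rf (a, b)) \<alpha> i w = 0"
    using W.fields_trunc[OF W.prd_fields[OF rf_fields assms(3)]] by blast
  have eq: "W.prd 0 k (rf (stens f a $$ j, stens f b $$ j)) \<alpha> (n + j) w = scW (f $$ j) (W.prd 0 k (rf (a, b)) \<alpha> (n + j) w)" for j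
    by (simp add: stens_nth rf_scale W.prd_const_left rf_fields assms W.fscale_const)
  have "j \<in> {fls_subdegree f..<K - n}" if "scW (f $$ j) (W.prd 0 k (rf (a, b)) \<alpha> (n + j) w) \<noteq> 0" for j
  proof -
    have "f $$ j \<noteq> 0" "W.prd 0 k (rf (a, b)) \<alpha> (n + j) w \<noteq> 0"
      using that by (metis W.scale_zero_left, metis W.scale_zero_right)
    moreover have "j < K - n"
      using K[rule_format, of "n + j"] calculation(2) by linarith
    ultimately show ?thesis using fls_eq0_below_subdegree[of j f] by (cases "fls_subdegree f \<le> j") auto
  qed
  then have "{j. scW (f $$ j) (W.prd 0 k (rf (a, b)) \<alpha> (n + j) w) \<noteq> 0} \<subseteq> {fls_subdegree f..<K - n}"
    by blast
  then show ?case unfolding fst_conv snd_conv eq by (rule finite_subset) simp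
next
  case (add F G)
  have "rf (fst (F + G) $$ j, snd (F + G) $$ j) = rf (fst F $$ j, snd F $$ j) + rf (fst G $$ j, snd G $$ j)" for j
    by (simp add: rf_add[symmetric])
  then have "{j. W.prd 0 k (rf (fst (F + G) $$ j, snd (F + G) $$ j)) \<alpha> (n + j) w \<noteq> 0}
      \<subseteq> {j. W.prd 0 k (rf (fst F $$ j, snd F $$ j)) \<alpha> (n + j) w \<noteq> 0} \<union> {j. W.prd 0 k (rf (fst G $$ j, snd G $$ j)) \<alpha> (n + j) w \<noteq> 0}"
    by (auto simp: W.prd_add_left rf_fields assms(3) plus_fun_apply)
  then show ?case using add by (meson finite_UnI finite_subset)
qed

lemma smear_add:
  assumes "fst F \<in> czt" "snd F \<in> czt" "fst G \<in> czt" "snd G \<in> czt" "\<alpha> \<in> W.fields"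
  shows "smear k (F + G) \<alpha> = smear k F \<alpha> + smear k G \<alpha>"
proof (intro ext)
  fix n w
  have split: "rf (fst (F + G) $$ j, snd (F + G) $$ j) = rf (fst F $$ j, snd F $$ j) + rf (fst G $$ j, snd G $$ j)" for j
    by (simp add: rf_add[symmetric])
  show "smear k (F + G) \<alpha> n w = (smear k F \<alpha> + smear k G \<alpha>) n w"
    unfolding smear_def plus_fun_apply split W.prd_add_left[OF rf_fields rf_fields assms(5)]
    by (rule Sum_any.distrib) (simp_all add: smear_finite assms)
qed

lemma smear_zero: "\<alpha> \<in> W.fields \<Longrightarrow> smear k 0 \<alpha> = 0"
  using smear_stens[of \<alpha> k 0 0 0] by (simp add: zero_prod_def)

lemma \<sigma>_superset:
  assumes "\<alpha> \<in> W.fields" "finite A" "Poly_Mapping.keys (fst x) \<subseteq> A"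
  shows "\<sigma> x \<alpha> = (\<Sum>k\<in>A. smear k (Poly_Mapping.lookup (fst x) k) \<alpha>) + W.fscale (snd x * fls_const l) \<alpha>"
  unfolding \<sigma>_def
  by (intro arg_cong2[where f = "(+)"] refl sum.mono_neutral_left) (use assms in \<open>auto simp: in_keys_iff smear_zero\<close>)

lemma \<sigma>_mode:
  assumes "\<alpha> \<in> W.fields"
  shows "\<sigma> (gsc f (gcheck_mode u n)) \<alpha> = W.fscale f (W.prd 0 n (rf u) \<alpha>)"
proof -
  obtain a b where u: "u = (a, b)" by (cases u)
  show ?thesis
    using \<sigma>_superset[OF assms, of "{n}" "mode (stens f a, stens f b) n"]
    by (simp add: u gsc_gcheck_mode smear_stens assms)
qed

lemma \<sigma>_central: "\<sigma> (gsc c central) \<alpha> = W.fscale (c * fls_const l) \<alpha>"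
  by (simp add: gsc_central \<sigma>_def)

lemma \<sigma>_add_left:
  assumes "x \<in> gcar" "y \<in> gcar" "\<alpha> \<in> W.fields"
  shows "\<sigma> (x + y) \<alpha> = \<sigma> x \<alpha> + \<sigma> y \<alpha>"
proof -
  define A where "A = Poly_Mapping.keys (fst x) \<union> Poly_Mapping.keys (fst y) \<union> Poly_Mapping.keys (fst (x + y))"
  have "\<sigma> z \<alpha> = (\<Sum>k\<in>A. smear k (Poly_Mapping.lookup (fst z) k) \<alpha>) + W.fscale (snd z * fls_const l) \<alpha>" if "z \<in> {x, y, x + y}" for z
    by (rule \<sigma>_superset) (use that assms in \<open>auto simp: A_def\<close>)
  moreover have "smear k (Poly_Mapping.lookup (fst x) k + Poly_Mapping.lookup (fst y) k) \<alpha>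
      = smear k (Poly_Mapping.lookup (fst x) k) \<alpha> + smear k (Poly_Mapping.lookup (fst y) k) \<alpha>" for k
    by (rule smear_add) (use assms in \<open>simp_all add: gcar_iff\<close>)
  ultimately show ?thesis
    using assms by (simp add: lookup_add sum.distrib distrib_right W.fscale_add_left add_ac)
qed

lemma \<sigma>_closed:
  assumes "x \<in> gcar" "\<alpha> \<in> W.fields"
  shows "\<sigma> x \<alpha> \<in> W.fields"
  using assms(1)
  by (induction x rule: gcar_induct) (simp_all add: assms(2) \<sigma>_mode \<sigma>_central \<sigma>_add_left rf_fields)

lemma \<sigma>_add_right:
  assumes "x \<in> gcar" "\<alpha> \<in> W.fields" "\<beta> \<in> W.fields"
  shows "\<sigma> x (\<alpha> + \<beta>) = \<sigma> x \<alpha> + \<sigma> x \<beta>"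
  using assms(1)
proof (induction x rule: gcar_induct)
  case (add x y)
  then show ?case using assms(2,3) by (simp add: \<sigma>_add_left add_ac)
qed (simp_all add: assms(2,3) \<sigma>_mode \<sigma>_central W.prd_add_right W.fscale_add_right rf_fields)

lemma \<sigma>_scale_right:
  assumes "x \<in> gcar" "\<alpha> \<in> W.fields"
  shows "\<sigma> x (W.fscale c \<alpha>) = W.fscale c (\<sigma> x \<alpha>)"
  using assms(1)
  by (induction x rule: gcar_induct)
    (simp_all add: assms(2) \<sigma>_mode \<sigma>_central \<sigma>_add_left \<sigma>_closed W.prd_fscale_right W.fscale_add_right
      W.fscale_mult[symmetric] rf_fields mult.commute mult.left_commute)

lemma \<sigma>_scale_left:
  assumes "x \<in> gcar" "\<alpha> \<in> W.fields"
  shows "\<sigma> (gsc c x) \<alpha> = W.fscale c (\<sigma> x \<alpha>)"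
  using assms(1)
  by (induction x rule: gcar_induct)
    (simp_all add: assms(2) gsc_gsc_mode gsc_gsc_central affine_scale_add[OF biadditive_fls(1)] gcar_scale
      \<sigma>_mode \<sigma>_central \<sigma>_add_left \<sigma>_closed W.fscale_add_right W.fscale_mult[symmetric] rf_fields mult.assoc)

lemma bracket_field_fields: "bracket_field (rf u) (rf v) a b q \<in> W.fields"
  by (simp add: bracket_field_def rf_fields)

text \<open>Products with the identity field on the left vanish unless K + i = -1, which singles out
  one coefficient of q.\<close>

lemma qact_idf:
  assumes "\<alpha> \<in> W.fields"
  shows "W.qact q (\<lambda>i. W.prd 0 (K + int i) W.idf \<alpha>) = W.fscale (int_coeff q (- 1 - K)) \<alpha>"
proof -
  define d where "d = Polynomial.degree q"
  have "W.qact q (\<lambda>i. W.prd 0 (K + int i) W.idf \<alpha>) = (\<Sum>i\<le>d. if K + int i = - 1 then W.fscale (Polynomial.coeff q i) \<alpha> else 0)"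
    unfolding W.qact_def d_def by (rule sum.cong[OF refl]) (simp add: W.prd_idf_left assms)
  also have "\<dots> = W.fscale (int_coeff q (- 1 - K)) \<alpha>"
  proof (cases "K \<le> - 1")
    case True
    define i where "i = nat (- 1 - K)"
    have "(\<Sum>j\<le>d. if K + int j = - 1 then W.fscale (Polynomial.coeff q j) \<alpha> else 0)
        = (\<Sum>j\<le>d. if j = i then W.fscale (Polynomial.coeff q i) \<alpha> else 0)"
      by (rule sum.cong[OF refl]) (use True in \<open>auto simp: i_def\<close>)
    also have "\<dots> = W.fscale (Polynomial.coeff q i) \<alpha>"
      by (auto simp: d_def coeff_eq_0 not_le)
    finally show ?thesis using True by (simp add: int_coeff_def i_def)
  next
    case False
    then have "(\<Sum>j\<le>d. if K + int j = - 1 then W.fscale (Polynomial.coeff q j) \<alpha> else 0) = 0"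
      by (intro sum.neutral) auto
    then show ?thesis using False by (simp add: int_coeff_def)
  qed
  finally show ?thesis .
qed

lemma prd_poly_idf_left:
  assumes "\<alpha> \<in> W.fields"
  shows "W.prd 0 K (W.fscale (fls_const c * poly_fls q) W.idf) \<alpha>
    = W.fscale (fls_const c * int_coeff (shift_poly q) (- 1 - K)) \<alpha>"
  using assms by (simp add: W.fscale_mult W.prd_const_left W.prd_poly_left qact_idf)

lemma prd_bracket_field_0:
  assumes "\<alpha> \<in> W.fields"
  shows "W.prd 0 K (bracket_field (rf u) (rf v) a b 0) \<alpha> = W.prd 0 K (rf u) \<alpha>
    + (W.qact (shift_poly p) (\<lambda>i. W.prd 0 (K + int i) (rf v) \<alpha>)
      + W.fscale (fls_const (1 / 2 * form (snd a) (snd b) * l) * int_coeff (shift_poly (pderiv p)) (- 1 - K)) \<alpha>)"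
  using assms by (simp add: bracket_field_def W.prd_add_left rf_fields W.prd_poly_left prd_poly_idf_left)

lemma prd_bracket_field_1:
  assumes "\<alpha> \<in> W.fields"
  shows "W.prd 0 K (bracket_field (rf u) (rf v) a b (Suc 0)) \<alpha>
    = W.fscale ((if K = - 1 then fls_const (form (fst a) (fst b) * l) else 0)
        + fls_const (form (snd a) (snd b) * l) * int_coeff (shift_poly p) (- 1 - K)) \<alpha>"
  using assms by (simp add: bracket_field_def W.fscale_add_left W.prd_add_left W.prd_const_left W.prd_idf_left prd_poly_idf_left)

text \<open>\<open>W.prd_commutator\<close> gives two terms whose fields contain p(x_1);
  \<open>W.prd_poly_left\<close> turns these into p(z + x), the polynomial in the bracket over
  \<complex>((z)).\<close>

lemma \<sigma>_bracket_modes: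
  assumes \<alpha>: "\<alpha> \<in> W.fields"
  shows "W.prd 0 m (rf u) (W.prd 0 n (rf v) \<alpha>) - W.prd 0 n (rf v) (W.prd 0 m (rf u) \<alpha>)
    = W.prd 0 (m + n) (rf (br0 u v)) \<alpha>
      + W.qact (shift_poly p) (\<lambda>i. W.prd 0 (m + n + int i) (rf (br1 u v)) \<alpha>)
      + W.fscale (klev u m v n * fls_const l) \<alpha>"
proof -
  let ?\<gamma> = "bracket_field (rf (br0 u v)) (rf (br1 u v)) u v"
  have "W.prd 0 m (rf u) (W.prd 0 n (rf v) \<alpha>) - W.prd 0 n (rf v) (W.prd 0 m (rf u) \<alpha>)
      = W.prd 0 (m + n) (?\<gamma> 0) \<alpha> + W.fscale (fls_const (of_int m)) (W.prd 0 (m + n - 1) (?\<gamma> (Suc 0)) \<alpha>)"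
  proof (intro ext)
    fix t w
    have "W.prd 0 m (rf u) (W.prd 0 n (rf v) \<alpha>) t w - W.prd 0 n (rf v) (W.prd 0 m (rf u) \<alpha>) t w
        = (\<Sum>q<2. scW (of_int m gchoose q) (W.prd 0 (n + m - int q) (?\<gamma> q) \<alpha> t w))"
      by (rule W.prd_commutator[OF rf_fields rf_fields \<alpha> bracket_field_fields rf_commutator])
    then show "(W.prd 0 m (rf u) (W.prd 0 n (rf v) \<alpha>) - W.prd 0 n (rf v) (W.prd 0 m (rf u) \<alpha>)) t w
        = (W.prd 0 (m + n) (?\<gamma> 0) \<alpha> + W.fscale (fls_const (of_int m)) (W.prd 0 (m + n - 1) (?\<gamma> (Suc 0)) \<alpha>)) t w"
      by (simp add: numeral_2_eq_2 W.fscale_const add.commute plus_fun_apply minus_apply)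
  qed
  also have "W.fscale (fls_const (of_int m)) (W.prd 0 (m + n - 1) (?\<gamma> (Suc 0)) \<alpha>)
      = W.fscale (fls_const (of_int m) * ((if m + n = 0 then fls_const (form (fst u) (fst v) * l) else 0)
        + fls_const (form (snd u) (snd v) * l) * int_coeff (shift_poly p) (- m - n))) \<alpha>"
    using \<alpha> by (simp add: prd_bracket_field_1 W.fscale_mult)
  also have "W.prd 0 (m + n) (?\<gamma> 0) \<alpha> + \<dots> = W.prd 0 (m + n) (rf (br0 u v)) \<alpha>
      + W.qact (shift_poly p) (\<lambda>i. W.prd 0 (m + n + int i) (rf (br1 u v)) \<alpha>)
      + (W.fscale (fls_const (1 / 2 * form (snd u) (snd v) * l) * int_coeff (shift_poly (pderiv p)) (- m - n - 1)) \<alpha>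
        + W.fscale (fls_const (of_int m) * ((if m + n = 0 then fls_const (form (fst u) (fst v) * l) else 0)
          + fls_const (form (snd u) (snd v) * l) * int_coeff (shift_poly p) (- m - n))) \<alpha>)"
  proof -
    have "- 1 - (m + n) = - m - n - 1" by simp
    then show ?thesis by (simp only: prd_bracket_field_0[OF \<alpha>] add.assoc)
  qed
  also have "W.fscale (fls_const (1 / 2 * form (snd u) (snd v) * l) * int_coeff (shift_poly (pderiv p)) (- m - n - 1)) \<alpha>
        + W.fscale (fls_const (of_int m) * ((if m + n = 0 then fls_const (form (fst u) (fst v) * l) else 0)
          + fls_const (form (snd u) (snd v) * l) * int_coeff (shift_poly p) (- m - n))) \<alpha>
      = W.fscale (klev u m v n * fls_const l) \<alpha>"
    unfolding W.fscale_add_left[OF \<alpha>, symmetric]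
  proof (rule arg_cong[where f = "\<lambda>f. W.fscale f \<alpha>"])
    have "klev u m v n * fls_const l = fls_const (if m + n = 0 then of_int m * form (fst u) (fst v) else 0) * fls_const l
      + (fls_const (1 / 2 * form (snd u) (snd v)) * int_coeff (shift_poly (pderiv p)) (- m - n - 1) * fls_const l
        + fls_const (form (snd u) (snd v)) * (of_int m * int_coeff (shift_poly p) (- m - n)) * fls_const l)"
      unfolding klev_def by (simp only: distrib_right mult.assoc)
    also have "\<dots> = fls_const (of_int m) * (if m + n = 0 then fls_const (form (fst u) (fst v) * l) else 0)
      + (fls_const (1 / 2 * form (snd u) (snd v) * l) * int_coeff (shift_poly (pderiv p)) (- m - n - 1)
        + fls_const (form (snd u) (snd v) * l) * (fls_const (of_int m) * int_coeff (shift_poly p) (- m - n)))"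
      unfolding fls_const_mult_swap by (simp add: fls_of_int mult.assoc)
    finally show "fls_const (1 / 2 * form (snd u) (snd v) * l) * int_coeff (shift_poly (pderiv p)) (- m - n - 1)
        + fls_const (of_int m) * ((if m + n = 0 then fls_const (form (fst u) (fst v) * l) else 0)
          + fls_const (form (snd u) (snd v) * l) * int_coeff (shift_poly p) (- m - n))
      = klev u m v n * fls_const l"
      by (simp only: distrib_left mult_ac add_ac)
  qed
  finally show ?thesis .
qed

lemma \<sigma>_zero: "\<alpha> \<in> W.fields \<Longrightarrow> \<sigma> 0 \<alpha> = 0"
  by (simp add: \<sigma>_def)

lemma \<sigma>_sum:
  assumes "\<alpha> \<in> W.fields" "\<And>i. i \<in> A \<Longrightarrow> f i \<in> gcar"
  shows "\<sigma> (sum f A) \<alpha> = (\<Sum>i\<in>A. \<sigma> (f i) \<alpha>)"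
  using assms(2) by (induction A rule: infinite_finite_induct) (simp_all add: assms(1) \<sigma>_zero \<sigma>_add_left gcar_sum)

text \<open>Both sides are biadditive. The multiples f and g of two modes come out as f g because
  products are linear over series in the second factor, and the modes themselves are
  \<open>\<sigma>_bracket_modes\<close>.\<close>

lemma \<sigma>_bracket:
  assumes "x \<in> gcar" "y \<in> gcar" "\<alpha> \<in> W.fields"
  shows "\<sigma> (gbr x y) \<alpha> = \<sigma> x (\<sigma> y \<alpha>) - \<sigma> y (\<sigma> x \<alpha>)"
  using assms(1,2)
proof (induction x rule: gcar_induct)
  case (mode f u m)
  show ?case using mode
  proof (induction y rule: gcar_induct)
    case (mode g v n)
    have c: "gsc h central \<in> gcar" for h using gcar_central[of h] by (simp add: gsc_central)
    have "\<sigma> (gbr (gsc f (gcheck_mode u m)) (gsc g (gcheck_mode v n))) \<alpha>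
      = W.fscale (f * g) (W.prd 0 (m + n) (rf (br0 u v)) \<alpha>)
        + (\<Sum>i\<le>Polynomial.degree (shift_poly p). W.fscale (f * g * Polynomial.coeff (shift_poly p) i) (W.prd 0 (m + n + int i) (rf (br1 u v)) \<alpha>))
        + W.fscale (f * g * klev u m v n * fls_const l) \<alpha>"
      unfolding gbr_modes
      by (simp add: \<sigma>_add_left \<sigma>_sum \<sigma>_mode \<sigma>_central assms(3) gcar_add gcar_sum gcar_scale gcheck_mode_in c)
    also have "\<dots> = W.fscale (f * g) (W.prd 0 (m + n) (rf (br0 u v)) \<alpha>
      + W.qact (shift_poly p) (\<lambda>i. W.prd 0 (m + n + int i) (rf (br1 u v)) \<alpha>)
      + W.fscale (klev u m v n * fls_const l) \<alpha>)"
      unfolding W.qact_def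
      by (simp add: W.fscale_add_right W.fscale_sum_right W.sum_fields assms(3) rf_fields W.fscale_mult[symmetric] mult.assoc)
    also have "\<dots> = W.fscale (f * g) (W.prd 0 m (rf u) (W.prd 0 n (rf v) \<alpha>) - W.prd 0 n (rf v) (W.prd 0 m (rf u) \<alpha>))"
      by (simp only: \<sigma>_bracket_modes[OF assms(3)])
    also have "\<dots> = W.fscale (f * g) (W.prd 0 m (rf u) (W.prd 0 n (rf v) \<alpha>)) - W.fscale (f * g) (W.prd 0 n (rf v) (W.prd 0 m (rf u) \<alpha>))"
    proof -
      have d: "W.fscale h (\<beta> - \<gamma>) = W.fscale h \<beta> - W.fscale h \<gamma>" if "\<beta> \<in> W.fields" "\<gamma> \<in> W.fields" for h \<beta> \<gamma>
        using W.fscale_add_right[of "\<beta> - \<gamma>" \<gamma> h] W.add_fields[OF that(1) W.uminus_fields[OF that(2)]] that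
        by (simp add: algebra_simps)
      show ?thesis by (rule d) (simp_all add: assms(3) rf_fields)
    qed
    also have "\<dots> = \<sigma> (gsc f (gcheck_mode u m)) (\<sigma> (gsc g (gcheck_mode v n)) \<alpha>)
        - \<sigma> (gsc g (gcheck_mode v n)) (\<sigma> (gsc f (gcheck_mode u m)) \<alpha>)"
      by (simp add: \<sigma>_mode assms(3) rf_fields W.prd_fscale_right W.fscale_mult[symmetric] mult.commute)
    finally show ?case .
  next
    case (central c)
    have x: "gsc f (gcheck_mode u m) \<in> gcar" by (intro gcar_scale gcheck_mode_in)
    show ?case
      by (simp add: gbr_central \<sigma>_zero assms(3) \<sigma>_central \<sigma>_scale_right x)
  next
    case (add y z)
    then show ?case
      by (simp add: gbr_add \<sigma>_add_left \<sigma>_add_right \<sigma>_closed gbr_closed gcar_scale gcheck_mode_in assms(3))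
  qed
next
  case (central c)
  then show ?case
    by (simp add: gbr_central \<sigma>_zero assms(3) \<sigma>_central \<sigma>_scale_right \<sigma>_closed)
next
  case (add x z)
  then show ?case
    by (simp add: gbr_add \<sigma>_add_left \<sigma>_add_right \<sigma>_closed gbr_closed assms(3))
qed

lemma \<sigma>_rep: "lie_rep gcar gsc gbr W.fields W.fscale \<sigma>"
proof (rule lie_rep.intro[OF lie_data_gcar], unfold_locales)
  show "W.fscale (c * d) \<alpha> = W.fscale c (W.fscale d \<alpha>)" if "\<alpha> \<in> W.fields" for c d \<alpha>
    using that by (rule W.fscale_mult)
qed (simp_all add: W.fscale_add_left W.fscale_add_right W.fscale_one \<sigma>_closed \<sigma>_add_right \<sigma>_add_left
    \<sigma>_scale_right \<sigma>_scale_left \<sigma>_bracket)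

text \<open>Nonnegative products with the identity field vanish, so only the central component acts:
  the condition that \<open>V_universal\<close> puts on the image of the vacuum.\<close>

lemma \<sigma>_idf:
  assumes "x \<in> bcar"
  shows "\<sigma> x W.idf = W.fscale (snd x * fls_const l) W.idf"
proof -
  have "smear k F W.idf = 0" if "k \<ge> 0" for k F
    by (intro ext) (simp add: smear_def W.prd_idf_right_nonneg rf_fields that)
  then show ?thesis
    unfolding \<sigma>_def using bcar_keys[OF assms] by simp
qed

lemma ghat_field_map:
  obtains \<Theta> where "field_map sc br form p l Y scW \<Theta>" "\<And>u. \<Theta> (emb u) = rf u"
    "\<And>u n v. v \<in> carrier V \<Longrightarrow> \<Theta> (act (gcheck_mode u n) v) = W.prd 0 n (\<Theta> (emb u)) (\<Theta> v)"
proof -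
  obtain \<Theta> where closed: "\<And>v. v \<in> carrier V \<Longrightarrow> \<Theta> v \<in> W.fields"
    and add: "\<And>v w. v \<in> carrier V \<Longrightarrow> w \<in> carrier V \<Longrightarrow> \<Theta> (v \<oplus>\<^bsub>V\<^esub> w) = \<Theta> v + \<Theta> w"
    and smult: "\<And>f v. v \<in> carrier V \<Longrightarrow> \<Theta> (f \<odot>\<^bsub>V\<^esub> v) = W.fscale f (\<Theta> v)"
    and act: "\<And>x v. x \<in> gcar \<Longrightarrow> v \<in> carrier V \<Longrightarrow> \<Theta> (act x v) = \<sigma> x (\<Theta> v)"
    and vac: "\<Theta> vac = W.idf"
  proof (rule V_universal)
    show "lie_rep gcar gsc gbr W.fields W.fscale \<sigma>" by (rule \<sigma>_rep)
    show "W.idf \<in> W.fields" by (rule W.idf_fields)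
    show "\<sigma> x W.idf = W.fscale (snd x * fls_const l) W.idf" if "x \<in> bcar" for x
      using that by (rule \<sigma>_idf)
    fix \<Theta>
    assume "\<And>v. v \<in> carrier V \<Longrightarrow> \<Theta> v \<in> W.fields"
    "\<And>v w. v \<in> carrier V \<Longrightarrow> w \<in> carrier V \<Longrightarrow> \<Theta> (v \<oplus>\<^bsub>V\<^esub> w) = \<Theta> v + \<Theta> w"
    "\<And>f v. v \<in> carrier V \<Longrightarrow> \<Theta> (f \<odot>\<^bsub>V\<^esub> v) = W.fscale f (\<Theta> v)"
    "\<And>x v. x \<in> gcar \<Longrightarrow> v \<in> carrier V \<Longrightarrow> \<Theta> (act x v) = \<sigma> x (\<Theta> v)"
    "\<Theta> vac = W.idf"
    then show thesis by (rule that)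
  qed
  have mode: "\<Theta> (act (gcheck_mode u n) v) = W.prd 0 n (rf u) (\<Theta> v)" if "v \<in> carrier V" for u n v
    using act[OF gcheck_mode_in that] \<sigma>_mode[OF closed[OF that], of 1 u n]
    by (simp add: gsc_one_mode W.fscale_one)
  \<comment> \<open>\<open>emb u\<close> is u(-1) applied to the vacuum, and the product of index -1
    with the identity field, the case s = 0 of \<open>W.prd_idf_right_neg\<close>, returns the
    field.\<close>
  have emb: "\<Theta> (emb u) = rf u" for u
  proof (intro ext)
    fix n w
    show "\<Theta> (emb u) n w = rf u n w"
      using W.prd_idf_right_neg[OF rf_fields, of 0 0 u n w]
      by (simp add: Vcheck_embed_def mode vac_closed vac dcf_def)
  qed
  show thesis
  proof (rule that[of \<Theta>])
    show "field_map sc br form p l Y scW \<Theta>"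
      by (intro field_map.intro field_map_axioms.intro vcheck_space_axioms closed add smult vac)
    show "\<Theta> (emb u) = rf u" for u by (rule emb)
    show "\<Theta> (act (gcheck_mode u n) v) = W.prd 0 n (\<Theta> (emb u)) (\<Theta> v)" if "v \<in> carrier V" for u n v
      using mode[OF that] by (simp only: emb)
  qed
qed

lemma type_zero_of_restricted_ghat_module:
  obtains YW where "YW \<in> extensional (carrier V)" "type_zero_module V Y vac scW YW" "\<And>u n. YW (emb u) n = \<rho> (mode u n)"
proof -
  obtain \<Theta> where F: "field_map sc br form p l Y scW \<Theta>" and emb: "\<And>u. \<Theta> (emb u) = rf u"
    and act: "\<And>u n v. v \<in> carrier V \<Longrightarrow> \<Theta> (act (gcheck_mode u n) v) = W.prd 0 n (\<Theta> (emb u)) (\<Theta> v)"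
    by (rule ghat_field_map) (rule that, blast+)
  interpret F: field_map sc br form p l Y scW \<Theta> by (rule F)
  \<comment> \<open>At k = 0 the claim compares the commutator of \<open>rf u\<close> and
    \<open>rf v\<close> with the products u(0) v and u(1) v, beyond which all vanish.\<close>
  have "F.Jac (emb u) (emb v) 0" for u v
  proof (rule F.JacI[OF emb_closed emb_closed])
    fix m
    have "W.prd m 0 (\<Theta> (emb u)) (\<Theta> (emb v)) = (\<Sum>i<N. W.fscale (W.xbin m i) (\<Theta> (Y (emb u) (0 + int i) (emb v))))"
      if "N \<ge> 2" for N
    proof -
      have "(\<Sum>i<N. W.fscale (W.xbin m i) (\<Theta> (Y (emb u) (0 + int i) (emb v))))
          = (\<Sum>i<2. W.fscale (W.xbin m i) (\<Theta> (act (gcheck_mode u (int i)) (emb v))))"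
        by (rule sum.mono_neutral_cong_right) (use that in \<open>auto simp: Y_emb emb_closed act_emb_ge2 F.\<Theta>_zero\<close>)
      moreover have "W.prd m 0 (\<Theta> (emb u)) (\<Theta> (emb v)) n w
          = (\<Sum>i<2. W.fscale (W.xbin m i) (\<Theta> (act (gcheck_mode u (int i)) (emb v)))) n w" for n w
        by (simp only: W.sum_fun_apply W.fscale_xbin F.sum_bracket_modes W.prd_k0[OF F.\<Theta>_fields F.\<Theta>_fields] emb_closed)
          (simp only: emb rf_commutator sum_bracket_field[OF rf_fields rf_fields])
      ultimately show ?thesis by (simp add: fun_eq_iff)
    qed
    then show "\<forall>\<^sub>F N in sequentially. W.prd m 0 (\<Theta> (emb u)) (\<Theta> (emb v))
        = (\<Sum>i<N. W.fscale (W.xbin m i) (\<Theta> (Y (emb u) (0 + int i) (emb v))))"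
      unfolding eventually_sequentially by blast
  qed
  then have Jac: "F.Jac v w k" if "v \<in> carrier V" "w \<in> carrier V" for v w k
    using F.Jac_all[OF act _ that] by blast
  \<comment> \<open>The value outside \<open>V\<close> is fixed as \<open>undefined\<close>, since
    uniqueness is claimed among extensional functions.\<close>
  define YW where "YW = restrict \<Theta> (carrier V)"
  have YW: "YW v = \<Theta> v" if "v \<in> carrier V" for v using that by (simp add: YW_def)
  have "type_zero_module V Y vac scW YW"
  proof (intro type_zero_module.intro vertex_module.intro vertex_module_axioms.intro type_zero_module_axioms.intro)
    show "vertex_algebra (restrict_scalars V) Y vac" by (rule V_vertex_algebra)
    show "vector_space scW" by (rule W.vector_space_axioms)
  next
    fix u u' n w assume "u \<in> carrier (restrict_scalars V)" "u' \<in> carrier (restrict_scalars V)"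
    then show "YW (u \<oplus>\<^bsub>restrict_scalars V\<^esub> u') n w = YW u n w + YW u' n w"
      by (simp add: YW V_add_closed F.\<Theta>_add plus_fun_apply)
  next
    fix u c n w assume "u \<in> carrier (restrict_scalars V)"
    then show "YW (c \<odot>\<^bsub>restrict_scalars V\<^esub> u) n w = scW c (YW u n w)"
      by (simp add: YW smult_closed F.\<Theta>_smult W.fscale_const)
  next
    fix u n assume "u \<in> carrier (restrict_scalars V)"
    then show "Vector_Spaces.linear scW scW (YW u n)"
      by (simp add: YW W.fields_linear F.\<Theta>_fields)
  next
    fix u w assume "u \<in> carrier (restrict_scalars V)"
    then show "\<exists>N. \<forall>n\<ge>N. YW u n w = 0"
      by (simp add: YW W.fields_trunc F.\<Theta>_fields)
  next
    show "YW vac n w = (if n = - 1 then w else 0)" for n w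
      by (simp add: YW vac_closed F.\<Theta>_vac W.idf_def)
  next
    fix v f n w assume "v \<in> carrier V"
    then show "YW (f \<odot>\<^bsub>V\<^esub> v) n w = Sum_any (\<lambda>j::int. scW (f $$ j) (YW v (n + j) w))"
      by (simp add: YW smult_closed F.\<Theta>_smult W.fscale_def)
  next
    fix u v k m n w assume "u \<in> carrier (restrict_scalars V)" "v \<in> carrier (restrict_scalars V)"
    then have u: "u \<in> carrier V" and v: "v \<in> carrier V" by simp_all
    obtain N where N: "\<forall>i\<ge>N. Y u (k + int i) v = \<zero>\<^bsub>V\<^esub>"
      using eventually_happens'[OF sequentially_bot Y_truncation[OF u v, of k]] by blast
    have "W.prd m k (\<Theta> u) (\<Theta> v) n w = (\<Sum>i<N. W.fscale (W.xbin m i) (\<Theta> (Y u (k + int i) v))) n w"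
      using Jac[OF u v, of k] N unfolding F.Jac_def by simp
    also have "\<dots> = (\<Sum>i<N. scW (of_int m gchoose i) (YW (Y u (k + int i) v) (m + n - int i) w))"
      by (simp add: W.sum_fun_apply W.fscale_xbin YW Y_closed u v)
    also have "\<dots> = Sum_any (\<lambda>i::nat. scW (of_int m gchoose i) (YW (Y u (k + int i) v) (m + n - int i) w))"
      by (rule W.Sum_any_eq_sum[symmetric]) (simp add: N YW F.\<Theta>_zero)
    finally show "Sum_any (\<lambda>i::nat. scW ((- 1) ^ i * (of_int k gchoose i)) (YW u (k + m - int i) (YW v (n + int i) w)))
      - Sum_any (\<lambda>i::nat. scW ((- 1) powi k * (- 1) ^ i * (of_int k gchoose i)) (YW v (k + n - int i) (YW u (m + int i) w)))
      = Sum_any (\<lambda>i::nat. scW (of_int m gchoose i) (YW (Y u (k + int i) v) (m + n - int i) w))"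
      unfolding W.prd_def YW[OF u] YW[OF v] .
  qed
  moreover have "YW \<in> extensional (carrier V)" by (simp add: YW_def)
  moreover have "YW (emb u) n = \<rho> (mode u n)" for u n
    by (simp add: YW emb_closed emb rf_def)
  ultimately show thesis using that by blast
qed

end

text \<open>The Jacobi identity at m = 0 expresses the field of u(k) w through those of u and w, and
  such modes together with scalars generate \<open>V\<close> from the vacuum.\<close>

lemma type_zero_unique:
  assumes T: "type_zero_module V Y vac scW YW" and T': "type_zero_module V Y vac scW YW'"
    and emb: "\<And>a. YW (emb (a, 0)) = YW' (emb (a, 0))" "\<And>a. YW (emb (0, a)) = YW' (emb (0, a))"
    and v: "v \<in> carrier V"
  shows "YW v = YW' v"
proof -
  interpret F: field_map sc br form p l Y scW YW by (rule type_zero_field_map[OF T])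
  interpret F': field_map sc br form p l Y scW YW' by (rule type_zero_field_map[OF T'])
  have pair: "YW (emb u) = YW' (emb u)" for u
    using emb_add[of "(fst u, 0)" "(0, snd u)"] emb
      F.\<Theta>_add[OF emb_closed emb_closed] F'.\<Theta>_add[OF emb_closed emb_closed] by simp
  have mode: "Z (act (gcheck_mode u k) w) n x = W.prd 0 k (Z (emb u)) (Z w) n x"
    if Z: "type_zero_module V Y vac scW Z" and w: "w \<in> carrier V" for Z u k w n x
  proof -
    have "W.prd 0 k (Z (emb u)) (Z w) n x = (\<Sum>i<1. scW (of_int 0 gchoose i) (Z (Y (emb u) (k + int i) w) (0 + n - int i) x))"
      unfolding type_zero_prd[OF Z emb_closed w] by (rule W.Sum_any_eq_sum) (simp add: gbinomial_0_left)
    then show ?thesis by (simp add: Y_emb w)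
  qed
  show ?thesis
    using v
  proof (induction v rule: V_induct)
    case vac
    show ?case by (simp add: F.\<Theta>_vac F'.\<Theta>_vac)
  next
    case (add v w)
    then show ?case by (simp add: F.\<Theta>_add F'.\<Theta>_add)
  next
    case (smult f v)
    then show ?case by (simp add: F.\<Theta>_smult F'.\<Theta>_smult)
  next
    case (act u n v)
    then show ?case by (intro ext) (simp add: mode[OF T] mode[OF T'] pair)
  qed
qed

end

theorem theorem3p16:
  fixes sc :: "complex \<Rightarrow> 'g::ab_group_add \<Rightarrow> 'g"
    and br :: "'g \<Rightarrow> 'g \<Rightarrow> 'g"
    and form :: "'g \<Rightarrow> 'g \<Rightarrow> complex"
    and p :: "complex poly"
    and l :: complex
    and Y :: "'g vacuum_elem \<Rightarrow> int \<Rightarrow> 'g vacuum_elem \<Rightarrow> 'g vacuum_elem"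
    and scW :: "complex \<Rightarrow> 'w::ab_group_add \<Rightarrow> 'w"
  assumes "quadratic_lie_algebra sc br form"
    and "is_Vcheck_structure sc br form p l Y"
  shows
    "(\<forall>\<rho>. restricted_ghat_module sc br form p l scW \<rho> \<longrightarrow>
        (\<exists>!YW. YW \<in> extensional (carrier (Vcheck sc br form p l)) \<and>
          type_zero_module (Vcheck sc br form p l) Y (Vcheck_vac sc br form p l) scW YW \<and>
          (\<forall>a n. YW (Vcheck_embed sc br form p l (a, 0)) n = \<rho> (mode (a, 0) n) \<and>
                 YW (Vcheck_embed sc br form p l (0, a)) n = \<rho> (mode (0, a) n))))
     \<and> (\<forall>YW. type_zero_module (Vcheck sc br form p l) Y (Vcheck_vac sc br form p l) scW YW \<longrightarrow>
        (\<exists>\<rho>. restricted_ghat_module sc br form p l scW \<rho> \<and>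
          (\<forall>a n. \<rho> (mode (a, 0) n) = YW (Vcheck_embed sc br form p l (a, 0)) n \<and>
                 \<rho> (mode (0, a) n) = YW (Vcheck_embed sc br form p l (0, a)) n)))"
proof (intro conjI allI impI)
  \<comment> \<open>That \<open>scW\<close> is a vector space comes from whichever module is given,
    so the locale is entered separately in each direction.\<close>
  have space: "vcheck_space sc br form p l Y scW" if "vector_space scW"
    using assms that
    by (intro vcheck_space.intro vcheck.intro gcheck.intro vcheck_axioms.intro complex_space.intro)
  fix \<rho> assume \<rho>: "restricted_ghat_module sc br form p l scW \<rho>"
  interpret vcheck_space sc br form p l Y scW
    by (rule space) (rule ghat_module.axioms(1)[OF restricted_ghat_module.axioms(1)[OF \<rho>]])
  obtain YW where YW: "YW \<in> extensional (carrier V)" "type_zero_module V Y vac scW YW"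
    "\<And>u n. YW (emb u) n = \<rho> (mode u n)"
    by (rule type_zero_of_restricted_ghat_module[OF \<rho>]) (rule that, blast+)
  show "\<exists>!YW. YW \<in> extensional (carrier V) \<and> type_zero_module V Y vac scW YW \<and>
          (\<forall>a n. YW (emb (a, 0)) n = \<rho> (mode (a, 0) n) \<and> YW (emb (0, a)) n = \<rho> (mode (0, a) n))"
  proof (rule ex1I[of _ YW])
    fix Z assume Z: "Z \<in> extensional (carrier V) \<and> type_zero_module V Y vac scW Z \<and>
          (\<forall>a n. Z (emb (a, 0)) n = \<rho> (mode (a, 0) n) \<and> Z (emb (0, a)) n = \<rho> (mode (0, a) n))"
    show "Z = YW"
    proof (rule extensionalityI)
      show "Z \<in> extensional (carrier V)" "YW \<in> extensional (carrier V)" using Z YW by simp_all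
      show "Z v = YW v" if "v \<in> carrier V" for v
        by (rule type_zero_unique[OF _ YW(2) _ _ that]) (use Z in \<open>auto simp: YW(3)\<close>)
    qed
  qed (use YW in simp)
next
  have space: "vcheck_space sc br form p l Y scW" if "vector_space scW"
    using assms that
    by (intro vcheck_space.intro vcheck.intro gcheck.intro vcheck_axioms.intro complex_space.intro)
  fix YW assume T: "type_zero_module (Vcheck sc br form p l) Y (Vcheck_vac sc br form p l) scW YW"
  interpret vcheck_space sc br form p l Y scW
    by (rule space) (rule vertex_module.axioms(2)[OF type_zero_module.axioms(1)[OF T]])
  show "\<exists>\<rho>. restricted_ghat_module sc br form p l scW \<rho> \<and>
          (\<forall>a n. \<rho> (mode (a, 0) n) = YW (emb (a, 0)) n \<and> \<rho> (mode (0, a) n) = YW (emb (0, a)) n)"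
    using restricted_ghat_module_of_type_zero[OF T] by metis
qed

end
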